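(* Let $\tilde\beta(t,x)=[\tilde\beta_{jk}(t,x)]_{j,k=1,2}$ and $\tilde\gamma(t,x)=[\tilde\gamma_{jk}(t,x)]_{j,k=1,2}$ be $2\times2$ matrices all of whose entries belong to $C_b^1\bigl(\mathbb{R};C^\infty(\mathbb{T};\mathbb{R})\bigr)$, let $I$ be the $2\times2$ identity matrix, $J=\begin{bmatrix}0&-1\\1&0\end{bmatrix}$, and $$\mathscr{P}=I\frac{\partial}{\partial t}+J\frac{\partial^4}{\partial x^4}+\tilde\beta(t,x)\frac{\partial^2}{\partial x^2}+\tilde\gamma(t,x)\frac{\partial}{\partial x}.$$ Assume that $$\int_0^{2\pi}\operatorname{tr}\bigl(\tilde\beta(t,x)\bigr)\,dx=0\qquad\text{and}\qquad\int_0^{2\pi}\operatorname{tr}\bigl(J\tilde\gamma(t,x)\bigr)\,dx=0$$ for every $t\in\mathbb{R}$. Then the initial value problem $$\mathscr{P}\vec{w}=\vec{h}(t,x)\ \text{ in }\ \mathbb{R}\times\mathbb{T},\qquad \vec{w}(0,x)=\vec{w}_0(x)\ \text{ in }\ \mathbb{T},$$ for an $\mathbb{R}^2$-valued unknown $\vec{w}(t,x)$ is $L^2$-well-posed.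
   Context: $\mathbb{T}=\mathbb{R}/2\pi\mathbb{Z}$. $C^\infty(\mathbb{T};\mathbb{R})$ is the (Fréchet) space of real-valued smooth functions on $\mathbb{T}$; $C_b(\mathbb{R};C^\infty(\mathbb{T};\mathbb{R}))$ is the set of bounded continuous $C^\infty(\mathbb{T};\mathbb{R})$-valued functions on $\mathbb{R}$; and $C_b^1(\mathbb{R};C^\infty(\mathbb{T};\mathbb{R}))$ is the set of $a\in C^1(\mathbb{R};C^\infty(\mathbb{T};\mathbb{R}))$ such that $a$ and $a_t$ both belong to $C_b(\mathbb{R};C^\infty(\mathbb{T};\mathbb{R}))$. $L^2(\mathbb{T};\mathbb{R}^2)$ is the set of $\mathbb{R}^2$-valued square-integrable functions on $\mathbb{T}$. $L^2$-well-posedness means: for any $\vec{w}_0\in L^2(\mathbb{T};\mathbb{R}^2)$ and any $\vec{h}\in L^1_{\mathrm{loc}}(\mathbb{R};L^2(\mathbb{T};\mathbb{R}^2))$, the initial value problem has a unique solution $\vec{w}\in C(\mathbb{R};L^2(\mathbb{T};\mathbb{R}^2))$, the equation being understood in the sense of distributions. Note $\operatorname{tr}(J\tilde\gamma)=\tilde\gamma_{12}-\tilde\gamma_{21}$. *)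

theory Defs
  imports "HOL-Analysis.Analysis"
begin

(* Functions on the torus T = R/(2 pi Z) are represented by 2 pi-periodic functions on the real
   line; integration over T is integration over one period. A function of (t, x) is curried, so
   that "a t" is the function on T at time t. *)

definition torus_periodic :: "(real \<Rightarrow> 'a) \<Rightarrow> bool" where
  "torus_periodic f \<longleftrightarrow> (\<forall>x. f (x + 2 * pi) = f x)"

abbreviation torus_measure :: "real measure" where
  "torus_measure \<equiv> lebesgue_on {0..2 * pi}"

definition Cinf_torus :: "(real \<Rightarrow> real) set" where
  "Cinf_torus = {f. torus_periodic f \<and> (\<forall>k x. (deriv ^^ k) f differentiable (at x))}"

(* The seminorms that define the topology; the supremum is finite on Cinf_torus. *)
definition Cinf_seminorm :: "nat \<Rightarrow> (real \<Rightarrow> real) \<Rightarrow> real" where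
  "Cinf_seminorm k f = (SUP x. \<bar>(deriv ^^ k) f x\<bar>)"

definition Cb_Cinf :: "(real \<Rightarrow> real \<Rightarrow> real) set" where
  "Cb_Cinf = {a. (\<forall>t. a t \<in> Cinf_torus)
     \<and> (\<forall>k t. ((\<lambda>s. Cinf_seminorm k (\<lambda>x. a s x - a t x)) \<longlongrightarrow> 0) (at t))
     \<and> (\<forall>k. \<exists>C. \<forall>t. Cinf_seminorm k (a t) \<le> C)}"

definition has_Cinf_time_derivative ::
    "(real \<Rightarrow> real \<Rightarrow> real) \<Rightarrow> (real \<Rightarrow> real \<Rightarrow> real) \<Rightarrow> bool" where
  "has_Cinf_time_derivative a a' \<longleftrightarrow>
     (\<forall>k t. ((\<lambda>s. Cinf_seminorm k (\<lambda>x. (a s x - a t x) / (s - t) - a' t x)) \<longlongrightarrow> 0) (at t))"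

definition Cb1_Cinf :: "(real \<Rightarrow> real \<Rightarrow> real) set" where
  "Cb1_Cinf = {a. a \<in> Cb_Cinf \<and> (\<exists>a'\<in>Cb_Cinf. has_Cinf_time_derivative a a')}"

(* Elements are functions, not classes; equality in L^2 is equality almost everywhere and is
   written out where it is needed. *)
definition L2_torus :: "(real \<Rightarrow> real^2) set" where
  "L2_torus = {f. torus_periodic f \<and> f \<in> borel_measurable torus_measure
     \<and> integrable torus_measure (\<lambda>x. (norm (f x))\<^sup>2)}"

definition L2_norm :: "(real \<Rightarrow> real^2) \<Rightarrow> real" where
  "L2_norm f = sqrt (LINT x|torus_measure. (norm (f x))\<^sup>2)"

definition C_L2 :: "(real \<Rightarrow> real \<Rightarrow> real^2) set" where
  "C_L2 = {w. (\<forall>t. w t \<in> L2_torus)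
     \<and> (\<forall>t. ((\<lambda>s. L2_norm (\<lambda>x. w s x - w t x)) \<longlongrightarrow> 0) (at t))}"

(* Bochner measurability of an L^2-valued function: it is almost everywhere the limit in L^2 of
   simple functions of t with values in L^2. *)
definition strongly_measurable_L2 :: "(real \<Rightarrow> real \<Rightarrow> real^2) \<Rightarrow> bool" where
  "strongly_measurable_L2 h \<longleftrightarrow>
     (\<exists>s :: nat \<Rightarrow> real \<Rightarrow> real \<Rightarrow> real^2.
        (\<forall>n. simple_function lebesgue (s n) \<and> (\<forall>t. s n t \<in> L2_torus))
        \<and> (AE t in lebesgue. (\<lambda>n. L2_norm (\<lambda>x. s n t x - h t x)) \<longlonglongrightarrow> 0))"

definition L1loc_L2 :: "(real \<Rightarrow> real \<Rightarrow> real^2) set" where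
  "L1loc_L2 = {h. (\<forall>t. h t \<in> L2_torus) \<and> strongly_measurable_L2 h
     \<and> (\<forall>a b. set_integrable lebesgue {a..b} (\<lambda>t. L2_norm (h t)))}"

definition partial_t :: "(real \<Rightarrow> real \<Rightarrow> real) \<Rightarrow> real \<Rightarrow> real \<Rightarrow> real" where
  "partial_t f t x = deriv (\<lambda>s. f s x) t"

definition partial_x :: "(real \<Rightarrow> real \<Rightarrow> real) \<Rightarrow> real \<Rightarrow> real \<Rightarrow> real" where
  "partial_x f t x = deriv (\<lambda>y. f t y) x"

(* Joint smoothness in (t, x): every iterated partial derivative, in any order of
   differentiation, is (Frechet) differentiable on the plane. *)
definition smooth_tx :: "(real \<Rightarrow> real \<Rightarrow> real) \<Rightarrow> bool" where
  "smooth_tx f \<longleftrightarrow>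
     (\<forall>ds \<in> lists {partial_t, partial_x}.
        (\<lambda>(t, x). fold (\<lambda>d. d) ds f t x) differentiable_on UNIV)"

definition test_functions :: "(real \<Rightarrow> real \<Rightarrow> real^2) set" where
  "test_functions = {\<phi>. (\<forall>j. smooth_tx (\<lambda>t x. \<phi> t x $ j)) \<and> (\<forall>t. torus_periodic (\<phi> t))
     \<and> (\<exists>R. \<forall>t x. R < \<bar>t\<bar> \<longrightarrow> \<phi> t x = 0)}"

definition Dt :: "(real \<Rightarrow> real \<Rightarrow> real^2) \<Rightarrow> real \<Rightarrow> real \<Rightarrow> real^2" where
  "Dt \<psi> t x = (\<chi> j. partial_t (\<lambda>s y. \<psi> s y $ j) t x)"

definition Dx :: "nat \<Rightarrow> (real \<Rightarrow> real \<Rightarrow> real^2) \<Rightarrow> real \<Rightarrow> real \<Rightarrow> real^2" where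
  "Dx m \<psi> t x = (\<chi> j. (partial_x ^^ m) (\<lambda>s y. \<psi> s y $ j) t x)"

definition pairing :: "(real \<Rightarrow> real \<Rightarrow> real^2) \<Rightarrow> (real \<Rightarrow> real \<Rightarrow> real^2) \<Rightarrow> real" where
  "pairing w \<psi> = (LINT t|lebesgue. LINT x|torus_measure. w t x \<bullet> \<psi> t x)"

definition dist_Dt :: "(real \<Rightarrow> real \<Rightarrow> real^2) \<Rightarrow> (real \<Rightarrow> real \<Rightarrow> real^2) \<Rightarrow> real" where
  "dist_Dt w \<psi> = - pairing w (Dt \<psi>)"

definition dist_Dx ::
    "nat \<Rightarrow> (real \<Rightarrow> real \<Rightarrow> real^2) \<Rightarrow> (real \<Rightarrow> real \<Rightarrow> real^2) \<Rightarrow> real" where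
  "dist_Dx m w \<psi> = (-1) ^ m * pairing w (Dx m \<psi>)"

(* The product of a matrix-valued function and a vector-valued distribution. It is applied to
   dist_Dx m w, which needs only x-smoothness of its argument, so that coefficients which are
   merely C^1 in t are admissible. *)
definition dist_mult :: "(real \<Rightarrow> real \<Rightarrow> real^2^2) \<Rightarrow>
    ((real \<Rightarrow> real \<Rightarrow> real^2) \<Rightarrow> real) \<Rightarrow> (real \<Rightarrow> real \<Rightarrow> real^2) \<Rightarrow> real" where
  "dist_mult B u \<psi> = u (\<lambda>t x. transpose (B t x) *v \<psi> t x)"

definition J_mat :: "real^2^2" where
  "J_mat = vector [vector [0, -1], vector [1, 0]]"

definition dist_P :: "(real \<Rightarrow> real \<Rightarrow> real^2^2) \<Rightarrow> (real \<Rightarrow> real \<Rightarrow> real^2^2) \<Rightarrow>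
    (real \<Rightarrow> real \<Rightarrow> real^2) \<Rightarrow> (real \<Rightarrow> real \<Rightarrow> real^2) \<Rightarrow> real" where
  "dist_P \<beta> \<gamma> w \<phi> = dist_Dt w \<phi> + dist_mult (\<lambda>t x. J_mat) (dist_Dx 4 w) \<phi>
     + dist_mult \<beta> (dist_Dx 2 w) \<phi> + dist_mult \<gamma> (dist_Dx 1 w) \<phi>"

definition solves_ivp :: "(real \<Rightarrow> real \<Rightarrow> real^2^2) \<Rightarrow> (real \<Rightarrow> real \<Rightarrow> real^2^2) \<Rightarrow>
    (real \<Rightarrow> real \<Rightarrow> real^2) \<Rightarrow> (real \<Rightarrow> real^2) \<Rightarrow> (real \<Rightarrow> real \<Rightarrow> real^2) \<Rightarrow> bool" where
  "solves_ivp \<beta> \<gamma> h w\<^sub>0 w \<longleftrightarrow>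
     w \<in> C_L2
     \<and> (\<forall>\<phi>\<in>test_functions. dist_P \<beta> \<gamma> w \<phi> = pairing h \<phi>)
     \<and> (AE x in torus_measure. w 0 x = w\<^sub>0 x)"

definition L2_well_posed ::
    "(real \<Rightarrow> real \<Rightarrow> real^2^2) \<Rightarrow> (real \<Rightarrow> real \<Rightarrow> real^2^2) \<Rightarrow> bool" where
  "L2_well_posed \<beta> \<gamma> \<longleftrightarrow>
     (\<forall>w\<^sub>0\<in>L2_torus. \<forall>h\<in>L1loc_L2.
        (\<exists>w. solves_ivp \<beta> \<gamma> h w\<^sub>0 w)
        \<and> (\<forall>w v. solves_ivp \<beta> \<gamma> h w\<^sub>0 w \<longrightarrow> solves_ivp \<beta> \<gamma> h w\<^sub>0 v
              \<longrightarrow> (\<forall>t. AE x in torus_measure. w t x = v t x)))"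

end

theory Submission
  imports Defs
begin

text \<open>In Fourier coordinates, and after diagonalizing \<open>J\<close>, the equation reads \<open>u\<^sub>i' + (A u)\<^sub>i = h\<^sub>i\<close>,
  where \<open>i = (k, s)\<close> consists of a frequency and a sign, and \<open>A\<close> is the diagonal with entries
  \<open>\<plusminus>\<i> k\<^sup>4\<close> plus a kernel of order 2 that decays rapidly off the diagonal. Since \<open>\<bar>\<plusminus>k\<^sup>4 - (\<plusminus>l\<^sup>4)\<bar>\<close>
  is at least the cube of the larger frequency unless it vanishes, two steps of solving homological
  equations give a gauge \<open>I + S\<close> that conjugates \<open>A\<close> into a diagonal plus a bounded kernel. The
  mean value conditions make the first order contribution to the diagonal imaginary, and the
  second order one is bounded because its leading part is odd in the frequency shift. Gronwall's
  inequality and a contraction argument in the interaction picture then solve the system in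
  \<open>\<ell>\<^sup>2\<close>. Testing against \<open>\<zeta>(t) e\<^sup>i\<^sup>k\<^sup>x\<close> and the du Bois-Reymond lemma identify distributional
  solutions with solutions of the system.\<close>

section \<open>Square-summable families\<close>

text \<open>The gap of order three explains the number of steps: the first gauge has order 2 - 3 =
  -1 and leaves an error of order 1, the second has order -2 and leaves an error of order 0. On the
  diagonal \<open>\<beta>\<close> contributes order two and \<open>\<gamma>\<close> order one; the
  two mean value conditions make exactly the real parts of these entries vanish. The time derivative
  of the gauge enters the bounded kernel, which is where the time derivative of the coefficients is
  used. Two obstacles shape the rest. The operator has order four, so for a merely square-summable
  \<open>u\<close> the family \<open>A u\<close> only has polynomial growth, and the algebraic
  identities are proved for such families. Moreover, the gauged equation alone does not say that the
  coordinates of \<open>u\<close> are differentiable; the way back is a uniqueness argument with the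
  weight of power -6, which is the reason for the decay exponent 8 imposed on the gauge. Cutting low
  frequencies out of the gauge makes it small, so that \<open>I + S\<close> is bounded below and is
  never inverted explicitly.\<close>

lemma summable_on_dominated:
  fixes f :: "'a \<Rightarrow> 'b::banach"
  assumes "g summable_on A" "\<And>x. x \<in> A \<Longrightarrow> norm (f x) \<le> g x"
  shows "f summable_on A"
  by (rule Infinite_Sum.abs_summable_summable, rule Infinite_Sum.abs_summable_on_comparison_test'[OF assms])

lemma infsum_dominated:
  fixes f :: "'a \<Rightarrow> 'b::banach"
  assumes "g summable_on A" "\<And>x. x \<in> A \<Longrightarrow> norm (f x) \<le> g x"
  shows "norm (infsum f A) \<le> infsum g A"
  by (rule norm_infsum_le[OF has_sum_infsum[OF summable_on_dominated[OF assms]] has_sum_infsum[OF assms(1)] assms(2)])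

lemma Re_mult_cnj_self: "Re (z * cnj z) = (cmod z)\<^sup>2"
  by (metis complex_norm_square Re_complex_of_real)

lemma cmod_add_square_le: "(cmod (a + b))\<^sup>2 \<le> 2 * (cmod a)\<^sup>2 + 2 * (cmod b)\<^sup>2"
proof -
  have "(cmod (a + b))\<^sup>2 \<le> (cmod a + cmod b)\<^sup>2"
    by (simp add: norm_triangle_ineq power_mono)
  also have "\<dots> \<le> 2 * (cmod a)\<^sup>2 + 2 * (cmod b)\<^sup>2"
    using sum_squares_bound[of "cmod a" "cmod b"] by (simp add: power2_sum)
  finally show ?thesis .
qed

lemma square_summable_add:
  fixes x y :: "'a \<Rightarrow> complex"
  assumes "(\<lambda>i. (cmod (x i))\<^sup>2) summable_on A" "(\<lambda>i. (cmod (y i))\<^sup>2) summable_on A"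
  shows "(\<lambda>i. (cmod (x i + y i))\<^sup>2) summable_on A"
proof (rule summable_on_comparison_test)
  show "(\<lambda>i. 2 * (cmod (x i))\<^sup>2 + 2 * (cmod (y i))\<^sup>2) summable_on A"
    by (intro summable_on_add summable_on_cmult_right assms)
qed (simp_all add: cmod_add_square_le)

lemma abs_Re_mult_cnj_le: "\<bar>Re (a * cnj b)\<bar> \<le> ((cmod a)\<^sup>2 + (cmod b)\<^sup>2) / 2"
proof -
  have "\<bar>Re (a * cnj b)\<bar> \<le> cmod a * cmod b"
    using abs_Re_le_cmod[of "a * cnj b"] by (simp add: norm_mult)
  also have "\<dots> \<le> ((cmod a)\<^sup>2 + (cmod b)\<^sup>2) / 2"
    using sum_squares_bound[of "cmod a" "cmod b"] by simp
  finally show ?thesis .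
qed

section \<open>The Hilbert space of square-summable complex families\<close>

typedef 'a ell2 = "{x :: 'a \<Rightarrow> complex. (\<lambda>i. (cmod (x i))\<^sup>2) summable_on UNIV}"
  morphisms ell2_at Ell2
  by (rule exI[of _ "\<lambda>_. 0"]) simp

setup_lifting type_definition_ell2

instantiation ell2 :: (type) real_vector
begin

lift_definition zero_ell2 :: "'a ell2" is "\<lambda>_. 0" by simp
lift_definition plus_ell2 :: "'a ell2 \<Rightarrow> 'a ell2 \<Rightarrow> 'a ell2" is "\<lambda>x y i. x i + y i"
  by (rule square_summable_add)
lift_definition uminus_ell2 :: "'a ell2 \<Rightarrow> 'a ell2" is "\<lambda>x i. - x i" by simp
lift_definition minus_ell2 :: "'a ell2 \<Rightarrow> 'a ell2 \<Rightarrow> 'a ell2" is "\<lambda>x y i. x i - y i"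
proof -
  fix x y :: "'a \<Rightarrow> complex"
  assume "(\<lambda>i. (cmod (x i))\<^sup>2) summable_on UNIV" "(\<lambda>i. (cmod (y i))\<^sup>2) summable_on UNIV"
  then show "(\<lambda>i. (cmod (x i - y i))\<^sup>2) summable_on UNIV"
    using square_summable_add[of x UNIV "\<lambda>i. - y i"] by simp
qed
lift_definition scaleR_ell2 :: "real \<Rightarrow> 'a ell2 \<Rightarrow> 'a ell2" is "\<lambda>r x i. r *\<^sub>R x i"
  by (simp add: norm_mult power_mult_distrib summable_on_cmult_right)
instance
proof
  fix x y z :: "'a ell2" and a b :: real
  show "x + y + z = x + (y + z)" by transfer (simp add: add.assoc)
  show "x + y = y + x" by transfer (simp add: add.commute)
  show "0 + x = x" by transfer simp
  show "- x + x = 0" by transfer simp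
  show "x - y = x + - y" by transfer simp
  show "a *\<^sub>R (x + y) = a *\<^sub>R x + a *\<^sub>R y" by transfer (simp add: scaleR_add_right)
  show "(a + b) *\<^sub>R x = a *\<^sub>R x + b *\<^sub>R x" by transfer (simp add: scaleR_add_left)
  show "a *\<^sub>R b *\<^sub>R x = (a * b) *\<^sub>R x" by transfer simp
  show "1 *\<^sub>R x = x" by transfer simp
qed

end

lemma inner_ell2_summable:
  fixes x y :: "'a \<Rightarrow> complex"
  assumes "(\<lambda>i. (cmod (x i))\<^sup>2) summable_on UNIV" "(\<lambda>i. (cmod (y i))\<^sup>2) summable_on UNIV"
  shows "(\<lambda>i. Re (x i * cnj (y i))) summable_on UNIV"
proof (rule summable_on_dominated)
  show "(\<lambda>i. ((cmod (x i))\<^sup>2 + (cmod (y i))\<^sup>2) / 2) summable_on UNIV"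
    using summable_on_cmult_right[OF summable_on_add[OF assms], of "1/2"] by simp
  show "norm (Re (x i * cnj (y i))) \<le> ((cmod (x i))\<^sup>2 + (cmod (y i))\<^sup>2) / 2" for i
    using abs_Re_mult_cnj_le[of "x i" "y i"] by simp
qed

instantiation ell2 :: (type) real_inner
begin

text \<open>The real part of the Hermitian product. The space is treated as a real Hilbert space,
  which suits the conjugation used at the end to single out real solutions: it is only real
  linear.\<close>

lift_definition inner_ell2 :: "'a ell2 \<Rightarrow> 'a ell2 \<Rightarrow> real" is "\<lambda>x y. \<Sum>\<^sub>\<infinity>i. Re (x i * cnj (y i))" .

definition norm_ell2 :: "'a ell2 \<Rightarrow> real" where "norm_ell2 x = sqrt (inner x x)"
definition dist_ell2 :: "'a ell2 \<Rightarrow> 'a ell2 \<Rightarrow> real" where "dist_ell2 x y = norm (x - y)"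
definition sgn_ell2 :: "'a ell2 \<Rightarrow> 'a ell2" where "sgn_ell2 x = scaleR (inverse (norm x)) x"
definition uniformity_ell2 :: "('a ell2 \<times> 'a ell2) filter"
  where "uniformity_ell2 = (INF e\<in>{0<..}. principal {(x, y). dist x y < e})"
definition open_ell2 :: "'a ell2 set \<Rightarrow> bool"
  where "open_ell2 U = (\<forall>x\<in>U. \<forall>\<^sub>F (x', y) in uniformity. x' = x \<longrightarrow> y \<in> U)"

instance
proof
  fix x y z :: "'a ell2" and a b :: real
  show "dist x y = norm (x - y)" by (rule dist_ell2_def)
  show "sgn x = x /\<^sub>R norm x" by (rule sgn_ell2_def)
  show "(uniformity :: ('a ell2 \<times> 'a ell2) filter) = (INF e\<in>{0<..}. principal {(x, y). dist x y < e})"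
    by (rule uniformity_ell2_def)
  show "open U = (\<forall>x\<in>U. \<forall>\<^sub>F (x', y) in uniformity. x' = x \<longrightarrow> y \<in> U)" for U :: "'a ell2 set"
    by (rule open_ell2_def)
  show "inner x y = inner y x" by transfer (simp add: mult.commute add.commute)
  show "inner (x + y) z = inner x z + inner y z"
    by transfer (simp only: distrib_right plus_complex.sel infsum_add inner_ell2_summable)
  show "inner (a *\<^sub>R x) y = a * inner x y"
    by transfer (simp only: mult_scaleR_left scaleR_complex.sel infsum_cmult_right')
  show "0 \<le> inner x x"
    by transfer (auto intro!: infsum_nonneg)
  show "inner x x = 0 \<longleftrightarrow> x = 0"
  proof transfer
    fix x :: "'a \<Rightarrow> complex"
    assume s: "(\<lambda>i. (cmod (x i))\<^sup>2) summable_on UNIV"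
    show "((\<Sum>\<^sub>\<infinity>i. Re (x i * cnj (x i))) = 0) = (x = (\<lambda>_. 0))"
    proof
      assume "(\<Sum>\<^sub>\<infinity>i. Re (x i * cnj (x i))) = 0"
      then have "(cmod (x i))\<^sup>2 = 0" for i
        using nonneg_infsum_le_0D[of "\<lambda>i. (cmod (x i))\<^sup>2" UNIV i] s unfolding Re_mult_cnj_self by simp
      then show "x = (\<lambda>_. 0)" by auto
    qed simp
  qed
  show "norm x = sqrt (inner x x)" by (rule norm_ell2_def)
qed

end

lemma ell2_at_simps [simp]:
  "ell2_at 0 i = 0" "ell2_at (x + y) i = ell2_at x i + ell2_at y i"
  "ell2_at (x - y) i = ell2_at x i - ell2_at y i" "ell2_at (- x) i = - ell2_at x i"
  "ell2_at (r *\<^sub>R x) i = of_real r * ell2_at x i"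
  by (transfer; simp add: scaleR_conv_of_real)+

lemma ell2_eqI: "(\<And>i. ell2_at x i = ell2_at y i) \<Longrightarrow> x = y"
  by transfer auto

lemma ell2_at_summable: "(\<lambda>i. (cmod (ell2_at x i))\<^sup>2) summable_on UNIV"
  by transfer

lemma norm_ell2_square: "(norm (x :: 'a ell2))\<^sup>2 = (\<Sum>\<^sub>\<infinity>i. (cmod (ell2_at x i))\<^sup>2)"
proof -
  have "(norm x)\<^sup>2 = inner x x" by (simp add: power2_norm_eq_inner)
  also have "\<dots> = (\<Sum>\<^sub>\<infinity>i. (cmod (ell2_at x i))\<^sup>2)"
    by transfer (simp only: Re_mult_cnj_self)
  finally show ?thesis .
qed

lemma sum_ell2_le_norm: "finite F \<Longrightarrow> (\<Sum>i\<in>F. (cmod (ell2_at x i))\<^sup>2) \<le> (norm x)\<^sup>2"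
  unfolding norm_ell2_square by (rule finite_sum_le_infsum[OF ell2_at_summable]) auto

lemma cmod_ell2_at_le: "cmod (ell2_at x i) \<le> norm x"
  using sum_ell2_le_norm[of "{i}" x] by (simp add: power2_le_iff_abs_le)

text \<open>Membership and norm bound come together from finite partial sums. Since
  \<open>Ell2\<close> is total, operators can be written with it before square summability of their
  values is known; this lemma then supplies both facts.\<close>

lemma norm_Ell2_le:
  fixes f :: "'a \<Rightarrow> complex"
  assumes "\<And>F. finite F \<Longrightarrow> (\<Sum>i\<in>F. (cmod (f i))\<^sup>2) \<le> c\<^sup>2" "0 \<le> c"
  shows "ell2_at (Ell2 f) = f" "norm (Ell2 f) \<le> c"
proof -
  have "(\<lambda>i. (cmod (f i))\<^sup>2) summable_on UNIV"
    by (rule nonneg_bdd_above_summable_on) (auto intro!: bdd_aboveI2 assms)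
  then show *: "ell2_at (Ell2 f) = f"
    by (simp add: Ell2_inverse)
  have "(norm (Ell2 f))\<^sup>2 \<le> c\<^sup>2"
    unfolding norm_ell2_square *
    by (rule infsum_le_finite_sums) (use \<open>_ summable_on _\<close> assms in auto)
  then show "norm (Ell2 f) \<le> c" using assms(2) by (simp add: power2_le_iff_abs_le)
qed

lemma bounded_linear_ell2_at: "bounded_linear (\<lambda>x. ell2_at x i)"
  by (rule bounded_linear_intro[of _ 1]) (simp_all add: cmod_ell2_at_le scaleR_conv_of_real)

lemmas continuous_on_ell2_at [continuous_intros] =
  bounded_linear.continuous_on[OF bounded_linear_ell2_at]

instance ell2 :: (type) banach
proof
  fix X :: "nat \<Rightarrow> 'a ell2"
  assume X: "Cauchy X"
  have "Cauchy (\<lambda>n. ell2_at (X n) i)" for i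
    by (rule bounded_linear.Cauchy[OF bounded_linear_ell2_at X])
  then have y: "(\<lambda>n. ell2_at (X n) i) \<longlonglongrightarrow> lim (\<lambda>n. ell2_at (X n) i)" for i
    using Cauchy_convergent convergent_LIMSEQ_iff by blast
  define y where "y i = lim (\<lambda>n. ell2_at (X n) i)" for i
  note y = y[folded y_def]
  \<comment> \<open>The second index tends to infinity inside finite partial sums, so no limit is
    exchanged with an infinite sum. The outcome is that \<open>X n - y\<close> lies in the space and
    is small there.\<close>
  have tail: "\<exists>N. \<forall>n\<ge>N. ell2_at (Ell2 (\<lambda>i. ell2_at (X n) i - y i)) = (\<lambda>i. ell2_at (X n) i - y i)
      \<and> norm (Ell2 (\<lambda>i. ell2_at (X n) i - y i)) \<le> e" if "e > 0" for e
  proof -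
    obtain N where N: "\<And>m n. m \<ge> N \<Longrightarrow> n \<ge> N \<Longrightarrow> norm (X m - X n) < e"
      using X \<open>e > 0\<close> unfolding Cauchy_iff by blast
    have "(\<Sum>i\<in>F. (cmod (ell2_at (X n) i - y i))\<^sup>2) \<le> e\<^sup>2" if "n \<ge> N" "finite F" for n F
    proof (rule LIMSEQ_le_const2)
      show "(\<lambda>m. \<Sum>i\<in>F. (cmod (ell2_at (X n) i - ell2_at (X m) i))\<^sup>2)
          \<longlonglongrightarrow> (\<Sum>i\<in>F. (cmod (ell2_at (X n) i - y i))\<^sup>2)"
        by (intro tendsto_intros y)
      have "(\<Sum>i\<in>F. (cmod (ell2_at (X n) i - ell2_at (X m) i))\<^sup>2) \<le> e\<^sup>2" if "m \<ge> N" for m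
      proof -
        have "(\<Sum>i\<in>F. (cmod (ell2_at (X n) i - ell2_at (X m) i))\<^sup>2) \<le> (norm (X n - X m))\<^sup>2"
          using sum_ell2_le_norm[OF \<open>finite F\<close>, of "X n - X m"] by simp
        also have "\<dots> \<le> e\<^sup>2"
          using N[OF \<open>n \<ge> N\<close> that] by (intro power_mono) auto
        finally show ?thesis .
      qed
      then show "\<exists>N. \<forall>m\<ge>N. (\<Sum>i\<in>F. (cmod (ell2_at (X n) i - ell2_at (X m) i))\<^sup>2) \<le> e\<^sup>2" by blast
    qed
    then show ?thesis
      by (intro exI[of _ N] allI impI conjI norm_Ell2_le[where c=e]) (use that in auto)
  qed
  obtain N where N: "ell2_at (Ell2 (\<lambda>i. ell2_at (X N) i - y i)) = (\<lambda>i. ell2_at (X N) i - y i)"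
    using tail[of 1] by auto
  define L where "L = X N - Ell2 (\<lambda>i. ell2_at (X N) i - y i)"
  have L: "ell2_at L i = y i" for i by (simp add: L_def N)
  have "X \<longlonglongrightarrow> L"
  proof (rule LIMSEQ_I)
    fix r :: real assume "r > 0"
    then obtain M where M: "\<forall>n\<ge>M. ell2_at (Ell2 (\<lambda>i. ell2_at (X n) i - y i)) = (\<lambda>i. ell2_at (X n) i - y i)
      \<and> norm (Ell2 (\<lambda>i. ell2_at (X n) i - y i)) \<le> r / 2" using tail[of "r/2"] by auto
    have "norm (X n - L) < r" if "n \<ge> M" for n
    proof -
      have "X n - L = Ell2 (\<lambda>i. ell2_at (X n) i - y i)"
        by (rule ell2_eqI) (use M that L in auto)
      then have "norm (X n - L) \<le> r / 2" using M that by simp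
      then show ?thesis using \<open>r > 0\<close> by linarith
    qed
    then show "\<exists>M. \<forall>n\<ge>M. norm (X n - L) < r" by blast
  qed
  then show "convergent X" by (auto simp: convergent_def)
qed

section \<open>Kernels of finite order\<close>

text \<open>Cauchy-Schwarz for the factors sqrt a and sqrt a * b. With \<open>a\<close> a row of a
  kernel majorant this is the first half of Schur's test.\<close>

lemma infsum_Cauchy_Schwarz_weighted:
  fixes a b :: "'a \<Rightarrow> real"
  assumes a: "a summable_on A" and ab: "(\<lambda>x. a x * (b x)\<^sup>2) summable_on A"
    and nn: "\<And>x. x \<in> A \<Longrightarrow> a x \<ge> 0" "\<And>x. x \<in> A \<Longrightarrow> b x \<ge> 0"
  shows "(\<lambda>x. a x * b x) summable_on A"
    and "(\<Sum>\<^sub>\<infinity>x\<in>A. a x * b x)\<^sup>2 \<le> infsum a A * (\<Sum>\<^sub>\<infinity>x\<in>A. a x * (b x)\<^sup>2)"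
proof -
  let ?S = "infsum a A * (\<Sum>\<^sub>\<infinity>x\<in>A. a x * (b x)\<^sup>2)"
  have S: "?S \<ge> 0" by (intro mult_nonneg_nonneg infsum_nonneg nn) (auto simp: nn)
  have fin: "(\<Sum>x\<in>G. a x * b x) \<le> sqrt ?S" if G: "finite G" "G \<subseteq> A" for G
  proof -
    have "(\<Sum>x\<in>G. a x * b x)\<^sup>2 = (\<Sum>x\<in>G. sqrt (a x) * (sqrt (a x) * b x))\<^sup>2"
      using G nn by (intro arg_cong[of _ _ "\<lambda>x. x\<^sup>2"] sum.cong refl) (auto simp: mult.assoc[symmetric])
    also have "\<dots> \<le> (\<Sum>x\<in>G. (sqrt (a x))\<^sup>2) * (\<Sum>x\<in>G. (sqrt (a x) * b x)\<^sup>2)"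
      by (rule Cauchy_Schwarz_ineq_sum)
    also have "\<dots> = (\<Sum>x\<in>G. a x) * (\<Sum>x\<in>G. a x * (b x)\<^sup>2)"
      using G nn by (intro arg_cong2[of _ _ _ _ "(*)"] sum.cong refl) (auto simp: power_mult_distrib)
    also have "\<dots> \<le> ?S"
      using G nn by (intro mult_mono finite_sum_le_infsum a ab sum_nonneg infsum_nonneg) auto
    finally show ?thesis by (rule real_le_rsqrt)
  qed
  show s: "(\<lambda>x. a x * b x) summable_on A"
    by (rule nonneg_bdd_above_summable_on) (use nn fin in \<open>auto intro!: bdd_aboveI2\<close>)
  have "(\<Sum>\<^sub>\<infinity>x\<in>A. a x * b x) \<le> sqrt ?S"
    by (rule infsum_le_finite_sums[OF s fin])
  moreover have "0 \<le> (\<Sum>\<^sub>\<infinity>x\<in>A. a x * b x)" by (intro infsum_nonneg) (auto simp: nn)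
  ultimately have "(\<Sum>\<^sub>\<infinity>x\<in>A. a x * b x)\<^sup>2 \<le> (sqrt ?S)\<^sup>2" by (intro power_mono) auto
  then show "(\<Sum>\<^sub>\<infinity>x\<in>A. a x * b x)\<^sup>2 \<le> ?S" using S by simp
qed

lemma has_sum_finite_sum:
  fixes f :: "'a \<Rightarrow> 'b \<Rightarrow> 'c::topological_comm_monoid_add"
  assumes "finite F" "\<And>i. i \<in> F \<Longrightarrow> (f i has_sum s i) A"
  shows "((\<lambda>x. \<Sum>i\<in>F. f i x) has_sum (\<Sum>i\<in>F. s i)) A"
  using assms by (induction F rule: finite_induct) (auto intro: has_sum_add)

text \<open>An index consists of a frequency and of the sign of an eigenvalue of \<open>J\<close>.\<close>

type_synonym idx = "int \<times> bool"

text \<open>A version of the Japanese bracket. It is equivalent to the square root of 1 + k^2, but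
  submultiplicative with constant 1, see \<open>jb_peetre\<close>.\<close>

definition jb :: "int \<Rightarrow> real" where "jb k = 1 + \<bar>real_of_int k\<bar>"

lemma jb_ge_1: "1 \<le> jb k" by (simp add: jb_def)
lemma jb_pos [simp]: "0 < jb k" by (simp add: jb_def add_pos_nonneg)
lemma jb_nonneg [simp]: "0 \<le> jb k" by (simp add: jb_def)
lemma jb_nonzero [simp]: "jb k \<noteq> 0" using jb_pos[of k] by linarith
lemma jb_minus [simp]: "jb (- k) = jb k" by (simp add: jb_def)
lemma jb_commute: "jb (k - l) = jb (l - k)" by (simp add: jb_def)
lemma jb_0 [simp]: "jb 0 = 1" by (simp add: jb_def)

lemma jb_peetre: "jb (k - l) \<le> jb (k - q) * jb (q - l)"
proof -
  have "\<bar>real_of_int (k - l)\<bar> \<le> \<bar>real_of_int (k - q)\<bar> + \<bar>real_of_int (q - l)\<bar>" by simp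
  moreover have "0 \<le> \<bar>real_of_int (k - q)\<bar> * \<bar>real_of_int (q - l)\<bar>" by simp
  ultimately show ?thesis unfolding jb_def distrib_left distrib_right by linarith
qed

lemma jb_le_mult: "jb k \<le> jb (k - l) * jb l"
  using jb_peetre[of k 0 l] by simp

text \<open>Peetre's inequality for integer exponents of either sign. For negative \<open>m\<close>
  the roles of \<open>k\<close> and \<open>l\<close> are exchanged, which costs the same power of
  the bracket of the difference.\<close>

lemma jb_powi_le: "jb k powi m \<le> jb (k - l) ^ nat \<bar>m\<bar> * jb l powi m"
proof (cases "m \<ge> 0")
  case True
  then show ?thesis
    using power_mono[OF jb_le_mult[of k l], of "nat m"] by (simp add: power_int_def power_mult_distrib)
next
  case False
  have "jb l ^ nat (- m) \<le> (jb (k - l) * jb k) ^ nat (- m)"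
    using jb_le_mult[of l k] by (intro power_mono) (auto simp: jb_commute)
  then have "1 / jb k ^ nat (-m) \<le> jb (k - l) ^ nat (- m) / jb l ^ nat (-m)"
    by (simp add: power_mult_distrib field_simps)
  then show ?thesis using False by (simp add: power_int_def power_inverse divide_inverse)
qed

lemma jb_power_ge_1: "1 \<le> jb k ^ n" by (rule one_le_power[OF jb_ge_1])

lemma jb_summable_nat: "summable (\<lambda>n. 1 / (1 + real n)\<^sup>2)"
  using inverse_squares_sums by (auto simp: sums_iff add.commute)

lemma jb_summable_int: "(\<lambda>k. 1 / (jb k)\<^sup>2) summable_on UNIV"
proof -
  have n: "(\<lambda>n. 1 / (1 + real n)\<^sup>2) summable_on UNIV"
    by (rule summable_nonneg_imp_summable_on[OF jb_summable_nat]) auto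
  have "(\<lambda>k. 1 / (jb k)\<^sup>2) summable_on range int"
    by (subst summable_on_reindex) (use n in \<open>auto simp: o_def jb_def\<close>)
  moreover have "(\<lambda>k. 1 / (jb k)\<^sup>2) summable_on range (\<lambda>n. - int n)"
    by (subst summable_on_reindex) (use n in \<open>auto simp: o_def jb_def inj_on_def\<close>)
  moreover have "range int \<union> range (\<lambda>n. - int n) = UNIV"
    by (metis (no_types, lifting) UNIV_eq_I Un_iff int_cases2 rangeI)
  ultimately show ?thesis
    using summable_on_union by metis
qed

lemma jb_summable_idx: "(\<lambda>i::idx. 1 / (jb (fst i))\<^sup>2) summable_on UNIV"
proof -
  have "(\<lambda>i::idx. 1 / (jb (fst i))\<^sup>2) summable_on UNIV \<times> UNIV"
    by (rule summable_on_SigmaI[where g = "\<lambda>k. 2 / (jb k)\<^sup>2"])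
      (use summable_on_cmult_right[OF jb_summable_int, of 2] in \<open>auto simp: UNIV_bool intro!: has_sum_finiteI\<close>)
  then show ?thesis by simp
qed

definition jsum :: real where "jsum = (\<Sum>\<^sub>\<infinity>i::idx. 1 / (jb (fst i))\<^sup>2)"

lemma jsum_shift:
  "((\<lambda>j::idx. 1 / (jb (k - fst j))\<^sup>2) has_sum jsum) UNIV"
proof -
  have b: "bij_betw (\<lambda>j::idx. (k - fst j, snd j)) UNIV UNIV"
    by (rule bij_betwI[where g = "\<lambda>j. (k - fst j, snd j)"]) auto
  have "((\<lambda>i::idx. 1 / (jb (fst i))\<^sup>2) has_sum jsum) UNIV"
    unfolding jsum_def by (rule has_sum_infsum[OF jb_summable_idx])
  then show ?thesis
    using has_sum_reindex_bij_betw[OF b, of "\<lambda>i. 1 / (jb (fst i))\<^sup>2" jsum] by simp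
qed

lemma jsum_nonneg: "0 \<le> jsum"
  unfolding jsum_def by (rule infsum_nonneg) simp

lemma jsum_shift_cmult: "((\<lambda>j::idx. c / (jb (k - fst j))\<^sup>2) has_sum (c * jsum)) UNIV"
  using has_sum_cmult_right[OF jsum_shift, of c k] by simp

section \<open>Kernels: action, composition, order\<close>

definition kapp :: "(idx \<Rightarrow> idx \<Rightarrow> complex) \<Rightarrow> (idx \<Rightarrow> complex) \<Rightarrow> idx \<Rightarrow> complex" where
  "kapp T x i = (\<Sum>\<^sub>\<infinity>j. T i j * x j)"

definition kcomp :: "(idx \<Rightarrow> idx \<Rightarrow> complex) \<Rightarrow> (idx \<Rightarrow> idx \<Rightarrow> complex) \<Rightarrow> idx \<Rightarrow> idx \<Rightarrow> complex" where
  "kcomp T S i j = (\<Sum>\<^sub>\<infinity>q. T i q * S q j)"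

definition kop :: "(idx \<Rightarrow> idx \<Rightarrow> complex) \<Rightarrow> idx ell2 \<Rightarrow> idx ell2" where
  "kop T x = Ell2 (kapp T (ell2_at x))"

text \<open>Schur's test. The majorant is symmetric, so its rows and its columns both sum to
  \<open>c * jsum\<close>: the rows enter through the weighted Cauchy-Schwarz inequality, the
  columns after the finite sum over \<open>i\<close> has been moved inside the sum over
  \<open>j\<close>.\<close>

lemma Schur_bound:
  assumes T: "\<And>i j. cmod (T i j) \<le> c / (jb (fst i - fst j))\<^sup>2"
  shows "ell2_at (kop T x) = kapp T (ell2_at x)" "norm (kop T x) \<le> c * jsum * norm x"
proof -
  have c: "0 \<le> c" using order_trans[OF norm_ge_zero T[of undefined undefined]] by simp
  define a where "a i j = c / (jb (fst i - fst j))\<^sup>2" for i j :: idx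
  define y where "y j = cmod (ell2_at x j)" for j
  have a0: "0 \<le> a i j" for i j using c by (simp add: a_def)
  have y0: "0 \<le> y j" for j by (simp add: y_def)
  have ya: "(\<lambda>j. (y j)\<^sup>2) summable_on UNIV" unfolding y_def by (rule ell2_at_summable)
  have as: "(a i has_sum (c * jsum)) UNIV" for i
    unfolding a_def by (rule jsum_shift_cmult)
  have ac: "a i j \<le> c" for i j
    unfolding a_def using c mult_left_mono[OF jb_power_ge_1[of "fst i - fst j" 2] c]
    by (simp add: divide_le_eq)
  have ay: "(\<lambda>j. a i j * (y j)\<^sup>2) summable_on UNIV" for i
    by (rule summable_on_comparison_test[OF summable_on_cmult_right[OF ya, of c]])
      (auto intro!: mult_right_mono ac simp: a0)
  note CS = infsum_Cauchy_Schwarz_weighted[OF has_sum_imp_summable[OF as] ay a0 y0]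
  have pt: "(cmod (kapp T (ell2_at x) i))\<^sup>2 \<le> c * jsum * (\<Sum>\<^sub>\<infinity>j. a i j * (y j)\<^sup>2)" for i
  proof -
    have "cmod (kapp T (ell2_at x) i) \<le> (\<Sum>\<^sub>\<infinity>j. a i j * y j)"
      unfolding kapp_def by (rule infsum_dominated[OF CS(1)])
        (unfold a_def y_def norm_mult, intro mult_right_mono T norm_ge_zero)
    then have "(cmod (kapp T (ell2_at x) i))\<^sup>2 \<le> (\<Sum>\<^sub>\<infinity>j. a i j * y j)\<^sup>2"
      by (rule power_mono) simp
    also have "\<dots> \<le> infsum (a i) UNIV * (\<Sum>\<^sub>\<infinity>j. a i j * (y j)\<^sup>2)" by (rule CS(2))
    also have "infsum (a i) UNIV = c * jsum" by (rule infsumI[OF as])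
    finally show ?thesis .
  qed
  have "(\<Sum>i\<in>F. (cmod (kapp T (ell2_at x) i))\<^sup>2) \<le> (c * jsum * norm x)\<^sup>2" if F: "finite F" for F
  proof -
    have "(\<Sum>i\<in>F. \<Sum>\<^sub>\<infinity>j. a i j * (y j)\<^sup>2) = (\<Sum>\<^sub>\<infinity>j. \<Sum>i\<in>F. a i j * (y j)\<^sup>2)"
      by (rule infsumI[OF has_sum_finite_sum[OF F has_sum_infsum[OF ay]], symmetric])
    also have "\<dots> \<le> (\<Sum>\<^sub>\<infinity>j. c * jsum * (y j)\<^sup>2)"
    proof (rule infsum_mono)
      show "(\<lambda>j. \<Sum>i\<in>F. a i j * (y j)\<^sup>2) summable_on UNIV"
        by (rule has_sum_imp_summable[OF has_sum_finite_sum[OF F has_sum_infsum[OF ay]]])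
      show "(\<lambda>j. c * jsum * (y j)\<^sup>2) summable_on UNIV" by (intro summable_on_cmult_right ya)
      show "(\<Sum>i\<in>F. a i j * (y j)\<^sup>2) \<le> c * jsum * (y j)\<^sup>2" for j
      proof -
        have "(\<Sum>i\<in>F. a i j) \<le> c * jsum"
          using finite_sum_le_has_sum[OF jsum_shift_cmult[of c "fst j"] F] a0
          by (auto simp: a_def jb_commute)
        then have "(\<Sum>i\<in>F. a i j) * (y j)\<^sup>2 \<le> c * jsum * (y j)\<^sup>2" by (rule mult_right_mono) simp
        then show ?thesis by (simp add: sum_distrib_right)
      qed
    qed
    also have "\<dots> = c * jsum * (norm x)\<^sup>2"
      unfolding norm_ell2_square y_def by (rule infsum_cmult_right')
    finally have Z: "(\<Sum>i\<in>F. \<Sum>\<^sub>\<infinity>j. a i j * (y j)\<^sup>2) \<le> c * jsum * (norm x)\<^sup>2" .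
    have "(\<Sum>i\<in>F. (cmod (kapp T (ell2_at x) i))\<^sup>2) \<le> (\<Sum>i\<in>F. c * jsum * (\<Sum>\<^sub>\<infinity>j. a i j * (y j)\<^sup>2))"
      by (rule sum_mono[OF pt])
    also have "\<dots> = c * jsum * (\<Sum>i\<in>F. \<Sum>\<^sub>\<infinity>j. a i j * (y j)\<^sup>2)" by (simp add: sum_distrib_left)
    also have "\<dots> \<le> c * jsum * (c * jsum * (norm x)\<^sup>2)"
      using c jsum_nonneg by (intro mult_left_mono[OF Z]) simp
    also have "\<dots> = (c * jsum * norm x)\<^sup>2" by (simp add: power2_eq_square mult_ac)
    finally show ?thesis .
  qed
  note * = norm_Ell2_le[OF this]
  show "ell2_at (kop T x) = kapp T (ell2_at x)" "norm (kop T x) \<le> c * jsum * norm x"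
    unfolding kop_def by (rule *; use c jsum_nonneg in simp)+
qed

text \<open>The matrix of an operator of order \<open>m\<close> on the circle: rapid decay off the
  diagonal reflects smooth coefficients. Measuring the order by \<open>fst j\<close> or by
  \<open>fst i\<close> is the same, by \<open>jb_powi_le\<close> and the decay. The constants do not
  depend on the parameter \<open>t\<close>, because the coefficients are bounded on the whole time
  axis.\<close>

definition kord :: "int \<Rightarrow> ('p \<Rightarrow> idx \<Rightarrow> idx \<Rightarrow> complex) \<Rightarrow> bool" where
  "kord m T \<longleftrightarrow> (\<forall>p::nat. \<exists>C. \<forall>t i j. cmod (T t i j) \<le> C * jb (fst j) powi m / jb (fst i - fst j) ^ p)"

lemma kordE:
  assumes "kord m T"
  obtains C where "C \<ge> 0" "\<And>t i j. cmod (T t i j) \<le> C * jb (fst j) powi m / jb (fst i - fst j) ^ p"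
proof -
  obtain C where C: "\<And>t i j. cmod (T t i j) \<le> C * jb (fst j) powi m / jb (fst i - fst j) ^ p"
    using assms unfolding kord_def by blast
  have "0 \<le> C * jb 0 powi m / jb 0 ^ p"
    using order_trans[OF norm_ge_zero C[of undefined "(0,True)" "(0,True)"]] by simp
  then have "C \<ge> 0" by simp
  then show ?thesis using C that by blast
qed

lemma kord_dominated:
  assumes "kord m S" "\<And>t i j. cmod (T t i j) \<le> c * cmod (S t i j)" "c \<ge> 0"
  shows "kord m T"
  unfolding kord_def
proof
  fix p
  obtain C where C: "C \<ge> 0" "\<And>t i j. cmod (S t i j) \<le> C * jb (fst j) powi m / jb (fst i - fst j) ^ p"
    using kordE[OF assms(1)] by blast
  have "cmod (T t i j) \<le> (c * C) * jb (fst j) powi m / jb (fst i - fst j) ^ p" for t i j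
    using order_trans[OF assms(2)[of t i j] mult_left_mono[OF C(2)[of t i j] assms(3)]] by (simp add: mult.assoc)
  then show "\<exists>C. \<forall>t i j. cmod (T t i j) \<le> C * jb (fst j) powi m / jb (fst i - fst j) ^ p" by blast
qed

lemma kord_mono:
  assumes "kord m T" "m \<le> n"
  shows "kord n T"
  unfolding kord_def
proof
  fix p
  obtain C where C: "C \<ge> 0" "\<And>t i j. cmod (T t i j) \<le> C * jb (fst j) powi m / jb (fst i - fst j) ^ p"
    using kordE[OF assms(1)] by blast
  have "cmod (T t i j) \<le> C * jb (fst j) powi n / jb (fst i - fst j) ^ p" for t i j
    by (rule order_trans[OF C(2)])
      (intro divide_right_mono mult_left_mono power_int_increasing assms C; simp add: jb_ge_1)
  then show "\<exists>C. \<forall>t i j. cmod (T t i j) \<le> C * jb (fst j) powi n / jb (fst i - fst j) ^ p" by blast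
qed

lemma kord_add:
  assumes "kord m T" "kord m S"
  shows "kord m (\<lambda>t i j. T t i j + S t i j)"
  unfolding kord_def
proof
  fix p
  obtain C where "C \<ge> 0" and C: "\<And>t i j. cmod (T t i j) \<le> C * jb (fst j) powi m / jb (fst i - fst j) ^ p"
    using kordE[OF assms(1)] by blast
  obtain D where "D \<ge> 0" and D: "\<And>t i j. cmod (S t i j) \<le> D * jb (fst j) powi m / jb (fst i - fst j) ^ p"
    using kordE[OF assms(2)] by blast
  have "cmod (T t i j + S t i j) \<le> (C + D) * jb (fst j) powi m / jb (fst i - fst j) ^ p" for t i j
  proof -
    have "cmod (T t i j + S t i j) \<le> cmod (T t i j) + cmod (S t i j)" by (rule norm_triangle_ineq)
    also have "\<dots> \<le> C * jb (fst j) powi m / jb (fst i - fst j) ^ p + D * jb (fst j) powi m / jb (fst i - fst j) ^ p"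
      by (intro add_mono C D)
    also have "\<dots> = (C + D) * jb (fst j) powi m / jb (fst i - fst j) ^ p"
      unfolding distrib_right add_divide_distrib ..
    finally show ?thesis .
  qed
  then show "\<exists>C. \<forall>t i j. cmod (T t i j + S t i j) \<le> C * jb (fst j) powi m / jb (fst i - fst j) ^ p" by blast
qed

lemma kord_uminus: "kord m T \<Longrightarrow> kord m (\<lambda>t i j. - T t i j)"
  by (rule kord_dominated[where c = 1]) auto

lemma kord_diff: "kord m T \<Longrightarrow> kord m S \<Longrightarrow> kord m (\<lambda>t i j. T t i j - S t i j)"
  using kord_add[of m T "\<lambda>t i j. - S t i j"] kord_uminus[of m S] by simp

lemma kord_if: "kord m T \<Longrightarrow> kord m (\<lambda>t i j. if P t i j then T t i j else 0)"
  by (rule kord_dominated[where c = 1]) auto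

text \<open>Budget of the decay: \<open>p\<close> powers of each factor combine by Peetre's
  inequality into decay in \<open>i - j\<close>, two more powers of \<open>T\<close> make the sum
  over \<open>q\<close> converge, and \<open>\<bar>m\<bar>\<close> more powers of \<open>S\<close>
  pay for moving the weight of order \<open>m\<close> from \<open>q\<close> to
  \<open>j\<close>.\<close>

lemma kord_comp_pointwise:
  assumes "kord m T" "kord n S"
  shows "\<exists>C\<ge>0. \<forall>t s i j q. cmod (T t i q * S s q j)
    \<le> C * jb (fst j) powi (m + n) / jb (fst i - fst j) ^ p / (jb (fst i - fst q))\<^sup>2"
proof -
  obtain C where C: "C \<ge> 0" "\<And>t i j. cmod (T t i j) \<le> C * jb (fst j) powi m / jb (fst i - fst j) ^ (p + 2)"
    using kordE[OF assms(1)] by blast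
  obtain D where D: "D \<ge> 0" "\<And>t i j. cmod (S t i j) \<le> D * jb (fst j) powi n / jb (fst i - fst j) ^ (p + nat \<bar>m\<bar>)"
    using kordE[OF assms(2)] by blast
  have "cmod (T t i q * S s q j)
    \<le> C * D * jb (fst j) powi (m + n) / jb (fst i - fst j) ^ p / (jb (fst i - fst q))\<^sup>2" for t s i j q
  proof -
    define X Y Z W where "X = jb (fst i - fst q)" and "Y = jb (fst q - fst j)"
      and "Z = jb (fst i - fst j)" and "W = jb (fst j)"
    note defs = X_def Y_def Z_def W_def
    have pos: "X > 0" "Y > 0" "Z > 0" "W > 0" by (simp_all add: defs)
    have "cmod (T t i q * S s q j) \<le> (C * jb (fst q) powi m / X ^ (p + 2)) * (D * W powi n / Y ^ (p + nat \<bar>m\<bar>))"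
      unfolding norm_mult defs by (intro mult_mono C D) (use C in auto)
    also have "\<dots> \<le> (C * (Y ^ nat \<bar>m\<bar> * W powi m) / X ^ (p + 2)) * (D * W powi n / Y ^ (p + nat \<bar>m\<bar>))"
      using C(1) D(1) pos jb_powi_le[of "fst q" m "fst j"] unfolding defs
      by (intro mult_right_mono divide_right_mono mult_left_mono) auto
    also have "\<dots> = C * D * W powi (m + n) / (X * Y) ^ p / X\<^sup>2"
      using pos by (simp add: power_int_add power_add power_mult_distrib field_simps power2_eq_square)
    also have "\<dots> \<le> C * D * W powi (m + n) / Z ^ p / X\<^sup>2"
      using C(1) D(1) pos jb_peetre[of "fst i" "fst j" "fst q"] unfolding defs
      by (intro divide_right_mono divide_left_mono power_mono mult_pos_pos zero_less_power) auto
    finally show ?thesis unfolding defs .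
  qed
  then show ?thesis using C(1) D(1) by (intro exI[of _ "C * D"]) auto
qed

lemma kord_comp:
  assumes "kord m T" "kord n S"
  shows "kord (m + n) (\<lambda>t. kcomp (T t) (S t))"
  unfolding kord_def
proof
  fix p
  obtain C where C: "C \<ge> 0" "\<And>t s i j q. cmod (T t i q * S s q j)
    \<le> C * jb (fst j) powi (m + n) / jb (fst i - fst j) ^ p / (jb (fst i - fst q))\<^sup>2"
    using kord_comp_pointwise[OF assms, of p] by blast
  have "cmod (kcomp (T t) (S t) i j) \<le> (C * jsum) * jb (fst j) powi (m + n) / jb (fst i - fst j) ^ p" for t i j
  proof -
    note h = jsum_shift_cmult[of "C * jb (fst j) powi (m + n) / jb (fst i - fst j) ^ p" "fst i"]
    show ?thesis
      using infsum_dominated[OF has_sum_imp_summable[OF h] C(2)[where t=t and s=t and i=i and j=j]] infsumI[OF h]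
      unfolding kcomp_def by (simp add: mult_ac)
  qed
  then show "\<exists>C. \<forall>t i j. cmod (kcomp (T t) (S t) i j) \<le> C * jb (fst j) powi (m + n) / jb (fst i - fst j) ^ p"
    by blast
qed

lemma kcomp_summable:
  assumes "kord m T" "kord n S"
  shows "(\<lambda>q. T t i q * S s q j) summable_on UNIV"
proof -
  obtain C where C: "C \<ge> 0" "\<And>t s i j q. cmod (T t i q * S s q j)
    \<le> C * jb (fst j) powi (m + n) / jb (fst i - fst j) ^ 0 / (jb (fst i - fst q))\<^sup>2"
    using kord_comp_pointwise[OF assms, of 0] by blast
  show ?thesis
    by (rule summable_on_dominated[OF has_sum_imp_summable[OF jsum_shift_cmult] C(2)])
qed

text \<open>Polynomially bounded families, the Fourier coefficients of distributions. Kernels of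
  positive order leave \<open>ell2\<close> but map this class to itself with a shift of the
  exponent. The constant \<open>D\<close> is explicit since it will depend on time and has to be
  integrated.\<close>

definition tempered :: "int \<Rightarrow> real \<Rightarrow> (idx \<Rightarrow> complex) \<Rightarrow> bool" where
  "tempered n D x \<longleftrightarrow> (\<forall>j. cmod (x j) \<le> D * jb (fst j) powi n)"

lemma tempered_ell2: "tempered 0 (norm x) (ell2_at x)"
  by (simp add: tempered_def cmod_ell2_at_le)

lemma tempered_nonneg: "tempered n D x \<Longrightarrow> 0 \<le> D"
proof -
  assume "tempered n D x"
  then have "0 \<le> D * jb 0 powi n"
    unfolding tempered_def using norm_ge_zero order_trans by (metis fst_conv)
  then show ?thesis by simp
qed

text \<open>The decay of the kernel is spent on two things: \<open>\<bar>m + n\<bar>\<close> powers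
  move the weight from the summation index \<open>j\<close> to the fixed index \<open>i\<close>, and
  two powers keep the sum over \<open>j\<close> convergent.\<close>

lemma kord_apply_pointwise:
  assumes "kord m T"
  shows "\<exists>C\<ge>0. \<forall>t x D. \<forall>i j::idx. tempered n D x \<longrightarrow>
    cmod (T t i j * x j) \<le> C * D * jb (fst i) powi (m + n) / (jb (fst i - fst j))\<^sup>2"
proof -
  obtain C where C: "C \<ge> 0" "\<And>t i j. cmod (T t i j) \<le> C * jb (fst j) powi m / jb (fst i - fst j) ^ (nat \<bar>m + n\<bar> + 2)"
    using kordE[OF assms(1)] by blast
  have "cmod (T t i j * x j) \<le> C * D * jb (fst i) powi (m + n) / (jb (fst i - fst j))\<^sup>2"
    if x: "tempered n D x" for t x D and i j :: idx
  proof -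
    define X W where "X = jb (fst i - fst j)" and "W = jb (fst j)"
    have pos: "X > 0" "W > 0" by (simp_all add: X_def W_def)
    have D: "D \<ge> 0" by (rule tempered_nonneg[OF x])
    have "cmod (T t i j * x j) \<le> (C * W powi m / X ^ (nat \<bar>m + n\<bar> + 2)) * (D * W powi n)"
      unfolding norm_mult X_def W_def by (intro mult_mono C x[unfolded tempered_def, rule_format]) (use C in auto)
    also have "\<dots> = C * D * W powi (m + n) / X ^ (nat \<bar>m + n\<bar> + 2)"
      using pos by (simp add: power_int_add)
    also have "\<dots> \<le> C * D * (X ^ nat \<bar>m + n\<bar> * jb (fst i) powi (m + n)) / X ^ (nat \<bar>m + n\<bar> + 2)"
      using C(1) D pos jb_powi_le[of "fst j" "m + n" "fst i"] unfolding X_def W_def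
      by (intro divide_right_mono mult_left_mono) (auto simp: jb_commute)
    also have "\<dots> = C * D * jb (fst i) powi (m + n) / X\<^sup>2"
      using pos by (simp add: power_add power2_eq_square)
    finally show ?thesis unfolding X_def .
  qed
  then show ?thesis using C(1) by blast
qed

lemma kapp_summable:
  assumes "kord m T" "tempered n D x"
  shows "(\<lambda>j. T t i j * x j) summable_on UNIV"
proof -
  obtain C where "\<And>t x D i j. tempered n D x \<Longrightarrow>
    cmod (T t i j * x j) \<le> C * D * jb (fst i) powi (m + n) / (jb (fst i - fst j))\<^sup>2"
    using kord_apply_pointwise[OF assms(1), of n] by blast
  note C = this[OF assms(2)]
  show ?thesis
    by (rule summable_on_dominated[OF has_sum_imp_summable[OF jsum_shift_cmult] C])
qed

lemma kapp_tempered: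
  assumes "kord m T"
  shows "\<exists>C\<ge>0. \<forall>t x D. tempered n D x \<longrightarrow> tempered (m + n) (C * D) (kapp (T t) x)"
proof -
  obtain C where C0: "C \<ge> 0" and C: "\<And>t x D i j. tempered n D x \<Longrightarrow>
    cmod (T t i j * x j) \<le> C * D * jb (fst i) powi (m + n) / (jb (fst i - fst j))\<^sup>2"
    using kord_apply_pointwise[OF assms(1), of n] by blast
  have "tempered (m + n) ((C * jsum) * D) (kapp (T t) x)" if x: "tempered n D x" for t D x
    unfolding tempered_def
  proof
    fix i :: idx
    note h = jsum_shift_cmult[of "C * D * jb (fst i) powi (m + n)" "fst i"]
    show "cmod (kapp (T t) x i) \<le> (C * jsum) * D * jb (fst i) powi (m + n)"
      using infsum_dominated[OF has_sum_imp_summable[OF h] C[OF x, of t]] infsumI[OF h]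
      unfolding kapp_def by (simp add: mult_ac)
  qed
  then show ?thesis using C0 jsum_nonneg by (intro exI[of _ "C * jsum"]) auto
qed

lemma kapp_kcomp:
  assumes "kord m T" "kord n S" "tempered q D x"
  shows "kapp (kcomp (T t) (S s)) x = kapp (T t) (kapp (S s) x)"
proof
  fix i :: idx
  obtain C where C0: "C \<ge> 0" and "\<And>t x D i j. tempered q D x \<Longrightarrow>
    cmod (S t i j * x j) \<le> C * D * jb (fst i) powi (n + q) / (jb (fst i - fst j))\<^sup>2"
    using kord_apply_pointwise[OF assms(2), of q] by blast
  note C = this(2)[OF assms(3)]
  \<comment> \<open>The weight is itself a tempered family. Applying the pointwise bound for
    \<open>T\<close> to it gives a bound for the kernel in which the growth of the intermediate
    index is already absorbed; this is the majorant for Fubini.\<close>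
  have w: "tempered (n + q) 1 (\<lambda>l. of_real (jb (fst l) powi (n + q)))"
    by (auto simp: tempered_def norm_power_int)
  obtain E where E0: "E \<ge> 0" and "\<And>t x D i j. tempered (n + q) D x \<Longrightarrow>
    cmod (T t i j * x j) \<le> E * D * jb (fst i) powi (m + (n + q)) / (jb (fst i - fst j))\<^sup>2"
    using kord_apply_pointwise[OF assms(1), of "n + q"] by blast
  note E = this(2)[OF w]
  define c where "c = C * D * (E * jb (fst i) powi (m + (n + q)))"
  have bd: "cmod (T t i l * S s l j * x j) \<le> c / (jb (fst i - fst l))\<^sup>2 * (1 / (jb (fst l - fst j))\<^sup>2)" for l j
  proof -
    have D0: "0 \<le> D" by (rule tempered_nonneg[OF assms(3)])
    have "cmod (T t i l * S s l j * x j) = cmod (T t i l) * cmod (S s l j * x j)"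
      by (simp add: norm_mult)
    also have "\<dots> \<le> cmod (T t i l) * (C * D * jb (fst l) powi (n + q) / (jb (fst l - fst j))\<^sup>2)"
      by (rule mult_left_mono[OF C]) simp
    also have "\<dots> = cmod (T t i l * of_real (jb (fst l) powi (n + q))) * (C * D / (jb (fst l - fst j))\<^sup>2)"
      by (simp add: norm_mult norm_power_int)
    also have "\<dots> \<le> (E * 1 * jb (fst i) powi (m + (n + q)) / (jb (fst i - fst l))\<^sup>2) * (C * D / (jb (fst l - fst j))\<^sup>2)"
      by (rule mult_right_mono[OF E]) (use C0 D0 in simp)
    finally show ?thesis by (simp add: c_def mult_ac)
  qed
  have c0: "c \<ge> 0" using bd[of i i] order_trans[OF norm_ge_zero] by force
  have sm: "(\<lambda>(l, j). c / (jb (fst i - fst l))\<^sup>2 * (1 / (jb (fst l - fst j))\<^sup>2)) summable_on (UNIV::idx set) \<times> (UNIV::idx set)"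
  proof (rule summable_on_SigmaI)
    show "((\<lambda>j::idx. case (l, j) of (l, j) \<Rightarrow> c / (jb (fst i - fst l))\<^sup>2 * (1 / (jb (fst l - fst j))\<^sup>2))
        has_sum c / (jb (fst i - fst l))\<^sup>2 * jsum) UNIV" for l :: idx
      using has_sum_cmult_right[OF jsum_shift[of "fst l"], of "c / (jb (fst i - fst l))\<^sup>2"] by simp
    show "(\<lambda>l. c / (jb (fst i - fst l))\<^sup>2 * jsum) summable_on (UNIV::idx set)"
      using summable_on_cmult_left[OF has_sum_imp_summable[OF jsum_shift_cmult]] .
  qed (use c0 in auto)
  have sm2: "(\<lambda>(l::idx, j). T t i l * S s l j * x j) summable_on UNIV \<times> UNIV"
  proof (rule summable_on_dominated[OF sm])
    fix z :: "idx \<times> idx"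
    show "cmod (case z of (l, j) \<Rightarrow> T t i l * S s l j * x j)
        \<le> (case z of (l, j) \<Rightarrow> c / (jb (fst i - fst l))\<^sup>2 * (1 / (jb (fst l - fst j))\<^sup>2))"
      unfolding case_prod_unfold by (rule bd)
  qed
  have sm3: "(\<lambda>(j, l::idx). T t i l * S s l j * x j) summable_on UNIV \<times> UNIV"
    using iffD1[OF summable_on_swap sm2] unfolding case_prod_unfold fst_conv snd_conv .
  have "kapp (kcomp (T t) (S s)) x i = (\<Sum>\<^sub>\<infinity>j. \<Sum>\<^sub>\<infinity>l. T t i l * S s l j * x j)"
    unfolding kapp_def kcomp_def infsum_cmult_left' ..
  also have "\<dots> = (\<Sum>\<^sub>\<infinity>l. \<Sum>\<^sub>\<infinity>j. T t i l * S s l j * x j)"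
    by (rule infsum_swap_banach[OF sm3])
  also have "\<dots> = kapp (T t) (kapp (S s) x) i"
    unfolding kapp_def mult.assoc infsum_cmult_right' ..
  finally show "kapp (kcomp (T t) (S s)) x i = kapp (T t) (kapp (S s) x) i" .
qed

lemma kord_kop_bounded:
  assumes "kord 0 T"
  shows "\<exists>C\<ge>0. \<forall>t x. ell2_at (kop (T t) x) = kapp (T t) (ell2_at x) \<and> norm (kop (T t) x) \<le> C * norm x"
proof -
  obtain C where C: "C \<ge> 0" "\<And>t i j. cmod (T t i j) \<le> C * jb (fst j) powi 0 / jb (fst i - fst j) ^ 2"
    using kordE[OF assms(1)] by blast
  have "cmod (T t i j) \<le> C / (jb (fst i - fst j))\<^sup>2" for t i j
    using C(2)[of t i j] by simp
  note S = Schur_bound[OF this]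
  show ?thesis
    by (rule exI[of _ "C * jsum"]) (use C(1) jsum_nonneg S in simp)
qed

section \<open>Locally integrable functions and their primitives\<close>

definition locint :: "(real \<Rightarrow> 'a::euclidean_space) \<Rightarrow> bool" where
  "locint f \<longleftrightarrow> (\<forall>a b. f absolutely_integrable_on {a..b})"

text \<open>Local absolute continuity of \<open>g\<close> with derivative \<open>f\<close>, stated
  as an integral identity so that differentiability almost everywhere never has to be discussed. The
  source term is only locally integrable in time, so classical derivatives would not do.\<close>

definition primitive_of :: "(real \<Rightarrow> 'a::euclidean_space) \<Rightarrow> (real \<Rightarrow> 'a) \<Rightarrow> bool" where
  "primitive_of g f \<longleftrightarrow> locint f \<and> (\<forall>a b. a \<le> b \<longrightarrow> g b - g a = integral {a..b} f)"

lemma locintD: "locint f \<Longrightarrow> f absolutely_integrable_on {a..b}" "locint f \<Longrightarrow> f integrable_on {a..b}"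
  by (auto simp: locint_def set_lebesgue_integral_eq_integral)

lemma locint_norm: "locint f \<Longrightarrow> locint (\<lambda>t. norm (f t))"
  unfolding locint_def using absolutely_integrable_norm[unfolded comp_def, where f = f] by blast

lemma locint_continuous: "continuous_on UNIV f \<Longrightarrow> locint f"
  unfolding locint_def
  by (metis absolutely_integrable_continuous_real continuous_on_subset top_greatest)

lemma locint_add: "locint f \<Longrightarrow> locint g \<Longrightarrow> locint (\<lambda>t. f t + g t)"
  by (simp add: locint_def set_integral_add)

lemma locint_diff: "locint f \<Longrightarrow> locint g \<Longrightarrow> locint (\<lambda>t. f t - g t)"
  by (simp add: locint_def set_integral_diff)

lemma locint_bounded_linear: "bounded_linear h \<Longrightarrow> locint f \<Longrightarrow> locint (\<lambda>t. h (f t))"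
  unfolding locint_def using absolutely_integrable_linear[unfolded o_def, where h = h and f = f] by blast

lemma locint_cmult: "locint f \<Longrightarrow> locint (\<lambda>t. (c::'a::{euclidean_space,real_normed_algebra}) * f t)"
  by (rule locint_bounded_linear[OF bounded_linear_mult_right])

lemma locint_dominated:
  fixes f :: "real \<Rightarrow> 'a::euclidean_space" and g :: "real \<Rightarrow> real"
  assumes "\<And>t. norm (f t) \<le> g t" "\<And>a b. f integrable_on {a..b}" "locint g"
  shows "locint f"
  unfolding locint_def
  by (intro allI absolutely_integrable_integrable_bound[where g = g] assms locintD)

lemma locint_mult_continuous:
  fixes f k :: "real \<Rightarrow> 'a::{euclidean_space,real_normed_field}"
  assumes k: "continuous_on UNIV k" and f: "locint f"
  shows "locint (\<lambda>t. k t * f t)"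
  unfolding locint_def
proof (intro allI)
  fix a b :: real
  have m: "k \<in> borel_measurable (lebesgue_on {a..b})"
    by (rule continuous_imp_measurable_on_sets_lebesgue) (auto intro: continuous_on_subset[OF k])
  have b: "bounded (k ` {a..b})"
    by (intro compact_imp_bounded compact_continuous_image continuous_on_subset[OF k]) auto
  show "(\<lambda>t. k t * f t) absolutely_integrable_on {a..b}"
    by (rule absolutely_integrable_bounded_measurable_product[OF bilinear_times m _ b locintD(1)[OF f]]) simp
qed

lemma primitive_ofD:
  assumes "primitive_of g f"
  shows "locint f" "a \<le> b \<Longrightarrow> g b - g a = integral {a..b} f"
  using assms by (auto simp: primitive_of_def)

lemma primitive_of_C1:
  assumes "\<And>t. (g has_vector_derivative g' t) (at t)" "continuous_on UNIV g'"
  shows "primitive_of g g'"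
  unfolding primitive_of_def
proof (intro conjI allI impI locint_continuous assms)
  fix a b :: real assume "a \<le> b"
  then show "g b - g a = integral {a..b} g'"
    by (intro integral_unique[symmetric] fundamental_theorem_of_calculus)
      (auto intro: has_vector_derivative_at_within assms)
qed

lemma primitive_of_exists:
  assumes f: "locint f"
  shows "\<exists>g. primitive_of g f \<and> g 0 = 0"
proof -
  define g where "g t = (if 0 \<le> t then integral {0..t} f else - integral {t..0} f)" for t :: real
  have "g b - g a = integral {a..b} f" if "a \<le> b" for a b
  proof -
    note c = Henstock_Kurzweil_Integration.integral_combine[OF _ _ locintD(2)[OF f]]
    consider "0 \<le> a" | "b < 0" | "a < 0" "0 \<le> b" by linarith
    then show ?thesis
    proof cases
      case 1 then show ?thesis using c[of 0 a b] that by (simp add: g_def algebra_simps)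
    next
      case 2 then show ?thesis using c[of a b 0] that by (auto simp: g_def algebra_simps)
    next
      case 3 then show ?thesis using c[of a 0 b] that by (simp add: g_def algebra_simps)
    qed
  qed
  then have "primitive_of g f" using f by (simp add: primitive_of_def)
  then show ?thesis by (intro exI[of _ g]) (simp add: g_def)
qed

lemma primitive_of_norm_bound:
  assumes "primitive_of g f" "a \<le> b" "\<And>t. norm (f t) \<le> H t" "locint H"
  shows "norm (g b - g a) \<le> integral {a..b} H"
  unfolding primitive_ofD(2)[OF assms(1,2)]
  by (rule integral_norm_bound_integral) (auto intro: locintD assms primitive_ofD[OF assms(1)])

lemma primitive_of_continuous:
  assumes "primitive_of g f"
  shows "continuous_on UNIV g"
proof -
  have "continuous_on {a<..<b} g" if "a < b" for a b
  proof -
    have "continuous_on {a..b} (\<lambda>t. integral {a..t} f)"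
      by (intro indefinite_integral_continuous_1 locintD primitive_ofD[OF assms])
    then have "continuous_on {a..b} (\<lambda>t. g a + integral {a..t} f)" by (intro continuous_intros)
    then have "continuous_on {a..b} g"
      by (rule continuous_on_eq) (use primitive_ofD(2)[OF assms] in \<open>auto simp: algebra_simps\<close>)
    then show ?thesis by (rule continuous_on_subset) auto
  qed
  then have "isCont g t" for t
    by (rule continuous_on_interior[of "{t-1<..<t+1}"]) (auto simp: interior_open)
  then show ?thesis by (simp add: continuous_at_imp_continuous_on)
qed

lemma primitive_of_derivative:
  assumes p: "primitive_of g f" and c: "continuous_on UNIV f"
  shows "(g has_vector_derivative f t) (at t)"
proof -
  have "((\<lambda>u. integral {t-1..u} f) has_vector_derivative f t) (at t within {t-1..t+1})"
    by (rule integral_has_vector_derivative) (auto intro: continuous_on_subset[OF c])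
  then have "((\<lambda>u. integral {t-1..u} f) has_vector_derivative f t) (at t)"
    by (simp add: at_within_interior[of t "{t-1..t+1}"])
  then have *: "((\<lambda>u. g (t-1) + integral {t-1..u} f) has_vector_derivative f t) (at t)"
    using has_vector_derivative_add[OF has_vector_derivative_const] by fastforce
  have e: "g (t-1) + integral {t-1..u} f = g u" if "u \<in> {t-1<..}" for u
    using primitive_ofD(2)[OF p, of "t - 1" u, symmetric] that by simp
  show ?thesis
    by (rule has_vector_derivative_transform_within_open[OF * _ _ e, of "{t-1<..}"]) auto
qed

lemma primitive_of_add:
  assumes "primitive_of g f" "primitive_of k l"
  shows "primitive_of (\<lambda>t. g t + k t) (\<lambda>t. f t + l t)"
  using assms unfolding primitive_of_def
  by (auto intro!: locint_add simp: integral_add locintD algebra_simps)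

lemma primitive_of_bounded_linear:
  assumes "primitive_of g f" "bounded_linear h"
  shows "primitive_of (\<lambda>t. h (g t)) (\<lambda>t. h (f t))"
  unfolding primitive_of_def
proof (intro conjI allI impI)
  show "locint (\<lambda>t. h (f t))" by (rule locint_bounded_linear[OF assms(2) primitive_ofD(1)[OF assms(1)]])
  fix a b :: real assume "a \<le> b"
  then have "h (g b) - h (g a) = h (integral {a..b} f)"
    by (simp add: primitive_ofD(2)[OF assms(1), symmetric] linear_diff[OF bounded_linear.linear[OF assms(2)]])
  also have "\<dots> = integral {a..b} (\<lambda>t. h (f t))"
    using integral_linear[OF locintD(2)[OF primitive_ofD(1)[OF assms(1)]] assms(2)] by (simp add: o_def)
  finally show "h (g b) - h (g a) = integral {a..b} (\<lambda>t. h (f t))" .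
qed

lemma primitive_of_cmult:
  "primitive_of g f \<Longrightarrow> primitive_of (\<lambda>t. (c::'a::{euclidean_space,real_normed_algebra}) * g t) (\<lambda>t. c * f t)"
  by (rule primitive_of_bounded_linear[OF _ bounded_linear_mult_right])

lemma primitive_of_uminus: "primitive_of g f \<Longrightarrow> primitive_of (\<lambda>t. - g t) (\<lambda>t. - f t)"
  by (rule primitive_of_bounded_linear[OF _ bounded_linear_minus[OF bounded_linear_ident]])

lemma primitive_of_diff:
  "primitive_of g f \<Longrightarrow> primitive_of k l \<Longrightarrow> primitive_of (\<lambda>t. g t - k t) (\<lambda>t. f t - l t)"
  using primitive_of_add[OF _ primitive_of_uminus, of g f k l] by simp

lemma primitive_of_const: "primitive_of (\<lambda>_. c) (\<lambda>_. 0)"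
  by (rule primitive_of_C1) (auto intro: derivative_eq_intros)

lemma primitive_of_sum:
  assumes "finite F" "\<And>i. i \<in> F \<Longrightarrow> primitive_of (g i) (f i)"
  shows "primitive_of (\<lambda>t. \<Sum>i\<in>F. g i t) (\<lambda>t. \<Sum>i\<in>F. f i t)"
  using assms by (induction F rule: finite_induct) (auto intro: primitive_of_const primitive_of_add)

text \<open>On a partition into n equal pieces the increments of \<open>F\<close> telescope, so the
  total increment of \<open>D\<close> is at most L (b - a) (F b - F a) / n, for every n. This
  replaces an argument with derivatives almost everywhere.\<close>

lemma constant_if_increment_small:
  fixes D :: "real \<Rightarrow> 'a::real_normed_vector"
  assumes "a \<le> b" and D: "\<And>s t. a \<le> s \<Longrightarrow> s \<le> t \<Longrightarrow> t \<le> b \<Longrightarrow> norm (D t - D s) \<le> L * (t - s) * (F t - F s)"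
  shows "D b = D a"
proof -
  have bd: "norm (D b - D a) \<le> L * (b - a) * (F b - F a) * inverse (real (Suc n))" for n
  proof -
    define h where "h = (b - a) / real (Suc n)"
    define x where "x i = a + real i * h" for i
    have h: "h \<ge> 0" using assms(1) by (simp add: h_def)
    have hn: "(1 + real n) * h = b - a" by (simp add: h_def)
    have x: "x 0 = a" "x (Suc n) = b" "x (Suc i) - x i = h" "x i \<le> x (Suc i)" for i
      using h hn by (simp_all add: x_def mult_right_mono) (simp add: algebra_simps)
    have xb: "x i \<le> b" if "i \<le> Suc n" for i
      using mult_right_mono[OF of_nat_mono[OF that] h] x(1,2) by (simp add: x_def)
    have xa: "a \<le> x i" for i using h by (simp add: x_def)
    have "norm (D b - D a) = norm (\<Sum>i<Suc n. D (x (Suc i)) - D (x i))"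
      using sum_lessThan_telescope[of "\<lambda>i. D (x i)" "Suc n"] by (simp only: x)
    also have "\<dots> \<le> (\<Sum>i<Suc n. norm (D (x (Suc i)) - D (x i)))" by (rule norm_sum)
    also have "\<dots> \<le> (\<Sum>i<Suc n. L * h * (F (x (Suc i)) - F (x i)))"
    proof (rule sum_mono)
      fix i assume "i \<in> {..<Suc n}"
      then show "norm (D (x (Suc i)) - D (x i)) \<le> L * h * (F (x (Suc i)) - F (x i))"
        using D[OF xa x(4) xb, of i] x(3)[of i] by simp
    qed
    also have "\<dots> = L * h * (F b - F a)"
      using sum_lessThan_telescope[of "\<lambda>i. F (x i)" "Suc n"]
      by (simp only: x sum_distrib_left[symmetric])
    finally show ?thesis by (simp add: h_def divide_inverse mult_ac)
  qed
  have "(\<lambda>n. L * (b - a) * (F b - F a) * inverse (real (Suc n))) \<longlonglongrightarrow> L * (b - a) * (F b - F a) * 0"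
    by (intro tendsto_intros LIMSEQ_inverse_real_of_nat)
  then have "norm (D b - D a) \<le> 0"
    using bd by (intro LIMSEQ_le_const[where X = "\<lambda>n. L * (b - a) * (F b - F a) * inverse (real (Suc n))"]) auto
  then show ?thesis by simp
qed

text \<open>Product rule with one factor merely absolutely continuous. The difference of
  \<open>k t * g t\<close> and the primitive \<open>Q\<close> of the expected derivative has
  increments bounded by the length of the interval times the variation of \<open>g\<close> there, so
  it is constant by \<open>constant_if_increment_small\<close>.\<close>

lemma primitive_of_mult:
  fixes g f k k' :: "real \<Rightarrow> 'a::{euclidean_space,real_normed_field}"
  assumes p: "primitive_of g f" and k: "\<And>t. (k has_vector_derivative k' t) (at t)" and k': "continuous_on UNIV k'"
  shows "primitive_of (\<lambda>t. k t * g t) (\<lambda>t. k' t * g t + k t * f t)"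
proof -
  note pk = primitive_of_C1[OF k k']
  have kc: "continuous_on UNIV k" by (rule primitive_of_continuous[OF pk])
  have gc: "continuous_on UNIV g" by (rule primitive_of_continuous[OF p])
  have li: "locint (\<lambda>t. k' t * g t + k t * f t)"
    by (intro locint_add locint_mult_continuous[OF kc] locint_continuous continuous_intros k' gc primitive_ofD(1)[OF p])
  obtain Q where Q: "primitive_of Q (\<lambda>t. k' t * g t + k t * f t)"
    using primitive_of_exists[OF li] by blast
  obtain F where F: "primitive_of F (\<lambda>t. norm (f t))"
    using primitive_of_exists[OF locint_norm[OF primitive_ofD(1)[OF p]]] by blast
  have gF: "norm (g t - g s) \<le> F t - F s" if "s \<le> t" for s t
    using primitive_of_norm_bound[OF p that _ primitive_ofD(1)[OF F]] primitive_ofD(2)[OF F that] by simp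
  have Fm: "F s \<le> F t" if "s \<le> t" for s t
    using gF[OF that] by (smt (verit) norm_ge_zero)
  define D where "D t = k t * g t - Q t" for t
  have "D b = D a" if ab: "a \<le> b" for a b
  proof -
    have "bounded (k' ` {a..b})"
      by (intro compact_imp_bounded compact_continuous_image continuous_on_subset[OF k']) auto
    then obtain L where L: "L > 0" "\<And>t. t \<in> {a..b} \<Longrightarrow> norm (k' t) \<le> L" by (auto simp: bounded_pos)
    have kl: "norm (k t - k r) \<le> L * (t - r)" if "a \<le> r" "r \<le> t" "t \<le> b" for r t
    proof -
      have "norm (k t - k r) \<le> integral {r..t} (\<lambda>_. L)"
        unfolding primitive_ofD(2)[OF pk that(2)]
        by (rule integral_norm_bound_integral) (use that L in \<open>auto intro: locintD primitive_ofD[OF pk]\<close>)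
      then show ?thesis using that by (simp add: mult.commute)
    qed
    have "norm (D t - D s) \<le> (2 * L) * (t - s) * (F t - F s)" if st: "a \<le> s" "s \<le> t" "t \<le> b" for s t
    proof -
      have i1: "((\<lambda>r. k t * f r) has_integral k t * (g t - g s)) {s..t}"
        unfolding primitive_ofD(2)[OF p st(2)]
        by (intro has_integral_mult_right integrable_integral locintD primitive_ofD[OF p])
      have i2: "((\<lambda>r. k' r * g s) has_integral (k t - k s) * g s) {s..t}"
        unfolding primitive_ofD(2)[OF pk st(2)]
        by (intro has_integral_mult_left integrable_integral locintD primitive_ofD[OF pk])
      have i3: "((\<lambda>t. k' t * g t + k t * f t) has_integral Q t - Q s) {s..t}"
        unfolding primitive_ofD(2)[OF Q st(2)] by (intro integrable_integral locintD li)
      have i4: "((\<lambda>r. (k t * f r + k' r * g s) - (k' r * g r + k r * f r)) has_integral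
          (k t * (g t - g s) + (k t - k s) * g s) - (Q t - Q s)) {s..t}"
        by (intro has_integral_diff has_integral_add i1 i2 i3)
      have i5: "((\<lambda>r. L * (t - s) * norm (f r) + L * (F t - F s)) has_integral
          (L * (t - s) * (F t - F s) + L * (F t - F s) * (t - s))) {s..t}"
        using has_integral_const_real[of "L * (F t - F s)" s t] st
        by (intro has_integral_add has_integral_mult_right)
          (auto simp: primitive_ofD(2)[OF F st(2)] mult_ac
            intro!: integrable_integral locintD primitive_ofD[OF F])
      have "norm (D t - D s) = norm ((k t * (g t - g s) + (k t - k s) * g s) - (Q t - Q s))"
        by (simp add: D_def algebra_simps)
      also have "\<dots> \<le> L * (t - s) * (F t - F s) + L * (F t - F s) * (t - s)"
        unfolding integral_unique[OF i4, symmetric] integral_unique[OF i5, symmetric]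
      proof (rule integral_norm_bound_integral)
        fix r assume r: "r \<in> {s..t}"
        have "norm (k t * f r + k' r * g s - (k' r * g r + k r * f r)) =
          norm ((k t - k r) * f r + k' r * (g s - g r))" by (simp add: algebra_simps)
        also have "\<dots> \<le> norm (k t - k r) * norm (f r) + norm (k' r) * norm (g r - g s)"
          by (metis norm_triangle_ineq norm_mult norm_minus_commute)
        also have "\<dots> \<le> (L * (t - s)) * norm (f r) + L * (F t - F s)"
        proof (intro add_mono mult_mono)
          have "norm (k t - k r) \<le> L * (t - r)" using r st by (intro kl) auto
          also have "\<dots> \<le> L * (t - s)" using r L by simp
          finally show "norm (k t - k r) \<le> L * (t - s)" .
          show "norm (k' r) \<le> L" using L r st by auto
          show "norm (g r - g s) \<le> F t - F s" using gF[of s r] Fm[of r t] r by auto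
        qed (use L st in auto)
        finally show "norm (k t * f r + k' r * g s - (k' r * g r + k r * f r))
            \<le> L * (t - s) * norm (f r) + L * (F t - F s)" .
      qed (use i4 i5 in \<open>auto simp: integrable_on_def\<close>)
      finally show ?thesis by (simp add: algebra_simps)
    qed
    then show ?thesis by (rule constant_if_increment_small[OF ab])
  qed
  then show ?thesis
    using Q unfolding primitive_of_def D_def by (auto simp: algebra_simps)
qed

text \<open>A sequence of finite sets that exhausts a countable index type. It replaces the net of
  all finite subsets behind \<open>infsum\<close> by a sequence, as dominated convergence
  requires.\<close>

definition initial :: "nat \<Rightarrow> 'i::countable set" where "initial N = {i. to_nat i < N}"

lemma finite_initial: "finite (initial N)"
  unfolding initial_def by (rule finite_imageD[of to_nat]) (auto intro: finite_subset[of _ "{..<N}"])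

lemma infsum_initial_tendsto:
  assumes "f summable_on (UNIV :: 'i::countable set)"
  shows "(\<lambda>N. \<Sum>i\<in>initial N. f i) \<longlonglongrightarrow> infsum f UNIV"
proof -
  have "filterlim initial (finite_subsets_at_top (UNIV :: 'i set)) sequentially"
    unfolding filterlim_finite_subsets_at_top
  proof (intro allI impI)
    fix X :: "'i set" assume X: "finite X \<and> X \<subseteq> UNIV"
    have "X \<subseteq> initial N" if N: "N \<ge> Suc (Max (to_nat ` X))" for N
    proof
      fix x assume "x \<in> X"
      then have "to_nat x \<le> Max (to_nat ` X)" using X by (intro Max_ge) auto
      then show "x \<in> initial N" using N by (simp add: initial_def)
    qed
    then show "\<forall>\<^sub>F y in sequentially. finite (initial y :: 'i set) \<and> X \<subseteq> initial y \<and> initial y \<subseteq> UNIV"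
      by (intro eventually_sequentiallyI[of "Suc (Max (to_nat ` X))"]) (simp add: finite_initial)
  qed
  then show ?thesis
    using has_sum_infsum[OF assms] unfolding has_sum_def by (rule filterlim_compose[rotated])
qed

text \<open>A bound of the product form \<open>a i * H t\<close> dominates the partial sums
  uniformly in their number and is integrable in time; all later exchanges of sum and time integral
  are of this kind.\<close>

lemma infsum_integral:
  fixes f :: "'i::countable \<Rightarrow> real \<Rightarrow> 'a::euclidean_space"
  assumes f: "\<And>i. locint (f i)" and H: "locint H" and a: "a summable_on UNIV"
    and bd: "\<And>i t. norm (f i t) \<le> a i * H t"
  shows "locint (\<lambda>t. \<Sum>\<^sub>\<infinity>i. f i t)"
    and "(\<lambda>N. \<Sum>i\<in>initial N. integral {b..c} (f i)) \<longlonglongrightarrow> integral {b..c} (\<lambda>t. \<Sum>\<^sub>\<infinity>i. f i t)"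
proof -
  define A where "A = (\<Sum>\<^sub>\<infinity>i. norm (a i))"
  have na: "(\<lambda>i. norm (a i)) summable_on UNIV"
    using a summable_on_iff_abs_summable_on_real by blast
  have bd': "norm (f i t) \<le> norm (a i) * norm (H t)" for i t
    using order_trans[OF bd abs_ge_self] by (simp add: abs_mult)
  have naH: "(\<lambda>i. norm (a i) * norm (H t)) summable_on UNIV" for t
    by (rule summable_on_cmult_left[OF na])
  have AH: "(\<Sum>\<^sub>\<infinity>i. norm (a i) * norm (H t)) = A * norm (H t)" for t
    unfolding A_def by (rule infsum_cmult_left')
  have s: "(\<lambda>i. f i t) summable_on UNIV" for t
    by (rule summable_on_dominated[OF naH bd'])
  have part: "norm (\<Sum>i\<in>initial N. f i t) \<le> A * norm (H t)" for N t
  proof -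
    have "norm (\<Sum>i\<in>initial N. f i t) \<le> (\<Sum>i\<in>initial N. norm (a i) * norm (H t))"
      by (rule sum_norm_le) (rule bd')
    also have "\<dots> \<le> A * norm (H t)"
      unfolding AH[symmetric] by (rule finite_sum_le_infsum[OF naH finite_initial]) auto
    finally show ?thesis .
  qed
  have nH: "locint (\<lambda>t. A * norm (H t))" by (intro locint_cmult locint_norm H)
  have int: "(\<lambda>t. \<Sum>i\<in>initial N. f i t) integrable_on {b..c}" for N b c
    by (intro integrable_sum finite_initial locintD f)
  note dc = dominated_convergence[OF int locintD(2)[OF nH] part infsum_initial_tendsto[OF s]]
  show "locint (\<lambda>t. \<Sum>\<^sub>\<infinity>i. f i t)"
  proof (rule locint_dominated[OF _ dc(1) nH])
    fix t show "norm (\<Sum>\<^sub>\<infinity>i. f i t) \<le> A * norm (H t)"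
      using infsum_dominated[OF naH bd'] unfolding AH .
  qed
  show "(\<lambda>N. \<Sum>i\<in>initial N. integral {b..c} (f i)) \<longlonglongrightarrow> integral {b..c} (\<lambda>t. \<Sum>\<^sub>\<infinity>i. f i t)"
    using dc(2)[of b c] by (simp add: integral_sum finite_initial locintD f)
qed

lemma primitive_of_infsum:
  fixes f :: "'i::countable \<Rightarrow> real \<Rightarrow> 'a::euclidean_space"
  assumes p: "\<And>i. primitive_of (g i) (f i)" and H: "locint H" and a: "a summable_on UNIV"
    and bd: "\<And>i t. norm (f i t) \<le> a i * H t" and s: "\<And>t. (\<lambda>i. g i t) summable_on UNIV"
  shows "primitive_of (\<lambda>t. \<Sum>\<^sub>\<infinity>i. g i t) (\<lambda>t. \<Sum>\<^sub>\<infinity>i. f i t)"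
  unfolding primitive_of_def
proof (intro conjI allI impI)
  note I = infsum_integral[OF primitive_ofD(1)[OF p] H a bd]
  show "locint (\<lambda>t. \<Sum>\<^sub>\<infinity>i. f i t)" by (rule I(1))
  fix b c :: real assume bc: "b \<le> c"
  have "(\<lambda>N. \<Sum>i\<in>initial N. integral {b..c} (f i)) \<longlonglongrightarrow> (\<Sum>\<^sub>\<infinity>i. g i c) - (\<Sum>\<^sub>\<infinity>i. g i b)"
    unfolding primitive_ofD(2)[OF p bc, symmetric] sum_subtractf
    by (intro tendsto_diff infsum_initial_tendsto s)
  then show "(\<Sum>\<^sub>\<infinity>i. g i c) - (\<Sum>\<^sub>\<infinity>i. g i b) = integral {b..c} (\<lambda>t. \<Sum>\<^sub>\<infinity>i. f i t)"
    using I(2) LIMSEQ_unique by blast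
qed

lemma continuous_on_infsum:
  fixes f :: "'i::countable \<Rightarrow> real \<Rightarrow> 'a::banach"
  assumes f: "\<And>i. continuous_on UNIV (f i)" and a: "a summable_on UNIV" and P: "continuous_on UNIV P"
    and bd: "\<And>i t. norm (f i t) \<le> a i * P t"
  shows "continuous_on UNIV (\<lambda>t. \<Sum>\<^sub>\<infinity>i. f i t)"
proof -
  have na: "(\<lambda>i. norm (a i)) summable_on UNIV"
    using a summable_on_iff_abs_summable_on_real by blast
  have "continuous_on {b..c} (\<lambda>t. \<Sum>\<^sub>\<infinity>i. f i t)" for b c
  proof -
    have "bounded (P ` {b..c})"
      by (intro compact_imp_bounded compact_continuous_image continuous_on_subset[OF P]) auto
    then obtain L where L: "L > 0" "\<And>t. t \<in> {b..c} \<Longrightarrow> norm (P t) \<le> L" by (auto simp: bounded_pos)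
    have bd': "norm (f i t) \<le> norm (a i) * L" if "t \<in> {b..c}" for i t
    proof -
      have "norm (f i t) \<le> norm (a i) * norm (P t)"
        using order_trans[OF bd abs_ge_self] by (simp add: abs_mult)
      also have "\<dots> \<le> norm (a i) * L" by (intro mult_left_mono L that) auto
      finally show ?thesis .
    qed
    have naL: "(\<lambda>i. norm (a i) * L) summable_on UNIV" by (rule summable_on_cmult_left[OF na])
    have s: "(\<lambda>i. f i t) summable_on UNIV" if "t \<in> {b..c}" for t
      by (rule summable_on_dominated[OF naL bd'[OF that]])
    have tail: "norm ((\<Sum>\<^sub>\<infinity>i. f i t) - (\<Sum>i\<in>initial N. f i t)) \<le> (\<Sum>\<^sub>\<infinity>i. norm (a i) * L) - (\<Sum>i\<in>initial N. norm (a i) * L)"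
      if t: "t \<in> {b..c}" for t N
    proof -
      have e: "(\<Sum>\<^sub>\<infinity>i\<in>-initial N. h i) = infsum h UNIV - (\<Sum>i\<in>initial N. h i)"
        if "h summable_on UNIV" for h :: "'i \<Rightarrow> 'b::banach"
        using infsum_Un_disjoint[of h "initial N" "- initial N"] that finite_initial[where 'a = 'i and N = N]
        by (auto simp: summable_on_subset_banach)
      have "norm (\<Sum>\<^sub>\<infinity>i\<in>-initial N. f i t) \<le> (\<Sum>\<^sub>\<infinity>i\<in>-initial N. norm (a i) * L)"
        by (rule infsum_dominated[OF summable_on_subset_banach[OF naL] bd'[OF t]]) simp
      then show ?thesis unfolding e[OF s[OF t]] e[OF naL] .
    qed
    have "uniform_limit {b..c} (\<lambda>N t. \<Sum>i\<in>initial N. f i t) (\<lambda>t. \<Sum>\<^sub>\<infinity>i. f i t) sequentially"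
    proof (rule uniform_limitI)
      fix e :: real assume "e > 0"
      have "(\<lambda>N. (\<Sum>\<^sub>\<infinity>i. norm (a i) * L) - (\<Sum>i\<in>initial N. norm (a i) * L)) \<longlonglongrightarrow> (\<Sum>\<^sub>\<infinity>i. norm (a i) * L) - (\<Sum>\<^sub>\<infinity>i. norm (a i) * L)"
        by (intro tendsto_diff tendsto_const infsum_initial_tendsto naL)
      then have "\<forall>\<^sub>F N in sequentially. (\<Sum>\<^sub>\<infinity>i. norm (a i) * L) - (\<Sum>i\<in>initial N. norm (a i) * L) < e"
        using \<open>e > 0\<close> by (intro order_tendstoD(2)) auto
      then show "\<forall>\<^sub>F N in sequentially. \<forall>t\<in>{b..c}. dist (\<Sum>i\<in>initial N. f i t) (\<Sum>\<^sub>\<infinity>i. f i t) < e"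
      proof eventually_elim
        case (elim N)
        show ?case
          using elim tail[of _ N] by (auto simp: dist_norm norm_minus_commute simp del: atLeastAtMost_iff intro: le_less_trans)
      qed
    qed
    then show ?thesis
      by (rule uniform_limit_theorem[rotated])
        (auto intro!: always_eventually continuous_on_sum continuous_on_subset[OF f])
  qed
  note c = this
  have "isCont (\<lambda>t. \<Sum>\<^sub>\<infinity>i. f i t) t" for t
    by (rule continuous_on_interior[OF c[of "t - 1" "t + 1"]]) auto
  then show ?thesis by (simp add: continuous_at_imp_continuous_on)
qed

lemma derivative_infsum:
  fixes f :: "'i::countable \<Rightarrow> real \<Rightarrow> 'a::euclidean_space"
  assumes "\<And>i t. (g i has_vector_derivative f i t) (at t)" "\<And>i. continuous_on UNIV (f i)"
    and "a summable_on UNIV" "\<And>i t. norm (f i t) \<le> a i" "\<And>t. (\<lambda>i. g i t) summable_on UNIV"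
  shows "((\<lambda>t. \<Sum>\<^sub>\<infinity>i. g i t) has_vector_derivative (\<Sum>\<^sub>\<infinity>i. f i t)) (at t)"
    and "continuous_on UNIV (\<lambda>t. \<Sum>\<^sub>\<infinity>i. f i t)"
proof -
  show c: "continuous_on UNIV (\<lambda>t. \<Sum>\<^sub>\<infinity>i. f i t)"
    by (rule continuous_on_infsum[where P = "\<lambda>_. 1" and a = a]) (use assms in auto)
  have "primitive_of (\<lambda>t. \<Sum>\<^sub>\<infinity>i. g i t) (\<lambda>t. \<Sum>\<^sub>\<infinity>i. f i t)"
    by (rule primitive_of_infsum[where H = "\<lambda>_. 1" and a = a])
      (use assms in \<open>auto intro: primitive_of_C1 locint_continuous\<close>)
  then show "((\<lambda>t. \<Sum>\<^sub>\<infinity>i. g i t) has_vector_derivative (\<Sum>\<^sub>\<infinity>i. f i t)) (at t)"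
    by (rule primitive_of_derivative[OF _ c])
qed

text \<open>Minkowski's integral inequality by duality: the vector of increments is paired with
  itself. Its squared length \<open>S\<^sup>2\<close> then is the increment of a scalar primitive
  whose derivative is at most \<open>S * H t\<close> by Cauchy-Schwarz, and one factor
  \<open>S\<close> cancels.\<close>

lemma primitive_of_l2_bound:
  fixes z g :: "'i \<Rightarrow> real \<Rightarrow> complex"
  assumes p: "\<And>i. primitive_of (z i) (g i)" and H: "locint H" "\<And>t. H t \<ge> 0" and F: "finite F"
    and bd: "\<And>t. (\<Sum>i\<in>F. (cmod (g i t))\<^sup>2) \<le> (H t)\<^sup>2" and ab: "a \<le> b"
  shows "(\<Sum>i\<in>F. (cmod (z i b - z i a))\<^sup>2) \<le> (integral {a..b} H)\<^sup>2"
proof -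
  define c where "c i = z i b - z i a" for i
  define S where "S = L2_set (\<lambda>i. cmod (c i)) F"
  have S2: "S\<^sup>2 = (\<Sum>i\<in>F. (cmod (c i))\<^sup>2)" by (simp add: S_def L2_set_def sum_nonneg)
  have S0: "S \<ge> 0" by (simp add: S_def L2_set_nonneg)
  have I0: "integral {a..b} H \<ge> 0" by (intro Henstock_Kurzweil_Integration.integral_nonneg locintD H)
  have P: "primitive_of (\<lambda>t. \<Sum>i\<in>F. cnj (c i) * z i t) (\<lambda>t. \<Sum>i\<in>F. cnj (c i) * g i t)"
    by (intro primitive_of_sum F primitive_of_cmult p)
  have "cmod (\<Sum>i\<in>F. cnj (c i) * g i t) \<le> S * H t" for t
  proof -
    have "cmod (\<Sum>i\<in>F. cnj (c i) * g i t) \<le> (\<Sum>i\<in>F. \<bar>cmod (c i)\<bar> * \<bar>cmod (g i t)\<bar>)"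
      by (rule sum_norm_le) (simp add: norm_mult)
    also have "\<dots> \<le> S * L2_set (\<lambda>i. cmod (g i t)) F"
      unfolding S_def by (rule L2_set_mult_ineq)
    also have "\<dots> \<le> S * H t"
      using bd[of t] H(2)[of t] by (intro mult_left_mono S0) (auto simp: L2_set_def intro: real_le_lsqrt sum_nonneg)
    finally show ?thesis .
  qed
  then have "cmod ((\<Sum>i\<in>F. cnj (c i) * z i b) - (\<Sum>i\<in>F. cnj (c i) * z i a)) \<le> integral {a..b} (\<lambda>t. S * H t)"
    by (intro primitive_of_norm_bound[OF P ab]) (auto intro: locint_cmult H)
  also have "(\<Sum>i\<in>F. cnj (c i) * z i b) - (\<Sum>i\<in>F. cnj (c i) * z i a) = (\<Sum>i\<in>F. of_real ((cmod (c i))\<^sup>2))"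
    unfolding sum_subtractf[symmetric] right_diff_distrib[symmetric] c_def[symmetric]
    by (intro sum.cong refl) (metis complex_norm_square mult.commute)
  also have "\<dots> = complex_of_real (S\<^sup>2)" unfolding S2 by simp
  finally have "S\<^sup>2 \<le> S * integral {a..b} H" by (simp add: norm_power)
  then have "S \<le> integral {a..b} H"
    using S0 I0 by (cases "S = 0") (auto simp: power2_eq_square)
  then have "S\<^sup>2 \<le> (integral {a..b} H)\<^sup>2" using S0 by (rule power_mono)
  then show ?thesis by (simp add: S2 c_def)
qed

lemma Gronwall_zero_right:
  fixes f :: "real \<Rightarrow> real"
  assumes f: "continuous_on UNIV f" "\<And>t. f t \<ge> 0" and C: "C \<ge> 0"
    and bd: "\<And>t. t \<ge> 0 \<Longrightarrow> f t \<le> C * integral {0..t} f" and t: "t \<ge> 0"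
  shows "f t = 0"
proof -
  obtain G where G: "primitive_of G f" "G 0 = 0"
    using primitive_of_exists[OF locint_continuous[OF f(1)]] by blast
  have Gi: "integral {0..t} f = G t" if "t \<ge> 0" for t
    using primitive_ofD(2)[OF G(1) that] G(2) by simp
  have d: "((\<lambda>t. exp (- C * t) * G t) has_real_derivative exp (- C * t) * (f t - C * G t)) (at t)" for t
    using primitive_of_derivative[OF G(1) f(1), of t]
    unfolding has_real_derivative_iff_has_vector_derivative[symmetric]
    by (auto intro!: derivative_eq_intros simp: algebra_simps)
  have "exp (- C * t) * G t \<le> exp (- C * 0) * G 0"
  proof (rule DERIV_nonpos_imp_nonincreasing[OF t], intro exI conjI)
    fix x assume "0 \<le> x" "x \<le> t"
    then show "exp (- C * x) * (f x - C * G x) \<le> 0"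
      using bd[of x] Gi[of x] by (simp add: mult_le_0_iff)
  qed (rule d)
  then have "G t \<le> 0" using G(2) by (simp add: mult_le_0_iff)
  then have "C * G t \<le> 0" using C by (simp add: mult_nonneg_nonpos)
  then show ?thesis using bd[OF t] Gi[OF t] f(2)[of t] by simp
qed

lemma Gronwall_zero:
  fixes f :: "real \<Rightarrow> real"
  assumes f: "continuous_on UNIV f" "\<And>t. f t \<ge> 0" "f 0 = 0" and C: "C \<ge> 0"
    and bd: "\<And>s t. s \<le> t \<Longrightarrow> \<bar>f t - f s\<bar> \<le> C * integral {s..t} f"
  shows "f t = 0"
proof (cases "t \<ge> 0")
  case True
  show ?thesis
    by (rule Gronwall_zero_right[OF f(1,2) C _ True]) (use bd[of 0] f in force)
next
  case False
  have "f (- (- t)) = 0"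
  proof (rule Gronwall_zero_right[where f = "\<lambda>t. f (- t)" and C = C])
    show "continuous_on UNIV (\<lambda>t. f (- t))"
      by (rule continuous_on_compose2[OF f(1)]) (auto intro: continuous_intros)
    show "f (- t) \<le> C * integral {0..t} (\<lambda>t. f (- t))" if "t \<ge> 0" for t
      using bd[of "- t" 0] that f Henstock_Kurzweil_Integration.integral_reflect_real[of 0 "-t" f] by simp
  qed (use f C False in auto)
  then show ?thesis by simp
qed

section \<open>Normal form of the kernel\<close>

text \<open>Differentiability and continuity in time are required entry by entry only. The uniform
  bounds contained in \<open>kord\<close> for \<open>T\<close> and \<open>T'\<close> carry them over
  to sums by domination.\<close>

definition kC1 :: "int \<Rightarrow> (real \<Rightarrow> idx \<Rightarrow> idx \<Rightarrow> complex) \<Rightarrow> (real \<Rightarrow> idx \<Rightarrow> idx \<Rightarrow> complex) \<Rightarrow> bool" where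
  "kC1 m T T' \<longleftrightarrow> kord m T \<and> kord m T' \<and> (\<forall>t i j. ((\<lambda>t. T t i j) has_vector_derivative T' t i j) (at t))
     \<and> (\<forall>i j. continuous_on UNIV (\<lambda>t. T' t i j))"

lemma kC1D:
  assumes "kC1 m T T'"
  shows "kord m T" "kord m T'" "((\<lambda>t. T t i j) has_vector_derivative T' t i j) (at t)"
    "continuous_on UNIV (\<lambda>t. T' t i j)"
  using assms unfolding kC1_def by blast+

lemma kC1I:
  assumes "kord m T" "kord m T'" "\<And>t i j. ((\<lambda>t. T t i j) has_vector_derivative T' t i j) (at t)"
    "\<And>i j. continuous_on UNIV (\<lambda>t. T' t i j)"
  shows "kC1 m T T'"
  using assms unfolding kC1_def by blast

lemma kC1_primitive: "kC1 m T T' \<Longrightarrow> primitive_of (\<lambda>t. T t i j) (\<lambda>t. T' t i j)"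
  by (rule primitive_of_C1) (auto dest: kC1D)

lemma kC1_continuous: "kC1 m T T' \<Longrightarrow> continuous_on UNIV (\<lambda>t. T t i j)"
  by (rule primitive_of_continuous[OF kC1_primitive])

lemma kC1_add: "kC1 m T T' \<Longrightarrow> kC1 m S S' \<Longrightarrow> kC1 m (\<lambda>t i j. T t i j + S t i j) (\<lambda>t i j. T' t i j + S' t i j)"
  by (rule kC1I) (intro kord_add has_vector_derivative_add continuous_on_add kC1D | assumption)+

lemma kC1_diff: "kC1 m T T' \<Longrightarrow> kC1 m S S' \<Longrightarrow> kC1 m (\<lambda>t i j. T t i j - S t i j) (\<lambda>t i j. T' t i j - S' t i j)"
  by (rule kC1I) (intro kord_diff has_vector_derivative_diff continuous_on_diff kC1D | assumption)+

lemma kC1_mono: "kC1 m T T' \<Longrightarrow> m \<le> n \<Longrightarrow> kC1 n T T'"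
  unfolding kC1_def by (auto intro: kord_mono)

lemma kC1_if:
  assumes "kC1 m T T'"
  shows "kC1 m (\<lambda>t i j. if P i j then T t i j else 0) (\<lambda>t i j. if P i j then T' t i j else 0)"
proof (rule kC1I)
  show "((\<lambda>t. if P i j then T t i j else 0) has_vector_derivative (if P i j then T' t i j else 0)) (at t)" for t i j
    using kC1D(3)[OF assms] by (cases "P i j") auto
  show "continuous_on UNIV (\<lambda>t. if P i j then T' t i j else 0)" for i j
    using kC1D(4)[OF assms] by (cases "P i j") auto
qed (intro kord_if kC1D[OF assms])+

lemma kC1_comp:
  assumes T: "kC1 m T T'" and S: "kC1 n S S'"
  shows "kC1 (m + n) (\<lambda>t. kcomp (T t) (S t)) (\<lambda>t i j. kcomp (T' t) (S t) i j + kcomp (T t) (S' t) i j)"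
proof -
  have "((\<lambda>t. kcomp (T t) (S t) i j) has_vector_derivative (kcomp (T' t) (S t) i j + kcomp (T t) (S' t) i j)) (at t)
      \<and> continuous_on UNIV (\<lambda>t. kcomp (T' t) (S t) i j + kcomp (T t) (S' t) i j)" for t i j
  proof -
    obtain C where C: "C \<ge> 0" "\<And>t s i j q. cmod (T' t i q * S s q j)
        \<le> C * jb (fst j) powi (m + n) / jb (fst i - fst j) ^ 0 / (jb (fst i - fst q))\<^sup>2"
      using kord_comp_pointwise[OF kC1D(2)[OF T] kC1D(1)[OF S], of 0] by blast
    obtain D where D: "D \<ge> 0" "\<And>t s i j q. cmod (T t i q * S' s q j)
        \<le> D * jb (fst j) powi (m + n) / jb (fst i - fst j) ^ 0 / (jb (fst i - fst q))\<^sup>2"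
      using kord_comp_pointwise[OF kC1D(1)[OF T] kC1D(2)[OF S], of 0] by blast
    define a where "a q = (C + D) * jb (fst j) powi (m + n) / (jb (fst i - fst q))\<^sup>2" for q :: idx
    have a: "a summable_on UNIV"
      unfolding a_def by (rule has_sum_imp_summable[OF jsum_shift_cmult])
    have bd: "norm (T' t i q * S t q j + T t i q * S' t q j) \<le> a q" for q t
      using norm_triangle_ineq[of "T' t i q * S t q j" "T t i q * S' t q j"] C(2)[of t i q t j] D(2)[of t i q t j]
      by (simp add: a_def distrib_right add_divide_distrib)
    note s1 = kcomp_summable[OF kC1D(2)[OF T] kC1D(1)[OF S]]
    note s2 = kcomp_summable[OF kC1D(1)[OF T] kC1D(2)[OF S]]
    have e: "(\<Sum>\<^sub>\<infinity>q. T' t i q * S t q j + T t i q * S' t q j) = kcomp (T' t) (S t) i j + kcomp (T t) (S' t) i j" for t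
      unfolding kcomp_def by (rule infsum_add[OF s1 s2])
    have d: "((\<lambda>t. T t i q * S t q j) has_vector_derivative (T' t i q * S t q j + T t i q * S' t q j)) (at t)" for q t
      using has_vector_derivative_mult[OF kC1D(3)[OF T, of i q t] kC1D(3)[OF S, of q j t]] by (simp add: add.commute)
    have c: "continuous_on UNIV (\<lambda>t. T' t i q * S t q j + T t i q * S' t q j)" for q
      by (intro continuous_intros kC1D(4)[OF T] kC1D(4)[OF S] kC1_continuous[OF T] kC1_continuous[OF S])
    show ?thesis
      using derivative_infsum[OF d c a bd kcomp_summable[OF kC1D(1)[OF T] kC1D(1)[OF S]]]
      unfolding e by (simp add: kcomp_def)
  qed
  then show ?thesis
    by (intro kC1I kord_add kord_comp kC1D(1)[OF T] kC1D(1)[OF S] kC1D(2)[OF T] kC1D(2)[OF S]) blast+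
qed

section \<open>Eigenvalue gaps and resonances\<close>

lemma one_le_abs_of_int: "k \<noteq> 0 \<Longrightarrow> 1 \<le> \<bar>real_of_int k\<bar>"
  by linarith

definition om :: "idx \<Rightarrow> real" where
  "om i = (if snd i then 1 else -1) * real_of_int (fst i) ^ 4"

lemma abs_om_le: "\<bar>om i\<bar> \<le> jb (fst i) ^ 4"
proof -
  have "\<bar>om i\<bar> = \<bar>real_of_int (fst i)\<bar> ^ 4" by (simp add: om_def abs_mult)
  also have "\<dots> \<le> jb (fst i) ^ 4" unfolding jb_def by (rule power_mono) auto
  finally show ?thesis .
qed

text \<open>The critical case is that of equal signs and neighbouring frequencies: a^4 - b^4 = (a -
  b) (a + b) (a^2 + b^2) with |a - b| at least 1 leaves a cubic lower bound. If a = b, the signs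
  differ and the gap is 2 b^4. The constant 8 comes from (1 + b)^3 \<le> (2 b)^3.\<close>

lemma om_gap:
  assumes "om i \<noteq> om j"
  shows "jb (fst j) ^ 3 \<le> 8 * \<bar>om i - om j\<bar>"
proof -
  define a b where "a = \<bar>real_of_int (fst i)\<bar>" and "b = \<bar>real_of_int (fst j)\<bar>"
  have ab: "a \<ge> 0" "b \<ge> 0" by (simp_all add: a_def b_def)
  have o: "om i = (if snd i then a ^ 4 else - (a ^ 4))" "om j = (if snd j then b ^ 4 else - (b ^ 4))"
    by (simp_all add: om_def a_def b_def)
  have p: "a ^ 4 \<ge> 0" "b ^ 4 \<ge> 0" by (simp_all add: ab)
  have b1: "b \<ge> 1" if "b \<noteq> 0" using that one_le_abs_of_int[of "fst j"] by (simp add: b_def)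
  have a1: "a \<ge> 1" if "a \<noteq> 0" using that one_le_abs_of_int[of "fst i"] by (simp add: a_def)
  have "jb (fst j) ^ 3 = (1 + b) ^ 3" by (simp add: jb_def b_def)
  have cube: "(1 + b) ^ 3 \<le> 8 * b ^ 3" if "b \<noteq> 0"
    using power_mono[of "1 + b" "2 * b" 3] b1[OF that] ab by (simp add: power_mult_distrib)
  have "(1 + b) ^ 3 \<le> 8 * \<bar>om i - om j\<bar>"
  proof (cases "a = b")
    case True
    then have b0: "b \<noteq> 0" and d: "\<bar>om i - om j\<bar> = 2 * b ^ 4" using assms o by (auto split: if_splits)
    have "b ^ 3 \<le> b ^ 4" by (rule power_increasing) (use b1[OF b0] in auto)
    then have "b ^ 3 \<le> 2 * b ^ 4" using p(2) by linarith
    then have "8 * b ^ 3 \<le> 8 * (2 * b ^ 4)" by simp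
    then show ?thesis unfolding d by (rule order_trans[OF cube[OF b0]])
  next
    case False
    have diff: "\<bar>a - b\<bar> \<ge> 1"
      using False one_le_abs_of_int[of "\<bar>fst i\<bar> - \<bar>fst j\<bar>"] by (auto simp: a_def b_def)
    have f: "a ^ 4 - b ^ 4 = (a - b) * ((a + b) * (a\<^sup>2 + b\<^sup>2))" by algebra
    have ge: "(a + b) * (a\<^sup>2 + b\<^sup>2) \<le> \<bar>a ^ 4 - b ^ 4\<bar>"
      unfolding f abs_mult using mult_right_mono[OF diff, of "\<bar>a + b\<bar> * \<bar>a\<^sup>2 + b\<^sup>2\<bar>"] ab by simp
    have ge2: "\<bar>a ^ 4 - b ^ 4\<bar> \<le> \<bar>om i - om j\<bar>"
    proof -
      have "\<bar>a ^ 4 - b ^ 4\<bar> \<le> a ^ 4 + b ^ 4" "\<bar>- (a ^ 4) - b ^ 4\<bar> = a ^ 4 + b ^ 4" using p by linarith+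
      then show ?thesis using o by (auto split: if_splits)
    qed
    have e: "(a + b) * (a\<^sup>2 + b\<^sup>2) = a ^ 3 + a * b\<^sup>2 + a\<^sup>2 * b + b ^ 3" by algebra
    have nn: "0 \<le> a ^ 3" "0 \<le> a * b\<^sup>2" "0 \<le> a\<^sup>2 * b" "0 \<le> b ^ 3" using ab by simp_all
    have g: "a ^ 3 \<le> \<bar>om i - om j\<bar>" "b ^ 3 \<le> \<bar>om i - om j\<bar>"
      using order_trans[OF ge ge2] nn unfolding e by linarith+
    show ?thesis
    proof (cases "b = 0")
      case True
      then have "a \<noteq> 0" using False by simp
      then have "1 \<le> a ^ 3" using a1 by simp
      then show ?thesis using g(1) True by simp
    next
      case False
      have "8 * b ^ 3 \<le> 8 * \<bar>om i - om j\<bar>" using g(2) by simp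
      then show ?thesis by (rule order_trans[OF cube[OF False]])
    qed
  qed
  then show ?thesis by (simp add: jb_def b_def)
qed

lemma om_eq_imp: "om i = om j \<Longrightarrow> i \<noteq> j \<Longrightarrow> fst i = - fst j"
proof -
  assume o: "om i = om j" and n: "i \<noteq> j"
  define a b where "a = real_of_int (fst i)" and "b = real_of_int (fst j)"
  have p: "a ^ 4 \<ge> 0" "b ^ 4 \<ge> 0" by simp_all
  have *: "a ^ 4 = b ^ 4 \<Longrightarrow> \<bar>a\<bar> = \<bar>b\<bar>"
    using power_eq_imp_eq_base[of "\<bar>a\<bar>" 4 "\<bar>b\<bar>"] by simp
  show ?thesis
  proof (cases "snd i = snd j")
    case True
    then have "\<bar>a\<bar> = \<bar>b\<bar>" using o * by (auto simp: om_def a_def b_def split: if_splits)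
    then have "fst i = fst j \<or> fst i = - fst j" by (auto simp: a_def b_def abs_eq_iff)
    then show ?thesis using True n by (auto simp: prod_eq_iff)
  next
    case False
    then have "a ^ 4 + b ^ 4 = 0"
      using o unfolding om_def a_def[symmetric] b_def[symmetric] by (cases "snd i"; cases "snd j") simp_all
    then have "a ^ 4 = 0" "b ^ 4 = 0" using p by linarith+
    then show ?thesis by (simp add: a_def b_def)
  qed
qed

text \<open>The solution operator of the homological equation: the commutator of \<open>kdiv T\<close> with the
  diagonal \<open>\<i> om\<close> is the negative of the non-resonant part of \<open>T\<close>.\<close>

definition kdiv :: "(idx \<Rightarrow> idx \<Rightarrow> complex) \<Rightarrow> idx \<Rightarrow> idx \<Rightarrow> complex" where
  "kdiv T i j = (if om i \<noteq> om j then T i j / (\<i> * of_real (om i - om j)) else 0)"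

lemma kdiv_mult: "\<i> * of_real (om i - om j) * kdiv T i j = (if om i \<noteq> om j then T i j else 0)"
proof (cases "om i = om j")
  case False
  then have "complex_of_real (om i - om j) \<noteq> 0" by simp
  then show ?thesis using False by (simp add: kdiv_def del: of_real_diff)
qed (simp add: kdiv_def)

lemma kord_kdiv:
  assumes "kord m T"
  shows "kord (m - 3) (\<lambda>t. kdiv (T t))"
  unfolding kord_def
proof
  fix p
  obtain C where C: "C \<ge> 0" "\<And>t i j. cmod (T t i j) \<le> C * jb (fst j) powi m / jb (fst i - fst j) ^ p"
    using kordE[OF assms(1)] by blast
  have "cmod (kdiv (T t) i j) \<le> (8 * C) * jb (fst j) powi (m - 3) / jb (fst i - fst j) ^ p" for t i j
  proof (cases "om i = om j")
    case True
    then show ?thesis using C(1) by (simp add: kdiv_def)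
  next
    case False
    define W where "W = jb (fst j)"
    have W: "W > 0" by (simp add: W_def)
    have g: "W ^ 3 / 8 \<le> \<bar>om i - om j\<bar>" using om_gap[OF False] by (simp add: W_def)
    have "cmod (kdiv (T t) i j) = cmod (T t i j) / \<bar>om i - om j\<bar>"
      using False by (simp add: kdiv_def norm_divide norm_mult del: of_real_diff)
    also have "\<dots> \<le> (C * W powi m / jb (fst i - fst j) ^ p) / (W ^ 3 / 8)"
      unfolding W_def by (intro frac_le C) (use C(1) g W in \<open>auto simp: W_def\<close>)
    also have "\<dots> = (8 * C) * W powi (m - 3) / jb (fst i - fst j) ^ p"
      using W by (simp add: power_int_diff field_simps)
    finally show ?thesis by (simp add: W_def)
  qed
  then show "\<exists>C. \<forall>t i j. cmod (kdiv (T t) i j) \<le> C * jb (fst j) powi (m - 3) / jb (fst i - fst j) ^ p" by blast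
qed

lemma kC1_kdiv:
  assumes "kC1 m T T'"
  shows "kC1 (m - 3) (\<lambda>t. kdiv (T t)) (\<lambda>t. kdiv (T' t))"
proof -
  have "((\<lambda>t. kdiv (T t) i j) has_vector_derivative kdiv (T' t) i j) (at t)" for t i j
    using bounded_linear.has_vector_derivative[OF bounded_linear_divide kC1D(3)[OF assms]]
    by (simp add: kdiv_def)
  moreover have "continuous_on UNIV (\<lambda>t. kdiv (T' t) i j)" for i j
    using kC1D(4)[OF assms, of i j] by (cases "om i = om j") (auto simp: kdiv_def intro!: continuous_intros)
  ultimately show ?thesis
    by (intro kC1I kord_kdiv kC1D[OF assms])
qed

definition kdiag :: "(idx \<Rightarrow> complex) \<Rightarrow> idx \<Rightarrow> idx \<Rightarrow> complex" where
  "kdiag d i j = (if i = j then d i else 0)"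

lemma infsum_single:
  assumes "\<And>j. j \<noteq> i \<Longrightarrow> f j = 0"
  shows "infsum f UNIV = f i" "(f :: 'a \<Rightarrow> 'b::{topological_comm_monoid_add,t2_space}) summable_on UNIV"
proof -
  have "(f has_sum f i) UNIV"
    by (rule has_sum_finite_neutralI[of "{i}"]) (use assms in auto)
  then show "infsum f UNIV = f i" "f summable_on UNIV"
    by (auto intro: infsumI has_sum_imp_summable)
qed

lemma kcomp_kdiag: "kcomp (kdiag d) T i j = d i * T i j"
  unfolding kcomp_def by (subst infsum_single[of i]) (auto simp: kdiag_def)

lemma kcomp_kdiag_right: "kcomp T (kdiag d) i j = T i j * d j"
  unfolding kcomp_def by (subst infsum_single[of j]) (auto simp: kdiag_def)

lemma kapp_kdiag: "kapp (kdiag d) x i = d i * x i"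
  unfolding kapp_def by (subst infsum_single[of i]) (auto simp: kdiag_def)

lemma kord_kdiag:
  assumes "\<And>t i. cmod (d t i) \<le> C * jb (fst i) powi m"
  shows "kord m (\<lambda>t. kdiag (d t))"
  unfolding kord_def
proof (intro allI exI)
  fix p t i j
  show "cmod (kdiag (d t) i j) \<le> \<bar>C\<bar> * jb (fst j) powi m / jb (fst i - fst j) ^ p"
  proof (cases "i = j")
    case True
    have "cmod (d t j) \<le> C * jb (fst j) powi m" by (rule assms)
    also have "\<dots> \<le> \<bar>C\<bar> * jb (fst j) powi m" by (intro mult_right_mono) auto
    finally show ?thesis using True by (simp add: kdiag_def)
  qed (simp add: kdiag_def)
qed

lemma kord_diagonal:
  assumes "kord m T"
  shows "kord m (\<lambda>t. kdiag (\<lambda>i. T t i i))"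
  by (rule kord_dominated[OF assms, of _ 1]) (auto simp: kdiag_def)

lemma kC1_diagonal:
  assumes "kC1 m T T'"
  shows "kC1 m (\<lambda>t. kdiag (\<lambda>i. T t i i)) (\<lambda>t. kdiag (\<lambda>i. T' t i i))"
proof (rule kC1I)
  show "((\<lambda>t. kdiag (\<lambda>i. T t i i) i j) has_vector_derivative kdiag (\<lambda>i. T' t i i) i j) (at t)" for t i j
    using kC1D(3)[OF assms] by (cases "i = j") (auto simp: kdiag_def)
  show "continuous_on UNIV (\<lambda>t. kdiag (\<lambda>i. T' t i i) i j)" for i j
    using kC1D(4)[OF assms] by (cases "i = j") (auto simp: kdiag_def)
qed (intro kord_diagonal kC1D[OF assms])+

lemma kord_om:
  assumes "kord m T"
  shows "kord (m + 4) (\<lambda>t i j. of_real (om i - om j) * T t i j)"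
  unfolding kord_def
proof
  fix p
  obtain C where C: "C \<ge> 0" "\<And>t i j. cmod (T t i j) \<le> C * jb (fst j) powi m / jb (fst i - fst j) ^ (p + 4)"
    using kordE[OF assms(1)] by blast
  have "cmod (of_real (om i - om j) * T t i j) \<le> (2 * C) * jb (fst j) powi (m + 4) / jb (fst i - fst j) ^ p" for t i j
  proof -
    define W X where "W = jb (fst j)" and "X = jb (fst i - fst j)"
    have W: "W > 0" "X \<ge> 1" by (simp_all add: W_def X_def jb_ge_1)
    have "\<bar>om i - om j\<bar> \<le> jb (fst i) ^ 4 + jb (fst j) ^ 4" using abs_om_le[of i] abs_om_le[of j] by linarith
    also have "\<dots> \<le> (X * W) ^ 4 + (X * W) ^ 4"
      using W jb_le_mult[of "fst i" "fst j"] by (intro add_mono power_mono) (auto simp: W_def X_def)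
    finally have om: "\<bar>om i - om j\<bar> \<le> 2 * (X * W) ^ 4" by simp
    have "cmod (of_real (om i - om j) * T t i j) \<le> (2 * (X * W) ^ 4) * (C * W powi m / X ^ (p + 4))"
      unfolding norm_mult norm_of_real W_def X_def
      by (intro mult_mono C om[unfolded W_def X_def]) (auto intro!: mult_nonneg_nonneg)
    also have "\<dots> = (2 * C) * W powi (m + 4) / X ^ p"
      using W by (simp add: power_int_add power_add power_mult_distrib field_simps)
    finally show ?thesis by (simp add: W_def X_def)
  qed
  then show "\<exists>C. \<forall>t i j. cmod (of_real (om i - om j) * T t i j) \<le> C * jb (fst j) powi (m + 4) / jb (fst i - fst j) ^ p" by blast
qed

text \<open>Resonant pairs off the diagonal connect k with -k, at distance 2 |k|. Rapid decay in the
  distance is therefore rapid decay in the frequency and beats any order \<open>m\<close>; such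
  entries need not be removed by the gauge.\<close>

lemma kord_resonant:
  assumes "kord m T"
  shows "kord 0 (\<lambda>t i j. if om i = om j \<and> i \<noteq> j then T t i j else 0)"
  unfolding kord_def
proof
  fix p
  obtain C where C: "C \<ge> 0" "\<And>t i j. cmod (T t i j) \<le> C * jb (fst j) powi m / jb (fst i - fst j) ^ (p + nat \<bar>m\<bar>)"
    using kordE[OF assms(1)] by blast
  have "cmod (T t i j) \<le> C / jb (fst i - fst j) ^ p" if "om i = om j" "i \<noteq> j" for t i j
  proof -
    define W X where "W = jb (fst j)" and "X = jb (fst i - fst j)"
    have WX: "1 \<le> W" "W \<le> X" using om_eq_imp[OF that] by (simp_all add: W_def X_def jb_def)
    have "W powi m \<le> W powi \<bar>m\<bar>" using WX by (intro power_int_increasing) auto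
    also have "\<dots> = W ^ nat \<bar>m\<bar>" by (simp add: power_int_def)
    also have "\<dots> \<le> X ^ nat \<bar>m\<bar>" using WX by (intro power_mono) auto
    finally have w: "W powi m \<le> X ^ nat \<bar>m\<bar>" .
    have "cmod (T t i j) \<le> C * W powi m / X ^ (p + nat \<bar>m\<bar>)" unfolding W_def X_def by (rule C)
    also have "\<dots> \<le> C * X ^ nat \<bar>m\<bar> / X ^ (p + nat \<bar>m\<bar>)"
      using WX C(1) by (intro divide_right_mono mult_left_mono w) auto
    also have "\<dots> = C / X ^ p" using WX by (simp add: power_add)
    finally show ?thesis unfolding X_def .
  qed
  then show "\<exists>C. \<forall>t i j. cmod (if om i = om j \<and> i \<noteq> j then T t i j else 0) \<le> C * jb (fst j) powi 0 / jb (fst i - fst j) ^ p"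
    using C(1) by (intro exI[of _ C]) auto
qed

text \<open>On a bounded range of frequencies all powers of the bracket are comparable, so the
  truncated kernel has every order \<open>n\<close>, however negative.\<close>

lemma kord_low_frequency:
  assumes "kord m T"
  shows "kord n (\<lambda>t i j. if max \<bar>fst i\<bar> \<bar>fst j\<bar> < int N then T t i j else 0)"
  unfolding kord_def
proof
  fix p
  obtain C where C: "C \<ge> 0" "\<And>t i j. cmod (T t i j) \<le> C * jb (fst j) powi m / jb (fst i - fst j) ^ p"
    using kordE[OF assms(1)] by blast
  define c where "c = (1 + real N) ^ nat \<bar>m - n\<bar>"
  have c0: "c \<ge> 0" by (simp add: c_def)
  have "cmod (T t i j) \<le> (C * c) * jb (fst j) powi n / jb (fst i - fst j) ^ p" if "\<bar>fst j\<bar> < int N" for t i j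
  proof -
    define W where "W = jb (fst j)"
    have W: "1 \<le> W" "W \<le> 1 + real N" using that by (auto simp: W_def jb_def)
    have "W powi (m - n) \<le> W powi \<bar>m - n\<bar>" using W by (intro power_int_increasing) auto
    also have "\<dots> = W ^ nat \<bar>m - n\<bar>" by (simp add: power_int_def)
    also have "\<dots> \<le> c" unfolding c_def using W by (intro power_mono) auto
    finally have "W powi m \<le> c * W powi n"
      using W by (simp add: power_int_diff divide_le_eq)
    then have "C * W powi m / jb (fst i - fst j) ^ p \<le> C * (c * W powi n) / jb (fst i - fst j) ^ p"
      using C(1) by (intro divide_right_mono mult_left_mono) auto
    then show ?thesis using C(2)[of t i j] unfolding W_def by (simp add: mult.assoc)
  qed
  then show "\<exists>C. \<forall>t i j. cmod (if max \<bar>fst i\<bar> \<bar>fst j\<bar> < int N then T t i j else 0) \<le> C * jb (fst j) powi n / jb (fst i - fst j) ^ p"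
    using C(1) c0 by (intro exI[of _ "C * c"]) auto
qed

text \<open>Order -1 yields smallness in the column frequency alone. One power of the decay off the
  diagonal extends it to all entries in which the larger of the two frequencies is high.\<close>

lemma high_frequency_small:
  assumes "kord (-1) T" "e > 0"
  shows "\<exists>N. \<forall>t i j. cmod (if int N \<le> max \<bar>fst i\<bar> \<bar>fst j\<bar> then T t i j else 0) \<le> e / jb (fst i - fst j) ^ p"
proof -
  obtain C where C: "C \<ge> 0" "\<And>t i j. cmod (T t i j) \<le> C * jb (fst j) powi (-1) / jb (fst i - fst j) ^ (p + 1)"
    using kordE[OF assms(1)] by blast
  obtain N :: nat where N: "C / e < real N" using reals_Archimedean2 by blast
  have "cmod (T t i j) \<le> e / jb (fst i - fst j) ^ p" if "int N \<le> max \<bar>fst i\<bar> \<bar>fst j\<bar>" for t i j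
  proof -
    define W X where "W = jb (fst j)" and "X = jb (fst i - fst j)"
    have W: "W > 0" "X \<ge> 1" by (simp_all add: W_def X_def jb_ge_1)
    have "real N \<le> max (jb (fst i)) (jb (fst j))" using that unfolding jb_def by linarith
    also have "\<dots> \<le> X * W"
      using jb_le_mult[of "fst i" "fst j"] W mult_right_mono[of 1 X W] by (simp add: W_def X_def)
    finally have "real N \<le> X * W" .
    then have "C \<le> e * (X * W)" using N assms(2) by (simp add: pos_divide_less_eq mult.commute) (smt (verit) mult_left_mono)
    then have "C / (X * W) \<le> e" using W by (simp add: pos_divide_le_eq)
    then have "C / (X * W) / X ^ p \<le> e / X ^ p" using W by (intro divide_right_mono) auto
    moreover have "C * W powi (-1) / X ^ (p + 1) = C / (X * W) / X ^ p"
      using W by (simp add: power_int_def field_simps)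
    ultimately show ?thesis using C(2)[of t i j] unfolding W_def X_def by simp
  qed
  then show ?thesis using assms(2) by (intro exI[of _ N]) auto
qed

section \<open>The gauge transformation\<close>

definition kA :: "(idx \<Rightarrow> idx \<Rightarrow> complex) \<Rightarrow> idx \<Rightarrow> idx \<Rightarrow> complex" where
  "kA B i j = kdiag (\<lambda>i. \<i> * of_real (om i)) i j + B i j"

text \<open>The gauge \<open>I + S\<close> conjugates \<open>kA B\<close> into an imaginary diagonal up to the bounded kernel \<open>M\<close>;
  the smallness of \<open>S\<close> makes \<open>I + S\<close> invertible, also on polynomially weighted spaces.\<close>

definition normal_form :: "(real \<Rightarrow> idx \<Rightarrow> idx \<Rightarrow> complex) \<Rightarrow> (real \<Rightarrow> idx \<Rightarrow> idx \<Rightarrow> complex) \<Rightarrow>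
    (real \<Rightarrow> idx \<Rightarrow> idx \<Rightarrow> complex) \<Rightarrow> (real \<Rightarrow> idx \<Rightarrow> idx \<Rightarrow> complex) \<Rightarrow> (real \<Rightarrow> idx \<Rightarrow> real) \<Rightarrow> bool" where
  "normal_form A S S' M lam \<longleftrightarrow> kord 4 A \<and> kC1 0 S S' \<and> kord 0 M
    \<and> (\<forall>i j. continuous_on UNIV (\<lambda>t. A t i j)) \<and> (\<forall>i j. continuous_on UNIV (\<lambda>t. M t i j))
    \<and> (\<forall>i. continuous_on UNIV (\<lambda>t. lam t i))
    \<and> (\<forall>t i j. cmod (S t i j) \<le> 1 / (2 * (jsum + 1)) / jb (fst i - fst j) ^ 8)
    \<and> (\<forall>t i j. M t i j = S' t i j - (A t i j + kcomp (S t) (A t) i j)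
          + \<i> * of_real (lam t i) * (kdiag (\<lambda>_. 1) i j + S t i j))"

text \<open>The orders are -1 for \<open>K1\<close>, 1 for \<open>R\<close>, -2 for
  \<open>K2\<close> and 0 for the products of \<open>K2\<close> with \<open>B\<close> and
  \<open>DB\<close>. Only the diagonal of \<open>R\<close> escapes this count, and
  \<open>cancel\<close> takes care of it. The assumption \<open>im\<close> makes the diagonal of
  \<open>B\<close> imaginary, so that it can be put into the real phase speed
  \<open>lam\<close>.\<close>

theorem normal_form_exists:
  assumes B: "kC1 2 B B'" and im: "\<And>t i. Re (B t i i) = 0"
    and cancel: "\<And>t i. cmod (kcomp (kdiv (B t)) (B t) i i) \<le> C0"
  shows "\<exists>S S' M lam. normal_form (\<lambda>t. kA (B t)) S S' M lam"
proof -
  define K1 where "K1 = (\<lambda>t. kdiv (B t))"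
  define DB where "DB = (\<lambda>t. kdiag (\<lambda>i. B t i i))"
  \<comment> \<open>The error left by the first step. The product with \<open>DB\<close> occurs
    because the diagonal of \<open>B\<close> is kept in \<open>lam\<close>, and
    \<open>\<i> lam\<close> multiplies the gauge from the left.\<close>
  define R where "R = (\<lambda>t i j. kcomp (K1 t) (B t) i j - kcomp (DB t) (K1 t) i j)"
  define K2 where "K2 = (\<lambda>t. kdiv (R t))"
  define P where "P = (\<lambda>t i j. K1 t i j + K2 t i j)"
  obtain K1' where K1: "kC1 (-1) K1 K1'" using kC1_kdiv[OF B] unfolding K1_def by auto
  obtain DB' where DB: "kC1 2 DB DB'" using kC1_diagonal[OF B] unfolding DB_def by auto
  have "kC1 1 (\<lambda>t. kcomp (K1 t) (B t)) (\<lambda>t i j. kcomp (K1' t) (B t) i j + kcomp (K1 t) (B' t) i j)"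
    using kC1_comp[OF K1 B] by simp
  moreover have "kC1 1 (\<lambda>t. kcomp (DB t) (K1 t)) (\<lambda>t i j. kcomp (DB' t) (K1 t) i j + kcomp (DB t) (K1' t) i j)"
    using kC1_comp[OF DB K1] by simp
  ultimately obtain R' where R: "kC1 1 R R'" unfolding R_def using kC1_diff by blast
  obtain K2' where K2: "kC1 (-2) K2 K2'" using kC1_kdiv[OF R] unfolding K2_def by auto
  obtain P' where P: "kC1 (-1) P P'"
    using kC1_add[OF K1 kC1_mono[OF K2]] unfolding P_def by force
  have "1 / (2 * (jsum + 1)) > 0" using jsum_nonneg by simp
  from high_frequency_small[OF kC1D(1)[OF P] this, of 8] obtain N where
    N: "\<And>t i j. cmod (if int N \<le> max \<bar>fst i\<bar> \<bar>fst j\<bar> then P t i j else 0)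
        \<le> 1 / (2 * (jsum + 1)) / jb (fst i - fst j) ^ 8" by blast
  \<comment> \<open>Dropping low frequencies makes the gauge small. The dropped part
    \<open>F\<close> has every order, so it contributes a bounded error even where it meets the
    diagonal of order four.\<close>
  define S where "S = (\<lambda>t i j. if int N \<le> max \<bar>fst i\<bar> \<bar>fst j\<bar> then P t i j else 0)"
  define S' where "S' = (\<lambda>t i j. if int N \<le> max \<bar>fst i\<bar> \<bar>fst j\<bar> then P' t i j else 0)"
  define F where "F = (\<lambda>t i j. if max \<bar>fst i\<bar> \<bar>fst j\<bar> < int N then P t i j else 0)"
  define lam where "lam = (\<lambda>t i. om i + Im (B t i i))"
  define M where "M = (\<lambda>t i j. S' t i j - (kA (B t) i j + kcomp (S t) (kA (B t)) i j)
          + \<i> * of_real (lam t i) * (kdiag (\<lambda>_. 1) i j + S t i j))"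
  have S: "kC1 (-1) S S'" unfolding S_def S'_def by (rule kC1_if[OF P])
  have F: "kord m F" for m unfolding F_def by (rule kord_low_frequency[OF kC1D(1)[OF P]])
  have Fs: "F t i j = P t i j - S t i j" for t i j
    by (cases "int N \<le> max \<bar>fst i\<bar> \<bar>fst j\<bar>") (simp_all add: F_def S_def not_le del: max_less_iff_conj le_max_iff_disj)
  have Bdiag: "B t i i = \<i> * of_real (Im (B t i i))" for t i using im[of t i] by (simp add: complex_eq_iff)
  have ilam: "\<i> * of_real (lam t i) = \<i> * of_real (om i) + B t i i" for t i
    unfolding lam_def by (subst Bdiag) (simp add: distrib_left)
  have om4: "kord 4 (\<lambda>t. kdiag (\<lambda>i. \<i> * complex_of_real (om i)))"
    by (rule kord_kdiag[where C = 1])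
      (simp add: norm_mult abs_om_le)
  have A: "kord 4 (\<lambda>t. kA (B t))"
    unfolding kA_def[abs_def] by (rule kord_add[OF om4 kord_mono[OF kC1D(1)[OF B]]]) simp
  have kSA: "kcomp (S t) (kA (B t)) i j = S t i j * (\<i> * of_real (om j)) + kcomp (S t) (B t) i j" for t i j
  proof -
    have "kcomp (S t) (kA (B t)) i j
        = (\<Sum>\<^sub>\<infinity>q. S t i q * kdiag (\<lambda>i. \<i> * of_real (om i)) q j + S t i q * B t q j)"
      unfolding kcomp_def kA_def distrib_left ..
    also have "\<dots> = kcomp (S t) (kdiag (\<lambda>i. \<i> * of_real (om i))) i j + kcomp (S t) (B t) i j"
      unfolding kcomp_def
      by (rule infsum_add[OF kcomp_summable[OF kC1D(1)[OF S] om4] kcomp_summable[OF kC1D(1)[OF S] kC1D(1)[OF B]]])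
    finally show ?thesis by (simp add: kcomp_kdiag_right)
  qed
  have kSB: "kcomp (S t) (B t) i j = kcomp (K1 t) (B t) i j + kcomp (K2 t) (B t) i j - kcomp (F t) (B t) i j" for t i j
  proof -
    have s: "S t i q * B t q j = K1 t i q * B t q j + K2 t i q * B t q j - F t i q * B t q j" for q
      by (simp add: Fs P_def algebra_simps)
    note sm = kcomp_summable[OF kC1D(1)[OF K1] kC1D(1)[OF B]] kcomp_summable[OF kC1D(1)[OF K2] kC1D(1)[OF B]]
      kcomp_summable[OF F kC1D(1)[OF B]]
    have "infsum (\<lambda>q. (K1 t i q * B t q j + K2 t i q * B t q j) + - (F t i q * B t q j)) UNIV =
        kcomp (K1 t) (B t) i j + kcomp (K2 t) (B t) i j + - kcomp (F t) (B t) i j"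
      unfolding kcomp_def
      by (simp only: infsum_add sm summable_on_add summable_on_uminus infsum_uminus)
    then show ?thesis unfolding kcomp_def[of "S t"] s by simp
  qed
  \<comment> \<open>With D the diagonal \<open>\<i> om\<close>, the definition reads M = S' - (B -
    DB) + [D, S] - S B + DB S. For S = K1 + K2 - F the commutator of \<open>K1\<close> removes the
    non-resonant part of \<open>B\<close> and that of \<open>K2\<close> the non-resonant part of
    \<open>R\<close>. What is left are resonant entries, the diagonal of \<open>R\<close>, and terms
    containing \<open>K2\<close> or \<open>F\<close>.\<close>
  have Mform: "M t i j = S' t i j - (if om i = om j \<and> i \<noteq> j then B t i j else 0)
     - (if om i = om j \<and> i \<noteq> j then R t i j else 0) - kdiag (\<lambda>i. R t i i) i j
     - kcomp (K2 t) (B t) i j + kcomp (DB t) (K2 t) i j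
     + (kcomp (F t) (B t) i j - kcomp (DB t) (F t) i j - \<i> * (of_real (om i - om j) * F t i j))" for t i j
  proof -
    have k: "\<i> * of_real (om i - om j) * P t i j = (if om i \<noteq> om j then B t i j + R t i j else 0)"
      unfolding P_def distrib_left K1_def K2_def kdiv_mult by simp
    have "M t i j = S' t i j - (B t i j - kdiag (\<lambda>i. B t i i) i j) + (\<i> * of_real (om i - om j) * S t i j)
        - kcomp (S t) (B t) i j + B t i i * S t i j"
      unfolding M_def kSA kA_def ilam by (simp add: algebra_simps kdiag_def)
    also have "\<i> * of_real (om i - om j) * S t i j
        = (if om i \<noteq> om j then B t i j + R t i j else 0) - \<i> * (of_real (om i - om j) * F t i j)"
      unfolding k[symmetric] Fs by (simp only: right_diff_distrib mult.assoc) simp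
    also have "S t i j = K1 t i j + K2 t i j - F t i j" by (simp add: Fs P_def)
    finally show ?thesis
      unfolding kSB DB_def kcomp_kdiag
      by (cases "i = j"; cases "om i = om j")
        (simp_all add: kdiag_def R_def DB_def kcomp_kdiag algebra_simps del: of_real_diff)
  qed
  \<comment> \<open>The diagonal of \<open>K1\<close> vanishes, so the diagonal of \<open>R\<close>
    is that of the composition of \<open>K1\<close> and \<open>B\<close>. Its order would be 1 by
    the calculus; \<open>cancel\<close> bounds it.\<close>
  have Rd: "kord 0 (\<lambda>t. kdiag (\<lambda>i. R t i i))"
    by (rule kord_kdiag[where C = C0])
      (use cancel in \<open>simp add: R_def DB_def kcomp_kdiag K1_def kdiv_def[of _ i i for i]\<close>)
  have M: "kord 0 M"
    unfolding Mform[abs_def]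
  proof (intro kord_add kord_diff)
    show "kord 0 S'" by (rule kord_mono[OF kC1D(2)[OF S]]) simp
    show "kord 0 (\<lambda>t i j. if om i = om j \<and> i \<noteq> j then B t i j else 0)"
      by (rule kord_resonant[OF kC1D(1)[OF B]])
    show "kord 0 (\<lambda>t i j. if om i = om j \<and> i \<noteq> j then R t i j else 0)"
      by (rule kord_resonant[OF kC1D(1)[OF R]])
    show "kord 0 (\<lambda>t. kdiag (\<lambda>i. R t i i))" by (rule Rd)
    show "kord 0 (\<lambda>t. kcomp (K2 t) (B t))" using kord_comp[OF kC1D(1)[OF K2] kC1D(1)[OF B]] by simp
    show "kord 0 (\<lambda>t. kcomp (DB t) (K2 t))" using kord_comp[OF kC1D(1)[OF DB] kC1D(1)[OF K2]] by simp
    show "kord 0 (\<lambda>t. kcomp (F t) (B t))" using kord_comp[OF F[of "-2"] kC1D(1)[OF B]] by simp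
    show "kord 0 (\<lambda>t. kcomp (DB t) (F t))" using kord_comp[OF kC1D(1)[OF DB] F[of "-2"]] by simp
    show "kord 0 (\<lambda>t i j. \<i> * (of_real (om i - om j) * F t i j))"
      using kord_dominated[OF kord_om[OF F[of "-4"]], of "\<lambda>t i j. \<i> * (of_real (om i - om j) * F t i j)" 1]
      by (simp add: norm_mult)
  qed
  have Bc: "continuous_on UNIV (\<lambda>t. B t i j)" for i j by (rule kC1_continuous[OF B])
  have Ac: "continuous_on UNIV (\<lambda>t. kA (B t) i j)" for i j
    unfolding kA_def by (intro continuous_intros Bc)
  have lc: "continuous_on UNIV (\<lambda>t. lam t i)" for i
    unfolding lam_def by (intro continuous_intros Bc)
  have Sc: "continuous_on UNIV (\<lambda>t. S t i j)" for i j by (rule kC1_continuous[OF S])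
  have kc: "continuous_on UNIV (\<lambda>t. kcomp (S t) (B t) i j)" for i j
    by (rule kC1_continuous[OF kC1_comp[OF S B]])
  have Mc: "continuous_on UNIV (\<lambda>t. M t i j)" for i j
    unfolding M_def kSA by (intro continuous_intros Ac lc Sc kc kC1D(4)[OF S])
  have "normal_form (\<lambda>t. kA (B t)) S S' M lam"
    unfolding normal_form_def
  proof (intro conjI allI)
    show "kC1 0 S S'" by (rule kC1_mono[OF S]) simp
    show "cmod (S t i j) \<le> 1 / (2 * (jsum + 1)) / jb (fst i - fst j) ^ 8" for t i j
      unfolding S_def by (rule N)
    show "M t i j = S' t i j - (kA (B t) i j + kcomp (S t) (kA (B t)) i j)
          + \<i> * of_real (lam t i) * (kdiag (\<lambda>_. 1) i j + S t i j)" for t i j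
      by (simp only: M_def)
  qed (rule A M Ac Mc lc)+
  then show ?thesis by blast
qed

section \<open>Evolution of square-summable families\<close>

lemma continuous_on_increment:
  fixes Z :: "real \<Rightarrow> 'a::real_normed_vector" and K :: "real \<Rightarrow> real"
  assumes "continuous_on UNIV K" "\<And>s t. norm (Z t - Z s) \<le> \<bar>K t - K s\<bar>"
  shows "continuous_on UNIV Z"
proof -
  have "(Z \<longlongrightarrow> Z s) (at s)" for s
  proof (rule LIM_zero_cancel, rule Lim_null_comparison)
    have "(K \<longlongrightarrow> K s) (at s)" using assms(1) by (auto simp: continuous_on_def)
    then show "((\<lambda>t. \<bar>K t - K s\<bar>) \<longlongrightarrow> 0) (at s)"
      using tendsto_rabs_zero LIM_zero by blast
  qed (auto intro: always_eventually assms(2))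
  then show ?thesis by (simp add: continuous_on_def)
qed

lemma primitive_of_increment_bound:
  assumes z: "primitive_of z g" and K: "primitive_of K F" and bd: "\<And>t. norm (g t) \<le> c * F t"
  shows "norm (z t - z s) \<le> \<bar>c * (K t - K s)\<bar>"
proof -
  have *: "norm (z b - z a) \<le> c * (K b - K a)" if "a \<le> b" for a b
  proof -
    have "norm (z b - z a) \<le> integral {a..b} (\<lambda>t. c * F t)"
      by (rule primitive_of_norm_bound[OF z that bd]) (intro locint_cmult primitive_ofD(1)[OF K])
    also have "\<dots> = c * (K b - K a)" using primitive_ofD(2)[OF K that] by simp
    finally show ?thesis .
  qed
  show ?thesis
  proof (cases "s \<le> t")
    case True
    then show ?thesis using *[OF True] by simp
  next
    case False
    then have "norm (z t - z s) \<le> c * (K s - K t)" using *[of t s] by (simp add: norm_minus_commute)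
    also have "\<dots> \<le> \<bar>c * (K t - K s)\<bar>" by (simp add: abs_mult abs_minus_commute[of "K t"]) (metis abs_ge_self abs_mult)
    finally show ?thesis .
  qed
qed

lemma tempered_mono: "tempered n D x \<Longrightarrow> n \<le> m \<Longrightarrow> tempered m D x"
  unfolding tempered_def
proof (intro allI)
  fix j :: idx assume x: "\<forall>j. cmod (x j) \<le> D * jb (fst j) powi n" and nm: "n \<le> m"
  have "tempered n D x" using x by (simp add: tempered_def)
  then have "0 \<le> D" by (rule tempered_nonneg)
  then have "D * jb (fst j) powi n \<le> D * jb (fst j) powi m"
    by (intro mult_left_mono power_int_increasing nm) (auto simp: jb_ge_1)
  then show "cmod (x j) \<le> D * jb (fst j) powi m" using x order_trans by blast
qed

lemma tempered_diff: "tempered n D x \<Longrightarrow> tempered n E y \<Longrightarrow> tempered n (D + E) (\<lambda>j. x j - y j)"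
  unfolding tempered_def distrib_right
  by (intro allI) (metis (no_types, lifting) add_mono norm_triangle_ineq4 order_trans)

lemma kapp_diff:
  assumes "kord m T" "tempered n D x" "tempered n E y"
  shows "kapp (T t) (\<lambda>j. x j - y j) i = kapp (T t) x i - kapp (T t) y i"
proof -
  have "((\<lambda>j. T t i j * x j + - (T t i j * y j)) has_sum (kapp (T t) x i + - kapp (T t) y i)) UNIV"
    unfolding kapp_def
    by (intro has_sum_add has_sum_uminusI has_sum_infsum kapp_summable[OF assms(1,2)] kapp_summable[OF assms(1,3)])
  then show ?thesis unfolding kapp_def by (subst infsumI[of "\<lambda>j. T t i j * (x j - y j)"]) (auto simp: right_diff_distrib)
qed

lemma primitive_of_kapp:
  assumes T: "kC1 m T T'" and p: "\<And>j. primitive_of (\<lambda>t. p t j) (\<lambda>t. f t j)"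
    and P: "\<And>t. tempered n (P t) (p t)" "locint P" and F: "\<And>t. tempered n (F t) (f t)" "locint F"
  shows "primitive_of (\<lambda>t. kapp (T t) (p t) i) (\<lambda>t. kapp (T' t) (p t) i + kapp (T t) (f t) i)"
proof -
  obtain C where C: "C \<ge> 0" "\<And>t x D i j. tempered n D x \<Longrightarrow>
      cmod (T t i j * x j) \<le> C * D * jb (fst i) powi (m + n) / (jb (fst i - fst j))\<^sup>2"
    using kord_apply_pointwise[OF kC1D(1)[OF T], of n] by blast
  obtain E where E: "E \<ge> 0" "\<And>t x D i j. tempered n D x \<Longrightarrow>
      cmod (T' t i j * x j) \<le> E * D * jb (fst i) powi (m + n) / (jb (fst i - fst j))\<^sup>2"
    using kord_apply_pointwise[OF kC1D(2)[OF T], of n] by blast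
  define a where "a j = jb (fst i) powi (m + n) / (jb (fst i - fst j))\<^sup>2" for j :: idx
  have s1: "(\<lambda>j. T' t i j * p t j) summable_on UNIV" for t by (rule kapp_summable[OF kC1D(2)[OF T] P(1)])
  have s2: "(\<lambda>j. T t i j * f t j) summable_on UNIV" for t by (rule kapp_summable[OF kC1D(1)[OF T] F(1)])
  have e: "(\<Sum>\<^sub>\<infinity>j. T' t i j * p t j + T t i j * f t j) = kapp (T' t) (p t) i + kapp (T t) (f t) i" for t
    unfolding kapp_def by (rule infsum_add[OF s1 s2])
  have "primitive_of (\<lambda>t. \<Sum>\<^sub>\<infinity>j. T t i j * p t j) (\<lambda>t. \<Sum>\<^sub>\<infinity>j. T' t i j * p t j + T t i j * f t j)"
  proof (rule primitive_of_infsum[where a = a and H = "\<lambda>t. E * P t + C * F t"])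
    show "primitive_of (\<lambda>t. T t i j * p t j) (\<lambda>t. T' t i j * p t j + T t i j * f t j)" for j
      by (rule primitive_of_mult[OF p kC1D(3)[OF T] kC1D(4)[OF T]])
    show "locint (\<lambda>t. E * P t + C * F t)" by (intro locint_add locint_cmult P F)
    show "a summable_on UNIV" unfolding a_def by (rule has_sum_imp_summable[OF jsum_shift_cmult])
    show "norm (T' t i j * p t j + T t i j * f t j) \<le> a j * (E * P t + C * F t)" for j t
      using norm_triangle_mono[OF E(2)[OF P(1)[of t], of t i j] C(2)[OF F(1)[of t], of t i j]]
      by (simp add: a_def distrib_left add_divide_distrib mult_ac)
    show "(\<lambda>j. T t i j * p t j) summable_on UNIV" for t by (rule kapp_summable[OF kC1D(1)[OF T] P(1)])
  qed
  then show ?thesis unfolding e by (simp add: kapp_def)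
qed

lemma locint_kapp:
  assumes T: "kord m T" "\<And>i j. continuous_on UNIV (\<lambda>t. T t i j)" and f: "\<And>j. locint (\<lambda>t. f t j)"
    and F: "\<And>t. tempered n (F t) (f t)" "locint F"
  shows "locint (\<lambda>t. kapp (T t) (f t) i)"
proof -
  obtain C where C: "C \<ge> 0" "\<And>t x D i j. tempered n D x \<Longrightarrow>
      cmod (T t i j * x j) \<le> C * D * jb (fst i) powi (m + n) / (jb (fst i - fst j))\<^sup>2"
    using kord_apply_pointwise[OF T(1), of n] by blast
  show ?thesis
    unfolding kapp_def
  proof (rule infsum_integral(1)[where H = F and a = "\<lambda>j. C * jb (fst i) powi (m + n) / (jb (fst i - fst j))\<^sup>2"])
    show "(\<lambda>j. C * jb (fst i) powi (m + n) / (jb (fst i - fst j))\<^sup>2) summable_on (UNIV :: idx set)"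
      by (rule has_sum_imp_summable[OF jsum_shift_cmult])
    show "norm (T t i j * f t j) \<le> C * jb (fst i) powi (m + n) / (jb (fst i - fst j))\<^sup>2 * F t" for j t
      using C(2)[OF F(1)[of t], of t i j] by (simp add: mult_ac)
  qed (intro locint_mult_continuous T f F)+
qed

text \<open>Coordinatewise integration stays in \<open>ell2\<close>: increments are square-summable
  by the Minkowski bound, and adding the initial value \<open>Z0\<close> gives membership at every
  time. Continuity is inherited from the scalar primitive \<open>K\<close>.\<close>

lemma ell2_primitive:
  fixes z g :: "'i \<Rightarrow> real \<Rightarrow> complex"
  assumes p: "\<And>i. primitive_of (z i) (g i)" and K: "primitive_of K H" and H: "\<And>t. H t \<ge> 0"
    and bd: "\<And>t F. finite F \<Longrightarrow> (\<Sum>i\<in>F. (cmod (g i t))\<^sup>2) \<le> (H t)\<^sup>2" and z0: "\<And>i. z i 0 = ell2_at Z0 i"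
  shows "ell2_at (Ell2 (\<lambda>i. z i t)) i = z i t"
    and "norm (Ell2 (\<lambda>i. z i t) - Ell2 (\<lambda>i. z i s)) \<le> \<bar>K t - K s\<bar>"
    and "continuous_on UNIV (\<lambda>t. Ell2 (\<lambda>i. z i t))"
proof -
  have inc: "(\<Sum>i\<in>F. (cmod (z i t - z i s))\<^sup>2) \<le> \<bar>K t - K s\<bar>\<^sup>2" if F: "finite F" for F s t
  proof -
    have *: "(\<Sum>i\<in>F. (cmod (z i b - z i a))\<^sup>2) \<le> (K b - K a)\<^sup>2" if "a \<le> b" for a b
      using primitive_of_l2_bound[OF p primitive_ofD(1)[OF K] H F bd[OF F] that] primitive_ofD(2)[OF K that] by simp
    show ?thesis
      using *[of s t] *[of t s] by (cases "s \<le> t") (auto simp: norm_minus_commute power2_commute)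
  qed
  note I = norm_Ell2_le[OF inc abs_ge_zero]
  have rep: "\<exists>x. \<forall>i. ell2_at x i = z i t" for t
    using I(1)[of t 0] by (intro exI[of _ "Z0 + Ell2 (\<lambda>i. z i t - z i 0)"]) (simp add: z0)
  show E: "ell2_at (Ell2 (\<lambda>i. z i t)) i = z i t" for i t
  proof -
    obtain x where x: "\<forall>i. ell2_at x i = z i t" using rep by blast
    then have "(\<lambda>i. z i t) = ell2_at x" by auto
    then show ?thesis by (simp add: ell2_at_inverse x)
  qed
  show n: "norm (Ell2 (\<lambda>i. z i t) - Ell2 (\<lambda>i. z i s)) \<le> \<bar>K t - K s\<bar>" for s t
  proof -
    have "Ell2 (\<lambda>i. z i t) - Ell2 (\<lambda>i. z i s) = Ell2 (\<lambda>i. z i t - z i s)"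
      by (rule ell2_eqI) (simp add: E I)
    then show ?thesis using I(2) by simp
  qed
  show "continuous_on UNIV (\<lambda>t. Ell2 (\<lambda>i. z i t))"
    by (rule continuous_on_increment[OF primitive_of_continuous[OF K] n])
qed

lemma ell2_Gronwall:
  fixes z g :: "'i \<Rightarrow> real \<Rightarrow> complex"
  assumes p: "\<And>i. primitive_of (z i) (g i)" and z0: "\<And>i. z i 0 = 0"
    and E: "continuous_on UNIV (\<lambda>t. Ell2 (\<lambda>i. z i t))" and C: "C \<ge> 0"
    and bd: "\<And>t F. finite F \<Longrightarrow> (\<Sum>i\<in>F. (cmod (g i t))\<^sup>2) \<le> (C * norm (Ell2 (\<lambda>i. z i t)))\<^sup>2"
  shows "z i t = 0"
proof -
  let ?Z = "\<lambda>t. Ell2 (\<lambda>i. z i t)"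
  have li: "locint (\<lambda>t. C * norm (?Z t))" by (intro locint_continuous continuous_intros E)
  obtain K where K: "primitive_of K (\<lambda>t. C * norm (?Z t))" using primitive_of_exists[OF li] by blast
  have H: "0 \<le> C * norm (?Z t)" for t using C by simp
  have z0': "z i 0 = ell2_at 0 i" for i by (simp add: z0)
  note P = ell2_primitive[OF p K H bd z0']
  have Z0: "?Z 0 = 0" using P(1)[of 0] z0 by (intro ell2_eqI) simp
  have "norm (?Z t) = 0"
  proof (rule Gronwall_zero[where f = "\<lambda>t. norm (?Z t)" and C = C])
    show "\<bar>norm (?Z t) - norm (?Z s)\<bar> \<le> C * integral {s..t} (\<lambda>t. norm (?Z t))" if "s \<le> t" for s t
    proof -
      have k: "K t - K s = C * integral {s..t} (\<lambda>t. norm (?Z t))"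
        using primitive_ofD(2)[OF K that] by simp
      have "0 \<le> integral {s..t} (\<lambda>t. norm (?Z t))"
        by (intro Henstock_Kurzweil_Integration.integral_nonneg locintD locint_continuous continuous_on_norm E) auto
      then have "\<bar>K t - K s\<bar> = C * integral {s..t} (\<lambda>t. norm (?Z t))" using C unfolding k by simp
      then show ?thesis using P(2)[of t s] norm_triangle_ineq3[of "?Z t" "?Z s"] by linarith
    qed
    show "continuous_on UNIV (\<lambda>t. norm (?Z t))" by (rule continuous_on_norm[OF E])
  qed (use C Z0 in auto)
  then have "?Z t = 0" by simp
  then show ?thesis using P(1)[of t i] by simp
qed

lemma tempered_ell2_neg:
  assumes "tempered (-2) D y"
  shows "ell2_at (Ell2 y) = y" "norm (Ell2 y) \<le> D * (jsum + 1)"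
proof -
  have D: "D \<ge> 0" by (rule tempered_nonneg[OF assms])
  have s: "(\<Sum>i\<in>F. (cmod (y i))\<^sup>2) \<le> (D * (jsum + 1))\<^sup>2" if F: "finite F" for F
  proof -
    have "(\<Sum>i\<in>F. (cmod (y i))\<^sup>2) \<le> (\<Sum>i\<in>F. D\<^sup>2 * (1 / (jb (fst i))\<^sup>2))"
    proof (rule sum_mono)
      fix i
      have "cmod (y i) \<le> D * (1 / (jb (fst i))\<^sup>2)"
        using assms[unfolded tempered_def, rule_format, of i] by (simp add: power_int_def divide_inverse power_inverse)
      also have "\<dots> \<le> D * (1 / jb (fst i))"
        using D jb_ge_1[of "fst i"] by (intro mult_left_mono) (auto simp: field_simps power2_eq_square)
      finally have "(cmod (y i))\<^sup>2 \<le> (D * (1 / jb (fst i)))\<^sup>2" by (rule power_mono) simp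
      then show "(cmod (y i))\<^sup>2 \<le> D\<^sup>2 * (1 / (jb (fst i))\<^sup>2)" by (simp add: power_mult_distrib power_divide)
    qed
    also have "\<dots> = D\<^sup>2 * (\<Sum>i\<in>F. 1 / (jb (fst i))\<^sup>2)" by (simp add: sum_distrib_left)
    also have "\<dots> \<le> D\<^sup>2 * jsum"
      using finite_sum_le_infsum[OF jb_summable_idx F] unfolding jsum_def by (intro mult_left_mono) auto
    also have "\<dots> \<le> (D * (jsum + 1))\<^sup>2"
    proof -
      have "0 \<le> jsum * jsum" using jsum_nonneg by simp
      then have "jsum \<le> (jsum + 1)\<^sup>2" using jsum_nonneg by (simp add: power2_eq_square algebra_simps)
      then show ?thesis by (simp add: power_mult_distrib mult_left_mono)
    qed
    finally show ?thesis .
  qed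
  show "ell2_at (Ell2 y) = y" "norm (Ell2 y) \<le> D * (jsum + 1)"
    by (rule norm_Ell2_le[OF s]; use D jsum_nonneg in simp)+
qed

lemma kop_diff:
  assumes "kord 0 T"
  shows "kop (T t) (x - y) = kop (T t) x - kop (T t) y"
proof (rule ell2_eqI)
  fix i
  obtain C where C: "\<And>t x. ell2_at (kop (T t) x) = kapp (T t) (ell2_at x)"
    using kord_kop_bounded[OF assms] by blast
  have "ell2_at (x - y) = (\<lambda>i. ell2_at x i - ell2_at y i)" by auto
  then show "ell2_at (kop (T t) (x - y)) i = ell2_at (kop (T t) x - kop (T t) y) i"
    by (simp add: C kapp_diff[OF assms tempered_ell2 tempered_ell2])
qed

text \<open>By Schur's test the bound on \<open>T'\<close> makes the operators Lipschitz in time in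
  the operator norm, whatever the vector they are applied to.\<close>

lemma continuous_on_kop:
  assumes T: "kC1 0 T T'" and u: "continuous_on UNIV u"
  shows "continuous_on UNIV (\<lambda>t. kop (T t) (u t))"
proof -
  obtain C where C: "C \<ge> 0" "\<And>t x. norm (kop (T t) x) \<le> C * norm x"
    and at: "\<And>t x. ell2_at (kop (T t) x) = kapp (T t) (ell2_at x)"
    using kord_kop_bounded[OF kC1D(1)[OF T]] by blast
  obtain E where E: "E \<ge> 0" "\<And>t i j. cmod (T' t i j) \<le> E * jb (fst j) powi 0 / jb (fst i - fst j) ^ 2"
    using kordE[OF kC1D(2)[OF T]] by blast
  have lip: "norm (kop (T t) x - kop (T s) x) \<le> (E * \<bar>t - s\<bar>) * jsum * norm x" for s t x
  proof -
    have "cmod (T t i j - T s i j) \<le> (E * \<bar>t - s\<bar>) / (jb (fst i - fst j))\<^sup>2" for i j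
    proof -
      have id: "primitive_of (\<lambda>t. t) (\<lambda>t::real. 1::real)"
        by (rule primitive_of_C1) (auto intro: derivative_eq_intros)
      have "cmod (T t i j - T s i j) \<le> \<bar>E / (jb (fst i - fst j))\<^sup>2 * (t - s)\<bar>"
        by (rule primitive_of_increment_bound[OF kC1_primitive[OF T] id]) (use E(2)[of _ i j] in simp)
      then show ?thesis using E(1) by (simp add: abs_mult)
    qed
    note S = Schur_bound[of "\<lambda>i j. T t i j - T s i j", OF this, of x]
    have "kop (T t) x - kop (T s) x = kop (\<lambda>i j. T t i j - T s i j) x"
    proof (rule ell2_eqI)
      fix i
      have "((\<lambda>j. T t i j * ell2_at x j + - (T s i j * ell2_at x j)) has_sum
          (kapp (T t) (ell2_at x) i + - kapp (T s) (ell2_at x) i)) UNIV"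
        unfolding kapp_def
        by (intro has_sum_add has_sum_uminusI has_sum_infsum kapp_summable[OF kC1D(1)[OF T] tempered_ell2])
      then have "kapp (\<lambda>i j. T t i j - T s i j) (ell2_at x) i = kapp (T t) (ell2_at x) i - kapp (T s) (ell2_at x) i"
        unfolding kapp_def[of "\<lambda>i j. T t i j - T s i j"] by (intro infsumI) (simp add: left_diff_distrib)
      then show "ell2_at (kop (T t) x - kop (T s) x) i = ell2_at (kop (\<lambda>i j. T t i j - T s i j) x) i"
        by (simp add: S(1) at)
    qed
    then show ?thesis using S(2) by simp
  qed
  have "((\<lambda>t. kop (T t) (u t)) \<longlongrightarrow> kop (T s) (u s)) (at s)" for s
  proof (rule LIM_zero_cancel, rule Lim_null_comparison)
    have us: "(u \<longlongrightarrow> u s) (at s)" using u by (auto simp: continuous_on_def)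
    have "((\<lambda>t. C * norm (u t - u s) + (E * \<bar>t - s\<bar>) * jsum * norm (u s)) \<longlongrightarrow>
        C * norm (u s - u s) + (E * \<bar>s - s\<bar>) * jsum * norm (u s)) (at s)"
      by (intro tendsto_intros us)
    then show "((\<lambda>t. C * norm (u t - u s) + (E * \<bar>t - s\<bar>) * jsum * norm (u s)) \<longlongrightarrow> 0) (at s)" by simp
    show "\<forall>\<^sub>F t in at s. norm (kop (T t) (u t) - kop (T s) (u s)) \<le> C * norm (u t - u s) + (E * \<bar>t - s\<bar>) * jsum * norm (u s)"
    proof (intro always_eventually allI)
      fix t
      have "kop (T t) (u t) - kop (T s) (u s) = kop (T t) (u t - u s) + (kop (T t) (u s) - kop (T s) (u s))"
        by (simp add: kop_diff[OF kC1D(1)[OF T]])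
      then show "norm (kop (T t) (u t) - kop (T s) (u s)) \<le> C * norm (u t - u s) + (E * \<bar>t - s\<bar>) * jsum * norm (u s)"
        using norm_triangle_mono[OF C(2) lip] by metis
    qed
  qed
  then show ?thesis by (simp add: continuous_on_def)
qed

definition umult :: "('i \<Rightarrow> complex) \<Rightarrow> 'i ell2 \<Rightarrow> 'i ell2" where
  "umult c x = Ell2 (\<lambda>i. c i * ell2_at x i)"

lemma umult:
  assumes "\<And>i. cmod (c i) = 1"
  shows "ell2_at (umult c x) i = c i * ell2_at x i" "norm (umult c x) = norm x"
proof -
  have s: "(\<Sum>i\<in>F. (cmod (c i * ell2_at x i))\<^sup>2) \<le> (norm x)\<^sup>2" if "finite F" for F
    using sum_ell2_le_norm[OF that, of x] by (simp add: norm_mult assms)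
  note * = norm_Ell2_le[OF s norm_ge_zero, folded umult_def]
  show 1: "ell2_at (umult c x) i = c i * ell2_at x i" for i by (simp add: *)
  have "(norm (umult c x))\<^sup>2 = (norm x)\<^sup>2"
    unfolding norm_ell2_square 1 by (simp add: norm_mult assms)
  then show "norm (umult c x) = norm x" by simp
qed

text \<open>The phases turn at speeds that are unbounded in the index, so the multipliers depend on
  time only strongly continuously. The increment is split accordingly: the multiplier is isometric
  on \<open>x t - x s\<close>, while for the fixed vector \<open>x s\<close> the sum is dominated by
  four times its squared entries.\<close>

lemma continuous_on_umult:
  fixes x :: "real \<Rightarrow> 'i::countable ell2"
  assumes c: "\<And>t i. cmod (c t i) = 1" "\<And>i. continuous_on UNIV (\<lambda>t. c t i)" and x: "continuous_on UNIV x"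
  shows "continuous_on UNIV (\<lambda>t. umult (c t) (x t))"
proof -
  have "((\<lambda>t. umult (c t) (x t)) \<longlongrightarrow> umult (c s) (x s)) (at s)" for s
  proof -
    define f where "f t = (\<Sum>\<^sub>\<infinity>i. (cmod ((c t i - c s i) * ell2_at (x s) i))\<^sup>2)" for t
    have "continuous_on UNIV f"
      unfolding f_def
    proof (rule continuous_on_infsum[where a = "\<lambda>i. 4 * (cmod (ell2_at (x s) i))\<^sup>2" and P = "\<lambda>_. 1"])
      show "(\<lambda>i. 4 * (cmod (ell2_at (x s) i))\<^sup>2) summable_on UNIV"
        by (intro summable_on_cmult_right ell2_at_summable)
      show "norm ((cmod ((c t i - c s i) * ell2_at (x s) i))\<^sup>2) \<le> 4 * (cmod (ell2_at (x s) i))\<^sup>2 * 1" for i t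
      proof -
        have "cmod (c t i - c s i) \<le> 2" using norm_triangle_ineq4[of "c t i" "c s i"] c(1) by simp
        then have "(cmod (c t i - c s i))\<^sup>2 \<le> 2\<^sup>2" by (rule power_mono) simp
        then show ?thesis by (simp add: norm_mult power_mult_distrib mult_right_mono)
      qed
    qed (intro continuous_intros c)+
    then have "(f \<longlongrightarrow> f s) (at s)" by (auto simp: continuous_on_def)
    then have f0: "(f \<longlongrightarrow> 0) (at s)" by (simp add: f_def)
    have xs: "(x \<longlongrightarrow> x s) (at s)" using x by (auto simp: continuous_on_def)
    have eq: "norm (umult (c t) (x s) - umult (c s) (x s)) = sqrt (f t)" for t
    proof -
      have "(norm (umult (c t) (x s) - umult (c s) (x s)))\<^sup>2 = f t"
        unfolding norm_ell2_square f_def by (simp add: umult c left_diff_distrib)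
      then show ?thesis by (metis norm_ge_zero real_sqrt_unique)
    qed
    show ?thesis
    proof (rule LIM_zero_cancel, rule Lim_null_comparison)
      have "((\<lambda>t. norm (x t - x s) + sqrt (f t)) \<longlongrightarrow> norm (x s - x s) + sqrt 0) (at s)"
        by (intro tendsto_intros xs f0)
      then show "((\<lambda>t. norm (x t - x s) + sqrt (f t)) \<longlongrightarrow> 0) (at s)" by simp
      show "\<forall>\<^sub>F t in at s. norm (umult (c t) (x t) - umult (c s) (x s)) \<le> norm (x t - x s) + sqrt (f t)"
      proof (intro always_eventually allI)
        fix t
        have "umult (c t) (x t) - umult (c s) (x s) = umult (c t) (x t - x s) + (umult (c t) (x s) - umult (c s) (x s))"
          by (rule ell2_eqI) (simp add: umult c algebra_simps)
        moreover have "norm (umult (c t) (x t - x s)) = norm (x t - x s)" by (rule umult(2)[OF c(1)])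
        ultimately show "norm (umult (c t) (x t) - umult (c s) (x s)) \<le> norm (x t - x s) + sqrt (f t)"
          unfolding eq[symmetric] using norm_triangle_ineq by metis
      qed
    qed
  qed
  then show ?thesis by (simp add: continuous_on_def)
qed

text \<open>For \<open>u\<close> in \<open>ell2\<close> the family \<open>A u\<close> is only
  tempered, so the equation is imposed on each coordinate separately, in integrated form.\<close>

definition solves_system :: "(real \<Rightarrow> idx \<Rightarrow> idx \<Rightarrow> complex) \<Rightarrow> (real \<Rightarrow> idx ell2) \<Rightarrow> (real \<Rightarrow> idx ell2) \<Rightarrow> bool" where
  "solves_system A h u \<longleftrightarrow> continuous_on UNIV u
    \<and> (\<forall>i. primitive_of (\<lambda>t. ell2_at (u t) i) (\<lambda>t. ell2_at (h t) i - kapp (A t) (ell2_at (u t)) i))"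

lemma solves_systemD:
  assumes "solves_system A h u"
  shows "continuous_on UNIV u"
    "primitive_of (\<lambda>t. ell2_at (u t) i) (\<lambda>t. ell2_at (h t) i - kapp (A t) (ell2_at (u t)) i)"
  using assms unfolding solves_system_def by blast+

section \<open>Uniqueness for the system and the way back from the gauged equation\<close>

locale normal_form_system =
  fixes A S S' M :: "real \<Rightarrow> idx \<Rightarrow> idx \<Rightarrow> complex" and lam :: "real \<Rightarrow> idx \<Rightarrow> real"
  assumes nf: "normal_form A S S' M lam"
begin

lemma A: "kord 4 A" and S: "kC1 0 S S'" and M: "kord 0 M"
  and Ac: "continuous_on UNIV (\<lambda>t. A t i j)" and Mc: "continuous_on UNIV (\<lambda>t. M t i j)"
  and lamc: "continuous_on UNIV (\<lambda>t. lam t i)"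
  and S_small: "cmod (S t i j) \<le> 1 / (2 * (jsum + 1)) / jb (fst i - fst j) ^ 8"
  and M_eq: "M t i j = S' t i j - (A t i j + kcomp (S t) (A t) i j)
          + \<i> * of_real (lam t i) * (kdiag (\<lambda>_. 1) i j + S t i j)"
  using nf unfolding normal_form_def by blast+

lemmas S0 = kC1D(1)[OF S] and S'0 = kC1D(2)[OF S]

text \<open>The constant makes the Schur bound at most one half. The last conclusion is the
  substitute for inverting I + T. It is applied to \<open>S\<close> and once more to
  \<open>S\<close> conjugated by a weight, hence the general \<open>T\<close>.\<close>

lemma half_bound:
  assumes "\<And>i j. cmod (T i j) \<le> 1 / (2 * (jsum + 1)) / (jb (fst i - fst j))\<^sup>2"
  shows "ell2_at (kop T x) = kapp T (ell2_at x)" "norm (kop T x) \<le> norm x / 2"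
    "norm x \<le> 2 * norm (x + kop T x)"
proof -
  note B = Schur_bound[of T, OF assms]
  show "ell2_at (kop T x) = kapp T (ell2_at x)" by (rule B(1))
  have "1 / (2 * (jsum + 1)) * jsum \<le> 1 / 2" using jsum_nonneg by (simp add: field_simps)
  then have le: "1 / (2 * (jsum + 1)) * jsum * norm x \<le> 1 / 2 * norm x" by (rule mult_right_mono) simp
  show *: "norm (kop T x) \<le> norm x / 2" using order_trans[OF B(2) le] by simp
  have "norm x \<le> norm (x + kop T x) + norm (kop T x)"
    using norm_triangle_ineq4[of "x + kop T x" "kop T x"] by simp
  then show "norm x \<le> 2 * norm (x + kop T x)" using * by linarith
qed

lemma S_half: "ell2_at (kop (S t) x) = kapp (S t) (ell2_at x)" "norm (kop (S t) x) \<le> norm x / 2"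
    "norm x \<le> 2 * norm (x + kop (S t) x)"
proof -
  have "cmod (S t i j) \<le> 1 / (2 * (jsum + 1)) / (jb (fst i - fst j))\<^sup>2" for i j
  proof (rule order_trans[OF S_small])
    have "(jb (fst i - fst j))\<^sup>2 \<le> jb (fst i - fst j) ^ 8"
      by (rule power_increasing) (auto simp: jb_ge_1)
    then show "1 / (2 * (jsum + 1)) / jb (fst i - fst j) ^ 8 \<le> 1 / (2 * (jsum + 1)) / (jb (fst i - fst j))\<^sup>2"
      using jsum_nonneg by (intro divide_left_mono) auto
  qed
  note h = half_bound[of "S t", OF this]
  show "ell2_at (kop (S t) x) = kapp (S t) (ell2_at x)" "norm (kop (S t) x) \<le> norm x / 2"
    "norm x \<le> 2 * norm (x + kop (S t) x)" by (rule h)+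
qed

lemma kapp_M:
  assumes x: "tempered n D x"
  shows "kapp (M t) x i = kapp (S' t) x i - (kapp (A t) x i + kapp (S t) (kapp (A t) x) i)
    + \<i> * of_real (lam t i) * (x i + kapp (S t) x i)"
proof -
  have c: "kord (0 + 4) (\<lambda>t. kcomp (S t) (A t))" by (rule kord_comp[OF S0 A])
  have one: "kord 0 (\<lambda>t::real. kdiag (\<lambda>_. 1))" by (rule kord_kdiag[where C = 1]) simp
  have "((\<lambda>j. S' t i j * x j + (- (A t i j * x j + kcomp (S t) (A t) i j * x j))
      + \<i> * of_real (lam t i) * (kdiag (\<lambda>_. 1) i j * x j + S t i j * x j)) has_sum
      (kapp (S' t) x i + (- (kapp (A t) x i + kapp (kcomp (S t) (A t)) x i))
      + \<i> * of_real (lam t i) * (kapp (kdiag (\<lambda>_. 1)) x i + kapp (S t) x i))) UNIV"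
    unfolding kapp_def
    by (intro has_sum_add has_sum_uminusI has_sum_cmult_right has_sum_infsum
        kapp_summable[OF S'0 x] kapp_summable[OF A x] kapp_summable[OF c x] kapp_summable[OF S0 x]
        kapp_summable[OF one x])
  then have "kapp (M t) x i = kapp (S' t) x i + (- (kapp (A t) x i + kapp (kcomp (S t) (A t)) x i))
      + \<i> * of_real (lam t i) * (kapp (kdiag (\<lambda>_. 1)) x i + kapp (S t) x i)"
    unfolding kapp_def[of "M t"] by (intro infsumI) (simp add: M_eq algebra_simps)
  then show ?thesis by (simp add: kapp_kcomp[OF S0 A x] kapp_kdiag)
qed

lemma gauge_primitive:
  assumes p: "\<And>j. primitive_of (\<lambda>t. p t j) (\<lambda>t. f t j)"
    and P: "\<And>t. tempered n (P t) (p t)" "locint P" and F: "\<And>t. tempered n (F t) (f t)" "locint F"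
  shows "primitive_of (\<lambda>t. p t i + kapp (S t) (p t) i) (\<lambda>t. f t i + (kapp (S' t) (p t) i + kapp (S t) (f t) i))"
  by (intro primitive_of_add p primitive_of_kapp[OF S p P F])

definition th :: "idx \<Rightarrow> real \<Rightarrow> real" where
  "th i = (SOME g. primitive_of g (\<lambda>t. lam t i) \<and> g 0 = 0)"

lemma th: "primitive_of (th i) (\<lambda>t. lam t i)" "th i 0 = 0"
  using someI_ex[OF primitive_of_exists[OF locint_continuous[OF lamc]]] unfolding th_def by blast+

text \<open>The integrating factor for the diagonal \<open>\<i> lam\<close>. It has modulus one
  because \<open>lam\<close> is real, so passing to the interaction picture costs nothing in
  norm.\<close>

definition ph :: "real \<Rightarrow> idx \<Rightarrow> complex" where "ph t i = exp (\<i> * of_real (th i t))"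

lemma ph_norm [simp]: "cmod (ph t i) = 1" "cmod (cnj (ph t i)) = 1" by (simp_all add: ph_def)
lemma ph_0 [simp]: "ph 0 i = 1" by (simp add: ph_def th)
lemma ph_cnj: "cnj (ph t i) * ph t i = 1"
  by (metis complex_norm_square mult.commute of_real_1 one_power2 ph_norm(1))

lemma ph_deriv: "((\<lambda>t. ph t i) has_vector_derivative (\<i> * of_real (lam t i) * ph t i)) (at t)"
proof -
  have "((\<lambda>t. \<i> * complex_of_real (th i t)) has_vector_derivative (\<i> * of_real (lam t i))) (at t)"
    by (intro has_vector_derivative_mult_right has_vector_derivative_of_real
        has_real_derivative_iff_has_vector_derivative[THEN iffD2, OF primitive_of_derivative[OF th(1) lamc]])
  from field_vector_diff_chain_at[OF this DERIV_exp] show ?thesis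
    by (simp add: o_def ph_def[abs_def])
qed

lemma ph_continuous: "continuous_on UNIV (\<lambda>t. ph t i)"
  unfolding ph_def by (intro continuous_intros primitive_of_continuous[OF th(1)])

lemma ph_cnj_deriv: "((\<lambda>t. cnj (ph t i)) has_vector_derivative (- (\<i> * of_real (lam t i)) * cnj (ph t i))) (at t)"
  using bounded_linear.has_vector_derivative[OF bounded_linear_cnj ph_deriv[of i t]] by simp

lemma locint_apply:
  assumes T: "kord 0 T" "\<And>i j. continuous_on UNIV (\<lambda>t. T t i j)"
    and h: "\<And>i. locint (\<lambda>t. ell2_at (h t) i)" and H: "locint H" "\<And>t. norm (h t) \<le> H t"
  shows "locint (\<lambda>t. kapp (T t) (ell2_at (h t)) i)"
proof (rule locint_kapp[OF T h _ H(1)])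
  show "tempered 0 (H t) (ell2_at (h t))" for t
    using cmod_ell2_at_le[of "h t"] H(2)[of t] by (auto simp: tempered_def intro: order_trans)
qed

text \<open>For the difference \<open>d\<close> of two solutions, v = (I + S) d satisfies v' = M d -
  i lam v. The phase removes the unbounded diagonal term, and \<open>d\<close> is controlled by v
  through the lower bound for I + S, so the derivative of the rotated v is bounded by a multiple of
  its norm and Gronwall applies.\<close>

lemma system_unique:
  assumes u: "solves_system A h u" and w: "solves_system A h w" and eq: "u 0 = w 0"
  shows "u t = w t"
proof -
  define d where "d t = u t - w t" for t
  have dc: "continuous_on UNIV d"
    unfolding d_def by (intro continuous_on_diff solves_systemD[OF u] solves_systemD[OF w])
  have pd: "primitive_of (\<lambda>t. ell2_at (d t) i) (\<lambda>t. - kapp (A t) (ell2_at (d t)) i)" for i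
  proof -
    have e: "ell2_at (d t) = (\<lambda>i. ell2_at (u t) i - ell2_at (w t) i)" for t by (auto simp: d_def)
    have "kapp (A t) (ell2_at (d t)) i = kapp (A t) (ell2_at (u t)) i - kapp (A t) (ell2_at (w t)) i" for t
      unfolding e by (rule kapp_diff[OF A tempered_ell2 tempered_ell2])
    moreover have "primitive_of (\<lambda>t. ell2_at (u t) i - ell2_at (w t) i)
      (\<lambda>t. (ell2_at (h t) i - kapp (A t) (ell2_at (u t)) i) - (ell2_at (h t) i - kapp (A t) (ell2_at (w t)) i))"
      by (intro primitive_of_diff solves_systemD[OF u] solves_systemD[OF w])
    ultimately show ?thesis by (simp add: d_def)
  qed
  have t4: "tempered 4 (norm (d t)) (ell2_at (d t))" for t by (rule tempered_mono[OF tempered_ell2]) simp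
  obtain C where C: "C \<ge> 0" "\<And>t x D. tempered 0 D x \<Longrightarrow> tempered (4 + 0) (C * D) (kapp (A t) x)"
    using kapp_tempered[OF A, of 0] by blast
  have fA: "tempered 4 (C * norm (d t)) (\<lambda>i. - kapp (A t) (ell2_at (d t)) i)" for t
    using C(2)[OF tempered_ell2[of "d t"], of t] by (simp add: tempered_def)
  define v where "v t i = ell2_at (d t) i + kapp (S t) (ell2_at (d t)) i" for t i
  have lin: "kapp (S t) (\<lambda>i. - kapp (A t) (ell2_at (d t)) i) i = - kapp (S t) (kapp (A t) (ell2_at (d t))) i" for t i
    unfolding kapp_def[of "S t"] by (simp add: infsum_uminus)
  have pv: "primitive_of (\<lambda>t. v t i) (\<lambda>t. kapp (M t) (ell2_at (d t)) i - \<i> * of_real (lam t i) * v t i)" for i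
  proof -
    have "primitive_of (\<lambda>t. v t i) (\<lambda>t. - kapp (A t) (ell2_at (d t)) i +
        (kapp (S' t) (ell2_at (d t)) i + kapp (S t) (\<lambda>i. - kapp (A t) (ell2_at (d t)) i) i))"
      unfolding v_def
      by (rule gauge_primitive[OF pd t4 _ fA]) (intro locint_continuous continuous_intros dc)+
    then show ?thesis by (simp add: kapp_M[OF tempered_ell2] v_def lin algebra_simps)
  qed
  define z where "z i t = ph t i * v t i" for i t
  define g where "g i t = ph t i * kapp (M t) (ell2_at (d t)) i" for i t
  have pz: "primitive_of (z i) (g i)" for i
  proof -
    have "primitive_of (z i) (\<lambda>t. (\<i> * of_real (lam t i) * ph t i) * v t i +
        ph t i * (kapp (M t) (ell2_at (d t)) i - \<i> * of_real (lam t i) * v t i))"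
      unfolding z_def
      by (rule primitive_of_mult[OF pv ph_deriv]) (intro continuous_intros lamc ph_continuous)
    then show ?thesis by (simp add: g_def[abs_def] algebra_simps)
  qed
  obtain CM where CM: "CM \<ge> 0" "\<And>t x. ell2_at (kop (M t) x) = kapp (M t) (ell2_at x)" "\<And>t x. norm (kop (M t) x) \<le> CM * norm x"
    using kord_kop_bounded[OF M] by blast
  have gb: "(\<Sum>i\<in>F. (cmod (g i t))\<^sup>2) \<le> (CM * norm (d t))\<^sup>2" if "finite F" for F t
  proof -
    have "(\<Sum>i\<in>F. (cmod (g i t))\<^sup>2) = (\<Sum>i\<in>F. (cmod (ell2_at (kop (M t) (d t)) i))\<^sup>2)"
      by (simp add: g_def norm_mult CM)
    also have "\<dots> \<le> (norm (kop (M t) (d t)))\<^sup>2" by (rule sum_ell2_le_norm[OF that])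
    also have "\<dots> \<le> (CM * norm (d t))\<^sup>2" by (intro power_mono CM) simp
    finally show ?thesis .
  qed
  have zrep: "Ell2 (\<lambda>i. z i t) = umult (ph t) (d t + kop (S t) (d t))" for t
    by (simp add: umult_def z_def v_def S_half)
  have nz: "norm (d t) \<le> 2 * norm (Ell2 (\<lambda>i. z i t))" for t
    unfolding zrep by (simp add: umult S_half(3))
  have cz: "continuous_on UNIV (\<lambda>t. Ell2 (\<lambda>i. z i t))"
    unfolding zrep
    by (intro continuous_on_umult continuous_on_add dc continuous_on_kop[OF S dc] ph_continuous) simp
  have zi: "z i 0 = 0" for i
  proof -
    have "ell2_at (d 0) = (\<lambda>_. 0)" using eq by (auto simp: d_def)
    then show ?thesis by (simp add: z_def v_def kapp_def)
  qed
  have bd: "(\<Sum>i\<in>F. (cmod (g i t))\<^sup>2) \<le> (2 * CM * norm (Ell2 (\<lambda>i. z i t)))\<^sup>2" if "finite F" for F t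
  proof (rule order_trans[OF gb[OF that]], rule power_mono)
    show "CM * norm (d t) \<le> 2 * CM * norm (Ell2 (\<lambda>i. z i t))"
      using mult_left_mono[OF nz CM(1), of t] by (simp add: mult_ac)
  qed (use CM in simp)
  have z0: "z i t = 0" for i t
    by (rule ell2_Gronwall[OF pz zi cz _ bd]) (use CM(1) in simp)
  have "Ell2 (\<lambda>i. z i t) = 0"
    unfolding z0 by (metis (no_types) ell2_at_inverse ell2_at_simps(1) ext)
  then have "d t = 0" using nz[of t] by simp
  then show ?thesis by (simp add: d_def)
qed

text \<open>The fixed point equation determines only (I + S) u, and the coordinates of
  \<open>u\<close> are not known to be absolutely continuous. A candidate \<open>p\<close> is
  obtained by integrating \<open>f\<close>, the right hand side evaluated at \<open>u\<close>,
  coordinate by coordinate. The difference \<open>r\<close> of \<open>u\<close> and \<open>p\<close>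
  then satisfies a homogeneous equation with the bounded kernel \<open>S'\<close> and vanishes by
  Gronwall's inequality.\<close>

lemma fixed_point_solves:
  assumes u: "continuous_on UNIV u" and h: "\<And>i. locint (\<lambda>t. ell2_at (h t) i)"
    and H: "locint H" "\<And>t. norm (h t) \<le> H t"
    and q: "\<And>i. primitive_of (q i) (\<lambda>t. ph t i * (kapp (M t) (ell2_at (u t)) i + ell2_at (h t) i + kapp (S t) (ell2_at (h t)) i))"
    and q0: "\<And>i. q i 0 = 0"
    and fp: "\<And>t i. ell2_at (u t + kop (S t) (u t)) i = cnj (ph t i) * (ell2_at (u0 + kop (S 0) u0) i + q i t)"
  shows "solves_system A h u" "u 0 = u0"
proof -
  have "u 0 + kop (S 0) (u 0) = u0 + kop (S 0) u0"
    by (rule ell2_eqI) (simp only: fp q0, simp)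
  then have "(u 0 - u0) + kop (S 0) (u 0 - u0) = 0" by (simp add: kop_diff[OF S0] algebra_simps)
  then show u0: "u 0 = u0" using S_half(3)[of "u 0 - u0" 0] by simp
  obtain C where C: "C \<ge> 0" "\<And>t x D. tempered 0 D x \<Longrightarrow> tempered (4 + 0) (C * D) (kapp (A t) x)"
    using kapp_tempered[OF A, of 0] by blast
  define f where "f t i = ell2_at (h t) i - kapp (A t) (ell2_at (u t)) i" for t i
  define X where "X t = H t + C * norm (u t)" for t
  have ut: "tempered 4 (norm (u t)) (ell2_at (u t))" for t by (rule tempered_mono[OF tempered_ell2]) simp
  have ht0: "tempered 0 (H t) (ell2_at (h t))" for t
    using cmod_ell2_at_le[of "h t"] H(2)[of t] by (auto simp: tempered_def intro: order_trans)
  then have ht: "tempered 4 (H t) (ell2_at (h t))" for t by (rule tempered_mono) simp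
  have At: "tempered 4 (C * norm (u t)) (kapp (A t) (ell2_at (u t)))" for t
    using C(2)[OF tempered_ell2[of "u t"], of t] by simp
  have ft: "tempered 4 (X t) (f t)" for t
    unfolding X_def f_def[abs_def] by (rule tempered_diff[OF ht At])
  have Xl: "locint X" unfolding X_def by (intro locint_add H locint_continuous continuous_intros u)
  have ui: "locint (\<lambda>t. ell2_at (u t) i)" for i by (intro locint_continuous continuous_intros u)
  have fl: "locint (\<lambda>t. f t i)" for i
    unfolding f_def
    by (intro locint_diff h locint_kapp[OF A Ac ui ut] locint_continuous continuous_intros u)
  have "\<exists>g. primitive_of g (\<lambda>t. f t i) \<and> g 0 = ell2_at u0 i" for i
  proof -
    obtain g where g: "primitive_of g (\<lambda>t. f t i)" "g 0 = 0" using primitive_of_exists[OF fl] by blast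
    have "primitive_of (\<lambda>t. g t + ell2_at u0 i) (\<lambda>t. f t i + 0)"
      by (rule primitive_of_add[OF g(1) primitive_of_const])
    then show ?thesis using g(2) by (intro exI[of _ "\<lambda>t. g t + ell2_at u0 i"]) simp
  qed
  then obtain p where p: "\<And>i. primitive_of (p i) (\<lambda>t. f t i)" "\<And>i. p i 0 = ell2_at u0 i"
    using choice[of "\<lambda>i g. primitive_of g (\<lambda>t. f t i) \<and> g 0 = ell2_at u0 i"] by blast
  obtain K where K: "primitive_of K X" "K 0 = 0" using primitive_of_exists[OF Xl] by blast
  define P where "P t = norm u0 + \<bar>K t\<bar>" for t
  have Kc: "continuous_on UNIV K" by (rule primitive_of_continuous[OF K(1)])
  have Pc: "continuous_on UNIV P" unfolding P_def by (intro continuous_intros Kc)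
  have pt: "tempered 4 (P t) (\<lambda>i. p i t)" for t
    unfolding tempered_def
  proof
    fix i :: idx
    have j: "1 \<le> jb (fst i) powi 4" using jb_power_ge_1[of "fst i" 4] by simp
    have "cmod (p i t - p i 0) \<le> \<bar>jb (fst i) powi 4 * (K t - K 0)\<bar>"
      by (rule primitive_of_increment_bound[OF p(1) K(1)])
        (use ft[unfolded tempered_def, rule_format, of _ i] in \<open>simp add: mult.commute\<close>)
    then have "cmod (p i t - ell2_at u0 i) \<le> jb (fst i) powi 4 * \<bar>K t\<bar>" by (simp add: p K abs_mult)
    moreover have "cmod (ell2_at u0 i) \<le> jb (fst i) powi 4 * norm u0"
      using mult_right_mono[OF j norm_ge_zero[of u0]] cmod_ell2_at_le[of u0 i] by simp
    ultimately show "cmod (p i t) \<le> P t * jb (fst i) powi 4"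
      using norm_triangle_ineq[of "p i t - ell2_at u0 i" "ell2_at u0 i"]
      by (simp add: P_def algebra_simps)
  qed
  have pv: "primitive_of (\<lambda>t. p i t + kapp (S t) (\<lambda>i. p i t) i)
      (\<lambda>t. f t i + (kapp (S' t) (\<lambda>i. p i t) i + kapp (S t) (f t) i))" for i
    by (rule gauge_primitive[OF p(1) pt _ ft Xl]) (intro locint_continuous Pc)
  \<comment> \<open>Multiplying Duhamel's formula by the conjugate phase brings back
    \<open>\<i> lam\<close>, which cancels against the one contained in \<open>M\<close> by
    \<open>kapp_M\<close>. The result is the derivative that \<open>gauge_primitive\<close> would
    give if \<open>u\<close> were a primitive of \<open>f\<close>.\<close>
  have uv: "primitive_of (\<lambda>t. ell2_at (u t) i + kapp (S t) (ell2_at (u t)) i)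
      (\<lambda>t. f t i + (kapp (S' t) (ell2_at (u t)) i + kapp (S t) (f t) i))" for i
  proof -
    have "primitive_of (\<lambda>t. ell2_at (u0 + kop (S 0) u0) i + q i t)
      (\<lambda>t. 0 + ph t i * (kapp (M t) (ell2_at (u t)) i + ell2_at (h t) i + kapp (S t) (ell2_at (h t)) i))"
      by (rule primitive_of_add[OF primitive_of_const q])
    note g = this
    have "continuous_on UNIV (\<lambda>t. - (\<i> * of_real (lam t i)) * cnj (ph t i))"
      by (intro continuous_intros lamc ph_continuous)
    from primitive_of_mult[OF g ph_cnj_deriv this]
    have "primitive_of (\<lambda>t. ell2_at (u t + kop (S t) (u t)) i)
      (\<lambda>t. - (\<i> * of_real (lam t i)) * ell2_at (u t + kop (S t) (u t)) i +
        (cnj (ph t i) * ph t i) * (kapp (M t) (ell2_at (u t)) i + ell2_at (h t) i + kapp (S t) (ell2_at (h t)) i))"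
      unfolding fp by (simp only: mult.assoc add_0_left)
    note g2 = this
    have e: "kapp (S t) (f t) i = kapp (S t) (ell2_at (h t)) i - kapp (S t) (kapp (A t) (ell2_at (u t))) i" for t
      unfolding f_def[abs_def] by (rule kapp_diff[OF S0 ht At])
    have "- (\<i> * of_real (lam t i)) * ell2_at (u t + kop (S t) (u t)) i +
        (cnj (ph t i) * ph t i) * (kapp (M t) (ell2_at (u t)) i + ell2_at (h t) i + kapp (S t) (ell2_at (h t)) i)
      = f t i + (kapp (S' t) (ell2_at (u t)) i + kapp (S t) (f t) i)" for t
      unfolding ph_cnj e kapp_M[OF tempered_ell2] by (simp add: S_half f_def algebra_simps)
    then show ?thesis using g2 by (simp only: ell2_at_simps S_half)
  qed
  define r where "r t i = ell2_at (u t) i - p i t" for t i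
  define D where "D t = norm (u t) + P t" for t
  have rt: "tempered 4 (D t) (r t)" for t
    unfolding D_def r_def[abs_def] by (rule tempered_diff[OF ut pt])
  have Dc: "continuous_on UNIV D" unfolding D_def by (intro continuous_intros Pc u)
  have D0: "D t \<ge> 0" for t by (rule tempered_nonneg[OF rt])
  \<comment> \<open>Both gauged functions contain the same \<open>f\<close>, so the terms of order
    four cancel in the difference and only \<open>S'\<close> remains.\<close>
  have rv: "primitive_of (\<lambda>t. r t i + kapp (S t) (r t) i) (\<lambda>t. kapp (S' t) (r t) i)" for i
  proof -
    have k: "kapp (S t) (r t) i = kapp (S t) (ell2_at (u t)) i - kapp (S t) (\<lambda>i. p i t) i"
      "kapp (S' t) (r t) i = kapp (S' t) (ell2_at (u t)) i - kapp (S' t) (\<lambda>i. p i t) i" for t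
      unfolding r_def[abs_def] by (rule kapp_diff[OF S0 ut pt] kapp_diff[OF S'0 ut pt])+
    have e1: "r t i + kapp (S t) (r t) i = (ell2_at (u t) i + kapp (S t) (ell2_at (u t)) i)
        - (p i t + kapp (S t) (\<lambda>i. p i t) i)" for t
      unfolding k by (simp add: r_def)
    have e2: "kapp (S' t) (r t) i = (f t i + (kapp (S' t) (ell2_at (u t)) i + kapp (S t) (f t) i))
        - (f t i + (kapp (S' t) (\<lambda>i. p i t) i + kapp (S t) (f t) i))" for t
      unfolding k by simp
    show ?thesis unfolding e1 unfolding e2 by (rule primitive_of_diff[OF uv pv])
  qed
  \<comment> \<open>The primitive \<open>p\<close> is only tempered of exponent 4, as
    \<open>A\<close> has order four, and exponent -2 is needed to be in \<open>ell2\<close>; hence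
    the weight of power -6. Conjugation by it costs six powers of the decay off the diagonal, and
    Schur's test takes two more: this is the exponent 8 in \<open>S_small\<close>.\<close>
  define w where "w i = complex_of_real (jb (fst i) powi (-6))" for i :: idx
  define w' where "w' i = complex_of_real (jb (fst i) powi 6)" for i :: idx
  have nw: "cmod (w i) = 1 / jb (fst i) ^ 6" "cmod (w' i) = jb (fst i) ^ 6" for i
    unfolding w_def w'_def norm_of_real by (simp_all add: power_int_minus inverse_eq_divide)
  have ww: "w' i * w i = 1" for i
    unfolding w_def w'_def of_real_mult[symmetric] by (simp add: power_int_minus)
  define y where "y t i = w i * r t i" for t i
  have wk: "kapp (\<lambda>i j. w i * T i j * w' j) (y t) i = w i * kapp T (r t) i" for T t i
  proof -
    have e: "w i * T i j * w' j * y t j = w i * (T i j * r t j)" for j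
      using ww[of j] by (simp add: y_def)
    show ?thesis unfolding kapp_def e infsum_cmult_right' ..
  qed
  have wbd: "cmod (w i * c * w' j) \<le> cmod c * jb (fst i - fst j) ^ 6" for i j c
  proof -
    have "jb (fst j) ^ 6 \<le> (jb (fst i - fst j) * jb (fst i)) ^ 6"
      using jb_le_mult[of "fst j" "fst i"] by (intro power_mono) (auto simp: jb_commute)
    then have "jb (fst j) ^ 6 / jb (fst i) ^ 6 \<le> jb (fst i - fst j) ^ 6"
      by (simp add: power_mult_distrib pos_divide_le_eq)
    then have "cmod c * (jb (fst j) ^ 6 / jb (fst i) ^ 6) \<le> cmod c * jb (fst i - fst j) ^ 6"
      by (rule mult_left_mono) simp
    then show ?thesis
      by (simp add: norm_mult nw mult_ac)
  qed
  have cancel: "c / jb k ^ 8 * jb k ^ 6 = c / (jb k)\<^sup>2" for c k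
  proof -
    have "jb k ^ 8 = jb k ^ 6 * (jb k)\<^sup>2" by (simp flip: power_add)
    then show ?thesis by (simp add: field_simps)
  qed
  define Sw where "Sw t i j = w i * S t i j * w' j" for t i j
  define Sw' where "Sw' t i j = w i * S' t i j * w' j" for t i j
  have Sw_small: "cmod (Sw t i j) \<le> 1 / (2 * (jsum + 1)) / (jb (fst i - fst j))\<^sup>2" for t i j
  proof -
    have "cmod (Sw t i j) \<le> (1 / (2 * (jsum + 1)) / jb (fst i - fst j) ^ 8) * jb (fst i - fst j) ^ 6"
      unfolding Sw_def by (rule order_trans[OF wbd mult_right_mono[OF S_small]]) simp
    also have "\<dots> = 1 / (2 * (jsum + 1)) / (jb (fst i - fst j))\<^sup>2"
      by (rule cancel)
    finally show ?thesis .
  qed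
  note Sw = half_bound[of "Sw _", OF Sw_small]
  obtain E where E: "E \<ge> 0" "\<And>t i j. cmod (S' t i j) \<le> E * jb (fst j) powi 0 / jb (fst i - fst j) ^ 8"
    using kordE[OF S'0] by blast
  have Sw'_bd: "cmod (Sw' t i j) \<le> E / (jb (fst i - fst j))\<^sup>2" for t i j
  proof -
    have "cmod (Sw' t i j) \<le> (E / jb (fst i - fst j) ^ 8) * jb (fst i - fst j) ^ 6"
      unfolding Sw'_def by (rule order_trans[OF wbd mult_right_mono[OF E(2)[simplified]]]) simp
    also have "\<dots> = E / (jb (fst i - fst j))\<^sup>2"
      by (rule cancel)
    finally show ?thesis .
  qed
  note Sw' = Schur_bound[of "Sw' _", OF Sw'_bd]
  have yt: "tempered (-2) (D t) (y t)" for t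
    unfolding tempered_def
  proof
    fix i :: idx
    have "cmod (y t i) = jb (fst i) powi (-6) * cmod (r t i)" by (simp add: y_def w_def norm_mult norm_power_int)
    also have "\<dots> \<le> jb (fst i) powi (-6) * (D t * jb (fst i) powi 4)"
      using rt[of t, unfolded tempered_def, rule_format, of i] by (intro mult_left_mono) auto
    also have "\<dots> = D t * jb (fst i) powi (-2)"
      using power_int_add[of "jb (fst i)" "-6" 4] by simp
    finally show "cmod (y t i) \<le> D t * jb (fst i) powi (-2)" .
  qed
  define Y where "Y t = Ell2 (y t)" for t
  have Y: "ell2_at (Y t) = y t" "norm (Y t) \<le> D t * (jsum + 1)" for t
    unfolding Y_def by (rule tempered_ell2_neg[OF yt])+
  define z where "z i t = y t i + kapp (Sw t) (y t) i" for i t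
  define g where "g i t = kapp (Sw' t) (y t) i" for i t
  have pz: "primitive_of (z i) (g i)" for i
    using primitive_of_cmult[OF rv[of i], of "w i"] unfolding z_def g_def Sw_def[abs_def] Sw'_def[abs_def] wk
    by (simp add: y_def distrib_left)
  have zrep: "Ell2 (\<lambda>i. z i t) = Y t + kop (Sw t) (Y t)" for t
  proof -
    have "(\<lambda>i. z i t) = ell2_at (Y t + kop (Sw t) (Y t))"
      by (auto simp: z_def Y Sw)
    then show ?thesis by (simp add: ell2_at_inverse)
  qed
  have gb: "(\<Sum>i\<in>F. (cmod (g i t))\<^sup>2) \<le> (E * jsum * norm (Y t))\<^sup>2" if "finite F" for F t
  proof -
    have "(\<Sum>i\<in>F. (cmod (g i t))\<^sup>2) = (\<Sum>i\<in>F. (cmod (ell2_at (kop (Sw' t) (Y t)) i))\<^sup>2)"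
      by (simp add: g_def Y Sw')
    also have "\<dots> \<le> (norm (kop (Sw' t) (Y t)))\<^sup>2" by (rule sum_ell2_le_norm[OF that])
    also have "\<dots> \<le> (E * jsum * norm (Y t))\<^sup>2" by (intro power_mono Sw') simp
    finally show ?thesis .
  qed
  have z0: "z i 0 = 0" for i
  proof -
    have "y 0 = (\<lambda>_. 0)" by (auto simp: y_def r_def u0 p)
    then show ?thesis by (simp add: z_def kapp_def)
  qed
  have EJ: "E * jsum \<ge> 0" using E jsum_nonneg by simp
  \<comment> \<open>Continuity of the weighted family in norm is not known beforehand. It follows
    from its derivative, which is bounded by the continuous function \<open>D\<close> up to a
    constant.\<close>
  have cz: "continuous_on UNIV (\<lambda>t. Ell2 (\<lambda>i. z i t))"
  proof -
    have l: "locint (\<lambda>t. E * jsum * (D t * (jsum + 1)))" by (intro locint_continuous continuous_intros Dc)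
    obtain Q where Q: "primitive_of Q (\<lambda>t. E * jsum * (D t * (jsum + 1)))" using primitive_of_exists[OF l] by blast
    show ?thesis
    proof (rule ell2_primitive(3)[OF pz Q, where ?Z0.0 = 0])
      show nn: "0 \<le> E * jsum * (D t * (jsum + 1))" for t using EJ D0[of t] jsum_nonneg by simp
      show "(\<Sum>i\<in>F. (cmod (g i t))\<^sup>2) \<le> (E * jsum * (D t * (jsum + 1)))\<^sup>2" if "finite F" for t F
        by (rule order_trans[OF gb[OF that]]) (intro power_mono mult_left_mono Y EJ mult_nonneg_nonneg norm_ge_zero)
    qed (simp add: z0)
  qed
  have nz: "norm (Y t) \<le> 2 * norm (Ell2 (\<lambda>i. z i t))" for t
    unfolding zrep by (rule Sw(3))
  have bd: "(\<Sum>i\<in>F. (cmod (g i t))\<^sup>2) \<le> (2 * (E * jsum) * norm (Ell2 (\<lambda>i. z i t)))\<^sup>2" if "finite F" for F t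
  proof (rule order_trans[OF gb[OF that]], rule power_mono)
    show "E * jsum * norm (Y t) \<le> 2 * (E * jsum) * norm (Ell2 (\<lambda>i. z i t))"
      using mult_left_mono[OF nz EJ, of t] by (simp add: mult_ac)
  qed (use EJ in simp)
  have zz: "z i t = 0" for i t
    by (rule ell2_Gronwall[OF pz z0 cz _ bd]) (use EJ in simp)
  have "Ell2 (\<lambda>i. z i t) = 0" for t
    unfolding zz by (metis (no_types) ell2_at_inverse ell2_at_simps(1) ext)
  then have "Y t = 0" for t using nz[of t] by simp
  then have "y t i = 0" for t i using Y(1)[of t] by (metis ell2_at_simps(1))
  then have "r t i = 0" for t i using ww[of i] unfolding y_def by (metis mult_eq_0_iff mult_zero_right zero_neq_one)
  then have "ell2_at (u t) i = p i t" for t i by (simp add: r_def)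
  then show "solves_system A h u" using p(1) u by (simp add: solves_system_def f_def)
qed

end

text \<open>The contraction argument runs in a sup norm weighted by \<open>1 / winv\<close>, which compensates the
  growth of the source term and makes the time integral small.\<close>

lemma winv_exists:
  fixes H :: "real \<Rightarrow> real"
  assumes H: "locint H" "\<And>t. H t \<ge> 0" and L: "L > 0"
  obtains winv G Q :: "real \<Rightarrow> real" where "continuous_on UNIV winv" "\<And>t. 1 \<le> winv t"
    "primitive_of G H" "G 0 = 0" "\<And>t. \<bar>G t\<bar> \<le> winv t"
    "primitive_of Q winv" "Q 0 = 0" "\<And>t. \<bar>Q t\<bar> \<le> winv t / L"
proof -
  obtain G where G: "primitive_of G H" "G 0 = 0" using primitive_of_exists[OF H(1)] by blast
  have Gc: "continuous_on UNIV G" by (rule primitive_of_continuous[OF G(1)])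
  have Gm: "G s \<le> G t" if "s \<le> t" for s t
  proof -
    have "0 \<le> integral {s..t} H" by (intro Henstock_Kurzweil_Integration.integral_nonneg locintD H)
    then show ?thesis using primitive_ofD(2)[OF G(1) that] by simp
  qed
  define rho where "rho t = 1 + \<bar>G t\<bar>" for t
  \<comment> \<open>The factor \<open>rho\<close> dominates the primitive of the source. As it is
    nondecreasing away from time 0, it can be pulled out of the integral of \<open>winv\<close>, and
    integrating the exponential gains the factor 1 / L.\<close>
  define winv where "winv t = exp (L * \<bar>t\<bar>) * rho t" for t
  have rc: "continuous_on UNIV rho" unfolding rho_def by (intro continuous_intros Gc)
  have wc: "continuous_on UNIV winv" unfolding winv_def by (intro continuous_intros rc)
  have r1: "1 \<le> rho t" for t by (simp add: rho_def)
  have e1: "1 \<le> exp (L * \<bar>t\<bar>)" for t using L by simp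
  have w1: "rho t \<le> winv t" for t using mult_right_mono[OF e1, of "rho t" t] r1[of t] by (simp add: winv_def)
  obtain Q where Q: "primitive_of Q winv" "Q 0 = 0" using primitive_of_exists[OF locint_continuous[OF wc]] by blast
  have Q0: "Q s \<le> Q t" if "s \<le> t" for s t
  proof -
    have "0 \<le> integral {s..t} winv"
      by (intro Henstock_Kurzweil_Integration.integral_nonneg locintD locint_continuous wc)
        (use w1 r1 in \<open>meson order_trans zero_le_one\<close>)
    then show ?thesis using primitive_ofD(2)[OF Q(1) that] by simp
  qed
  have ex: "primitive_of (\<lambda>s. c * (exp (k * s) / k)) (\<lambda>s. c * exp (k * s))" if "k \<noteq> 0" for c k :: real
    by (rule primitive_of_C1)
      (use that in \<open>auto intro!: derivative_eq_intros continuous_intros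
        simp: has_real_derivative_iff_has_vector_derivative[symmetric]\<close>)
  have L0: "L \<noteq> 0" "- L \<noteq> 0" using L by auto
  have "\<bar>Q t\<bar> \<le> winv t / L" for t
  proof (cases "0 \<le> t")
    case True
    have "Q t - Q 0 \<le> rho t * (exp (L * t) / L) - rho t * (exp (L * 0) / L)"
      unfolding primitive_ofD(2)[OF Q(1) True] primitive_ofD(2)[OF ex[OF L0(1), of "rho t"] True]
    proof (rule integral_le)
      fix s assume s: "s \<in> {0..t}"
      then have "rho s \<le> rho t" using Gm[of 0 s] Gm[of s t] G(2) by (simp add: rho_def)
      then show "winv s \<le> rho t * exp (L * s)" using s by (simp add: winv_def mult.commute)
    qed (intro locintD locint_continuous wc continuous_intros)+
    also have "\<dots> \<le> winv t / L" using True L r1[of t] by (simp add: winv_def mult_ac)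
    finally show ?thesis using Q(2) Q0[OF True] by simp
  next
    case False
    then have t: "t \<le> 0" by simp
    have "Q 0 - Q t \<le> rho t * (exp (- L * 0) / - L) - rho t * (exp (- L * t) / - L)"
      unfolding primitive_ofD(2)[OF Q(1) t] primitive_ofD(2)[OF ex[OF L0(2), of "rho t"] t]
    proof (rule integral_le)
      fix s assume s: "s \<in> {t..0}"
      then have "rho s \<le> rho t" using Gm[of t s] Gm[of s 0] G(2) by (simp add: rho_def)
      then show "winv s \<le> rho t * exp (- L * s)" using s by (simp add: winv_def mult.commute)
    qed (intro locintD locint_continuous wc continuous_intros)+
    also have "\<dots> \<le> winv t / L" using t L r1[of t] by (simp add: winv_def mult_ac)
    finally show ?thesis using Q(2) Q0[OF t] by simp
  qed
  moreover have "\<bar>G t\<bar> \<le> winv t" "1 \<le> winv t" for t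
    using w1[of t] r1[of t] by (simp_all add: rho_def)
  ultimately show ?thesis using that[of winv G Q] wc G Q by blast
qed

lemma umult_diff:
  assumes "\<And>i. cmod (c i) = 1"
  shows "umult c x - umult c y = umult c (x - y)"
  by (rule ell2_eqI) (simp add: umult assms algebra_simps)

context normal_form_system
begin

text \<open>The map sends u to its Duhamel integral in the interaction picture, rotated back, minus
  S u. Keeping S u on the right hand side avoids an inverse of I + S at the price of one half in the
  Lipschitz constant; the integral of \<open>M\<close> adds one quarter, so the constant is
  3/4.\<close>

lemma system_exists:
  assumes h: "\<And>i. locint (\<lambda>t. ell2_at (h t) i)" and H: "locint H" "\<And>t. norm (h t) \<le> H t"
  shows "\<exists>u. solves_system A h u \<and> u 0 = u0"
proof -
  obtain CM where CM: "CM \<ge> 0" "\<And>t x. ell2_at (kop (M t) x) = kapp (M t) (ell2_at x)" "\<And>t x. norm (kop (M t) x) \<le> CM * norm x"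
    using kord_kop_bounded[OF M] by blast
  have H0: "H t \<ge> 0" for t using H(2)[of t] norm_ge_zero order_trans by blast
  \<comment> \<open>This rate makes the time integral of \<open>CM * winv\<close> at most a quarter
    of \<open>winv\<close>, see \<open>CQ\<close>.\<close>
  define L where "L = 4 * CM + 1"
  have L: "L > 0" "CM \<le> L / 4" using CM by (simp_all add: L_def)
  obtain winv G Q where w: "continuous_on UNIV winv" "\<And>t. 1 \<le> winv t"
    and G: "primitive_of G H" "G 0 = 0" "\<And>t. \<bar>G t\<bar> \<le> winv t"
    and Q: "primitive_of Q winv" "Q 0 = 0" "\<And>t. \<bar>Q t\<bar> \<le> winv t / L"
    using winv_exists[OF H(1) H0 L(1)] by metis
  have w0: "winv t > 0" "winv t \<noteq> 0" for t using w(2)[of t] by auto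
  have CQ: "\<bar>CM * Q t\<bar> \<le> winv t / 4" for t
  proof -
    have "\<bar>CM * Q t\<bar> \<le> (L / 4) * (winv t / L)"
      unfolding abs_mult using CM(1) L w0[of t] Q(3)[of t] by (intro mult_mono) auto
    then show ?thesis using L(1) by simp
  qed
  define gv where "gv u t = umult (ph t) (kop (M t) (u t) + h t + kop (S t) (h t))" for u t
  \<comment> \<open>For a discontinuous argument this choice is arbitrary. It is evaluated at the
    functions \<open>ux x\<close>, which are continuous, and there it is a primitive.\<close>
  define q where "q u i = (SOME q. primitive_of q (\<lambda>t. ell2_at (gv u t) i) \<and> q 0 = 0)" for u i
  have gv_at: "ell2_at (gv u t) i = ph t i * (kapp (M t) (ell2_at (u t)) i + ell2_at (h t) i + kapp (S t) (ell2_at (h t)) i)" for u t i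
    by (simp add: gv_def umult CM S_half)
  have gv_norm: "norm (gv u t) \<le> CM * norm (u t) + 2 * H t" for u t
  proof -
    have "norm (gv u t) = norm (kop (M t) (u t) + h t + kop (S t) (h t))" by (simp add: gv_def umult)
    also have "\<dots> \<le> norm (kop (M t) (u t)) + norm (h t) + norm (kop (S t) (h t))"
      by (intro norm_triangle_mono order_refl)
    also have "\<dots> \<le> CM * norm (u t) + 2 * H t"
      using CM(3)[of t "u t"] S_half(2)[of t "h t"] H(2)[of t] H0[of t] by linarith
    finally show ?thesis .
  qed
  have gv_diff: "norm (gv u t - gv v t) \<le> CM * norm (u t - v t)" for u v t
    using CM(3)[of t "u t - v t"] by (simp add: gv_def umult_diff umult kop_diff[OF M])
  have lg: "locint (\<lambda>t. ell2_at (gv u t) i)" if u: "continuous_on UNIV u" for u i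
    unfolding gv_at
  proof (intro locint_mult_continuous ph_continuous locint_add h)
    show "locint (\<lambda>t. kapp (M t) (ell2_at (u t)) i)"
      by (rule locint_apply[OF M Mc, where H = "\<lambda>t. norm (u t)"])
        (auto intro!: locint_continuous continuous_intros u)
    show "locint (\<lambda>t. kapp (S t) (ell2_at (h t)) i)"
      by (rule locint_apply[OF S0 kC1_continuous[OF S] h H])
  qed
  have q: "primitive_of (q u i) (\<lambda>t. ell2_at (gv u t) i)" "q u i 0 = 0" if "continuous_on UNIV u" for u i
    using someI_ex[OF primitive_of_exists[OF lg[OF that]]] unfolding q_def by blast+
  define PP where "PP u t = Ell2 (\<lambda>i. q u i t)" for u t
  have PP: "ell2_at (PP u t) i = q u i t" "continuous_on UNIV (PP u)"
    "norm (PP u t) \<le> \<bar>K t\<bar>"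
    if u: "continuous_on UNIV u" and K: "primitive_of K X" "K 0 = 0"
      and X: "\<And>t. CM * norm (u t) + 2 * H t \<le> X t" for u t i K X
  proof -
    have X': "norm (gv u t) \<le> X t" for t using gv_norm[of u t] X[of t] by linarith
    have bd: "(\<Sum>i\<in>F. (cmod (ell2_at (gv u t) i))\<^sup>2) \<le> (X t)\<^sup>2" if "finite F" for F t
      by (rule order_trans[OF sum_ell2_le_norm[OF that]]) (intro power_mono X' norm_ge_zero)
    have X0: "X t \<ge> 0" for t using X'[of t] norm_ge_zero order_trans by blast
    have "q u i 0 = ell2_at 0 i" for i by (simp add: q[OF u])
    note E = ell2_primitive[OF q(1)[OF u] K(1) X0 bd this]
    show at: "ell2_at (PP u t) i = q u i t" for t i unfolding PP_def by (rule E(1))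
    show "continuous_on UNIV (PP u)" unfolding PP_def by (rule E(3))
    have "PP u 0 = 0" by (rule ell2_eqI) (simp add: at q[OF u])
    then show "norm (PP u t) \<le> \<bar>K t\<bar>" using E(2)[of t 0] by (simp add: PP_def K)
  qed
  have PPd: "norm (PP u t - PP v t) \<le> \<bar>K t\<bar>"
    if u: "continuous_on UNIV u" and v: "continuous_on UNIV v" and K: "primitive_of K X" "K 0 = 0"
      and X: "\<And>t. CM * norm (u t - v t) \<le> X t"
      and au: "\<And>t i. ell2_at (PP u t) i = q u i t" and av: "\<And>t i. ell2_at (PP v t) i = q v i t" for u v t K X
  proof -
    have X': "norm (gv u t - gv v t) \<le> X t" for t using gv_diff[of u t v] X[of t] by linarith
    have bd: "(\<Sum>i\<in>F. (cmod (ell2_at (gv u t) i - ell2_at (gv v t) i))\<^sup>2) \<le> (X t)\<^sup>2" if "finite F" for F t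
      using sum_ell2_le_norm[OF that, of "gv u t - gv v t"] power_mono[OF X'[of t] norm_ge_zero, of 2] by simp
    have X0: "X t \<ge> 0" for t using X'[of t] norm_ge_zero order_trans by blast
    have z: "q u i 0 - q v i 0 = ell2_at 0 i" for i by (simp add: q[OF u] q[OF v])
    note E = ell2_primitive[OF primitive_of_diff[OF q(1)[OF u] q(1)[OF v]] K(1) X0 bd z]
    have at: "Ell2 (\<lambda>i. q u i t - q v i t) = PP u t - PP v t" for t
      by (rule ell2_eqI) (simp add: E(1) au av)
    have "PP u 0 - PP v 0 = 0" by (rule ell2_eqI) (simp add: au av q[OF u] q[OF v])
    then show ?thesis using E(2)[of t 0] unfolding at by (simp add: K)
  qed
  define g0 where "g0 = u0 + kop (S 0) u0"
  define Ga where "Ga u t = umult (\<lambda>i. cnj (ph t i)) (g0 + PP u t)" for u t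
  \<comment> \<open>The unknown is written as \<open>winv\<close> times a bounded continuous
    function, so that the complete space \<open>bcontfun\<close> carries the weighted sup
    norm.\<close>
  define ux where "ux x t = winv t *\<^sub>R apply_bcontfun x t" for x :: "(real, idx ell2) bcontfun" and t
  have uxc: "continuous_on UNIV (ux x)" for x
    unfolding ux_def by (intro continuous_intros w(1) continuous_on_apply_bcontfun)
  have uxn: "norm (ux x t) \<le> winv t * norm x" for x t
    using w0[of t] norm_bounded[of x t] by (simp add: ux_def)
  define K where "K x t = (CM * norm x) * Q t + 2 * G t" for x :: "(real, idx ell2) bcontfun" and t
  have K: "primitive_of (K x) (\<lambda>t. (CM * norm x) * winv t + 2 * H t)" "K x 0 = 0" for x
    unfolding K_def by (intro primitive_of_add primitive_of_cmult G Q) (simp add: G Q)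
  have KX: "CM * norm (ux x t) + 2 * H t \<le> (CM * norm x) * winv t + 2 * H t" for x t
    using mult_left_mono[OF uxn CM(1), of x t] by (simp add: mult_ac)
  note PPx = PP[OF uxc K KX]
  have Kb: "\<bar>K x t\<bar> \<le> (norm x + 2) * winv t" for x t
  proof -
    have "\<bar>K x t\<bar> \<le> norm x * \<bar>CM * Q t\<bar> + 2 * \<bar>G t\<bar>"
      unfolding K_def by (rule order_trans[OF abs_triangle_ineq]) (simp add: abs_mult)
    also have "\<dots> \<le> norm x * (winv t / 4) + 2 * winv t"
      using CQ[of t] G(3)[of t] by (intro add_mono mult_left_mono) auto
    also have "\<dots> \<le> (norm x + 2) * winv t" using w0[of t] by (simp add: distrib_right)
    finally show ?thesis .
  qed
  define Phi0 where "Phi0 x t = (1 / winv t) *\<^sub>R (Ga (ux x) t - kop (S t) (ux x t))" for x t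
  have Gac: "continuous_on UNIV (Ga (ux x))" for x
    unfolding Ga_def
    by (intro continuous_on_umult continuous_intros PPx(2) ph_continuous) simp
  have Phi0: "Phi0 x \<in> bcontfun" for x
  proof (rule bcontfun_normI)
    show "continuous_on UNIV (Phi0 x)"
      unfolding Phi0_def by (intro continuous_intros w(1) Gac continuous_on_kop[OF S uxc]) (use w0 in auto)
    fix t
    have "norm (Ga (ux x) t - kop (S t) (ux x t)) \<le> norm (g0 + PP (ux x) t) + norm (kop (S t) (ux x t))"
      using norm_triangle_ineq4[of "Ga (ux x) t" "kop (S t) (ux x t)"] by (simp add: Ga_def umult)
    also have "\<dots> \<le> norm g0 + norm (PP (ux x) t) + norm (ux x t)"
      using norm_triangle_ineq[of g0 "PP (ux x) t"] S_half(2)[of t "ux x t"] by (smt (verit) norm_ge_zero field_sum_of_halves)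
    also have "\<dots> \<le> norm g0 * winv t + (norm x + 2) * winv t + winv t * norm x"
    proof (intro add_mono uxn order_trans[OF PPx(3) Kb])
      show "norm g0 \<le> norm g0 * winv t" using mult_left_mono[OF w(2) norm_ge_zero[of g0], of t] by simp
    qed
    also have "\<dots> = winv t * (norm g0 + 2 * norm x + 2)" by (simp add: algebra_simps)
    finally have "norm (Ga (ux x) t - kop (S t) (ux x t)) / winv t \<le> norm g0 + 2 * norm x + 2"
      using w0[of t] by (simp add: divide_le_eq mult.commute)
    then show "norm (Phi0 x t) \<le> norm g0 + 2 * norm x + 2" using w0[of t] by (simp add: Phi0_def)
  qed
  define Phi where "Phi x = Bcontfun (Phi0 x)" for x
  have Phi: "apply_bcontfun (Phi x) t = Phi0 x t" for x t
    unfolding Phi_def by (simp add: Bcontfun_inverse[OF Phi0])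
  have "\<forall>x y. dist (Phi x) (Phi y) \<le> 3 / 4 * dist x y"
  proof (intro allI dist_bound)
    fix x y :: "(real, idx ell2) bcontfun" and t
    define D where "D = dist x y"
    have dxy: "norm (ux x t - ux y t) \<le> winv t * D" for t
      using dist_bounded[of x t y] w0[of t]
      by (simp add: ux_def scaleR_diff_right[symmetric] D_def dist_norm)
    have KK: "primitive_of (\<lambda>t. (CM * D) * Q t) (\<lambda>t. (CM * D) * winv t)" "(CM * D) * Q 0 = 0"
      by (intro primitive_of_cmult Q) (simp add: Q)
    have "norm (PP (ux x) t - PP (ux y) t) \<le> \<bar>(CM * D) * Q t\<bar>"
    proof (rule PPd[OF uxc uxc KK])
      show "CM * norm (ux x t - ux y t) \<le> CM * D * winv t" for t
        using mult_left_mono[OF dxy CM(1), of t] by (simp add: mult_ac)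
    qed (rule PPx(1))+
    also have "\<dots> = D * \<bar>CM * Q t\<bar>" by (simp add: D_def abs_mult)
    also have "\<dots> \<le> D * (winv t / 4)" by (rule mult_left_mono[OF CQ]) (simp add: D_def)
    finally have P: "norm (PP (ux x) t - PP (ux y) t) \<le> D * winv t / 4" by simp
    have "Phi0 x t - Phi0 y t = (1 / winv t) *\<^sub>R ((Ga (ux x) t - Ga (ux y) t) - kop (S t) (ux x t - ux y t))"
      by (simp add: Phi0_def kop_diff[OF S0] algebra_simps scaleR_diff_right)
    also have "Ga (ux x) t - Ga (ux y) t = umult (\<lambda>i. cnj (ph t i)) (PP (ux x) t - PP (ux y) t)"
      by (simp add: Ga_def umult_diff)
    finally have "norm (Phi0 x t - Phi0 y t) =
      norm (umult (\<lambda>i. cnj (ph t i)) (PP (ux x) t - PP (ux y) t) - kop (S t) (ux x t - ux y t)) / winv t"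
      using w0[of t] by simp
    also have "\<dots> \<le> (D * winv t / 4 + winv t * D / 2) / winv t"
    proof (rule divide_right_mono)
      have "norm (kop (S t) (ux x t - ux y t)) \<le> winv t * D / 2"
        using S_half(2)[of t "ux x t - ux y t"] dxy[of t] by linarith
      moreover have "norm (umult (\<lambda>i. cnj (ph t i)) (PP (ux x) t - PP (ux y) t)) = norm (PP (ux x) t - PP (ux y) t)"
        by (simp add: umult)
      ultimately show "norm (umult (\<lambda>i. cnj (ph t i)) (PP (ux x) t - PP (ux y) t) - kop (S t) (ux x t - ux y t))
          \<le> D * winv t / 4 + winv t * D / 2"
        using norm_triangle_ineq4[of "umult (\<lambda>i. cnj (ph t i)) (PP (ux x) t - PP (ux y) t)" "kop (S t) (ux x t - ux y t)"] P
        by linarith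
    qed (use w0[of t] in simp)
    also have "\<dots> = 3 / 4 * D" using w0[of t] by (simp add: field_simps)
    finally show "dist (apply_bcontfun (Phi x) t) (apply_bcontfun (Phi y) t) \<le> 3 / 4 * dist x y"
      by (simp add: dist_norm Phi D_def)
  qed
  then have "\<exists>!x. Phi x = x" by (intro banach_fix_type[of "3/4"]) auto
  then obtain x where x: "Phi x = x" by blast
  have fp: "ell2_at (ux x t + kop (S t) (ux x t)) i = cnj (ph t i) * (ell2_at (u0 + kop (S 0) u0) i + q (ux x) i t)" for t i
  proof -
    have "ux x t = winv t *\<^sub>R Phi0 x t" using Phi[of x t] by (simp add: x ux_def)
    also have "\<dots> = Ga (ux x) t - kop (S t) (ux x t)" using w0[of t] by (simp add: Phi0_def)
    finally have "ux x t + kop (S t) (ux x t) = Ga (ux x) t" by (simp add: algebra_simps)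
    then show ?thesis by (simp only: Ga_def) (simp add: umult PPx(1) g0_def)
  qed
  have "solves_system A h (ux x)" "ux x 0 = u0"
    by (rule fixed_point_solves[OF uxc h H q(1)[OF uxc, unfolded gv_at] q(2)[OF uxc] fp])+
  then show ?thesis by blast
qed

end

section \<open>The kernel of the differential operator\<close>

text \<open>The kernel of \<open>\<beta> \<partial>\<^sub>x\<^sup>2 + \<gamma> \<partial>\<^sub>x\<close>, where \<open>b\<close> and \<open>c\<close> are the Fourier coefficients of \<open>\<beta>\<close> and
  \<open>\<gamma>\<close> in the coordinates that diagonalize \<open>J\<close>.\<close>

definition pk :: "(real \<Rightarrow> bool \<Rightarrow> bool \<Rightarrow> int \<Rightarrow> complex) \<Rightarrow> (real \<Rightarrow> bool \<Rightarrow> bool \<Rightarrow> int \<Rightarrow> complex) \<Rightarrow>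
    real \<Rightarrow> idx \<Rightarrow> idx \<Rightarrow> complex" where
  "pk b c t i j = - b t (snd i) (snd j) (fst i - fst j) * of_int (fst j) ^ 2
     + \<i> * c t (snd i) (snd j) (fst i - fst j) * of_int (fst j)"

definition rapid :: "(real \<Rightarrow> bool \<Rightarrow> bool \<Rightarrow> int \<Rightarrow> complex) \<Rightarrow> bool" where
  "rapid b \<longleftrightarrow> (\<forall>p. \<exists>C. \<forall>t s s' n. cmod (b t s s' n) \<le> C / jb n ^ p)"

lemma rapidE:
  assumes "rapid b"
  obtains C where "C \<ge> 0" "\<And>t s s' n. cmod (b t s s' n) \<le> C / jb n ^ p"
proof -
  obtain C where C: "\<And>t s s' n. cmod (b t s s' n) \<le> C / jb n ^ p"
    using assms unfolding rapid_def by blast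
  have "0 \<le> C / jb 0 ^ p" using order_trans[OF norm_ge_zero C[of undefined undefined undefined 0]] .
  then show ?thesis using C that by simp
qed

lemma abs_le_jb: "\<bar>real_of_int k\<bar> \<le> jb k" by (simp add: jb_def)

lemma kord_pk:
  assumes "rapid b" "rapid c"
  shows "kord 2 (pk b c)"
  unfolding kord_def
proof
  fix p
  obtain C where C: "C \<ge> 0" "\<And>t s s' n. cmod (b t s s' n) \<le> C / jb n ^ p" using rapidE[OF assms(1)] by blast
  obtain D where D: "D \<ge> 0" "\<And>t s s' n. cmod (c t s s' n) \<le> D / jb n ^ p" using rapidE[OF assms(2)] by blast
  have "cmod (pk b c t i j) \<le> (C + D) * jb (fst j) powi 2 / jb (fst i - fst j) ^ p" for t i j
  proof -
    have sq: "\<bar>real_of_int (fst j)\<bar>\<^sup>2 \<le> (jb (fst j))\<^sup>2" by (intro power_mono abs_le_jb) simp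
    have ab: "\<bar>real_of_int (fst j)\<bar> \<le> (jb (fst j))\<^sup>2"
      using order_trans[OF abs_le_jb, of "fst j" "(jb (fst j))\<^sup>2"] jb_ge_1[of "fst j"] by (simp add: power2_eq_square)
    have "cmod (pk b c t i j) \<le> cmod (b t (snd i) (snd j) (fst i - fst j)) * \<bar>real_of_int (fst j)\<bar>\<^sup>2
        + cmod (c t (snd i) (snd j) (fst i - fst j)) * \<bar>real_of_int (fst j)\<bar>"
      unfolding pk_def by (rule order_trans[OF norm_triangle_ineq]) (simp add: norm_mult norm_power)
    also have "\<dots> \<le> (C / jb (fst i - fst j) ^ p) * (jb (fst j))\<^sup>2 + (D / jb (fst i - fst j) ^ p) * (jb (fst j))\<^sup>2"
      by (intro add_mono mult_mono C D sq ab) (use C(1) D(1) in auto)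
    also have "\<dots> = (C + D) * jb (fst j) powi 2 / jb (fst i - fst j) ^ p"
      by (simp add: distrib_right add_divide_distrib)
    finally show ?thesis .
  qed
  then show "\<exists>C. \<forall>t i j. cmod (pk b c t i j) \<le> C * jb (fst j) powi 2 / jb (fst i - fst j) ^ p" by blast
qed

lemma kC1_pk:
  assumes "rapid b" "rapid c" "rapid b'" "rapid c'"
    and b: "\<And>t s s' n. ((\<lambda>t. b t s s' n) has_vector_derivative b' t s s' n) (at t)"
    and c: "\<And>t s s' n. ((\<lambda>t. c t s s' n) has_vector_derivative c' t s s' n) (at t)"
    and bc: "\<And>s s' n. continuous_on UNIV (\<lambda>t. b' t s s' n)" "\<And>s s' n. continuous_on UNIV (\<lambda>t. c' t s s' n)"
  shows "kC1 2 (pk b c) (pk b' c')"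
proof (rule kC1I)
  show "((\<lambda>t. pk b c t i j) has_vector_derivative pk b' c' t i j) (at t)" for t i j
    unfolding pk_def
    by (intro has_vector_derivative_add has_vector_derivative_mult_left has_vector_derivative_mult_right
        has_vector_derivative_minus b c)
  show "continuous_on UNIV (\<lambda>t. pk b' c' t i j)" for i j
    unfolding pk_def by (intro continuous_intros bc)
qed (intro kord_pk assms)+

text \<open>The diagonal entries of the composition are sums over the frequency shift \<open>n\<close> whose leading
  part is odd in \<open>n\<close>; the difference is bounded uniformly in the frequency \<open>k\<close>.\<close>

lemma cancellation_term:
  fixes k n :: int and s d a :: real and b1 b2 c1 c2 :: complex
  assumes s: "\<bar>s\<bar> = 1" and d: "d = s * (real_of_int k ^ 4 - real_of_int (k - n) ^ 4)" "d \<noteq> 0"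
    and gap: "jb k ^ 3 \<le> 8 * \<bar>d\<bar>"
    and bd: "cmod b1 \<le> a" "cmod b2 \<le> a" "cmod c1 \<le> a" "cmod c2 \<le> a"
  shows "cmod ((- b1 * of_int (k - n) ^ 2 + \<i> * c1 * of_int (k - n)) * (- b2 * of_int k ^ 2 + \<i> * c2 * of_int k) / (\<i> * of_real d)
      - b1 * b2 * of_int k / (4 * \<i> * of_real s * of_int n)) \<le> 32 * a\<^sup>2 * jb n ^ 3"
proof -
  define u where "u = complex_of_int (k - n)"
  define K where "K = complex_of_int k"
  define m where "m = complex_of_int n"
  have n0: "n \<noteq> 0" using d by auto
  have s0: "s \<noteq> 0" using s by auto
  have m0: "m \<noteq> 0" using n0 by (simp add: m_def)
  have uK: "u = K - m" by (simp add: u_def K_def m_def)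
  have dc: "complex_of_real d = of_real s * (K ^ 4 - u ^ 4)" by (simp add: d(1) K_def u_def)
  have d0: "complex_of_real d \<noteq> 0" using d(2) by simp
  have a0: "a \<ge> 0" using bd(1) norm_ge_zero order_trans by blast
  \<comment> \<open>The numerator that is left once the odd leading term has been brought to the
    common denominator. Each of its terms has degree at most three in the frequency
    \<open>k\<close>, which is what \<open>gap\<close> compensates.\<close>
  define E where "E = - (\<i> * b1 * c2 * (u\<^sup>2 * K)) - \<i> * c1 * b2 * (u * K\<^sup>2) - c1 * c2 * (u * K) + b1 * b2 * (K * m * (m\<^sup>2 - 2 * K\<^sup>2) / 4)"
  have key: "b1 * b2 * K / (4 * \<i> * of_real s * m) = b1 * b2 * (K * (K ^ 4 - u ^ 4) / (4 * m)) / (\<i> * of_real d)"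
    unfolding dc using s0 m0 d0[unfolded dc] by (simp add: field_simps)
  have poly: "K * (K ^ 4 - u ^ 4) = m * (4 * (u\<^sup>2 * K\<^sup>2) - K * m * (m\<^sup>2 - 2 * K\<^sup>2))"
    unfolding uK by algebra
  have key2: "K * (K ^ 4 - u ^ 4) / (4 * m) = u\<^sup>2 * K\<^sup>2 - K * m * (m\<^sup>2 - 2 * K\<^sup>2) / 4"
    unfolding poly using m0 by (simp add: field_simps)
  have "(- b1 * u ^ 2 + \<i> * c1 * u) * (- b2 * K ^ 2 + \<i> * c2 * K) / (\<i> * of_real d) - b1 * b2 * K / (4 * \<i> * of_real s * m)
      = E / (\<i> * of_real d)"
    unfolding key key2 diff_divide_distrib[symmetric] E_def
    by (intro arg_cong2[of _ _ _ _ "(/)"] refl) (simp add: algebra_simps power2_eq_square)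
  moreover have "cmod (E / (\<i> * of_real d)) \<le> 32 * a\<^sup>2 * jb n ^ 3"
  proof -
    define X Y where "X = jb k" and "Y = jb n"
    have XY: "1 \<le> X" "1 \<le> Y" by (simp_all add: X_def Y_def jb_ge_1)
    have nK: "cmod K \<le> X" unfolding K_def X_def by (simp add: jb_def)
    have nm: "cmod m \<le> Y" unfolding m_def Y_def by (simp add: jb_def)
    have nu: "cmod u \<le> X * Y"
      using order_trans[OF abs_le_jb jb_le_mult[of "k - n" "- n"]] unfolding u_def X_def Y_def by (simp del: of_int_diff)
    have e1: "cmod (u\<^sup>2 * K) \<le> X ^ 3 * Y ^ 3"
    proof -
      have "cmod (u\<^sup>2 * K) \<le> (X * Y)\<^sup>2 * X" unfolding norm_mult norm_power by (intro mult_mono power_mono nu nK) (use XY in auto)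
      also have "\<dots> = X ^ 3 * Y ^ 2" by (simp add: power2_eq_square power3_eq_cube)
      also have "\<dots> \<le> X ^ 3 * Y ^ 3" by (intro mult_left_mono power_increasing) (use XY in auto)
      finally show ?thesis .
    qed
    have e2: "cmod (u * K\<^sup>2) \<le> X ^ 3 * Y ^ 3"
    proof -
      have "cmod (u * K\<^sup>2) \<le> (X * Y) * X\<^sup>2" unfolding norm_mult norm_power by (intro mult_mono power_mono nu nK) (use XY in auto)
      also have "\<dots> = X ^ 3 * Y ^ 1" by (simp add: power2_eq_square power3_eq_cube)
      also have "\<dots> \<le> X ^ 3 * Y ^ 3" by (intro mult_left_mono power_increasing) (use XY in auto)
      finally show ?thesis .
    qed
    have e3: "cmod (u * K) \<le> X ^ 3 * Y ^ 3"
    proof -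
      have "cmod (u * K) \<le> (X * Y) * X" unfolding norm_mult by (intro mult_mono nu nK) (use XY in auto)
      also have "\<dots> = X ^ 2 * Y ^ 1" by (simp add: power2_eq_square)
      also have "\<dots> \<le> X ^ 3 * Y ^ 3" by (intro mult_mono power_increasing) (use XY in auto)
      finally show ?thesis .
    qed
    have e4: "cmod (K * m * (m\<^sup>2 - 2 * K\<^sup>2) / 4) \<le> X ^ 3 * Y ^ 3"
    proof -
      have "cmod (m\<^sup>2 - 2 * K\<^sup>2) \<le> Y\<^sup>2 + 2 * X\<^sup>2"
        by (rule order_trans[OF norm_triangle_ineq4]) (auto simp: norm_mult norm_power intro!: add_mono power_mono nm nK)
      also have "\<dots> \<le> X\<^sup>2 * Y\<^sup>2 + 2 * (X\<^sup>2 * Y\<^sup>2)"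
        using XY by (intro add_mono mult_left_mono) (auto simp: power_mono one_le_power)
      finally have "cmod (m\<^sup>2 - 2 * K\<^sup>2) \<le> 3 * (X\<^sup>2 * Y\<^sup>2)" by simp
      then have "cmod (K * m * (m\<^sup>2 - 2 * K\<^sup>2) / 4) \<le> X * Y * (3 * (X\<^sup>2 * Y\<^sup>2)) / 4"
        unfolding norm_divide norm_mult norm_numeral using XY by (intro divide_right_mono mult_mono nK nm order_refl) auto
      also have "\<dots> \<le> X ^ 3 * Y ^ 3" using XY by (simp add: power2_eq_square power3_eq_cube)
      finally show ?thesis .
    qed
    define Z where "Z = X ^ 3 * Y ^ 3"
    have Z0: "Z \<ge> 0" using XY by (simp add: Z_def)
    have aa: "cmod (x * y * z) \<le> a * a * Z" if "cmod x \<le> a" "cmod y \<le> a" "cmod z \<le> Z" for x y z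
      unfolding norm_mult using that a0 Z0 by (intro mult_mono) auto
    have "cmod E \<le> cmod (\<i> * b1 * c2 * (u\<^sup>2 * K)) + cmod (\<i> * c1 * b2 * (u * K\<^sup>2)) + cmod (c1 * c2 * (u * K))
        + cmod (b1 * b2 * (K * m * (m\<^sup>2 - 2 * K\<^sup>2) / 4))"
      unfolding E_def
      by (intro norm_triangle_mono norm_triangle_le_diff add_mono) (simp_all add: norm_minus_cancel)
    also have "\<dots> \<le> a * a * Z + a * a * Z + a * a * Z + a * a * Z"
      using aa[OF bd(1,4) e1[folded Z_def]] aa[OF bd(3,2) e2[folded Z_def]] aa[OF bd(3,4) e3[folded Z_def]]
        aa[OF bd(1,2) e4[folded Z_def]]
      by (intro add_mono) (simp_all add: norm_mult)
    finally have EE: "cmod E \<le> 4 * a\<^sup>2 * Z" by (simp add: power2_eq_square mult_ac)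
    have dpos: "\<bar>d\<bar> > 0" using d(2) by simp
    have le: "4 * a\<^sup>2 * Z \<le> 32 * a\<^sup>2 * Y ^ 3 * \<bar>d\<bar>"
      using mult_left_mono[OF gap, of "4 * a\<^sup>2 * Y ^ 3"] XY by (simp add: Z_def X_def mult_ac)
    have "cmod E / \<bar>d\<bar> \<le> 32 * a\<^sup>2 * Y ^ 3"
      unfolding pos_divide_le_eq[OF dpos] by (rule order_trans[OF EE le])
    then show ?thesis by (simp add: norm_divide norm_mult Y_def)
  qed
  ultimately show ?thesis unfolding u_def K_def m_def by simp
qed

lemma om_gap_opposite:
  assumes "om i \<noteq> om j" "snd i \<noteq> snd j"
  shows "(jb (fst i))\<^sup>2 * (jb (fst j))\<^sup>2 \<le> 16 * \<bar>om i - om j\<bar>"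
proof -
  define a b where "a = \<bar>real_of_int (fst i)\<bar>" and "b = \<bar>real_of_int (fst j)\<bar>"
  have ab: "a \<ge> 0" "b \<ge> 0" by (simp_all add: a_def b_def)
  define m where "m = max a b"
  have d: "\<bar>om i - om j\<bar> = a ^ 4 + b ^ 4"
  proof -
    have "om i = (if snd i then a ^ 4 else - (a ^ 4))" "om j = (if snd j then b ^ 4 else - (b ^ 4))"
      by (simp_all add: om_def a_def b_def)
    note o = this
    have p: "a ^ 4 \<ge> 0" "b ^ 4 \<ge> 0" using ab by simp_all
    show ?thesis
    proof (cases "snd i")
      case True
      then have "om i - om j = a ^ 4 + b ^ 4" using o assms(2) by simp
      then show ?thesis using p by linarith
    next
      case False
      then have "om i - om j = - (a ^ 4 + b ^ 4)" using o assms(2) by simp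
      then show ?thesis using p by linarith
    qed
  qed
  have "m \<noteq> 0" using assms(1) d ab by (auto simp: m_def max_def split: if_splits)
  then have m1: "m \<ge> 1"
    using one_le_abs_of_int[of "fst i"] one_le_abs_of_int[of "fst j"] by (auto simp: m_def max_def a_def b_def split: if_splits)
  have "(jb (fst i))\<^sup>2 * (jb (fst j))\<^sup>2 \<le> (2 * m)\<^sup>2 * (2 * m)\<^sup>2"
    using m1 by (intro mult_mono power_mono) (auto simp: jb_def m_def a_def b_def max_def split: if_splits)
  also have "\<dots> = 16 * m ^ 4" by (simp add: power_mult_distrib flip: power_add)
  also have "\<dots> \<le> 16 * (a ^ 4 + b ^ 4)" using ab by (simp add: m_def max_def)
  finally show ?thesis unfolding d .
qed

text \<open>By size alone an entry of the sum has order 2 + 2 - 3 = 1 in the frequency. Subtracting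
  \<open>G\<close>, whose total is zero by the reflection of \<open>fst q\<close> about
  \<open>k\<close>, leaves terms bounded by a summable function of the shift, uniformly in
  \<open>k\<close>.\<close>

lemma diagonal_cancellation:
  assumes "rapid b" "rapid c"
  shows "\<exists>C. \<forall>t i. cmod (kcomp (kdiv (pk b c t)) (pk b c t) i i) \<le> C"
proof -
  \<comment> \<open>Exponent 4 suffices: squared it gives decay of order 8, which absorbs the cube
    of the bracket of \<open>n\<close> from \<open>cancellation_term\<close> and leaves more than
    the two powers needed for summation.\<close>
  obtain C1 where C1: "C1 \<ge> 0" "\<And>t s s' n. cmod (b t s s' n) \<le> C1 / jb n ^ 4" using rapidE[OF assms(1)] by blast
  obtain C2 where C2: "C2 \<ge> 0" "\<And>t s s' n. cmod (c t s s' n) \<le> C2 / jb n ^ 4" using rapidE[OF assms(2)] by blast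
  define C where "C = C1 + C2"
  have C0: "C \<ge> 0" using C1(1) C2(1) by (simp add: C_def)
  define a where "a n = C / jb n ^ 4" for n
  have a0: "a n \<ge> 0" for n using C0 by (simp add: a_def)
  have am: "a (- n) = a n" for n by (simp add: a_def)
  have ba: "cmod (b t s s' n) \<le> a n" "cmod (c t s s' n) \<le> a n" for t s s' n
  proof -
    have "C1 / jb n ^ 4 \<le> a n" "C2 / jb n ^ 4 \<le> a n"
      unfolding a_def C_def using C1(1) C2(1) by (intro divide_right_mono; simp)+
    then show "cmod (b t s s' n) \<le> a n" "cmod (c t s s' n) \<le> a n"
      using C1(2) C2(2) order_trans by blast+
  qed
  have a2: "(a n)\<^sup>2 * jb n ^ 3 \<le> C\<^sup>2 / (jb n)\<^sup>2" "(a n)\<^sup>2 \<le> C\<^sup>2 / (jb n)\<^sup>2" for n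
  proof -
    have "(a n)\<^sup>2 * jb n ^ 3 = C\<^sup>2 / jb n ^ 5"
    proof -
      have e8: "jb n ^ 8 = jb n ^ 3 * jb n ^ 5" by (simp flip: power_add)
      have g: "c * x / (x * y) = c / y" if "x \<noteq> 0" for c x y :: real using that by simp
      have "c * jb n ^ 3 / jb n ^ 8 = c / jb n ^ 5" for c unfolding e8 by (rule g) simp
      then show ?thesis by (simp add: a_def power_divide)
    qed
    also have "\<dots> \<le> C\<^sup>2 / (jb n)\<^sup>2"
      by (intro divide_left_mono power_increasing mult_pos_pos zero_less_power) (auto simp: jb_ge_1)
    finally show 1: "(a n)\<^sup>2 * jb n ^ 3 \<le> C\<^sup>2 / (jb n)\<^sup>2" .
    have "(a n)\<^sup>2 * 1 \<le> (a n)\<^sup>2 * jb n ^ 3" by (intro mult_left_mono jb_power_ge_1) auto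
    then show "(a n)\<^sup>2 \<le> C\<^sup>2 / (jb n)\<^sup>2" using 1 by simp
  qed
  have "cmod (kcomp (kdiv (pk b c t)) (pk b c t) i i) \<le> 64 * C\<^sup>2 * jsum" for t i
  proof -
    define k s where "k = fst i" and "s = (if snd i then 1 else -1 :: real)"
    define F where "F q = kdiv (pk b c t) i q * pk b c t q i" for q
    \<comment> \<open>The leading part for large \<open>k\<close>, where k^4 - (k - n)^4 behaves
      like 4 k^3 n. The product of the coefficients at \<open>n\<close> and \<open>- n\<close> is
      even in \<open>n\<close>, the denominator is odd. Division by zero gives the value 0 at
      \<open>n = 0\<close>, as required for \<open>q = i\<close>, where \<open>kdiv\<close>
      vanishes.\<close>
    define g where "g n = b t (snd i) (snd i) n * b t (snd i) (snd i) (- n) * of_int k / (4 * \<i> * of_real s * of_int n)" for n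
    define G where "G q = (if snd q = snd i then g (k - fst q) else 0)" for q :: idx
    have s: "\<bar>s\<bar> = 1" by (simp add: s_def)
    have odd: "g (- n) = - g n" for n by (simp add: g_def mult_ac)
    have gb: "cmod (g n) \<le> \<bar>real_of_int k\<bar> * (C\<^sup>2 / (jb n)\<^sup>2)" for n
    proof (cases "n = 0")
      case False
      then have "1 \<le> \<bar>real_of_int n\<bar>" by (rule one_le_abs_of_int)
      have "cmod (g n) = cmod (b t (snd i) (snd i) n) * cmod (b t (snd i) (snd i) (- n)) * \<bar>real_of_int k\<bar> / (4 * \<bar>real_of_int n\<bar>)"
        using s by (simp add: g_def norm_mult norm_divide)
      also have "\<dots> \<le> (a n * a n * \<bar>real_of_int k\<bar>) / 1"
        using ba[of t "snd i" "snd i" n] ba[of t "snd i" "snd i" "- n"] a0[of n] \<open>1 \<le> \<bar>real_of_int n\<bar>\<close>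
        by (intro frac_le mult_mono) (auto simp: am)
      also have "\<dots> \<le> \<bar>real_of_int k\<bar> * (C\<^sup>2 / (jb n)\<^sup>2)"
        using mult_left_mono[OF a2(2)[of n], of "\<bar>real_of_int k\<bar>"] by (simp add: power2_eq_square mult_ac)
      finally show ?thesis .
    qed (use C0 in \<open>simp add: g_def\<close>)
    \<comment> \<open>This majorant grows with \<open>k\<close>. It serves summability alone, since
      the value of the sum is zero.\<close>
    have Gs: "G summable_on UNIV"
    proof (rule summable_on_dominated[OF has_sum_imp_summable[OF jsum_shift_cmult[of "\<bar>real_of_int k\<bar> * C\<^sup>2" k]]])
      show "cmod (G q) \<le> \<bar>real_of_int k\<bar> * C\<^sup>2 / (jb (k - fst q))\<^sup>2" for q
        using gb[of "k - fst q"] by (simp add: G_def)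
    qed
    have G0: "infsum G UNIV = 0"
    proof -
      have bij: "bij_betw (\<lambda>q::idx. (2 * k - fst q, snd q)) UNIV UNIV"
        by (rule bij_betwI[where g = "\<lambda>q. (2 * k - fst q, snd q)"]) auto
      have "infsum G UNIV = (\<Sum>\<^sub>\<infinity>q. G (2 * k - fst q, snd q))"
        using infsum_reindex_bij_betw[OF bij, of G] by simp
      also have "\<dots> = (\<Sum>\<^sub>\<infinity>q. - G q)"
      proof (rule infsum_cong)
        fix q :: idx
        have "k - (2 * k - fst q) = - (k - fst q)" by simp
        then show "G (2 * k - fst q, snd q) = - G q" using odd[of "k - fst q"] by (simp add: G_def)
      qed
      also have "\<dots> = - infsum G UNIV" by (rule infsum_uminus)
      finally show ?thesis by simp
    qed
    have FG: "cmod (F q - G q) \<le> 64 * C\<^sup>2 / (jb (k - fst q))\<^sup>2" for q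
    proof -
      define n where "n = k - fst q"
      have kn: "fst q = k - n" by (simp add: n_def)
      consider (same) "snd q = snd i" "om i \<noteq> om q" | (res) "snd q = snd i" "om i = om q"
        | (opp) "snd q \<noteq> snd i" "om i \<noteq> om q" | (opp0) "snd q \<noteq> snd i" "om i = om q" by blast
      then show ?thesis
      proof cases
        case same
        define d where "d = om i - om q"
        have d: "d = s * (real_of_int k ^ 4 - real_of_int (k - n) ^ 4)" "d \<noteq> 0"
          using same by (auto simp: d_def om_def s_def k_def kn[unfolded k_def] algebra_simps)
        have gap: "jb k ^ 3 \<le> 8 * \<bar>d\<bar>"
          using om_gap[of q i] same(2) by (simp add: d_def k_def abs_minus_commute)
        have "F q - G q = (- b t (snd i) (snd i) n * of_int (k - n) ^ 2 + \<i> * c t (snd i) (snd i) n * of_int (k - n))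
            * (- b t (snd i) (snd i) (- n) * of_int k ^ 2 + \<i> * c t (snd i) (snd i) (- n) * of_int k) / (\<i> * of_real d)
            - b t (snd i) (snd i) n * b t (snd i) (snd i) (- n) * of_int k / (4 * \<i> * of_real s * of_int n)"
          using same unfolding F_def G_def g_def kdiv_def pk_def d_def[symmetric] by (simp add: kn k_def[symmetric])
        also have "cmod \<dots> \<le> 32 * (a n)\<^sup>2 * jb n ^ 3"
          by (rule cancellation_term[OF s d gap])
            (use ba[of t "snd i" "snd i" n] ba[of t "snd i" "snd i" "- n"] in \<open>simp_all add: am\<close>)
        also have "\<dots> \<le> 32 * (C\<^sup>2 / (jb n)\<^sup>2)" using a2(1)[of n] by simp
        also have "\<dots> \<le> 64 * C\<^sup>2 / (jb n)\<^sup>2" by (simp add: divide_right_mono)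
        finally show ?thesis by (simp add: n_def)
      next
        case res
        have F0: "F q = 0" using res by (simp add: F_def kdiv_def)
        show ?thesis
        proof (cases "q = i \<or> k = 0")
          case True
          then have "G q = 0" by (auto simp: G_def g_def k_def)
          then show ?thesis using F0 by simp
        next
          case False
          \<comment> \<open>At the mirrored frequency \<open>kdiv\<close> vanishes but
            \<open>G\<close> does not. There the shift is \<open>2 * k\<close>, which cancels the
            factor \<open>k\<close> in \<open>g\<close>, so the entry is harmless.\<close>
          then have "fst q = - k" using om_eq_imp[OF res(2)] by (auto simp: k_def)
          then have n2: "n = 2 * k" by (simp add: n_def)
          have "cmod (G q) = cmod (b t (snd i) (snd i) n) * cmod (b t (snd i) (snd i) (- n)) / 8"
            using res False s n2 by (simp add: G_def g_def n_def[symmetric] norm_mult norm_divide)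
          also have "\<dots> \<le> (a n * a n) / 1"
            using ba[of t "snd i" "snd i" n] ba[of t "snd i" "snd i" "- n"] a0[of n]
            by (intro frac_le mult_mono) (auto simp: am)
          also have "\<dots> \<le> C\<^sup>2 / (jb n)\<^sup>2" using a2(2)[of n] by (simp add: power2_eq_square)
          also have "\<dots> \<le> 64 * C\<^sup>2 / (jb n)\<^sup>2" by (simp add: divide_right_mono)
          finally show ?thesis using F0 by (simp add: n_def)
        qed
      next
        case opp
        have G0: "G q = 0" using opp by (simp add: G_def)
        have pkb: "cmod (pk b c t i' j') \<le> 2 * a (fst i' - fst j') * (jb (fst j'))\<^sup>2" for i' j'
        proof -
          have sq: "\<bar>real_of_int (fst j')\<bar>\<^sup>2 \<le> (jb (fst j'))\<^sup>2" by (intro power_mono abs_le_jb) simp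
          have ab: "\<bar>real_of_int (fst j')\<bar> \<le> (jb (fst j'))\<^sup>2"
            using order_trans[OF abs_le_jb, of "fst j'" "(jb (fst j'))\<^sup>2"] jb_ge_1[of "fst j'"] by (simp add: power2_eq_square)
          have "cmod (pk b c t i' j') \<le> cmod (b t (snd i') (snd j') (fst i' - fst j')) * \<bar>real_of_int (fst j')\<bar>\<^sup>2
              + cmod (c t (snd i') (snd j') (fst i' - fst j')) * \<bar>real_of_int (fst j')\<bar>"
            unfolding pk_def by (rule order_trans[OF norm_triangle_ineq]) (simp add: norm_mult norm_power)
          also have "\<dots> \<le> a (fst i' - fst j') * (jb (fst j'))\<^sup>2 + a (fst i' - fst j') * (jb (fst j'))\<^sup>2"
            by (intro add_mono mult_mono ba sq ab a0) auto
          finally show ?thesis by simp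
        qed
        have "cmod (F q) = cmod (pk b c t i q) * cmod (pk b c t q i) / \<bar>om i - om q\<bar>"
          using opp by (simp add: F_def kdiv_def norm_mult norm_divide del: of_real_diff)
        also have "\<dots> \<le> (2 * a n * (jb (fst q))\<^sup>2) * (2 * a n * (jb k)\<^sup>2) / \<bar>om i - om q\<bar>"
        proof (intro divide_right_mono mult_mono)
          show "cmod (pk b c t i q) \<le> 2 * a n * (jb (fst q))\<^sup>2" using pkb[of i q] by (simp add: n_def k_def)
          have "a (fst q - k) = a n" using am[of n] by (simp add: n_def)
          then show "cmod (pk b c t q i) \<le> 2 * a n * (jb k)\<^sup>2" using pkb[of q i] by (simp add: k_def)
        qed (use a0[of n] in auto)
        also have "\<dots> = 4 * (a n)\<^sup>2 * ((jb k)\<^sup>2 * (jb (fst q))\<^sup>2) / \<bar>om i - om q\<bar>" by (simp add: power2_eq_square mult_ac)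
        also have "\<dots> \<le> 4 * (a n)\<^sup>2 * (16 * \<bar>om i - om q\<bar>) / \<bar>om i - om q\<bar>"
          using om_gap_opposite[of i q] opp by (intro divide_right_mono mult_left_mono) (auto simp: k_def)
        also have "\<dots> = 64 * (a n)\<^sup>2" using opp by simp
        also have "\<dots> \<le> 64 * C\<^sup>2 / (jb n)\<^sup>2" using a2(2)[of n] by simp
        finally show ?thesis using G0 by (simp add: n_def)
      next
        case opp0
        then show ?thesis using C0 by (simp add: F_def G_def kdiv_def)
      qed
    qed
    note J = jsum_shift_cmult[of "64 * C\<^sup>2" k]
    have "(\<lambda>q. F q - G q) summable_on UNIV" by (rule summable_on_dominated[OF has_sum_imp_summable[OF J] FG])
    from infsum_add[OF this Gs] have "infsum F UNIV = (\<Sum>\<^sub>\<infinity>q. F q - G q)" by (simp add: G0)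
    moreover have "cmod (\<Sum>\<^sub>\<infinity>q. F q - G q) \<le> 64 * C\<^sup>2 * jsum"
      using infsum_dominated[OF has_sum_imp_summable[OF J] FG] infsumI[OF J] by simp
    ultimately show ?thesis by (simp add: kcomp_def F_def[symmetric])
  qed
  then show ?thesis by blast
qed

theorem pk_normal_form:
  assumes "rapid b" "rapid c" "rapid b'" "rapid c'"
    and "\<And>t s s' n. ((\<lambda>t. b t s s' n) has_vector_derivative b' t s s' n) (at t)"
    and "\<And>t s s' n. ((\<lambda>t. c t s s' n) has_vector_derivative c' t s s' n) (at t)"
    and "\<And>s s' n. continuous_on UNIV (\<lambda>t. b' t s s' n)" "\<And>s s' n. continuous_on UNIV (\<lambda>t. c' t s s' n)"
    and im: "\<And>t s. Re (b t s s 0) = 0" "\<And>t s. Im (c t s s 0) = 0"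
  obtains S S' M lam where "normal_form_system (\<lambda>t. kA (pk b c t)) S S' M lam"
proof -
  obtain C where C: "\<And>t i. cmod (kcomp (kdiv (pk b c t)) (pk b c t) i i) \<le> C"
    using diagonal_cancellation[OF assms(1,2)] by blast
  have sq: "(complex_of_int l)\<^sup>2 = of_real ((real_of_int l)\<^sup>2)" for l by simp
  have "Re (pk b c t i i) = 0" for t i
    unfolding pk_def sq by (simp add: im del: of_real_power)
  from normal_form_exists[OF kC1_pk[OF assms(1-8)] this C] show ?thesis
    using that unfolding normal_form_system_def by blast
qed

section \<open>Fourier series on the torus\<close>

definition L2c :: "(real \<Rightarrow> complex) \<Rightarrow> bool" where
  "L2c f \<longleftrightarrow> f \<in> borel_measurable torus_measure \<and> integrable torus_measure (\<lambda>x. (cmod (f x))\<^sup>2)"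

definition nc :: "(real \<Rightarrow> complex) \<Rightarrow> real" where
  "nc f = sqrt (LINT x|torus_measure. (cmod (f x))\<^sup>2)"

definition ew :: "int \<Rightarrow> real \<Rightarrow> complex" where
  "ew k x = exp (\<i> * of_int k * of_real x)"

text \<open>The coefficients carry the factor 1 / (2 pi), the norm \<open>nc\<close> does not; hence
  the factors \<open>2 * pi\<close> in the Bessel and Parseval relations.\<close>

definition fc :: "(real \<Rightarrow> complex) \<Rightarrow> int \<Rightarrow> complex" where
  "fc f k = (LINT x|torus_measure. f x * ew (- k) x) / of_real (2 * pi)"

interpretation torus: finite_measure torus_measure
  by (rule finite_measure_lebesgue_on) simp

lemma measure_torus [simp]: "measure torus_measure {0..2 * pi} = 2 * pi"
  by (simp add: measure_restrict_space)

lemma integrable_torus_iff: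
  fixes f :: "real \<Rightarrow> 'b::euclidean_space"
  shows "integrable torus_measure f \<longleftrightarrow> f absolutely_integrable_on {0..2 * pi}"
  by (subst integrable_restrict_space) (auto simp: set_integrable_def)

lemma integrable_torus_continuous:
  fixes f :: "real \<Rightarrow> 'b::euclidean_space"
  assumes "continuous_on {0..2 * pi} f"
  shows "integrable torus_measure f"
  unfolding integrable_torus_iff by (rule absolutely_integrable_continuous_real[OF assms])

lemma integral_torus:
  fixes f :: "real \<Rightarrow> 'b::euclidean_space"
  assumes "integrable torus_measure f"
  shows "(LINT x|torus_measure. f x) = integral {0..2 * pi} f"
  by (rule lebesgue_integral_eq_integral[OF assms]) simp

lemma ew_norm [simp]: "cmod (ew k x) = 1" by (simp add: ew_def)
lemma ew_0 [simp]: "ew 0 x = 1" by (simp add: ew_def)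
lemma ew_add: "ew k x * ew l x = ew (k + l) x" by (simp add: ew_def exp_add[symmetric] algebra_simps)
lemma ew_cnj: "cnj (ew k x) = ew (- k) x" by (simp add: ew_def exp_cnj)
lemma ew_continuous: "continuous_on A (ew k)" unfolding ew_def by (intro continuous_intros)
lemma ew_measurable [measurable]: "ew k \<in> borel_measurable torus_measure"
  by (rule continuous_imp_measurable_on_sets_lebesgue[OF ew_continuous]) simp
lemma ew_cis: "ew k x = cis (of_int k * x)" by (simp add: ew_def cis_conv_exp mult.assoc)

lemma ew_periodic: "ew k (x + 2 * pi) = ew k x"
  using exp_integer_2pi[of "of_int k"] by (simp add: ew_def distrib_left exp_add mult_ac)

lemma ew_deriv: "(ew k has_vector_derivative (\<i> * of_int k * ew k x)) (at x within S)"
proof -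
  have "((\<lambda>z. exp (\<i> * of_int k * z)) has_field_derivative (\<i> * of_int k * exp (\<i> * of_int k * of_real x))) (at (of_real x))"
    by (auto intro!: derivative_eq_intros)
  from has_vector_derivative_real_field[OF this] show ?thesis by (simp add: ew_def[abs_def])
qed

lemma ew_integral: "(LINT x|torus_measure. ew k x) = (if k = 0 then of_real (2 * pi) else 0)"
proof (cases "k = 0")
  case True
  then show ?thesis by (simp add: scaleR_conv_of_real)
next
  case False
  have "((\<lambda>x. ew k x / (\<i> * of_int k)) has_vector_derivative ew k x) (at x within {0..2*pi})" for x
    using has_vector_derivative_divide[OF ew_deriv[of k x "{0..2*pi}"], of "\<i> * of_int k"] False by simp
  then have "((\<lambda>x. ew k x) has_integral (ew k (2 * pi) / (\<i> * of_int k) - ew k 0 / (\<i> * of_int k))) {0..2*pi}"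
    by (intro fundamental_theorem_of_calculus) auto
  moreover have "ew k (2 * pi) = ew k 0" using ew_periodic[of k 0] by simp
  ultimately have "integral {0..2*pi} (ew k) = 0" by (simp add: integral_unique)
  then show ?thesis using False by (simp add: integral_torus integrable_torus_continuous ew_continuous)
qed

lemma L2cD: "L2c f \<Longrightarrow> f \<in> borel_measurable torus_measure" "L2c f \<Longrightarrow> integrable torus_measure (\<lambda>x. (cmod (f x))\<^sup>2)"
  by (simp_all add: L2c_def)

lemma L2c_integrable_mult:
  assumes "L2c f" "L2c g"
  shows "integrable torus_measure (\<lambda>x. f x * g x)"
proof (rule Bochner_Integration.integrable_bound)
  show "integrable torus_measure (\<lambda>x. (cmod (f x))\<^sup>2 + (cmod (g x))\<^sup>2)"
    by (intro Bochner_Integration.integrable_add L2cD assms)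
  note [measurable] = L2cD(1)[OF assms(1)] L2cD(1)[OF assms(2)]
  show "(\<lambda>x. f x * g x) \<in> borel_measurable torus_measure" by measurable
  have "cmod (f x * g x) \<le> (cmod (f x))\<^sup>2 + (cmod (g x))\<^sup>2" for x
    using sum_squares_bound[of "cmod (f x)" "cmod (g x)"] mult_nonneg_nonneg[OF norm_ge_zero norm_ge_zero, of "f x" "g x"]
    unfolding norm_mult by linarith
  then show "AE x in torus_measure. norm (f x * g x) \<le> norm ((cmod (f x))\<^sup>2 + (cmod (g x))\<^sup>2)" by simp
qed

lemma L2c_bounded:
  assumes "f \<in> borel_measurable torus_measure" "\<And>x. cmod (f x) \<le> B"
  shows "L2c f"
  unfolding L2c_def
proof
  note [measurable] = assms(1)
  show "integrable torus_measure (\<lambda>x. (cmod (f x))\<^sup>2)"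
  proof (rule Bochner_Integration.integrable_bound[of _ "\<lambda>_. B\<^sup>2"])
    show "AE x in torus_measure. norm ((cmod (f x))\<^sup>2) \<le> norm (B\<^sup>2)"
      using assms(2) by (auto intro!: power_mono)
  qed simp_all
qed (rule assms)

lemma L2c_ew: "L2c (ew k)"
  by (rule L2c_bounded[where B = 1]) auto

lemma L2c_integrable: "L2c f \<Longrightarrow> integrable torus_measure f"
  using L2c_integrable_mult[OF _ L2c_ew[of 0]] by simp

lemma L2c_mult_bounded:
  assumes "L2c f" "g \<in> borel_measurable torus_measure" "\<And>x. cmod (g x) \<le> B"
  shows "L2c (\<lambda>x. g x * f x)"
  unfolding L2c_def
proof
  note [measurable] = assms(2) L2cD(1)[OF assms(1)]
  show "(\<lambda>x. g x * f x) \<in> borel_measurable torus_measure" by measurable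
  show "integrable torus_measure (\<lambda>x. (cmod (g x * f x))\<^sup>2)"
  proof (rule Bochner_Integration.integrable_bound)
    show "integrable torus_measure (\<lambda>x. B\<^sup>2 * (cmod (f x))\<^sup>2)" by (intro integrable_mult_right L2cD assms)
    show "AE x in torus_measure. norm ((cmod (g x * f x))\<^sup>2) \<le> norm (B\<^sup>2 * (cmod (f x))\<^sup>2)"
      using assms(3) by (auto simp: norm_mult power_mult_distrib intro!: mult_right_mono power_mono)
  qed measurable
qed

lemma L2c_cmult: "L2c f \<Longrightarrow> L2c (\<lambda>x. c * f x)"
  by (rule L2c_mult_bounded[where g = "\<lambda>_. c" and B = "cmod c"]) auto

lemma L2c_cnj: "L2c f \<Longrightarrow> L2c (\<lambda>x. cnj (f x))"
  unfolding L2c_def using borel_measurable_continuous_on[OF continuous_on_cnj[OF continuous_on_id]] by auto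

lemma L2c_add:
  assumes "L2c f" "L2c g"
  shows "L2c (\<lambda>x. f x + g x)"
  unfolding L2c_def
proof
  note [measurable] = L2cD(1)[OF assms(1)] L2cD(1)[OF assms(2)]
  show "(\<lambda>x. f x + g x) \<in> borel_measurable torus_measure" by measurable
  show "integrable torus_measure (\<lambda>x. (cmod (f x + g x))\<^sup>2)"
  proof (rule Bochner_Integration.integrable_bound)
    show "integrable torus_measure (\<lambda>x. 2 * (cmod (f x))\<^sup>2 + 2 * (cmod (g x))\<^sup>2)"
      by (intro Bochner_Integration.integrable_add integrable_mult_right L2cD assms)
    show "AE x in torus_measure. norm ((cmod (f x + g x))\<^sup>2) \<le> norm (2 * (cmod (f x))\<^sup>2 + 2 * (cmod (g x))\<^sup>2)"
      using cmod_add_square_le by simp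
  qed measurable
qed

lemma L2c_diff: "L2c f \<Longrightarrow> L2c g \<Longrightarrow> L2c (\<lambda>x. f x - g x)"
  using L2c_add[OF _ L2c_cmult, of f g "-1"] by simp

lemma L2c_sum: "finite F \<Longrightarrow> (\<And>i. i \<in> F \<Longrightarrow> L2c (f i)) \<Longrightarrow> L2c (\<lambda>x. \<Sum>i\<in>F. f i x)"
proof (induction F rule: finite_induct)
  case empty
  then show ?case by (simp add: L2c_def)
qed (auto intro: L2c_add)

lemma nc_square: "(nc f)\<^sup>2 = (LINT x|torus_measure. (cmod (f x))\<^sup>2)"
  by (simp add: nc_def integral_nonneg_AE)

lemma nc_nonneg [simp]: "0 \<le> nc f" by (simp add: nc_def integral_nonneg_AE)

text \<open>The integral of the square of |f| - r |g| is nonnegative for every real r. The optimal r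
  gives the claim; if \<open>nc g\<close> vanishes, arbitrarily large r forces the left hand side to
  be zero.\<close>

lemma L2c_Cauchy_Schwarz:
  assumes f: "L2c f" and g: "L2c g"
  shows "(LINT x|torus_measure. cmod (f x * g x)) \<le> nc f * nc g"
proof -
  define X where "X = (LINT x|torus_measure. cmod (f x * g x))"
  have i: "integrable torus_measure (\<lambda>x. cmod (f x * g x))"
    using L2c_integrable_mult[OF f g] by (rule integrable_norm)
  have q: "2 * r * X \<le> (nc f)\<^sup>2 + r\<^sup>2 * (nc g)\<^sup>2" for r
  proof -
    have "(LINT x|torus_measure. 2 * r * cmod (f x * g x)) \<le> (LINT x|torus_measure. (cmod (f x))\<^sup>2 + r\<^sup>2 * (cmod (g x))\<^sup>2)"
    proof (rule integral_mono)
      show "2 * r * cmod (f x * g x) \<le> (cmod (f x))\<^sup>2 + r\<^sup>2 * (cmod (g x))\<^sup>2" for x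
        using sum_squares_bound[of "cmod (f x)" "r * cmod (g x)"] by (simp add: norm_mult power_mult_distrib mult_ac)
    qed (intro integrable_mult_right Bochner_Integration.integrable_add L2cD f g i)+
    then show ?thesis using L2cD(2)[OF f] L2cD(2)[OF g] i by (simp add: X_def nc_square)
  qed
  have X0: "0 \<le> X" by (simp add: X_def integral_nonneg_AE)
  have "X \<le> nc f * nc g"
  proof (cases "nc g = 0")
    case True
    then have *: "2 * r * X \<le> (nc f)\<^sup>2" for r using q[of r] by simp
    have "X = 0"
    proof (rule ccontr)
      assume "X \<noteq> 0"
      then have "2 * (((nc f)\<^sup>2 + 1) / (2 * X)) * X = (nc f)\<^sup>2 + 1" by simp
      then show False using *[of "((nc f)\<^sup>2 + 1) / (2 * X)"] by simp
    qed
    then show ?thesis using True by simp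
  next
    case False
    then have g0: "nc g > 0" using nc_nonneg[of g] by linarith
    define B where "B = (nc g)\<^sup>2"
    have B: "B > 0" using g0 by (simp add: B_def)
    have "2 * (X / B) * X \<le> (nc f)\<^sup>2 + (X / B)\<^sup>2 * B" using q[of "X / B"] by (simp add: B_def)
    moreover have "(X / B)\<^sup>2 * B = (X / B) * X" using B by (simp add: power2_eq_square)
    ultimately have "X\<^sup>2 / B \<le> (nc f)\<^sup>2" by (simp add: power2_eq_square)
    then have "X\<^sup>2 \<le> (nc f * nc g)\<^sup>2" using B by (simp add: pos_divide_le_eq B_def power_mult_distrib)
    then show ?thesis by (rule power2_le_imp_le) simp
  qed
  then show ?thesis by (simp add: X_def)
qed

lemma L2c_pair_bound:
  assumes "L2c f" "L2c g"
  shows "cmod (LINT x|torus_measure. f x * g x) \<le> nc f * nc g"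
  using order_trans[OF integral_norm_bound L2c_Cauchy_Schwarz[OF assms]] .

lemma nc_ew: "nc (ew k) = sqrt (2 * pi)"
  by (simp add: nc_def)

lemma fc_bound:
  assumes "L2c f"
  shows "cmod (fc f k) \<le> nc f"
proof -
  have "cmod (fc f k) \<le> nc f * sqrt (2 * pi) / (2 * pi)"
    using L2c_pair_bound[OF assms L2c_ew[of "- k"]] by (simp add: fc_def norm_divide nc_ew divide_right_mono)
  also have "\<dots> \<le> nc f * (2 * pi) / (2 * pi)"
  proof (intro divide_right_mono mult_left_mono)
    show "sqrt (2 * pi) \<le> 2 * pi" using pi_ge_two by (intro real_le_lsqrt) (auto simp: power2_eq_square)
  qed auto
  finally show ?thesis by simp
qed


lemma fc_diff: "L2c f \<Longrightarrow> L2c g \<Longrightarrow> fc (\<lambda>x. f x - g x) k = fc f k - fc g k"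
  by (simp add: fc_def left_diff_distrib diff_divide_distrib L2c_integrable_mult L2c_ew)

lemma fc_cmult: "fc (\<lambda>x. c * f x) k = c * fc f k"
  by (simp add: fc_def mult.assoc)

lemma fc_ew: "fc (ew l) k = (if k = l then 1 else 0)"
  by (simp add: fc_def ew_add ew_integral)

lemma fc_sum_ew:
  assumes "finite F"
  shows "fc (\<lambda>x. \<Sum>l\<in>F. c l * ew l x) k = (if k \<in> F then c k else 0)"
proof -
  have "fc (\<lambda>x. \<Sum>l\<in>F. c l * ew l x) k = (\<Sum>l\<in>F. (LINT x|torus_measure. c l * ew l x * ew (- k) x)) / of_real (2 * pi)"
    unfolding fc_def sum_distrib_right
    by (subst Bochner_Integration.integral_sum) (auto intro!: L2c_integrable_mult L2c_cmult L2c_ew)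
  also have "\<dots> = (\<Sum>l\<in>F. if l = k then c l else 0)"
    unfolding sum_divide_distrib mult.assoc ew_add by (intro sum.cong refl) (auto simp: ew_integral)
  finally show ?thesis using assms by simp
qed

text \<open>The coefficients \<open>c\<close> are arbitrary because the identity is used twice: with
  the Fourier coefficients of \<open>f\<close> it gives Bessel's inequality, with \<open>f\<close>
  zero it gives the norm of a trigonometric polynomial.\<close>

lemma nc_square_diff_partial:
  assumes f: "L2c f" and F: "finite F"
  shows "(nc (\<lambda>x. f x - (\<Sum>k\<in>F. c k * ew k x)))\<^sup>2 =
    (nc f)\<^sup>2 + 2 * pi * (\<Sum>k\<in>F. (cmod (c k))\<^sup>2 - 2 * Re (cnj (c k) * fc f k))"
proof -
  define s where "s x = (\<Sum>k\<in>F. c k * ew k x)" for x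
  have s: "L2c s" unfolding s_def by (intro L2c_sum F L2c_cmult L2c_ew)
  have cs: "cnj (s x) = (\<Sum>k\<in>F. cnj (c k) * ew (- k) x)" for x by (simp add: s_def ew_cnj)
  have p: "(LINT x|torus_measure. g x * cnj (s x)) = of_real (2 * pi) * (\<Sum>k\<in>F. cnj (c k) * fc g k)" if g: "L2c g" for g
  proof -
    have e: "g x * cnj (s x) = (\<Sum>k\<in>F. cnj (c k) * (g x * ew (- k) x))" for x
      by (simp add: cs sum_distrib_left mult_ac)
    have "(LINT x|torus_measure. g x * cnj (s x)) = (\<Sum>k\<in>F. (LINT x|torus_measure. cnj (c k) * (g x * ew (- k) x)))"
      unfolding e
      by (rule Bochner_Integration.integral_sum) (intro integrable_mult_right L2c_integrable_mult g L2c_ew)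
    then show ?thesis by (simp add: fc_def sum_distrib_left)
  qed
  have ss: "(LINT x|torus_measure. s x * cnj (s x)) = of_real (2 * pi * (\<Sum>k\<in>F. (cmod (c k))\<^sup>2))"
  proof -
    have "fc s k = c k" if "k \<in> F" for k using fc_sum_ew[OF F, of c k] that by (simp add: s_def[abs_def])
    then have "(\<Sum>k\<in>F. cnj (c k) * fc s k) = (\<Sum>k\<in>F. of_real ((cmod (c k))\<^sup>2))"
      by (intro sum.cong refl) (simp only: complex_norm_square mult.commute)
    then show ?thesis unfolding p[OF s] by simp
  qed
  have e: "(cmod (f x - s x))\<^sup>2 = (cmod (f x))\<^sup>2 - 2 * Re (f x * cnj (s x)) + Re (s x * cnj (s x))" for x
    unfolding Re_mult_cnj_self by (simp add: cmod_power2 power2_diff algebra_simps)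
  have i1: "integrable torus_measure (\<lambda>x. f x * cnj (s x))" "integrable torus_measure (\<lambda>x. s x * cnj (s x))"
    by (intro L2c_integrable_mult f s L2c_cnj)+
  have "(nc (\<lambda>x. f x - s x))\<^sup>2 = (nc f)\<^sup>2 - 2 * Re (LINT x|torus_measure. f x * cnj (s x)) + Re (LINT x|torus_measure. s x * cnj (s x))"
  proof -
    define A where "A x = (cmod (f x))\<^sup>2" for x
    define B where "B x = Re (f x * cnj (s x))" for x
    define C where "C x = Re (s x * cnj (s x))" for x
    have i: "integrable torus_measure A" "integrable torus_measure B" "integrable torus_measure C"
      unfolding A_def B_def C_def by (intro L2cD(2) f integrable_Re i1)+
    have "(LINT x|torus_measure. A x - 2 * B x + C x) =
        (LINT x|torus_measure. A x) - 2 * (LINT x|torus_measure. B x) + (LINT x|torus_measure. C x)"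
      using i by simp
    moreover have "(LINT x|torus_measure. B x) = Re (LINT x|torus_measure. f x * cnj (s x))"
      "(LINT x|torus_measure. C x) = Re (LINT x|torus_measure. s x * cnj (s x))"
      unfolding B_def C_def by (rule integral_Re i1)+
    ultimately show ?thesis unfolding nc_square e A_def B_def C_def by simp
  qed
  also have "\<dots> = (nc f)\<^sup>2 + 2 * pi * (\<Sum>k\<in>F. (cmod (c k))\<^sup>2 - 2 * Re (cnj (c k) * fc f k))"
    unfolding p[OF f] ss sum_subtractf sum_distrib_left[symmetric] Re_sum[symmetric]
    by (simp add: algebra_simps)
  finally show ?thesis by (simp add: s_def)
qed

lemma Bessel:
  assumes "L2c f" "finite F"
  shows "2 * pi * (\<Sum>k\<in>F. (cmod (fc f k))\<^sup>2) \<le> (nc f)\<^sup>2"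
proof -
  have "Re (cnj z * z) = (cmod z)\<^sup>2" for z using Re_mult_cnj_self[of z] by (simp only: mult.commute)
  then have "(nc f)\<^sup>2 + 2 * pi * (\<Sum>k\<in>F. - (cmod (fc f k))\<^sup>2) = (nc (\<lambda>x. f x - (\<Sum>k\<in>F. fc f k * ew k x)))\<^sup>2"
    unfolding nc_square_diff_partial[OF assms] by simp
  also have "\<dots> \<ge> 0" by simp
  finally show ?thesis by (simp add: sum_negf)
qed

lemma fc_square_summable:
  assumes "L2c f"
  shows "(\<lambda>k. (cmod (fc f k))\<^sup>2) summable_on UNIV"
proof (rule nonneg_bdd_above_summable_on)
  show "bdd_above (sum (\<lambda>k. (cmod (fc f k))\<^sup>2) ` {F. F \<subseteq> UNIV \<and> finite F})"
  proof (rule bdd_aboveI2)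
    fix F assume "F \<in> {F. F \<subseteq> (UNIV :: int set) \<and> finite F}"
    then have "2 * pi * (\<Sum>k\<in>F. (cmod (fc f k))\<^sup>2) \<le> (nc f)\<^sup>2" by (intro Bessel assms) auto
    then show "(\<Sum>k\<in>F. (cmod (fc f k))\<^sup>2) \<le> (nc f)\<^sup>2 / (2 * pi)"
      by (simp add: field_simps)
  qed
qed simp

section \<open>Completeness of the exponentials\<close>

inductive trig_poly :: "(real \<Rightarrow> complex) \<Rightarrow> bool" where
  mono: "trig_poly (\<lambda>x. c * ew k x)"
| sum: "trig_poly p \<Longrightarrow> trig_poly q \<Longrightarrow> trig_poly (\<lambda>x. p x + q x)"

lemma trig_poly_mult:
  assumes "trig_poly p" "trig_poly q"
  shows "trig_poly (\<lambda>x. p x * q x)"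
  using assms
proof (induction p)
  case (mono c k)
  from mono(1) show ?case
  proof (induction q)
    case (mono d l)
    have "(\<lambda>x. c * ew k x * (d * ew l x)) = (\<lambda>x. (c * d) * ew (k + l) x)" by (auto simp: ew_add[symmetric] mult_ac)
    then show ?case by (simp only: trig_poly.mono)
  qed (simp only: distrib_left trig_poly.sum)
qed (simp only: distrib_right trig_poly.sum)

text \<open>A real linear functional of \<open>cis x\<close> is a combination of \<open>ew 1\<close>
  and \<open>ew (-1)\<close>. Hence real polynomials in the plane, which Stone-Weierstrass provides
  on the unit circle, restrict to trigonometric polynomials.\<close>

lemma trig_poly_of_polynomial:
  fixes g :: "complex \<Rightarrow> real"
  assumes "real_polynomial_function g"
  shows "trig_poly (\<lambda>x. of_real (g (cis x)))"
  using assms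
proof induction
  case (linear f)
  interpret bounded_linear f by fact
  have "complex_of_real (f (cis x)) = (of_real (f 1) / 2 - \<i> * of_real (f \<i>) / 2) * ew 1 x
      + (of_real (f 1) / 2 + \<i> * of_real (f \<i>) / 2) * ew (- 1) x" for x
  proof -
    have "cis x = cos x *\<^sub>R 1 + sin x *\<^sub>R \<i>" by (simp add: complex_eq_iff)
    then have "f (cis x) = cos x * f 1 + sin x * f \<i>" by (simp only: add scale) simp
    then show ?thesis by (simp add: ew_cis complex_eq_iff algebra_simps)
  qed
  then show ?case by (simp only: trig_poly.intros)
next
  case (const c)
  show ?case using trig_poly.mono[of "of_real c" 0] by simp
qed (simp_all only: of_real_add of_real_mult trig_poly.sum trig_poly_mult)

lemma trig_poly_orthogonal:
  assumes "trig_poly p" and f: "L2c f" "\<And>k. fc f k = 0"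
  shows "(LINT x|torus_measure. f x * p x) = 0" "L2c p"
  using assms(1)
proof induction
  case (mono c k)
  { case 1 show ?case using f(2)[of "- k"] by (simp add: fc_def mult.left_commute) }
  { case 2 show ?case by (intro L2c_cmult L2c_ew) }
next
  case (sum p q)
  { case 1 show ?case using sum by (simp add: distrib_left L2c_integrable_mult f(1)) }
  { case 2 show ?case using sum by (intro L2c_add) }
qed

text \<open>Approximation takes place on the unit circle rather than on an interval, which builds
  periodicity into the continuous functions. Since \<open>f\<close> is integrable, a uniform error
  of size e costs at most e times its integral norm.\<close>

lemma fc_zero_continuous:
  assumes f: "L2c f" "\<And>k. fc f k = 0" and \<phi>: "continuous_on UNIV (\<phi> :: complex \<Rightarrow> real)"
  shows "(LINT x|torus_measure. f x * of_real (\<phi> (cis x))) = 0"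
proof -
  let ?I = "LINT x|torus_measure. f x * of_real (\<phi> (cis x))"
  define A where "A = (LINT x|torus_measure. cmod (f x))"
  have A0: "A \<ge> 0" by (simp add: A_def integral_nonneg_AE)
  have fi: "integrable torus_measure f" by (rule L2c_integrable[OF f(1)])
  have pc: "continuous_on UNIV (\<lambda>x. complex_of_real (\<phi> (cis x)))"
    by (intro continuous_on_of_real continuous_on_compose2[OF \<phi>] continuous_intros) auto
  have pm: "(\<lambda>x. complex_of_real (\<phi> (cis x))) \<in> borel_measurable torus_measure"
    by (rule continuous_imp_measurable_on_sets_lebesgue[OF continuous_on_subset[OF pc]]) auto
  have "bounded (\<phi> ` sphere 0 1)"
    by (intro compact_imp_bounded compact_continuous_image continuous_on_subset[OF \<phi>]) auto
  then obtain B where B: "\<forall>z\<in>sphere 0 1. \<bar>\<phi> z\<bar> \<le> B" unfolding bounded_iff by auto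
  have pL: "L2c (\<lambda>x. complex_of_real (\<phi> (cis x)))"
    by (rule L2c_bounded[OF pm, of B]) (use B in simp)
  have "cmod ?I \<le> e * A" if e: "e > 0" for e
  proof -
    obtain g where g: "real_polynomial_function g" "\<And>z. z \<in> sphere 0 1 \<Longrightarrow> \<bar>\<phi> z - g z\<bar> < e"
      using Stone_Weierstrass_real_polynomial_function[of "sphere 0 1" \<phi> e] continuous_on_subset[OF \<phi>] e by auto
    note tp = trig_poly_orthogonal[OF trig_poly_of_polynomial[OF g(1)] f]
    have "?I = ?I - (LINT x|torus_measure. f x * of_real (g (cis x)))" by (simp add: tp)
    also have "\<dots> = (LINT x|torus_measure. f x * of_real (\<phi> (cis x)) - f x * of_real (g (cis x)))"
      by (rule Bochner_Integration.integral_diff[symmetric]) (intro L2c_integrable_mult f(1) pL tp(2))+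
    also have "cmod \<dots> \<le> (LINT x|torus_measure. e * cmod (f x))"
    proof (rule order_trans[OF integral_norm_bound integral_mono])
      show "integrable torus_measure (\<lambda>x. norm (f x * of_real (\<phi> (cis x)) - f x * of_real (g (cis x))))"
        by (intro integrable_norm Bochner_Integration.integrable_diff L2c_integrable_mult f(1) pL tp(2))
      show "integrable torus_measure (\<lambda>x. e * cmod (f x))" using fi by simp
      show "norm (f x * of_real (\<phi> (cis x)) - f x * of_real (g (cis x))) \<le> e * cmod (f x)" for x
      proof -
        have "norm (f x * of_real (\<phi> (cis x)) - f x * of_real (g (cis x))) = cmod (f x) * \<bar>\<phi> (cis x) - g (cis x)\<bar>"
          by (simp only: right_diff_distrib[symmetric] of_real_diff[symmetric] norm_mult norm_of_real)
        also have "\<dots> \<le> cmod (f x) * e" using g(2)[of "cis x"] by (intro mult_left_mono) auto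
        finally show ?thesis by (simp add: mult.commute)
      qed
    qed
    finally show ?thesis by (simp add: A_def)
  qed
  note small = this
  have "cmod ?I \<le> e" if "e > 0" for e
  proof -
    have "cmod ?I \<le> e / (A + 1) * A" by (rule small) (use that A0 in simp)
    also have "\<dots> \<le> e" using that A0 by (simp add: field_simps)
    finally show ?thesis .
  qed
  note b = this
  have "cmod ?I \<le> 0"
  proof (rule field_le_epsilon)
    fix e :: real assume "0 < e"
    then show "cmod ?I \<le> 0 + e" using b[of e] by simp
  qed
  then show ?thesis by simp
qed

lemma fc_zero_interval:
  assumes f: "L2c f" "\<And>k. fc f k = 0" and ab: "0 < a" "a \<le> b" "b < 2 * pi"
  shows "integral {a..b} f = 0"
proof -
  have fi: "integrable torus_measure f" by (rule L2c_integrable[OF f(1)])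
  define K where "K = cis ` {a..b}"
  have K: "compact K" "K \<noteq> {}"
    unfolding K_def using ab by (auto intro!: compact_continuous_image continuous_intros)
  have clK: "closed K" by (rule compact_imp_closed[OF K(1)])
  \<comment> \<open>Continuous functions on the plane that tend pointwise to the indicator of the
    arc \<open>K\<close> and stay between 0 and 1, so dominated convergence applies.\<close>
  define \<phi> where "\<phi> n z = max 0 (1 - real n * infdist z K)" for n z
  have \<phi>c: "continuous_on UNIV (\<phi> n)" for n
    unfolding \<phi>_def by (intro continuous_intros)
  have \<phi>1: "\<bar>\<phi> n z\<bar> \<le> 1" for n z using infdist_nonneg[of z K] by (simp add: \<phi>_def)
  \<comment> \<open>The end points 0 and \<open>2 * pi\<close> are the same point of the circle. The
    strict inequalities on \<open>a\<close> and \<open>b\<close> keep the arc away from it, so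
    membership in the arc and in the interval agree.\<close>
  have inK: "cis x \<in> K \<longleftrightarrow> x \<in> {a..b}" if x: "x \<in> {0..2*pi}" for x
  proof
    assume "cis x \<in> K"
    then obtain y where y: "y \<in> {a..b}" "cis x = cis y" by (auto simp: K_def)
    then have "cos x = cos y" "sin x = sin y" by (simp_all add: complex_eq_iff)
    then obtain m :: int where m: "x = y + 2 * pi * m" using sin_cos_eq_iff by metis
    have "m = 0"
    proof (rule ccontr)
      assume "m \<noteq> 0"
      then consider "real_of_int m \<ge> 1" | "real_of_int m \<le> -1" by linarith
      then show False
      proof cases
        case 1
        then have "2 * pi * 1 \<le> 2 * pi * m" by (intro mult_left_mono) auto
        moreover have "y + 2 * pi * m \<le> 2 * pi" "0 < y" using m y(1) x ab by auto
        ultimately show False by linarith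
      next
        case 2
        then have "2 * pi * m \<le> 2 * pi * (-1)" by (intro mult_left_mono) auto
        moreover have "0 \<le> y + 2 * pi * m" "y < 2 * pi" using m y(1) x ab by auto
        ultimately show False by linarith
      qed
    qed
    then show "x \<in> {a..b}" using m y by simp
  qed (simp add: K_def)
  have lim: "(\<lambda>n. \<phi> n z) \<longlonglongrightarrow> (if z \<in> K then 1 else 0)" for z
  proof (cases "z \<in> K")
    case True
    then show ?thesis by (simp add: \<phi>_def)
  next
    case False
    then have p: "infdist z K > 0" using clK K(2) by (simp add: infdist_pos_not_in_closed)
    obtain N :: nat where N: "1 / infdist z K < real N" using reals_Archimedean2 by blast
    have "\<phi> n z = 0" if "n \<ge> N" for n
    proof -
      have "1 / infdist z K < real n" using N that by simp
      then have "1 < real n * infdist z K" using p by (simp add: pos_divide_less_eq)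
      then show ?thesis by (simp add: \<phi>_def)
    qed
    then have "\<forall>\<^sub>F n in sequentially. \<phi> n z = 0" by (auto simp: eventually_sequentially)
    then show ?thesis using False by (simp add: tendsto_eventually)
  qed
  note [measurable] = L2cD(1)[OF f(1)]
  have m: "(\<lambda>x. f x * of_real (\<phi> n (cis x))) \<in> borel_measurable torus_measure" for n
  proof -
    have "continuous_on {0..2*pi} (\<lambda>x. complex_of_real (\<phi> n (cis x)))"
      by (intro continuous_on_of_real continuous_on_compose2[OF \<phi>c] continuous_intros) auto
    then have [measurable]: "(\<lambda>x. complex_of_real (\<phi> n (cis x))) \<in> borel_measurable torus_measure"
      by (rule continuous_imp_measurable_on_sets_lebesgue) simp
    show ?thesis by measurable
  qed
  have mi: "(\<lambda>x. f x * indicator {a..b} x) \<in> borel_measurable torus_measure"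
  proof -
    have "{0..2*pi} \<inter> {a..b} \<in> sets torus_measure" by (subst sets_restrict_space) auto
    then have [measurable]: "(\<lambda>x. indicator ({0..2*pi} \<inter> {a..b}) x :: complex) \<in> borel_measurable torus_measure"
      by (rule borel_measurable_indicator)
    have "(\<lambda>x. f x * indicator ({0..2*pi} \<inter> {a..b}) x) \<in> borel_measurable torus_measure" by measurable
    then show ?thesis by (rule measurable_cong[THEN iffD1, rotated]) (auto simp: indicator_def)
  qed
  have "(\<lambda>n. LINT x|torus_measure. f x * of_real (\<phi> n (cis x))) \<longlonglongrightarrow> (LINT x|torus_measure. f x * indicator {a..b} x)"
  proof (rule integral_dominated_convergence[where w = "\<lambda>x. cmod (f x)"])
    show "AE x in torus_measure. (\<lambda>n. f x * of_real (\<phi> n (cis x))) \<longlonglongrightarrow> f x * indicator {a..b} x"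
    proof (rule AE_I2)
      fix x assume "x \<in> space torus_measure"
      then have x: "x \<in> {0..2*pi}" by simp
      have "(\<lambda>n. f x * of_real (\<phi> n (cis x))) \<longlonglongrightarrow> f x * of_real (if cis x \<in> K then 1 else 0)"
        by (intro tendsto_intros lim)
      then show "(\<lambda>n. f x * of_real (\<phi> n (cis x))) \<longlonglongrightarrow> f x * indicator {a..b} x"
        using inK[OF x] by (auto simp: indicator_def)
    qed
    show "AE x in torus_measure. norm (f x * of_real (\<phi> n (cis x))) \<le> cmod (f x)" for n
      by (auto simp: norm_mult intro!: mult_left_le \<phi>1)
  qed (use m mi fi in auto)
  then have "(LINT x|torus_measure. f x * indicator {a..b} x) = 0"
    unfolding fc_zero_continuous[OF f \<phi>c] by (simp add: LIMSEQ_const_iff)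
  moreover have "integrable torus_measure (\<lambda>x. f x * indicator {a..b} x)"
    by (rule Bochner_Integration.integrable_bound[OF integrable_norm[OF fi] mi]) (auto simp: indicator_def)
  ultimately have "integral {0..2*pi} (\<lambda>x. f x * indicator {a..b} x) = 0"
    using integral_torus by metis
  moreover have "integral {0..2*pi} (\<lambda>x. f x * indicator {a..b} x) = integral ({0..2*pi} \<inter> {a..b}) f"
  proof -
    have "(\<lambda>x. f x * indicator {a..b} x) = (\<lambda>x. if x \<in> {a..b} then f x else 0)" by (auto simp: indicator_def)
    then show ?thesis by (simp only: Henstock_Kurzweil_Integration.integral_restrict_Int Int_commute)
  qed
  moreover have "{0..2*pi} \<inter> {a..b} = {a..b}" using ab by auto
  ultimately show ?thesis by metis
qed

text \<open>Integrals over all compact intervals inside the period vanish, so the Lebesgue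
  differentiation theorem, applied to the extension of \<open>f\<close> by zero, gives
  \<open>f x = 0\<close> off a null set.\<close>

theorem fc_zero_imp_zero:
  assumes f: "L2c f" "\<And>k. fc f k = 0"
  shows "AE x in torus_measure. f x = 0"
proof -
  have fi: "f absolutely_integrable_on {0..2*pi}"
    using L2c_integrable[OF f(1)] by (simp add: integrable_torus_iff)
  define g where "g x = (if x \<in> {0..2*pi} then f x else 0)" for x
  have gi: "g integrable_on cbox a b" for a b
  proof -
    have "g integrable_on UNIV"
      unfolding g_def integrable_restrict_UNIV using fi by (rule set_lebesgue_integral_eq_integral(1))
    then show ?thesis by (rule integrable_on_subcbox) simp
  qed
  obtain N where N: "negligible N" "\<And>x e. x \<notin> N \<Longrightarrow> 0 < e \<Longrightarrow> \<exists>d>0. \<forall>h. 0 < h \<and> h < d \<longrightarrow>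
      norm (integral (cbox x (x + h *\<^sub>R One)) g /\<^sub>R h ^ DIM(real) - g x) < e"
    using integrable_ccontinuous_explicit[OF gi] by blast
  have z: "f x = 0" if x: "x \<notin> N" "0 < x" "x < 2 * pi" for x
  proof -
    have "norm (g x) \<le> e" if e: "e > 0" for e
    proof -
      obtain d where d: "d > 0" "\<And>h. 0 < h \<Longrightarrow> h < d \<Longrightarrow> norm (integral (cbox x (x + h *\<^sub>R One)) g /\<^sub>R h ^ DIM(real) - g x) < e"
        using N(2)[OF x(1) e] by blast
      define h where "h = min d (2 * pi - x) / 2"
      have h: "0 < h" "h < d" "x + h < 2 * pi" using d(1) x by (auto simp: h_def min_def field_simps)
      have "integral {x..x+h} g = integral {x..x+h} f"
        by (rule integral_cong) (use x h in \<open>auto simp: g_def\<close>)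
      also have "\<dots> = 0" by (rule fc_zero_interval[OF f]) (use x h in auto)
      finally show ?thesis using d(2)[OF h(1,2)] by simp
    qed
    note b = this
    have "norm (g x) \<le> 0"
    proof (rule field_le_epsilon)
      fix e :: real assume "0 < e"
      then show "norm (g x) \<le> 0 + e" using b[of e] by simp
    qed
    then show ?thesis using x by (simp add: g_def)
  qed
  have "AE x in lebesgue. x \<notin> N \<union> {0, 2 * pi}"
  proof -
    have "negligible (N \<union> {0, 2*pi})" using N(1) by (intro negligible_Un) (auto intro: negligible_finite)
    then show ?thesis by (intro AE_not_in) (simp only: negligible_iff_null_sets)
  qed
  then have "AE x in lebesgue. x \<in> {0..2*pi} \<longrightarrow> f x = 0"
    by eventually_elim (use z in \<open>force simp: less_eq_real_def\<close>)
  then show ?thesis by (subst AE_restrict_space_iff) auto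
qed

section \<open>Convergence in mean: Riesz-Fischer and Parseval\<close>

definition fsum :: "(int \<Rightarrow> complex) \<Rightarrow> nat \<Rightarrow> real \<Rightarrow> complex" where
  "fsum c n x = (\<Sum>k\<in>{- int n..int n}. c k * ew k x)"

lemma L2c_fsum: "L2c (fsum c n)"
  unfolding fsum_def[abs_def] by (intro L2c_sum L2c_cmult L2c_ew) auto

lemma filterlim_symmetric_int: "filterlim (\<lambda>n. {- int n..int n}) (finite_subsets_at_top UNIV) sequentially"
  unfolding filterlim_finite_subsets_at_top
proof (intro allI impI)
  fix X :: "int set" assume X: "finite X \<and> X \<subseteq> UNIV"
  define N where "N = nat (Max (abs ` X \<union> {0}))"
  have "X \<subseteq> {- int n..int n}" if n: "n \<ge> N" for n
  proof
    fix k assume "k \<in> X"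
    then have "\<bar>k\<bar> \<le> Max (abs ` X \<union> {0})" using X by (intro Max_ge) auto
    then have "\<bar>k\<bar> \<le> int n" using n unfolding N_def by linarith
    then show "k \<in> {- int n..int n}" by auto
  qed
  then show "\<forall>\<^sub>F n in sequentially. finite {- int n..int n} \<and> X \<subseteq> {- int n..int n} \<and> {- int n..int n} \<subseteq> UNIV"
    by (intro eventually_sequentiallyI[of N]) auto
qed

lemma has_sum_symmetric_int: "(f has_sum s) UNIV \<Longrightarrow> (\<lambda>n. \<Sum>k\<in>{- int n..int n}. f k) \<longlonglongrightarrow> s"
  unfolding has_sum_def by (rule filterlim_compose[OF _ filterlim_symmetric_int])

lemma nc_zero: "nc (\<lambda>x. 0) = 0" by (simp add: nc_def)
lemma fc_zero: "fc (\<lambda>x. 0) k = 0" by (simp add: fc_def)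

lemma nc_fsum_diff:
  assumes "m \<le> n"
  shows "(nc (\<lambda>x. fsum c n x - fsum c m x))\<^sup>2
    = 2 * pi * ((\<Sum>k\<in>{- int n..int n}. (cmod (c k))\<^sup>2) - (\<Sum>k\<in>{- int m..int m}. (cmod (c k))\<^sup>2))"
proof -
  define A where "A = {- int n..int n} - {- int m..int m}"
  have sub: "{- int m..int m} \<subseteq> {- int n..int n}" using assms by auto
  have e: "fsum c n x - fsum c m x = (\<Sum>k\<in>A. c k * ew k x)" for x
    unfolding fsum_def A_def using sum_diff[OF _ sub, of "\<lambda>k. c k * ew k x"] by simp
  have "L2c (\<lambda>x. 0)" by (simp add: L2c_def)
  from nc_square_diff_partial[OF this, of A c]
  have "(nc (\<lambda>x. - (\<Sum>k\<in>A. c k * ew k x)))\<^sup>2 = 2 * pi * (\<Sum>k\<in>A. (cmod (c k))\<^sup>2)"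
    by (simp add: A_def nc_zero fc_zero)
  moreover have "nc (\<lambda>x. - (\<Sum>k\<in>A. c k * ew k x)) = nc (\<lambda>x. \<Sum>k\<in>A. c k * ew k x)" by (simp add: nc_def)
  ultimately show ?thesis unfolding e A_def using sum_diff[OF _ sub, of "\<lambda>k. (cmod (c k))\<^sup>2"] by simp
qed

text \<open>The partial sums are Cauchy in L^2 and, as the measure is finite, in L^1, so a
  subsequence converges almost everywhere. Fatou's lemma passes the L^2 tail bound to the limit.
  Because \<open>lim\<close> is total and the partial sums are periodic, the limit is periodic at
  every point and not only almost everywhere.\<close>

theorem Riesz_Fischer:
  assumes c: "(\<lambda>k. (cmod (c k))\<^sup>2) summable_on (UNIV :: int set)"
  obtains f where "L2c f" "\<And>x. f (x + 2 * pi) = f x" "\<And>k. fc f k = c k"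
    "(\<lambda>n. nc (\<lambda>x. f x - fsum c n x)) \<longlonglongrightarrow> 0"
proof -
  define \<sigma> where "\<sigma> n = (\<Sum>k\<in>{- int n..int n}. (cmod (c k))\<^sup>2)" for n
  define \<tau> where "\<tau> = (\<Sum>\<^sub>\<infinity>k. (cmod (c k))\<^sup>2)"
  have \<sigma>: "\<sigma> \<longlonglongrightarrow> \<tau>" unfolding \<sigma>_def[abs_def] \<tau>_def by (rule has_sum_symmetric_int[OF has_sum_infsum[OF c]])
  have \<sigma>le: "\<sigma> n \<le> \<tau>" for n
    unfolding \<sigma>_def \<tau>_def by (rule finite_sum_le_infsum[OF c]) auto
  define s where "s n = fsum c n" for n
  have sL: "L2c (s n)" for n by (simp add: s_def L2c_fsum)
  have sd: "nc (\<lambda>x. s n x - s m x) \<le> sqrt (2 * pi * (\<tau> - \<sigma> m))" if "m \<le> n" for m n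
  proof -
    have "(nc (\<lambda>x. s n x - s m x))\<^sup>2 \<le> 2 * pi * (\<tau> - \<sigma> m)"
      unfolding s_def nc_fsum_diff[OF that] \<sigma>_def[symmetric] using \<sigma>le[of n] by simp
    then show ?thesis by (rule real_le_rsqrt)
  qed
  have r0: "(\<lambda>m. sqrt (2 * pi * (\<tau> - \<sigma> m))) \<longlonglongrightarrow> 0"
  proof -
    have "(\<lambda>m. sqrt (2 * pi * (\<tau> - \<sigma> m))) \<longlonglongrightarrow> sqrt (2 * pi * (\<tau> - \<tau>))" by (intro tendsto_intros \<sigma>)
    then show ?thesis by simp
  qed
  have L1: "(LINT x|torus_measure. norm (s i x - s j x)) \<le> sqrt (2 * pi) * nc (\<lambda>x. s i x - s j x)" for i j
    using L2c_Cauchy_Schwarz[OF L2c_diff[OF sL sL] L2c_ew[of 0], of i j] nc_ew[of 0] by (simp add: mult.commute)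
  have cau: "\<exists>N. \<forall>i\<ge>N. \<forall>j\<ge>N. (LINT x|torus_measure. norm (s i x - s j x)) < e" if e: "e > 0" for e
  proof -
    have "(\<lambda>m. sqrt (2 * pi) * (2 * sqrt (2 * pi * (\<tau> - \<sigma> m)))) \<longlonglongrightarrow> sqrt (2 * pi) * (2 * 0)"
      by (intro tendsto_intros r0)
    then have "\<forall>\<^sub>F m in sequentially. sqrt (2 * pi) * (2 * sqrt (2 * pi * (\<tau> - \<sigma> m))) < e"
      using e by (intro order_tendstoD(2)) auto
    then obtain N where N: "sqrt (2 * pi) * (2 * sqrt (2 * pi * (\<tau> - \<sigma> N))) < e"
      by (auto simp: eventually_sequentially)
    have "(LINT x|torus_measure. norm (s i x - s j x)) < e" if ij: "i \<ge> N" "j \<ge> N" for i j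
    proof -
      have n: "(LINT x|torus_measure. norm (s k x - s N x)) \<le> sqrt (2 * pi) * sqrt (2 * pi * (\<tau> - \<sigma> N))" if "k \<ge> N" for k
        by (rule order_trans[OF L1 mult_left_mono[OF sd[OF that]]]) simp
      have "(LINT x|torus_measure. norm (s i x - s j x)) \<le> (LINT x|torus_measure. norm (s i x - s N x) + norm (s j x - s N x))"
      proof (rule integral_mono)
        show "norm (s i x - s j x) \<le> norm (s i x - s N x) + norm (s j x - s N x)" for x
          using norm_triangle_ineq4[of "s i x - s N x" "s j x - s N x"] by simp
      qed (intro integrable_norm Bochner_Integration.integrable_add Bochner_Integration.integrable_diff L2c_integrable sL)+
      also have "\<dots> = (LINT x|torus_measure. norm (s i x - s N x)) + (LINT x|torus_measure. norm (s j x - s N x))"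
        by (rule Bochner_Integration.integral_add) (intro integrable_norm Bochner_Integration.integrable_diff L2c_integrable sL)+
      also have "\<dots> \<le> sqrt (2 * pi) * (2 * sqrt (2 * pi * (\<tau> - \<sigma> N)))" using n[OF ij(1)] n[OF ij(2)] by simp
      finally show ?thesis using N by simp
    qed
    then show ?thesis by blast
  qed
  obtain r where r: "strict_mono r" "AE x in torus_measure. Cauchy (\<lambda>i. s (r i) x)"
    using cauchy_L1_AE_cauchy_subseq[OF L2c_integrable[OF sL] cau] by blast
  define f where "f x = lim (\<lambda>i. s (r i) x)" for x
  note [measurable] = L2cD(1)[OF sL]
  have fm[measurable]: "f \<in> borel_measurable torus_measure" unfolding f_def by measurable
  have conv: "AE x in torus_measure. (\<lambda>i. s (r i) x) \<longlonglongrightarrow> f x"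
    using r(2) by eventually_elim (simp add: f_def Cauchy_convergent_iff convergent_LIMSEQ_iff)
  have per: "f (x + 2 * pi) = f x" for x unfolding f_def s_def fsum_def by (simp add: ew_periodic)
  have fatou: "(\<integral>\<^sup>+x. ennreal ((cmod (f x - s m x))\<^sup>2) \<partial>torus_measure) \<le> ennreal (2 * pi * (\<tau> - \<sigma> m))" for m
  proof -
    have "(\<integral>\<^sup>+x. ennreal ((cmod (f x - s m x))\<^sup>2) \<partial>torus_measure)
        = (\<integral>\<^sup>+x. liminf (\<lambda>i. ennreal ((cmod (s (r i) x - s m x))\<^sup>2)) \<partial>torus_measure)"
    proof (rule nn_integral_cong_AE)
      show "AE x in torus_measure. ennreal ((cmod (f x - s m x))\<^sup>2) = liminf (\<lambda>i. ennreal ((cmod (s (r i) x - s m x))\<^sup>2))"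
        using conv
      proof eventually_elim
        case (elim x)
        have "(\<lambda>i. ennreal ((cmod (s (r i) x - s m x))\<^sup>2)) \<longlonglongrightarrow> ennreal ((cmod (f x - s m x))\<^sup>2)"
          by (intro tendsto_intros elim)
        then show ?case by (rule lim_imp_Liminf[OF trivial_limit_sequentially, symmetric])
      qed
    qed
    also have "\<dots> \<le> liminf (\<lambda>i. \<integral>\<^sup>+x. ennreal ((cmod (s (r i) x - s m x))\<^sup>2) \<partial>torus_measure)"
      by (rule nn_integral_liminf) measurable
    also have "\<dots> \<le> ennreal (2 * pi * (\<tau> - \<sigma> m))"
    proof (rule Liminf_le)
      show "\<forall>\<^sub>F i in sequentially. (\<integral>\<^sup>+x. ennreal ((cmod (s (r i) x - s m x))\<^sup>2) \<partial>torus_measure) \<le> ennreal (2 * pi * (\<tau> - \<sigma> m))"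
      proof (rule eventually_sequentiallyI[of m])
        fix i assume "m \<le> i"
        then have mi: "m \<le> r i" using strict_mono_imp_increasing[OF r(1), of i] by linarith
        have "(\<integral>\<^sup>+x. ennreal ((cmod (s (r i) x - s m x))\<^sup>2) \<partial>torus_measure) = ennreal ((nc (\<lambda>x. s (r i) x - s m x))\<^sup>2)"
          unfolding nc_square by (rule nn_integral_eq_integral[OF L2cD(2)[OF L2c_diff[OF sL sL]]]) simp
        also have "\<dots> \<le> ennreal (2 * pi * (\<tau> - \<sigma> m))"
          unfolding s_def nc_fsum_diff[OF mi] \<sigma>_def[symmetric] using \<sigma>le[of "r i"] by (intro ennreal_leI) simp
        finally show "(\<integral>\<^sup>+x. ennreal ((cmod (s (r i) x - s m x))\<^sup>2) \<partial>torus_measure) \<le> ennreal (2 * pi * (\<tau> - \<sigma> m))" .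
      qed
    qed simp
    finally show ?thesis .
  qed
  have dL: "L2c (\<lambda>x. f x - s m x)" for m
    unfolding L2c_def
  proof
    show "integrable torus_measure (\<lambda>x. (cmod (f x - s m x))\<^sup>2)"
      by (rule integrableI_bounded) (use le_less_trans[OF fatou[of m]] in auto)
  qed measurable
  have fL: "L2c f" using L2c_add[OF dL[of 0] sL[of 0]] by simp
  have dn: "nc (\<lambda>x. f x - s m x) \<le> sqrt (2 * pi * (\<tau> - \<sigma> m))" for m
  proof -
    have "ennreal ((nc (\<lambda>x. f x - s m x))\<^sup>2) \<le> ennreal (2 * pi * (\<tau> - \<sigma> m))"
      using fatou[of m] unfolding nc_square
      by (subst nn_integral_eq_integral[OF L2cD(2)[OF dL], symmetric]) auto
    then have "(nc (\<lambda>x. f x - s m x))\<^sup>2 \<le> 2 * pi * (\<tau> - \<sigma> m)"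
      using \<sigma>le[of m] by (simp add: ennreal_le_iff)
    then show ?thesis by (rule real_le_rsqrt)
  qed
  have n0: "(\<lambda>m. nc (\<lambda>x. f x - s m x)) \<longlonglongrightarrow> 0"
    by (rule Lim_null_comparison[OF _ r0]) (auto intro: always_eventually dn)
  have "fc f k = c k" for k
  proof -
    have "(\<lambda>m. fc f k - fc (s m) k) \<longlonglongrightarrow> 0"
      by (rule Lim_null_comparison[OF _ n0])
        (auto intro!: always_eventually simp: fc_diff[OF fL sL, symmetric] fc_bound[OF dL])
    moreover have "\<forall>\<^sub>F m in sequentially. fc f k - fc (s m) k = fc f k - c k"
    proof (rule eventually_sequentiallyI[of "nat \<bar>k\<bar>"])
      fix m assume "nat \<bar>k\<bar> \<le> m"
      then show "fc f k - fc (s m) k = fc f k - c k"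
        using fc_sum_ew[of "{- int m..int m}" c k] by (simp add: s_def fsum_def[abs_def]) linarith
    qed
    ultimately have "(\<lambda>m::nat. fc f k - c k) \<longlonglongrightarrow> 0" by (rule Lim_transform_eventually)
    then show ?thesis by (simp add: LIMSEQ_const_iff)
  qed
  then show ?thesis using that[OF fL per _ n0[unfolded s_def]] by blast
qed

lemma nc_cong_AE: "AE x in torus_measure. f x = g x \<Longrightarrow> f \<in> borel_measurable torus_measure
    \<Longrightarrow> g \<in> borel_measurable torus_measure \<Longrightarrow> nc f = nc g"
  unfolding nc_def by (intro arg_cong[of _ _ sqrt] integral_cong_AE) auto

text \<open>Riesz-Fischer produces some function with these coefficients that is the limit in mean
  of the partial sums; completeness of the exponentials identifies it with \<open>f\<close> almost
  everywhere.\<close>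

lemma fsum_tendsto:
  assumes f: "L2c f"
  shows "(\<lambda>n. nc (\<lambda>x. f x - fsum (fc f) n x)) \<longlonglongrightarrow> 0"
proof -
  obtain g where g: "L2c g" "\<And>k. fc g k = fc f k" "(\<lambda>n. nc (\<lambda>x. g x - fsum (fc f) n x)) \<longlonglongrightarrow> 0"
    using Riesz_Fischer[OF fc_square_summable[OF f]] by metis
  have "AE x in torus_measure. f x - g x = 0"
    by (rule fc_zero_imp_zero[OF L2c_diff[OF f g(1)]]) (simp add: fc_diff f g)
  then have ae: "AE x in torus_measure. f x - fsum (fc f) n x = g x - fsum (fc f) n x" for n
    by eventually_elim simp
  have "nc (\<lambda>x. f x - fsum (fc f) n x) = nc (\<lambda>x. g x - fsum (fc f) n x)" for n
    by (rule nc_cong_AE[OF ae]) (intro L2cD(1) L2c_diff f g L2c_fsum)+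
  then show ?thesis using g(3) by simp
qed

theorem Parseval:
  assumes f: "L2c f" and g: "L2c g"
  shows "((\<lambda>k. fc f k * cnj (fc g k)) has_sum ((LINT x|torus_measure. f x * cnj (g x)) / of_real (2 * pi))) UNIV"
proof -
  let ?I = "\<lambda>f. LINT x|torus_measure. f x * cnj (g x)"
  have s: "(\<lambda>k. fc f k * cnj (fc g k)) summable_on UNIV"
  proof (rule summable_on_dominated)
    show "(\<lambda>k. (cmod (fc f k))\<^sup>2 + (cmod (fc g k))\<^sup>2) summable_on UNIV"
      by (intro summable_on_add fc_square_summable f g)
    show "cmod (fc f k * cnj (fc g k)) \<le> (cmod (fc f k))\<^sup>2 + (cmod (fc g k))\<^sup>2" for k
      using sum_squares_bound[of "cmod (fc f k)" "cmod (fc g k)"] mult_nonneg_nonneg[OF norm_ge_zero norm_ge_zero, of "fc f k" "fc g k"]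
      unfolding norm_mult complex_mod_cnj by linarith
  qed
  have part: "?I (fsum (fc f) n) = of_real (2 * pi) * (\<Sum>k\<in>{- int n..int n}. fc f k * cnj (fc g k))" for n
  proof -
    have "?I (fsum (fc f) n) = (LINT x|torus_measure. (\<Sum>k\<in>{- int n..int n}. fc f k * cnj (g x * ew (- k) x)))"
      unfolding fsum_def sum_distrib_right by (intro Bochner_Integration.integral_cong refl sum.cong) (simp add: ew_cnj mult_ac)
    also have "\<dots> = (\<Sum>k\<in>{- int n..int n}. (LINT x|torus_measure. fc f k * cnj (g x * ew (- k) x)))"
      by (rule Bochner_Integration.integral_sum)
        (intro integrable_mult_right integrable_cnj L2c_integrable_mult g L2c_ew)
    also have "\<dots> = (\<Sum>k\<in>{- int n..int n}. of_real (2 * pi) * (fc f k * cnj (fc g k)))"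
    proof (rule sum.cong)
      fix k
      have "(LINT x|torus_measure. cnj (g x * ew (- k) x)) = cnj (LINT x|torus_measure. g x * ew (- k) x)"
        by (rule Bochner_Integration.integral_cnj)
      then show "(LINT x|torus_measure. fc f k * cnj (g x * ew (- k) x)) = of_real (2 * pi) * (fc f k * cnj (fc g k))"
        by (simp only: integral_mult_right_zero fc_def complex_cnj_divide complex_cnj_complex_of_real) simp
    qed simp
    finally show ?thesis by (simp add: sum_distrib_left)
  qed
  have "(\<lambda>n. ?I (fsum (fc f) n)) \<longlonglongrightarrow> ?I f"
  proof (rule LIM_zero_cancel, rule Lim_null_comparison)
    show "\<forall>\<^sub>F n in sequentially. norm (?I (fsum (fc f) n) - ?I f) \<le> nc (\<lambda>x. f x - fsum (fc f) n x) * nc (\<lambda>x. cnj (g x))"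
    proof (intro always_eventually allI)
      fix n
      have "?I f - ?I (fsum (fc f) n) = (LINT x|torus_measure. (f x - fsum (fc f) n x) * cnj (g x))"
        unfolding left_diff_distrib
        by (rule Bochner_Integration.integral_diff[symmetric]) (intro L2c_integrable_mult f L2c_fsum L2c_cnj g)+
      then show "norm (?I (fsum (fc f) n) - ?I f) \<le> nc (\<lambda>x. f x - fsum (fc f) n x) * nc (\<lambda>x. cnj (g x))"
        using L2c_pair_bound[OF L2c_diff[OF f L2c_fsum] L2c_cnj[OF g], of "fc f" n] by (simp add: norm_minus_commute)
    qed
    show "(\<lambda>n. nc (\<lambda>x. f x - fsum (fc f) n x) * nc (\<lambda>x. cnj (g x))) \<longlonglongrightarrow> 0"
      using tendsto_mult_right[OF fsum_tendsto[OF f], of "nc (\<lambda>x. cnj (g x))"] by simp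
  qed
  moreover have "(\<lambda>n. ?I (fsum (fc f) n)) \<longlonglongrightarrow> of_real (2 * pi) * (\<Sum>\<^sub>\<infinity>k. fc f k * cnj (fc g k))"
    unfolding part by (intro tendsto_intros has_sum_symmetric_int has_sum_infsum s)
  ultimately have "?I f = of_real (2 * pi) * (\<Sum>\<^sub>\<infinity>k. fc f k * cnj (fc g k))" by (rule LIMSEQ_unique)
  then have "(\<Sum>\<^sub>\<infinity>k. fc f k * cnj (fc g k)) = ?I f / of_real (2 * pi)" by simp
  then show ?thesis using has_sum_infsum[OF s] by simp
qed

section \<open>Smooth functions and vector fields on the torus\<close>

text \<open>The recursion enters through \<open>deriv f\<close>, whereas the iterates
  \<open>deriv ^^ k\<close> apply the last derivative on the outside. This form allows induction for
  sums, products and compositions.\<close>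

fun times_diff :: "nat \<Rightarrow> (real \<Rightarrow> real) \<Rightarrow> bool" where
  "times_diff 0 f \<longleftrightarrow> (\<forall>x. f differentiable (at x))"
| "times_diff (Suc k) f \<longleftrightarrow> (\<forall>x. f differentiable (at x)) \<and> times_diff k (deriv f)"

definition smooth1 :: "(real \<Rightarrow> real) \<Rightarrow> bool" where
  "smooth1 f \<longleftrightarrow> (\<forall>k x. (deriv ^^ k) f differentiable (at x))"

lemma times_diff_differentiable: "times_diff k f \<Longrightarrow> f differentiable (at x)"
  by (cases k) auto

lemma times_diff_SucD: "times_diff (Suc k) f \<Longrightarrow> times_diff k f"
  by (induction k arbitrary: f) auto

lemma funpow_deriv_Suc: "(deriv ^^ Suc j) f = (deriv ^^ j) (deriv f)"
  by (simp only: funpow_Suc_right o_apply)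

lemma smooth1_iff_times_diff: "smooth1 f \<longleftrightarrow> (\<forall>k. times_diff k f)"
proof
  assume s: "smooth1 f"
  have "(\<forall>k x. (deriv ^^ k) f differentiable (at x)) \<Longrightarrow> times_diff k f" for k f
  proof (induction k arbitrary: f)
    case 0
    then show ?case using spec[OF 0, of 0] by simp
  next
    case (Suc k)
    have "(deriv ^^ j) (deriv f) differentiable (at x)" for j x
      using spec[OF Suc.prems, of "Suc j"] unfolding funpow_deriv_Suc by blast
    then show ?case using Suc.IH[of "deriv f"] spec[OF Suc.prems, of 0] by simp
  qed
  then show "\<forall>k. times_diff k f" using s by (simp add: smooth1_def)
next
  assume t: "\<forall>k. times_diff k f"
  have "times_diff k f \<Longrightarrow> (deriv ^^ k) f differentiable (at x)" for k f x
  proof (induction k arbitrary: f)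
    case (Suc k)
    then show ?case using Suc.IH[of "deriv f"] unfolding funpow_deriv_Suc by simp
  qed simp
  then show "smooth1 f" using t by (simp add: smooth1_def)
qed

lemma deriv_eqI: "(\<And>x. (f has_real_derivative f' x) (at x)) \<Longrightarrow> deriv f = f'"
  by (auto intro: DERIV_imp_deriv)

lemma times_diff_DERIV: "times_diff k f \<Longrightarrow> (f has_real_derivative deriv f x) (at x)"
  using times_diff_differentiable DERIV_deriv_iff_real_differentiable by blast

lemma times_diff_add: "times_diff k f \<Longrightarrow> times_diff k g \<Longrightarrow> times_diff k (\<lambda>x. f x + g x)"
proof (induction k arbitrary: f g)
  case (Suc k)
  have "deriv (\<lambda>x. f x + g x) = (\<lambda>x. deriv f x + deriv g x)"
    by (rule deriv_eqI) (intro DERIV_add times_diff_DERIV[OF Suc.prems(1)] times_diff_DERIV[OF Suc.prems(2)])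
  then show ?case using Suc by (simp add: differentiable_add)
qed (simp add: differentiable_add)

lemma times_diff_mult: "times_diff k f \<Longrightarrow> times_diff k g \<Longrightarrow> times_diff k (\<lambda>x. f x * g x)"
proof (induction k arbitrary: f g)
  case (Suc k)
  have "deriv (\<lambda>x. f x * g x) = (\<lambda>x. deriv f x * g x + deriv g x * f x)"
    by (rule deriv_eqI) (intro DERIV_mult times_diff_DERIV[OF Suc.prems(1)] times_diff_DERIV[OF Suc.prems(2)])
  moreover have "times_diff k (\<lambda>x. deriv f x * g x + deriv g x * f x)"
    using Suc.prems by (intro times_diff_add Suc.IH times_diff_SucD[of k f] times_diff_SucD[of k g]) auto
  ultimately show ?case using Suc.prems by (simp add: differentiable_mult)
qed (simp add: differentiable_mult)

lemma smooth1_add: "smooth1 f \<Longrightarrow> smooth1 g \<Longrightarrow> smooth1 (\<lambda>x. f x + g x)"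
  and smooth1_mult: "smooth1 f \<Longrightarrow> smooth1 g \<Longrightarrow> smooth1 (\<lambda>x. f x * g x)"
  by (simp_all add: smooth1_iff_times_diff times_diff_add times_diff_mult)

lemma smooth1_deriv: "smooth1 f \<Longrightarrow> smooth1 (deriv f)"
  unfolding smooth1_iff_times_diff using times_diff.simps(2) by blast

lemma smooth1_DERIV: "smooth1 f \<Longrightarrow> (f has_real_derivative deriv f x) (at x)"
  unfolding smooth1_iff_times_diff using times_diff_DERIV by blast

lemma smooth1_continuous: "smooth1 f \<Longrightarrow> continuous_on A f"
  by (meson DERIV_isCont continuous_at_imp_continuous_on smooth1_DERIV)

lemma Cinf_torus_iff: "f \<in> Cinf_torus \<longleftrightarrow> torus_periodic f \<and> smooth1 f"
  by (simp add: Cinf_torus_def smooth1_def)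

lemma Cinf_torus_add: "f \<in> Cinf_torus \<Longrightarrow> g \<in> Cinf_torus \<Longrightarrow> (\<lambda>x. f x + g x) \<in> Cinf_torus"
  and Cinf_torus_mult: "f \<in> Cinf_torus \<Longrightarrow> g \<in> Cinf_torus \<Longrightarrow> (\<lambda>x. f x * g x) \<in> Cinf_torus"
  by (auto simp: Cinf_torus_iff smooth1_add smooth1_mult torus_periodic_def)

lemma torus_periodic_deriv:
  assumes "torus_periodic f"
  shows "torus_periodic (deriv f)"
  unfolding torus_periodic_def
proof
  fix x
  have "(\<lambda>y. f (y + 2 * pi)) = f" using assms by (auto simp: torus_periodic_def)
  then have "((f has_real_derivative D) (at (x + 2 * pi))) = ((f has_real_derivative D) (at x))" for D
    using DERIV_shift[of f D x "2 * pi"] by simp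
  then show "deriv f (x + 2 * pi) = deriv f x" by (simp add: deriv_def)
qed

lemma Cinf_torus_deriv: "f \<in> Cinf_torus \<Longrightarrow> deriv f \<in> Cinf_torus"
  by (simp add: Cinf_torus_iff smooth1_deriv torus_periodic_deriv)

lemma Cinf_torus_funpow: "f \<in> Cinf_torus \<Longrightarrow> (deriv ^^ k) f \<in> Cinf_torus"
  by (induction k) (auto intro: Cinf_torus_deriv)

lemma torus_periodic_reduce:
  fixes f :: "real \<Rightarrow> 'a"
  assumes "torus_periodic f"
  shows "\<exists>y\<in>{0..2*pi}. f x = f y"
proof -
  have n: "f (x + 2 * pi * real n) = f x" for x n
  proof (induction n)
    case (Suc n)
    have "f (x + 2 * pi * real (Suc n)) = f ((x + 2 * pi * real n) + 2 * pi)" by (simp add: algebra_simps)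
    then show ?case using Suc assms by (simp add: torus_periodic_def)
  qed simp
  define k where "k = \<lfloor>x / (2 * pi)\<rfloor>"
  define y where "y = x - 2 * pi * of_int k"
  have "of_int k \<le> x / (2 * pi)" "x / (2 * pi) < of_int k + 1" using floor_correct[of "x / (2*pi)"] by (auto simp: k_def)
  then have "of_int k * (2 * pi) \<le> x" "x < (of_int k + 1) * (2 * pi)" by (simp_all add: pos_le_divide_eq pos_divide_less_eq)
  then have "y \<in> {0..2*pi}" by (auto simp: y_def algebra_simps)
  moreover have "f x = f y"
  proof (cases "k \<ge> 0")
    case True then show ?thesis using n[of y "nat k"] by (simp add: y_def)
  next
    case False then show ?thesis using n[of x "nat (- k)"] by (simp add: y_def)
  qed
  ultimately show ?thesis by blast
qed

lemma torus_periodic_bounded: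
  fixes f :: "real \<Rightarrow> real"
  assumes p: "torus_periodic f" and c: "continuous_on UNIV f"
  shows "\<exists>B. \<forall>x. \<bar>f x\<bar> \<le> B"
proof -
  have "bounded (f ` {0..2*pi})"
    by (intro compact_imp_bounded compact_continuous_image continuous_on_subset[OF c]) auto
  then obtain B where B: "\<forall>y\<in>{0..2*pi}. \<bar>f y\<bar> \<le> B" unfolding bounded_iff by auto
  have "\<bar>f x\<bar> \<le> B" for x
  proof -
    obtain y where "y \<in> {0..2*pi}" "f x = f y" using torus_periodic_reduce[OF p] by blast
    then show ?thesis using B by simp
  qed
  then show ?thesis by blast
qed

text \<open>The supremum of an unbounded set of reals is an unspecified number, so boundedness has
  to come first; periodicity reduces it to a compact interval.\<close>

lemma abs_le_Cinf_seminorm: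
  assumes "torus_periodic ((deriv ^^ k) f)" "continuous_on UNIV ((deriv ^^ k) f)"
  shows "\<bar>(deriv ^^ k) f x\<bar> \<le> Cinf_seminorm k f"
proof -
  obtain B where "\<forall>x. \<bar>(deriv ^^ k) f x\<bar> \<le> B" using torus_periodic_bounded[OF assms] by blast
  then have "bdd_above (range (\<lambda>x. \<bar>(deriv ^^ k) f x\<bar>))" by (intro bdd_aboveI2[where M = B]) auto
  then show ?thesis unfolding Cinf_seminorm_def by (intro cSUP_upper) auto
qed

lemma Cinf_torus_continuous: "f \<in> Cinf_torus \<Longrightarrow> continuous_on A f"
  by (simp add: Cinf_torus_iff smooth1_continuous)

lemma Cinf_seminorm_bound: "f \<in> Cinf_torus \<Longrightarrow> \<bar>(deriv ^^ k) f x\<bar> \<le> Cinf_seminorm k f"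
  using Cinf_torus_funpow[of f k] by (intro abs_le_Cinf_seminorm) (auto simp: Cinf_torus_iff smooth1_continuous)

section \<open>Fourier coefficients of smooth functions and real vector fields\<close>

definition fr :: "(real \<Rightarrow> real) \<Rightarrow> int \<Rightarrow> complex" where
  "fr f k = fc (\<lambda>x. of_real (f x)) k"

lemma L2c_continuous: "continuous_on {0..2*pi} f \<Longrightarrow> L2c f"
  unfolding L2c_def
  by (intro conjI integrable_torus_continuous continuous_intros continuous_imp_measurable_on_sets_lebesgue) auto

lemma L2c_of_real: "continuous_on UNIV f \<Longrightarrow> L2c (\<lambda>x. complex_of_real (f x))"
  by (intro L2c_continuous continuous_intros) (auto intro: continuous_on_subset)

lemma L2c_Cinf: "f \<in> Cinf_torus \<Longrightarrow> L2c (\<lambda>x. complex_of_real (f x))"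
  by (intro L2c_of_real Cinf_torus_continuous)

lemma fr_bound:
  assumes f: "continuous_on UNIV f" "\<And>x. \<bar>f x\<bar> \<le> B"
  shows "cmod (fr f k) \<le> B"
proof -
  have i: "integrable torus_measure (\<lambda>x. of_real (f x) * ew (- k) x)"
    by (intro L2c_integrable_mult L2c_of_real L2c_ew f)
  have "cmod (LINT x|torus_measure. of_real (f x) * ew (- k) x) \<le> (LINT x|torus_measure. B)"
    by (rule order_trans[OF integral_norm_bound integral_mono[OF integrable_norm[OF i]]])
      (auto simp: norm_mult f(2))
  then have "cmod (LINT x|torus_measure. of_real (f x) * ew (- k) x) \<le> B * (2 * pi)" by (simp add: mult.commute[of B])
  then show ?thesis by (simp add: fr_def fc_def norm_divide pos_divide_le_eq)
qed

lemma fr_deriv: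
  assumes f: "f \<in> Cinf_torus"
  shows "fr (deriv f) k = \<i> * of_int k * fr f k"
proof -
  have fd: "((\<lambda>x. complex_of_real (f x)) has_vector_derivative of_real (deriv f x)) (at x within S)" for x S
    by (rule has_vector_derivative_of_real[OF has_field_derivative_at_within[OF smooth1_DERIV]])
      (use f in \<open>simp add: Cinf_torus_iff\<close>)
  have "((\<lambda>x. of_real (f x) * ew (- k) x) has_vector_derivative
      (of_real (f x) * (\<i> * of_int (- k) * ew (- k) x) + of_real (deriv f x) * ew (- k) x)) (at x within {0..2*pi})" for x
    by (rule has_vector_derivative_mult[OF fd ew_deriv])
  then have "((\<lambda>x. of_real (f x) * (\<i> * of_int (- k) * ew (- k) x) + of_real (deriv f x) * ew (- k) x) has_integral
      (of_real (f (2 * pi)) * ew (- k) (2 * pi) - of_real (f 0) * ew (- k) 0)) {0..2*pi}"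
    by (intro fundamental_theorem_of_calculus) auto
  moreover have "f (0 + 2 * pi) = f 0" using f unfolding Cinf_torus_iff torus_periodic_def by blast
  moreover have "ew (- k) (2 * pi) = ew (- k) 0" using ew_periodic[of "- k" 0] by simp
  ultimately have z: "integral {0..2*pi} (\<lambda>x. of_real (f x) * (\<i> * of_int (- k) * ew (- k) x) + of_real (deriv f x) * ew (- k) x) = 0"
    by (simp add: integral_unique)
  have e: "(\<lambda>x. of_real (f x) * (\<i> * of_int (- k) * ew (- k) x) + of_real (deriv f x) * ew (- k) x)
    = (\<lambda>x. \<i> * of_int (- k) * (of_real (f x) * ew (- k) x) + of_real (deriv f x) * ew (- k) x)"
    by (auto simp: mult_ac)
  have i: "integrable torus_measure (\<lambda>x. of_real (f x) * ew (- k) x)" "integrable torus_measure (\<lambda>x. of_real (deriv f x) * ew (- k) x)"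
    by (intro L2c_integrable_mult L2c_Cinf L2c_ew f Cinf_torus_deriv)+
  then have "(LINT x|torus_measure. \<i> * of_int (- k) * (of_real (f x) * ew (- k) x) + of_real (deriv f x) * ew (- k) x) = 0"
    using z unfolding e by (subst integral_torus) auto
  then have "\<i> * of_int (- k) * (LINT x|torus_measure. of_real (f x) * ew (- k) x) + (LINT x|torus_measure. of_real (deriv f x) * ew (- k) x) = 0"
    using i by simp
  then have "(LINT x|torus_measure. of_real (deriv f x) * ew (- k) x) = \<i> * of_int k * (LINT x|torus_measure. of_real (f x) * ew (- k) x)"
    by (simp add: add_eq_0_iff)
  then show ?thesis by (simp add: fr_def fc_def)
qed

lemma fr_funpow: "f \<in> Cinf_torus \<Longrightarrow> fr ((deriv ^^ m) f) k = (\<i> * of_int k) ^ m * fr f k"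
  by (induction m) (simp_all add: fr_deriv[OF Cinf_torus_funpow])

text \<open>Integration by parts p times controls nonzero frequencies, where the bracket is at most
  2 |k|; this is the factor \<open>2 ^ p\<close>. Frequency zero is covered by the bound on
  \<open>f\<close> itself.\<close>

lemma fr_rapid:
  assumes f: "f \<in> Cinf_torus" and B: "\<And>x. \<bar>f x\<bar> \<le> B" "\<And>x. \<bar>(deriv ^^ p) f x\<bar> \<le> B"
  shows "cmod (fr f k) \<le> (2 ^ p * B) / jb k ^ p"
proof -
  have B0: "B \<ge> 0" using B(1)[of 0] by linarith
  have 1: "cmod (fr f k) \<le> B" by (rule fr_bound[OF Cinf_torus_continuous[OF f] B(1)])
  have "cmod (fr ((deriv ^^ p) f) k) \<le> B"
    by (rule fr_bound[OF Cinf_torus_continuous[OF Cinf_torus_funpow[OF f]] B(2)])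
  then have 2: "\<bar>real_of_int k\<bar> ^ p * cmod (fr f k) \<le> B"
    by (simp add: fr_funpow[OF f] norm_mult norm_power)
  have "jb k ^ p * cmod (fr f k) \<le> 2 ^ p * B"
  proof (cases "k = 0")
    case True
    have "1 * B \<le> 2 ^ p * B" using B0 by (intro mult_right_mono) auto
    then show ?thesis using 1 True by simp
  next
    case False
    have "jb k ^ p \<le> (2 * \<bar>real_of_int k\<bar>) ^ p"
      using one_le_abs_of_int[OF False] by (intro power_mono) (auto simp: jb_def)
    then have "jb k ^ p * cmod (fr f k) \<le> (2 * \<bar>real_of_int k\<bar>) ^ p * cmod (fr f k)" by (rule mult_right_mono) simp
    also have "\<dots> \<le> 2 ^ p * B" using mult_left_mono[OF 2, of "2 ^ p"] by (simp add: power_mult_distrib mult_ac)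
    finally show ?thesis .
  qed
  then show ?thesis by (simp add: pos_le_divide_eq mult.commute)
qed

lemma fc_cnj: "fc (\<lambda>x. cnj (f x)) k = cnj (fc f (- k))"
proof -
  have "(LINT x|torus_measure. cnj (f x) * ew (- k) x) = (LINT x|torus_measure. cnj (f x * ew k x))"
    by (simp add: ew_cnj)
  also have "\<dots> = cnj (LINT x|torus_measure. f x * ew k x)" by (rule Bochner_Integration.integral_cnj)
  finally show ?thesis by (simp add: fc_def)
qed

lemma fr_cnj: "cnj (fr f k) = fr f (- k)"
  using fc_cnj[of "\<lambda>x. of_real (f x)" "- k"] by (simp add: fr_def)

text \<open>Parseval's identity for \<open>g\<close> and the function \<open>a\<close> times
  \<open>ew k\<close>: as \<open>a\<close> is real, the right hand side is the coefficient of the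
  product, and the coefficients of the second function are shifted coefficients of
  \<open>a\<close>.\<close>

lemma fc_product:
  assumes a: "a \<in> Cinf_torus" and g: "L2c g"
  shows "((\<lambda>l. fr a (k - l) * fc g l) has_sum fc (\<lambda>x. of_real (a x) * g x) k) UNIV"
proof -
  have aL: "L2c (\<lambda>x. of_real (a x) * ew k x)"
    by (intro L2c_continuous continuous_intros ew_continuous Cinf_torus_continuous a)
  have e: "fc (\<lambda>x. of_real (a x) * ew k x) l = fr a (l - k)" for l
    by (simp add: fr_def fc_def mult.assoc ew_add)
  have e1: "fc g l * cnj (fc (\<lambda>x. of_real (a x) * ew k x) l) = fr a (k - l) * fc g l" for l
    unfolding e fr_cnj by simp
  have e2: "(LINT x|torus_measure. g x * cnj (of_real (a x) * ew k x)) / of_real (2 * pi) = fc (\<lambda>x. of_real (a x) * g x) k"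
    by (simp add: fc_def ew_cnj mult_ac)
  show ?thesis using Parseval[OF g aL] unfolding e1 e2 .
qed

lemma has_sum_idx:
  fixes f :: "idx \<Rightarrow> 'a::{topological_comm_monoid_add,t2_space}"
  assumes "\<And>s. ((\<lambda>k. f (k, s)) has_sum S s) UNIV"
  shows "(f has_sum (S True + S False)) UNIV"
proof -
  have r: "(f has_sum S s) (range (\<lambda>k. (k, s)))" for s
    using assms[of s] by (subst has_sum_reindex) (auto simp: inj_on_def o_def)
  have "(f has_sum (S True + S False)) (range (\<lambda>k. (k, True)) \<union> range (\<lambda>k. (k, False)))"
    by (rule has_sum_Un_disjoint[OF r r]) auto
  moreover have "range (\<lambda>k. (k, True)) \<union> range (\<lambda>k. (k, False)) = (UNIV :: idx set)"
  proof -
    have "i \<in> range (\<lambda>k. (k, True)) \<union> range (\<lambda>k. (k, False))" for i :: idx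
      by (cases i; cases "snd i") auto
    then show ?thesis by blast
  qed
  ultimately show ?thesis by simp
qed

text \<open>The coordinates \<open>w\<^sub>1 \<plusminus> \<i> w\<^sub>2\<close> diagonalize \<open>J\<close>; the sign is the Boolean component of the index.\<close>

definition PJ :: "bool \<Rightarrow> 2 \<Rightarrow> complex" where
  "PJ s j = (if j = 1 then 1 else if s then \<i> else - \<i>)"

definition cp :: "bool \<Rightarrow> (real \<Rightarrow> real^2) \<Rightarrow> real \<Rightarrow> complex" where
  "cp s f x = of_real (f x $ 1) + PJ s 2 * of_real (f x $ 2)"

definition FT :: "(real \<Rightarrow> real^2) \<Rightarrow> idx \<Rightarrow> complex" where
  "FT f i = fc (cp (snd i) f) (fst i)"

lemma PJ_simps [simp]: "PJ s 1 = 1" "PJ True 2 = \<i>" "PJ False 2 = - \<i>" by (simp_all add: PJ_def)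

lemma norm_vec2: "(norm (v :: real^2))\<^sup>2 = (v $ 1)\<^sup>2 + (v $ 2)\<^sup>2"
  by (simp add: norm_vec_def L2_set_def sum_2)

lemma cmod_cp: "(cmod (cp s f x))\<^sup>2 = (norm (f x))\<^sup>2"
  unfolding norm_vec2 by (cases s) (simp_all add: cp_def cmod_power2)

lemma L2_torusD:
  assumes "f \<in> L2_torus"
  shows "torus_periodic f" "f \<in> borel_measurable torus_measure" "integrable torus_measure (\<lambda>x. (norm (f x))\<^sup>2)"
  using assms by (auto simp: L2_torus_def)

lemma measurable_vec_nth: "f \<in> borel_measurable M \<Longrightarrow> (\<lambda>x. (f x :: real^2) $ j) \<in> borel_measurable M"
  by (rule borel_measurable_continuous_on[of "\<lambda>v. v $ j"]) (auto intro: continuous_intros)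

lemma measurable_vec2I:
  assumes "\<And>j. (\<lambda>x. (f x :: real^2) $ j) \<in> borel_measurable M"
  shows "f \<in> borel_measurable M"
  unfolding borel_measurable_euclidean_space[of f]
  using assms by (auto simp: Basis_vec_def inner_axis)

lemma L2c_cp:
  assumes "f \<in> L2_torus"
  shows "L2c (cp s f)"
  unfolding L2c_def cmod_cp
proof
  note [measurable] = measurable_vec_nth[OF L2_torusD(2)[OF assms]]
  show "cp s f \<in> borel_measurable torus_measure" unfolding cp_def[abs_def] by measurable
qed (rule L2_torusD[OF assms])

lemma L2_torusI:
  assumes "torus_periodic f" "\<And>j. (\<lambda>x. f x $ j) \<in> borel_measurable torus_measure" "L2c (cp True f)"
  shows "f \<in> L2_torus"
  using assms measurable_vec2I[of f] L2cD(2)[OF assms(3)] by (simp add: L2_torus_def cmod_cp)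

lemma inner_cp: "cp True f x * cnj (cp True g x) + cp False f x * cnj (cp False g x) = of_real (2 * (f x \<bullet> g x))"
  by (simp add: cp_def inner_vec_def sum_2 complex_eq_iff algebra_simps)

text \<open>The two signs together contribute twice the real inner product, while the coefficients
  are normalized by 1 / (2 pi); this is the origin of the factor 1 / pi.\<close>

theorem FT_Parseval:
  assumes f: "f \<in> L2_torus" and g: "g \<in> L2_torus"
  shows "((\<lambda>i. FT f i * cnj (FT g i)) has_sum (of_real ((LINT x|torus_measure. f x \<bullet> g x) / pi))) UNIV"
proof -
  let ?I = "\<lambda>s. LINT x|torus_measure. cp s f x * cnj (cp s g x)"
  have "((\<lambda>i. FT f i * cnj (FT g i)) has_sum (?I True / of_real (2 * pi) + ?I False / of_real (2 * pi))) UNIV"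
    by (rule has_sum_idx[where S = "\<lambda>s. ?I s / of_real (2 * pi)"])
      (use Parseval[OF L2c_cp[OF f] L2c_cp[OF g]] in \<open>simp add: FT_def\<close>)
  moreover have "?I True + ?I False = of_real (2 * (LINT x|torus_measure. f x \<bullet> g x))"
  proof -
    have "?I True + ?I False = (LINT x|torus_measure. cp True f x * cnj (cp True g x) + cp False f x * cnj (cp False g x))"
      by (rule Bochner_Integration.integral_add[symmetric]) (intro L2c_integrable_mult L2c_cnj L2c_cp f g)+
    then show ?thesis unfolding inner_cp by simp
  qed
  then have "?I True / of_real (2 * pi) + ?I False / of_real (2 * pi) = of_real ((LINT x|torus_measure. f x \<bullet> g x) / pi)"
    unfolding add_divide_distrib[symmetric] by simp
  ultimately show ?thesis by simp
qed

lemma FT_ell2: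
  assumes f: "f \<in> L2_torus"
  shows "ell2_at (Ell2 (FT f)) = FT f" "L2_norm f = sqrt pi * norm (Ell2 (FT f))"
proof -
  have "((\<lambda>i. FT f i * cnj (FT f i)) has_sum (of_real ((L2_norm f)\<^sup>2 / pi))) UNIV"
    using FT_Parseval[OF f f] by (simp add: L2_norm_def power2_norm_eq_inner integral_nonneg_AE)
  then have "((\<lambda>i. Re (FT f i * cnj (FT f i))) has_sum ((L2_norm f)\<^sup>2 / pi)) UNIV"
    using has_sum_Re by fastforce
  then have h: "((\<lambda>i. (cmod (FT f i))\<^sup>2) has_sum ((L2_norm f)\<^sup>2 / pi)) UNIV"
    unfolding Re_mult_cnj_self .
  then show 1: "ell2_at (Ell2 (FT f)) = FT f" by (intro Ell2_inverse) (auto intro: has_sum_imp_summable)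
  have "(norm (Ell2 (FT f)))\<^sup>2 = (L2_norm f)\<^sup>2 / pi"
    unfolding norm_ell2_square 1 by (rule infsumI[OF h])
  then have "(L2_norm f)\<^sup>2 = (sqrt pi * norm (Ell2 (FT f)))\<^sup>2" by (simp add: power_mult_distrib)
  then show "L2_norm f = sqrt pi * norm (Ell2 (FT f))"
    by (rule power2_eq_imp_eq) (simp_all add: L2_norm_def integral_nonneg_AE)
qed

lemma cp_diff: "cp s (\<lambda>x. f x - g x) x = cp s f x - cp s g x"
  by (simp add: cp_def algebra_simps)

lemma L2_torus_diff:
  assumes "f \<in> L2_torus" "g \<in> L2_torus"
  shows "(\<lambda>x. f x - g x) \<in> L2_torus"
proof (rule L2_torusI)
  show "torus_periodic (\<lambda>x. f x - g x)" using assms[THEN L2_torusD(1)] by (simp add: torus_periodic_def)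
  note [measurable] = measurable_vec_nth[OF L2_torusD(2)[OF assms(1)]] measurable_vec_nth[OF L2_torusD(2)[OF assms(2)]]
  show "(\<lambda>x. (f x - g x) $ j) \<in> borel_measurable torus_measure" for j by (simp, measurable)
  show "L2c (cp True (\<lambda>x. f x - g x))" unfolding cp_diff[abs_def] by (intro L2c_diff L2c_cp assms)
qed

lemma FT_diff:
  assumes "f \<in> L2_torus" "g \<in> L2_torus"
  shows "FT (\<lambda>x. f x - g x) i = FT f i - FT g i"
  unfolding FT_def cp_diff[abs_def] by (rule fc_diff[OF L2c_cp[OF assms(1)] L2c_cp[OF assms(2)]])

lemma Ell2_FT_diff:
  assumes "f \<in> L2_torus" "g \<in> L2_torus"
  shows "Ell2 (FT (\<lambda>x. f x - g x)) = Ell2 (FT f) - Ell2 (FT g)"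
  by (rule ell2_eqI) (simp add: FT_ell2 FT_diff L2_torus_diff assms)

lemma FT_inject:
  assumes f: "f \<in> L2_torus" and g: "g \<in> L2_torus" and eq: "\<And>i. FT f i = FT g i"
  shows "AE x in torus_measure. f x = g x"
proof -
  have "fc (cp True (\<lambda>x. f x - g x)) k = 0" for k
    using FT_diff[OF f g, of "(k, True)"] eq[of "(k, True)"] by (simp add: FT_def)
  then have "AE x in torus_measure. cp True (\<lambda>x. f x - g x) x = 0"
    by (rule fc_zero_imp_zero[OF L2c_cp[OF L2_torus_diff[OF f g]]])
  then show ?thesis
  proof eventually_elim
    case (elim x)
    then have "norm (f x - g x) = 0" using cmod_cp[of True "\<lambda>x. f x - g x" x] by simp
    then show ?case by simp
  qed
qed

text \<open>The symmetry says that the two complex coordinates are conjugate to each other, that is,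
  that the field is real. Its real and imaginary components are then read off from the function that
  Riesz-Fischer gives for the sign \<open>True\<close>.\<close>

lemma FT_surject:
  fixes x :: "idx ell2"
  assumes sym: "\<And>k. ell2_at x (k, False) = cnj (ell2_at x (- k, True))"
  shows "\<exists>f\<in>L2_torus. FT f = ell2_at x"
proof -
  have "(\<lambda>k. (cmod (ell2_at x (k, True)))\<^sup>2) summable_on UNIV"
  proof -
    have "(\<lambda>i. (cmod (ell2_at x i))\<^sup>2) summable_on range (\<lambda>k. (k, True))"
      by (rule summable_on_subset_banach[OF ell2_at_summable]) simp
    then show ?thesis by (subst (asm) summable_on_reindex) (auto simp: inj_on_def o_def)
  qed
  then obtain g where g: "L2c g" "\<And>y. g (y + 2 * pi) = g y" "\<And>k. fc g k = ell2_at x (k, True)"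
    using Riesz_Fischer[of "\<lambda>k. ell2_at x (k, True)"] by metis
  define f :: "real \<Rightarrow> real^2" where "f y = vector [Re (g y), Im (g y)]" for y
  have f: "cp True f = g" "cp False f = (\<lambda>y. cnj (g y))"
    by (auto simp: cp_def f_def complex_eq_iff)
  have "FT f = ell2_at x"
  proof
    show "FT f i = ell2_at x i" for i
      by (cases i; cases "snd i") (auto simp: FT_def f g fc_cnj sym)
  qed
  moreover have "f \<in> L2_torus"
  proof (rule L2_torusI)
    show "torus_periodic f" by (simp add: torus_periodic_def f_def g)
    note [measurable] = L2cD(1)[OF g(1)]
    have "(\<lambda>y. f y $ 1) \<in> borel_measurable torus_measure" "(\<lambda>y. f y $ 2) \<in> borel_measurable torus_measure"
      by (simp_all add: f_def)
    then show "(\<lambda>y. f y $ j) \<in> borel_measurable torus_measure" for j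
      using exhaust_2[of j] by auto
  qed (simp add: f g)
  ultimately show ?thesis by auto
qed

lemma FT_symmetric: "FT f (k, False) = cnj (FT f (- k, True))"
proof -
  have "cp False f = (\<lambda>x. cnj (cp True f x))" by (auto simp: cp_def)
  then show ?thesis by (simp add: FT_def fc_cnj)
qed

section \<open>The operator in Fourier coordinates\<close>

lemma fc_add: "L2c f \<Longrightarrow> L2c g \<Longrightarrow> fc (\<lambda>x. f x + g x) k = fc f k + fc g k"
  by (simp add: fc_def distrib_right add_divide_distrib L2c_integrable_mult L2c_ew)

lemma fc_sum:
  assumes "finite F" "\<And>a. a \<in> F \<Longrightarrow> L2c (g a)"
  shows "fc (\<lambda>x. \<Sum>a\<in>F. c a * g a x) k = (\<Sum>a\<in>F. c a * fc (g a) k)"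
  using assms
proof (induction F rule: finite_induct)
  case (insert a F)
  have "fc (\<lambda>x. c a * g a x + (\<Sum>a\<in>F. c a * g a x)) k = fc (\<lambda>x. c a * g a x) k + fc (\<lambda>x. \<Sum>a\<in>F. c a * g a x) k"
    using insert by (intro fc_add L2c_cmult L2c_sum) auto
  then show ?case using insert by (simp add: fc_cmult)
qed (simp add: fc_zero)

definition smooth2 :: "(real \<Rightarrow> real^2) \<Rightarrow> bool" where
  "smooth2 \<phi> \<longleftrightarrow> (\<forall>j. (\<lambda>x. \<phi> x $ j) \<in> Cinf_torus)"

definition Dxv :: "nat \<Rightarrow> (real \<Rightarrow> real^2) \<Rightarrow> real \<Rightarrow> real^2" where
  "Dxv m \<psi> x = (\<chi> j. (deriv ^^ m) (\<lambda>y. \<psi> y $ j) x)"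

lemma partial_x_funpow: "(partial_x ^^ m) f t x = (deriv ^^ m) (f t) x"
proof (induction m arbitrary: x)
  case (Suc m)
  then have "(partial_x ^^ m) f t = (deriv ^^ m) (f t)" by auto
  then show ?case by (simp only: funpow.simps o_apply partial_x_def[of "(partial_x ^^ m) f" t x])
qed simp

lemma Dx_eq_Dxv: "Dx m \<psi> t = Dxv m (\<psi> t)"
  by (auto simp: Dx_def Dxv_def partial_x_funpow)

lemma smooth2D: "smooth2 \<phi> \<Longrightarrow> (\<lambda>x. \<phi> x $ j) \<in> Cinf_torus" by (simp add: smooth2_def)

lemma smooth2_Dxv: "smooth2 \<phi> \<Longrightarrow> smooth2 (Dxv m \<phi>)"
  by (auto simp: smooth2_def Dxv_def intro: Cinf_torus_funpow)

lemma L2c_cp_smooth2: "smooth2 \<phi> \<Longrightarrow> L2c (cp s \<phi>)"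
  unfolding cp_def[abs_def] by (intro L2c_add L2c_cmult L2c_Cinf smooth2D)

lemma smooth2_L2:
  assumes "smooth2 \<phi>"
  shows "\<phi> \<in> L2_torus"
proof (rule L2_torusI)
  show "torus_periodic \<phi>"
    using assms unfolding smooth2_def Cinf_torus_iff torus_periodic_def by (simp add: vec_eq_iff)
  show "(\<lambda>x. \<phi> x $ j) \<in> borel_measurable torus_measure" for j
    by (rule continuous_imp_measurable_on_sets_lebesgue[OF Cinf_torus_continuous[OF smooth2D[OF assms]]]) simp
qed (rule L2c_cp_smooth2[OF assms])

lemma FT_fr:
  assumes "smooth2 \<phi>"
  shows "FT \<phi> i = fr (\<lambda>x. \<phi> x $ 1) (fst i) + PJ (snd i) 2 * fr (\<lambda>x. \<phi> x $ 2) (fst i)"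
  unfolding FT_def fr_def cp_def[abs_def]
  using fc_add[OF L2c_Cinf[OF smooth2D[OF assms, of 1]] L2c_cmult[OF L2c_Cinf[OF smooth2D[OF assms, of 2]], of "PJ (snd i) 2"]]
  by (simp add: fc_cmult)

lemma FT_Dxv:
  assumes "smooth2 \<phi>"
  shows "FT (Dxv m \<phi>) i = (\<i> * of_int (fst i)) ^ m * FT \<phi> i"
  unfolding FT_fr[OF assms] FT_fr[OF smooth2_Dxv[OF assms]]
  by (simp add: Dxv_def fr_funpow[OF smooth2D[OF assms]] distrib_left mult_ac)

lemma PJ_norm: "cmod (PJ s j) = 1" by (simp add: PJ_def)

lemma FT_decay:
  assumes \<phi>: "smooth2 \<phi>" and B: "\<And>j x. \<bar>\<phi> x $ j\<bar> \<le> B" "\<And>j x. \<bar>(deriv ^^ p) (\<lambda>y. \<phi> y $ j) x\<bar> \<le> B"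
  shows "tempered (- int p) (2 ^ Suc p * B) (FT \<phi>)"
  unfolding tempered_def
proof
  fix i :: idx
  have f: "cmod (fr (\<lambda>x. \<phi> x $ j) (fst i)) \<le> 2 ^ p * B / jb (fst i) ^ p" for j
    by (rule fr_rapid[OF smooth2D[OF \<phi>] B])
  have "cmod (FT \<phi> i) \<le> cmod (fr (\<lambda>x. \<phi> x $ 1) (fst i)) + cmod (fr (\<lambda>x. \<phi> x $ 2) (fst i))"
    unfolding FT_fr[OF \<phi>] by (rule order_trans[OF norm_triangle_ineq]) (simp add: norm_mult PJ_norm)
  also have "\<dots> \<le> 2 ^ Suc p * B * jb (fst i) powi (- int p)"
    using f[of 1] f[of 2] by (simp add: power_int_minus divide_inverse)
  finally show "cmod (FT \<phi> i) \<le> 2 ^ Suc p * B * jb (fst i) powi (- int p)" .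
qed

lemma FT_decay_exists:
  assumes "smooth2 \<phi>"
  shows "\<exists>D. tempered (- int p) D (FT \<phi>)"
proof -
  have "\<exists>B. \<forall>x. \<bar>(deriv ^^ q) (\<lambda>y. \<phi> y $ j) x\<bar> \<le> B" for q j
    using Cinf_seminorm_bound[OF smooth2D[OF assms]] by blast
  then obtain Bf where Bf: "\<And>q j x. \<bar>(deriv ^^ q) (\<lambda>y. \<phi> y $ j) x\<bar> \<le> Bf q j" by metis
  define B where "B = Max {Bf 0 1, Bf 0 2, Bf p 1, Bf p 2}"
  have Bf_le: "Bf q j \<le> B" if "q \<in> {0, p}" for q j
    using that exhaust_2[of j] by (auto simp: B_def)
  have "\<bar>(deriv ^^ q) (\<lambda>y. \<phi> y $ j) x\<bar> \<le> B" if "q \<in> {0, p}" for q j x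
    by (rule order_trans[OF Bf Bf_le[OF that]])
  from this[of 0] this[of p] show ?thesis using FT_decay[OF assms, of B p] by auto
qed

lemma fr_seminorm_bound:
  assumes "f \<in> Cinf_torus"
  shows "cmod (fr f n) \<le> 2 ^ p * max (Cinf_seminorm 0 f) (Cinf_seminorm p f) / jb n ^ p"
  by (rule fr_rapid[OF assms]; rule order_trans[OF Cinf_seminorm_bound[OF assms, of 0, simplified] max.cobounded1]
    order_trans[OF Cinf_seminorm_bound[OF assms, of p] max.cobounded2])

text \<open>The Fourier coefficients of P B P^(-1), where P is the matrix with rows (1, i) and (1,
  -i). Its inverse is half its adjoint, which explains the conjugate and the division by 2.\<close>

definition mcoef :: "(real \<Rightarrow> real^2^2) \<Rightarrow> bool \<Rightarrow> bool \<Rightarrow> int \<Rightarrow> complex" where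
  "mcoef B s s' n = (\<Sum>l\<in>UNIV. \<Sum>j\<in>UNIV. PJ s l * cnj (PJ s' j) * fr (\<lambda>x. B x $ l $ j) n) / 2"

definition smoothm :: "(real \<Rightarrow> real^2^2) \<Rightarrow> bool" where
  "smoothm B \<longleftrightarrow> (\<forall>l j. (\<lambda>x. B x $ l $ j) \<in> Cinf_torus)"

lemma smooth2_mult:
  assumes "smoothm B" "smooth2 \<phi>"
  shows "smooth2 (\<lambda>x. transpose (B x) *v \<phi> x)"
  using assms unfolding smooth2_def smoothm_def
  by (auto simp: matrix_vector_mult_def transpose_def sum_2 intro!: Cinf_torus_add Cinf_torus_mult)

lemma sum_2_2: "(\<Sum>a\<in>UNIV. f (a :: 2 \<times> 2)) = f (1, 1) + f (1, 2) + f (2, 1) + f (2, 2)"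
proof -
  have "(\<Sum>a\<in>UNIV. f a) = (\<Sum>l\<in>UNIV. \<Sum>j\<in>UNIV. f (l, j))"
    unfolding sum.cartesian_product UNIV_Times_UNIV by simp
  then show ?thesis by (simp add: sum_2 add.assoc)
qed

text \<open>The real transpose acting on fields corresponds to the adjoint kernel: indices are
  exchanged and entries conjugated. The sum over frequencies is the convolution of
  \<open>fc_product\<close>, done for each of the four matrix entries and both signs.\<close>

lemma FT_matrix_mult:
  assumes B: "smoothm B" and \<phi>: "smooth2 \<phi>"
  shows "((\<lambda>j. cnj (mcoef B (snd j) (snd i) (fst j - fst i)) * FT \<phi> j) has_sum
    FT (\<lambda>x. transpose (B x) *v \<phi> x) i) UNIV"
proof -
  obtain k s where i: "i = (k, s)" by (cases i)
  define c where "c \<tau> a = PJ s (snd a) * cnj (PJ \<tau> (fst a)) / 2" for \<tau> and a :: "2 \<times> 2"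
  define g where "g \<tau> a x = of_real (B x $ fst a $ snd a) * cp \<tau> \<phi> x" for \<tau> and a :: "2 \<times> 2" and x
  define S where "S \<tau> = (\<Sum>a\<in>UNIV. c \<tau> a * fc (g \<tau> a) k)" for \<tau>
  have BC: "(\<lambda>x. B x $ l $ j) \<in> Cinf_torus" for l j using B by (simp add: smoothm_def)
  have gL: "L2c (g \<tau> a)" for \<tau> a
    unfolding g_def cp_def
    by (intro L2c_continuous continuous_intros Cinf_torus_continuous BC smooth2D[OF \<phi>])
  have tm: "cnj (mcoef B \<tau> s (n - k)) * FT \<phi> (n, \<tau>) = (\<Sum>a\<in>UNIV. c \<tau> a * (fr (\<lambda>x. B x $ fst a $ snd a) (k - n) * fc (cp \<tau> \<phi>) n))" for n \<tau>
    unfolding mcoef_def c_def sum_2_2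
    by (simp add: sum_2 fr_cnj FT_def field_simps)
  have "((\<lambda>n. cnj (mcoef B \<tau> s (n - k)) * FT \<phi> (n, \<tau>)) has_sum S \<tau>) UNIV" for \<tau>
    unfolding tm S_def
  proof (rule has_sum_finite_sum)
    show "((\<lambda>n. c \<tau> a * (fr (\<lambda>x. B x $ fst a $ snd a) (k - n) * fc (cp \<tau> \<phi>) n)) has_sum c \<tau> a * fc (g \<tau> a) k) UNIV" for a
      unfolding g_def by (intro has_sum_cmult_right fc_product BC L2c_cp_smooth2 \<phi>)
  qed simp
  then have "((\<lambda>j. cnj (mcoef B (snd j) (snd i) (fst j - fst i)) * FT \<phi> j) has_sum (S True + S False)) UNIV"
    by (intro has_sum_idx) (simp add: i)
  moreover have "S True + S False = FT (\<lambda>x. transpose (B x) *v \<phi> x) i"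
  proof -
    have "S True + S False = fc (\<lambda>x. (\<Sum>a\<in>UNIV. c True a * g True a x) + (\<Sum>a\<in>UNIV. c False a * g False a x)) k"
      unfolding S_def by (subst fc_add) (auto intro!: L2c_sum L2c_cmult gL simp: fc_sum gL)
    also have "(\<lambda>x. (\<Sum>a\<in>UNIV. c True a * g True a x) + (\<Sum>a\<in>UNIV. c False a * g False a x)) = cp s (\<lambda>x. transpose (B x) *v \<phi> x)"
    proof
      fix x
      show "(\<Sum>a\<in>UNIV. c True a * g True a x) + (\<Sum>a\<in>UNIV. c False a * g False a x) = cp s (\<lambda>x. transpose (B x) *v \<phi> x) x"
        unfolding c_def g_def sum_2_2
        by (simp add: sum_2 cp_def matrix_vector_mult_def transpose_def field_simps)
    qed
    finally show ?thesis by (simp add: FT_def i)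
  qed
  ultimately show ?thesis by simp
qed

text \<open>The kernel of the operator that differentiates \<open>m\<close> times and then
  multiplies by the matrix with coefficients \<open>b\<close>. Here the first index \<open>j\<close>
  is the output and \<open>i\<close> the input.\<close>

definition ksym :: "nat \<Rightarrow> (bool \<Rightarrow> bool \<Rightarrow> int \<Rightarrow> complex) \<Rightarrow> idx \<Rightarrow> idx \<Rightarrow> complex" where
  "ksym m b j i = b (snd j) (snd i) (fst j - fst i) * (\<i> * of_int (fst i)) ^ m"

lemma kord_ksym:
  assumes "rapid b"
  shows "kord (int m) (\<lambda>t. ksym m (b t))"
  unfolding kord_def
proof
  fix p
  obtain C where C: "C \<ge> 0" "\<And>t s s' n. cmod (b t s s' n) \<le> C / jb n ^ p" using rapidE[OF assms] by blast
  have "cmod (ksym m (b t) i j) \<le> C * jb (fst j) powi (int m) / jb (fst i - fst j) ^ p" for t i j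
  proof -
    have "cmod (ksym m (b t) i j) \<le> C / jb (fst i - fst j) ^ p * jb (fst j) ^ m"
      unfolding ksym_def norm_mult norm_power
      by (intro mult_mono power_mono C) (use C(1) in \<open>auto simp: norm_mult jb_def\<close>)
    then show ?thesis by simp
  qed
  then show "\<exists>C. \<forall>t i j. cmod (ksym m (b t) i j) \<le> C * jb (fst j) powi (int m) / jb (fst i - fst j) ^ p" by blast
qed

lemma mcoef_bound:
  assumes "\<And>l j. cmod (fr (\<lambda>x. B x $ l $ j) n) \<le> C"
  shows "cmod (mcoef B s s' n) \<le> 2 * C"
proof -
  have "cmod (\<Sum>l\<in>UNIV. \<Sum>j\<in>UNIV. PJ s l * cnj (PJ s' j) * fr (\<lambda>x. B x $ l $ j) n) \<le> (\<Sum>l\<in>(UNIV::2 set). \<Sum>j\<in>(UNIV::2 set). C)"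
    by (intro sum_norm_le) (simp add: norm_mult PJ_norm assms)
  then show ?thesis by (simp add: mcoef_def norm_divide)
qed

lemma rapid_mcoef:
  assumes "\<And>p l j. \<exists>C. \<forall>t n. cmod (fr (\<lambda>x. B t x $ l $ j) n) \<le> C / jb n ^ p"
  shows "rapid (\<lambda>t. mcoef (B t))"
  unfolding rapid_def
proof
  fix p
  obtain Cf where Cf: "\<And>l j t n. cmod (fr (\<lambda>x. B t x $ l $ j) n) \<le> Cf l j / jb n ^ p"
    using assms[where p=p] by metis
  define C where "C = Max (range (\<lambda>a. Cf (fst a) (snd a)))"
  have "Cf l j \<le> C" for l j
    unfolding C_def by (rule Max_ge) (auto intro: range_eqI[of _ _ "(l, j)"])
  then have "cmod (fr (\<lambda>x. B t x $ l $ j) n) \<le> C / jb n ^ p" for t n l j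
    by (intro order_trans[OF Cf divide_right_mono]) auto
  from mcoef_bound[OF this] have "cmod (mcoef (B t) s s' n) \<le> 2 * C / jb n ^ p" for t s s' n by simp
  then show "\<exists>C. \<forall>t s s' n. cmod (mcoef (B t) s s' n) \<le> C / jb n ^ p" by blast
qed

lemma summable_product_kernel:
  fixes F :: "idx \<Rightarrow> idx \<Rightarrow> complex"
  assumes "\<And>j i. cmod (F j i) \<le> c * (1 / (jb (fst j))\<^sup>2) * (1 / (jb (fst j - fst i))\<^sup>2)" "c \<ge> 0"
  shows "(\<lambda>(j, i). F j i) summable_on UNIV \<times> UNIV"
proof (rule summable_on_dominated)
  show "(\<lambda>(j::idx, i::idx). c * (1 / (jb (fst j))\<^sup>2) * (1 / (jb (fst j - fst i))\<^sup>2)) summable_on UNIV \<times> UNIV"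
  proof (rule summable_on_SigmaI)
    show "((\<lambda>i::idx. case (j, i) of (j, i) \<Rightarrow> c * (1 / (jb (fst j))\<^sup>2) * (1 / (jb (fst j - fst i))\<^sup>2))
        has_sum (c * (1 / (jb (fst j))\<^sup>2)) * jsum) UNIV" for j :: idx
      using has_sum_cmult_right[OF jsum_shift[of "fst j"], of "c * (1 / (jb (fst j))\<^sup>2)"] by simp
    show "(\<lambda>j::idx. (c * (1 / (jb (fst j))\<^sup>2)) * jsum) summable_on UNIV"
      by (intro summable_on_cmult_left summable_on_cmult_right jb_summable_idx)
  qed (use assms(2) in auto)
  fix z :: "idx \<times> idx"
  show "norm (case z of (j, i) \<Rightarrow> F j i) \<le> (case z of (j, i) \<Rightarrow> c * (1 / (jb (fst j))\<^sup>2) * (1 / (jb (fst j - fst i))\<^sup>2))"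
    unfolding case_prod_unfold by (rule assms(1))
qed

text \<open>As \<open>w\<close> is only square integrable, the derivatives and the transposed matrix
  act on the test field. Expanding by Parseval and exchanging the two sums moves them back onto
  \<open>w\<close> as the kernel \<open>ksym\<close>, whose action on the coefficients of
  \<open>w\<close> is tempered.\<close>

theorem spatial_pairing:
  assumes B: "smoothm B" and \<phi>: "smooth2 \<phi>" and w: "w \<in> L2_torus"
  shows "((\<lambda>j. cnj (FT \<phi> j) * kapp (ksym m (mcoef B)) (FT w) j) has_sum
    of_real ((-1) ^ m * (LINT x|torus_measure. w x \<bullet> Dxv m (\<lambda>x. transpose (B x) *v \<phi> x) x) / pi)) UNIV"
proof -
  define \<psi> where "\<psi> x = transpose (B x) *v \<phi> x" for x
  have \<psi>: "smooth2 \<psi>" unfolding \<psi>_def by (rule smooth2_mult[OF B \<phi>])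
  \<comment> \<open>The matrix is fixed in this lemma; the time parameter is a dummy that makes the
    calculus of kernels applicable.\<close>
  have "rapid (\<lambda>t::real. mcoef B)"
  proof (rule rapid_mcoef)
    fix p l j
    have a: "(\<lambda>x. B x $ l $ j) \<in> Cinf_torus" using B by (simp add: smoothm_def)
    have "cmod (fr (\<lambda>x. B x $ l $ j) n) \<le> 2 ^ p * max (Cinf_seminorm 0 (\<lambda>x. B x $ l $ j)) (Cinf_seminorm p (\<lambda>x. B x $ l $ j)) / jb n ^ p" for n
      by (rule fr_seminorm_bound[OF a])
    then show "\<exists>C. \<forall>(t::real) n. cmod (fr (\<lambda>x. B x $ l $ j) n) \<le> C / jb n ^ p" by blast
  qed
  then have T: "kord (int m) (\<lambda>t::real. ksym m (mcoef B))" by (rule kord_ksym)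
  have tw: "tempered 0 (norm (Ell2 (FT w))) (FT w)" using tempered_ell2[of "Ell2 (FT w)"] by (simp add: FT_ell2[OF w])
  obtain C where C: "C \<ge> 0" "\<And>(t::real) x D j i. tempered 0 D x \<Longrightarrow>
      cmod (ksym m (mcoef B) j i * x i) \<le> C * D * jb (fst j) powi (int m + 0) / (jb (fst j - fst i))\<^sup>2"
    using kord_apply_pointwise[OF T, of 0] by blast
  \<comment> \<open>Of this decay, \<open>m\<close> powers absorb the growth of the kernel applied
    to \<open>w\<close>, and two make the double sum absolutely convergent.\<close>
  obtain D where D: "tempered (- int (m + 2)) D (FT \<phi>)" using FT_decay_exists[OF \<phi>] by blast
  have D0: "D \<ge> 0" by (rule tempered_nonneg[OF D])
  define F where "F j i = cnj (FT \<phi> j) * (ksym m (mcoef B) j i * FT w i)" for j i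
  define N where "N = norm (Ell2 (FT w))"
  have Fb: "cmod (F j i) \<le> (C * N * D) * (1 / (jb (fst j))\<^sup>2) * (1 / (jb (fst j - fst i))\<^sup>2)" for j i
  proof -
    have "cmod (F j i) \<le> (D * jb (fst j) powi (- int (m + 2))) * (C * N * jb (fst j) powi (int m + 0) / (jb (fst j - fst i))\<^sup>2)"
      unfolding F_def norm_mult[of "cnj _"] complex_mod_cnj N_def
      by (intro mult_mono C tw D[unfolded tempered_def, rule_format]) (use D0 C(1) in auto)
    also have "jb (fst j) powi (- int (m + 2)) = inverse (jb (fst j) ^ m * (jb (fst j))\<^sup>2)"
      by (simp only: power_int_minus power_int_of_nat power_add)
    finally show ?thesis by (simp add: field_simps)
  qed
  have Fs: "(\<lambda>(j, i). F j i) summable_on UNIV \<times> UNIV"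
    by (rule summable_product_kernel[OF Fb]) (use C D0 in \<open>simp add: N_def\<close>)
  have inner: "(\<lambda>j. F j i) = (\<lambda>j. FT w i * (\<i> * of_int (fst i)) ^ m * cnj (cnj (mcoef B (snd j) (snd i) (fst j - fst i)) * FT \<phi> j))" for i
    by (auto simp: F_def ksym_def mult_ac)
  have si: "((\<lambda>j. F j i) has_sum (FT w i * (\<i> * of_int (fst i)) ^ m * cnj (FT \<psi> i))) UNIV" for i
    unfolding inner \<psi>_def by (intro has_sum_cmult_right) (simp only: has_sum_cnj_iff FT_matrix_mult[OF B \<phi>])
  have e: "FT w i * (\<i> * of_int (fst i)) ^ m * cnj (FT \<psi> i) = (-1) ^ m * (FT w i * cnj (FT (Dxv m \<psi>) i))" for i
  proof -
    have "cnj ((\<i> * of_int (fst i)) ^ m) = (-1) ^ m * (\<i> * of_int (fst i)) ^ m"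
      by (simp add: power_mult_distrib[symmetric])
    then show ?thesis by (simp add: FT_Dxv[OF \<psi>] mult_ac flip: power_add)
  qed
  have tot: "(\<Sum>\<^sub>\<infinity>i. \<Sum>\<^sub>\<infinity>j. F j i) = of_real ((-1) ^ m * (LINT x|torus_measure. w x \<bullet> Dxv m \<psi> x) / pi)"
  proof -
    have "(\<Sum>\<^sub>\<infinity>i. \<Sum>\<^sub>\<infinity>j. F j i) = (\<Sum>\<^sub>\<infinity>i. (-1) ^ m * (FT w i * cnj (FT (Dxv m \<psi>) i)))"
      unfolding infsumI[OF si] e ..
    also have "\<dots> = (-1) ^ m * of_real ((LINT x|torus_measure. w x \<bullet> Dxv m \<psi> x) / pi)"
      unfolding infsum_cmult_right' infsumI[OF FT_Parseval[OF w smooth2_L2[OF smooth2_Dxv[OF \<psi>]]]] ..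
    finally show ?thesis by simp
  qed
  have sw: "(\<Sum>\<^sub>\<infinity>j. \<Sum>\<^sub>\<infinity>i. F j i) = (\<Sum>\<^sub>\<infinity>i. \<Sum>\<^sub>\<infinity>j. F j i)"
    by (rule infsum_swap_banach[OF Fs])
  have kF: "(\<Sum>\<^sub>\<infinity>i. F j i) = cnj (FT \<phi> j) * kapp (ksym m (mcoef B)) (FT w) j" for j
    unfolding F_def kapp_def by (rule infsum_cmult_right')
  have "(\<lambda>j. \<Sum>\<^sub>\<infinity>i. F j i) summable_on UNIV"
    by (rule summable_on_Sigma_banach[OF Fs])
  from has_sum_infsum[OF this] show ?thesis
    unfolding sw tot unfolding kF \<psi>_def .
qed

lemma fr_const: "fr (\<lambda>x. c) n = (if n = 0 then of_real c else 0)"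
  using fc_cmult[of "of_real c" "ew 0" n] by (simp add: fr_def fc_ew)

text \<open>The chosen coordinates are eigenvectors of \<open>J_mat\<close> with eigenvalues i and
  -i, and i^4 = 1. The leading term is therefore exactly the diagonal in \<open>kA\<close>, without
  any remainder.\<close>

lemma ksym_J: "ksym 4 (mcoef (\<lambda>x. J_mat)) = kdiag (\<lambda>i. \<i> * of_real (om i))"
proof (intro ext)
  fix i j :: idx
  have J: "J_mat $ 1 $ 1 = 0" "J_mat $ 1 $ 2 = -1" "J_mat $ 2 $ 1 = 1" "J_mat $ 2 $ 2 = 0" by (simp_all add: J_mat_def)
  obtain k s where i: "i = (k, s)" by (cases i)
  obtain l s' where j: "j = (l, s')" by (cases j)
  have pw: "(\<i> * of_int l) ^ 4 = (of_int l :: complex) ^ 4" by (simp add: power_mult_distrib)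
  show "ksym 4 (mcoef (\<lambda>x. J_mat)) i j = kdiag (\<lambda>i. \<i> * of_real (om i)) i j"
    unfolding ksym_def mcoef_def kdiag_def fr_const i j fst_conv snd_conv pw
    by (cases s; cases s') (auto simp: sum_2 J om_def)
qed

lemma pk_ksym: "pk b c t i j = ksym 2 (b t) i j + ksym 1 (c t) i j"
  by (simp add: pk_def ksym_def power_mult_distrib)

lemma smooth1_const: "smooth1 (\<lambda>x. c)"
proof -
  have "times_diff k (\<lambda>x::real. c)" for k c by (induction k arbitrary: c) simp_all
  then show ?thesis by (simp add: smooth1_iff_times_diff)
qed

lemma Cinf_torus_const: "(\<lambda>x. c) \<in> Cinf_torus"
  by (simp add: Cinf_torus_iff smooth1_const torus_periodic_def)

lemma Cinf_torus_cmult: "f \<in> Cinf_torus \<Longrightarrow> (\<lambda>x. c * f x) \<in> Cinf_torus"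
  by (rule Cinf_torus_mult[OF Cinf_torus_const])

lemma Cinf_torus_diff: "f \<in> Cinf_torus \<Longrightarrow> g \<in> Cinf_torus \<Longrightarrow> (\<lambda>x. f x - g x) \<in> Cinf_torus"
  using Cinf_torus_add[OF _ Cinf_torus_cmult[of g "-1"], of f] by simp

lemma fr_diff: "f \<in> Cinf_torus \<Longrightarrow> g \<in> Cinf_torus \<Longrightarrow> fr (\<lambda>x. f x - g x) n = fr f n - fr g n"
  using fc_diff[OF L2c_Cinf L2c_Cinf] by (simp add: fr_def)

lemma fr_cmult: "fr (\<lambda>x. c * f x) n = of_real c * fr f n"
  using fc_cmult[of "of_real c" "\<lambda>x. of_real (f x)"] by (simp add: fr_def)

lemma fr_seminorm_0: "f \<in> Cinf_torus \<Longrightarrow> cmod (fr f n) \<le> Cinf_seminorm 0 f"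
  using fr_bound[OF Cinf_torus_continuous Cinf_seminorm_bound[of f 0, simplified]] .

section \<open>Regularity of the coefficients in time\<close>

lemma Cb_CinfD:
  assumes "a \<in> Cb_Cinf"
  shows "a t \<in> Cinf_torus" "((\<lambda>s. Cinf_seminorm k (\<lambda>x. a s x - a t x)) \<longlongrightarrow> 0) (at t)"
    "\<exists>C. \<forall>t. Cinf_seminorm k (a t) \<le> C"
  using assms by (auto simp: Cb_Cinf_def)

lemma fr_time_continuous:
  assumes a: "a \<in> Cb_Cinf"
  shows "continuous_on UNIV (\<lambda>t. fr (a t) n)"
  unfolding continuous_on_def
proof
  fix t
  have "((\<lambda>s. fr (a s) n - fr (a t) n) \<longlongrightarrow> 0) (at t)"
  proof (rule Lim_null_comparison[OF always_eventually Cb_CinfD(2)[OF a, of 0 t]], rule allI)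
    fix s
    show "cmod (fr (a s) n - fr (a t) n) \<le> Cinf_seminorm 0 (\<lambda>x. a s x - a t x)"
      using fr_seminorm_0[OF Cinf_torus_diff[OF Cb_CinfD(1)[OF a, of s] Cb_CinfD(1)[OF a, of t]], of n]
      by (simp add: fr_diff Cb_CinfD(1)[OF a])
  qed
  then show "((\<lambda>t. fr (a t) n) \<longlongrightarrow> fr (a t) n) (at t within UNIV)" using LIM_zero_iff by blast
qed

text \<open>A Fourier coefficient is bounded by the seminorm of order zero, so convergence of the
  difference quotients in that seminorm gives convergence of the coefficients.\<close>

lemma fr_time_derivative:
  assumes a: "a \<in> Cb_Cinf" and a': "a' \<in> Cb_Cinf" and d: "has_Cinf_time_derivative a a'"
  shows "((\<lambda>t. fr (a t) n) has_vector_derivative fr (a' t) n) (at t)"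
  unfolding has_vector_derivative_def has_derivative_iff_norm
proof (intro conjI bounded_linear_scaleR_left)
  show "((\<lambda>s. norm (fr (a s) n - fr (a t) n - (s - t) *\<^sub>R fr (a' t) n) / norm (s - t)) \<longlongrightarrow> 0) (at t)"
  proof (rule Lim_null_comparison)
    show "((\<lambda>s. Cinf_seminorm 0 (\<lambda>x. (a s x - a t x) / (s - t) - a' t x)) \<longlongrightarrow> 0) (at t)"
      using d by (simp add: has_Cinf_time_derivative_def)
    have "norm (norm (fr (a s) n - fr (a t) n - (s - t) *\<^sub>R fr (a' t) n) / norm (s - t))
        \<le> Cinf_seminorm 0 (\<lambda>x. (a s x - a t x) / (s - t) - a' t x)" if st: "s \<noteq> t" for s
    proof -
      let ?q = "\<lambda>x. inverse (s - t) * (a s x - a t x)"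
      have q: "?q \<in> Cinf_torus" by (intro Cinf_torus_cmult Cinf_torus_diff Cb_CinfD(1) a)
      have "fr (\<lambda>x. ?q x - a' t x) n = (fr (a s) n - fr (a t) n - (s - t) *\<^sub>R fr (a' t) n) / of_real (s - t)"
        unfolding fr_diff[OF q Cb_CinfD(1)[OF a']] fr_cmult fr_diff[OF Cb_CinfD(1)[OF a] Cb_CinfD(1)[OF a]] scaleR_conv_of_real
        using st by (simp add: field_simps del: of_real_diff)
      with fr_seminorm_0[OF Cinf_torus_diff[OF q Cb_CinfD(1)[OF a', of t]], of n]
      have "norm ((fr (a s) n - fr (a t) n - (s - t) *\<^sub>R fr (a' t) n) / of_real (s - t)) \<le> Cinf_seminorm 0 (\<lambda>x. ?q x - a' t x)"
        by simp
      then show ?thesis by (simp only: norm_divide norm_of_real divide_inverse mult.commute real_norm_def abs_mult abs_abs abs_inverse abs_norm_cancel norm_mult norm_inverse)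
    qed
    then show "\<forall>\<^sub>F s in at t. norm (norm (fr (a s) n - fr (a t) n - (s - t) *\<^sub>R fr (a' t) n) / norm (s - t))
        \<le> Cinf_seminorm 0 (\<lambda>x. (a s x - a t x) / (s - t) - a' t x)"
      unfolding eventually_at by (intro exI[of _ 1]) auto
  qed
qed

definition Cb_mat :: "(real \<Rightarrow> real \<Rightarrow> real^2^2) \<Rightarrow> bool" where
  "Cb_mat B \<longleftrightarrow> (\<forall>l j. (\<lambda>t x. B t x $ l $ j) \<in> Cb_Cinf)"

lemma Cb_matD: "Cb_mat B \<Longrightarrow> (\<lambda>t x. B t x $ l $ j) \<in> Cb_Cinf" by (simp add: Cb_mat_def)

lemma Cb_mat_smoothm: "Cb_mat B \<Longrightarrow> smoothm (B t)"
  unfolding smoothm_def using Cb_CinfD(1)[OF Cb_matD] by blast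

lemma rapid_Cb_mat:
  assumes "Cb_mat B"
  shows "rapid (\<lambda>t. mcoef (B t))"
proof (rule rapid_mcoef)
  fix p l j
  let ?a = "\<lambda>t x. B t x $ l $ j"
  obtain C0 Cp where C: "\<And>t. Cinf_seminorm 0 (?a t) \<le> C0" "\<And>t. Cinf_seminorm p (?a t) \<le> Cp"
    using Cb_CinfD(3)[OF Cb_matD[OF assms, of l j]] by metis
  have "cmod (fr (?a t) n) \<le> 2 ^ p * max C0 Cp / jb n ^ p" for t n
    by (rule order_trans[OF fr_seminorm_bound[OF Cb_CinfD(1)[OF Cb_matD[OF assms]], of _ _ _ _ p]])
      (intro divide_right_mono mult_left_mono max.mono C, auto)
  then show "\<exists>C. \<forall>t n. cmod (fr (?a t) n) \<le> C / jb n ^ p" by blast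
qed

lemma mcoef_2:
  "mcoef B s s' n = (fr (\<lambda>x. B x $ 1 $ 1) n + cnj (PJ s' 2) * fr (\<lambda>x. B x $ 1 $ 2) n
     + PJ s 2 * fr (\<lambda>x. B x $ 2 $ 1) n + PJ s 2 * cnj (PJ s' 2) * fr (\<lambda>x. B x $ 2 $ 2) n) / 2"
  by (simp add: mcoef_def sum_2)

lemma mcoef_continuous:
  assumes "Cb_mat B"
  shows "continuous_on UNIV (\<lambda>t. mcoef (B t) s s' n)"
  unfolding mcoef_2 by (intro continuous_intros fr_time_continuous Cb_matD[OF assms]) simp_all

lemma mcoef_derivative:
  assumes "Cb_mat B" "Cb_mat B'" "\<And>l j. has_Cinf_time_derivative (\<lambda>t x. B t x $ l $ j) (\<lambda>t x. B' t x $ l $ j)"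
  shows "((\<lambda>t. mcoef (B t) s s' n) has_vector_derivative mcoef (B' t) s s' n) (at t)"
  unfolding mcoef_2
  by (intro has_vector_derivative_divide has_vector_derivative_add has_vector_derivative_mult_right fr_time_derivative
      Cb_matD[OF assms(1)] Cb_matD[OF assms(2)] assms(3))

lemma Cb1_mat:
  assumes "\<And>l j. (\<lambda>t x. B t x $ l $ j) \<in> Cb1_Cinf"
  obtains B' where "Cb_mat B" "Cb_mat B'" "\<And>l j. has_Cinf_time_derivative (\<lambda>t x. B t x $ l $ j) (\<lambda>t x. B' t x $ l $ j)"
proof -
  have "\<forall>l j. \<exists>a'\<in>Cb_Cinf. has_Cinf_time_derivative (\<lambda>t x. B t x $ l $ j) a'"
    using assms by (simp add: Cb1_Cinf_def)
  then obtain b where b: "\<And>l j. b l j \<in> Cb_Cinf" "\<And>l j. has_Cinf_time_derivative (\<lambda>t x. B t x $ l $ j) (b l j)" by metis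
  show ?thesis
    by (rule that[of "\<lambda>t x. \<chi> l j. b l j t x"]) (use b assms in \<open>simp_all add: Cb_mat_def Cb1_Cinf_def\<close>)
qed

lemma fr_0: "fr f 0 = of_real ((LINT x|torus_measure. f x) / (2 * pi))"
  by (simp add: fr_def fc_def ew_def)

text \<open>At frequency zero a diagonal entry of \<open>mcoef\<close> is half the mean trace plus
  or minus i / 2 times the mean of the entry 21 minus the entry 12. For \<open>\<beta>\<close> the
  real part, and for \<open>\<gamma>\<close> the imaginary part, would give the diagonal of the
  kernel a real part; the next lemma treats the latter.\<close>

lemma mean_trace:
  assumes "smoothm B" "(LINT x|torus_measure. trace (B x)) = 0"
  shows "Re (mcoef B s s 0) = 0"
proof -
  have i: "integrable torus_measure (\<lambda>x. B x $ l $ j)" for l j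
    using assms(1) by (intro integrable_torus_continuous Cinf_torus_continuous) (simp add: smoothm_def)
  have "(LINT x|torus_measure. B x $ 1 $ 1) + (LINT x|torus_measure. B x $ 2 $ 2) = 0"
    using assms(2) by (simp add: trace_def sum_2 i)
  then show ?thesis by (simp add: mcoef_2 fr_0 PJ_def flip: add_divide_distrib)
qed

lemma mean_trace_J:
  assumes "smoothm B" "(LINT x|torus_measure. trace (J_mat ** B x)) = 0"
  shows "Im (mcoef B s s 0) = 0"
proof -
  have J: "J_mat $ 1 $ 1 = 0" "J_mat $ 1 $ 2 = -1" "J_mat $ 2 $ 1 = 1" "J_mat $ 2 $ 2 = 0" by (simp_all add: J_mat_def)
  have i: "integrable torus_measure (\<lambda>x. B x $ l $ j)" for l j
    using assms(1) by (intro integrable_torus_continuous Cinf_torus_continuous) (simp add: smoothm_def)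
  have "(LINT x|torus_measure. B x $ 1 $ 2) = (LINT x|torus_measure. B x $ 2 $ 1)"
    using assms(2) by (simp add: trace_def sum_2 matrix_matrix_mult_def J i)
  then show ?thesis by (simp add: mcoef_2 fr_0 PJ_def)
qed

definition PK :: "(real \<Rightarrow> real \<Rightarrow> real^2^2) \<Rightarrow> (real \<Rightarrow> real \<Rightarrow> real^2^2) \<Rightarrow> real \<Rightarrow> idx \<Rightarrow> idx \<Rightarrow> complex" where
  "PK \<beta> \<gamma> = (\<lambda>t. kA (pk (\<lambda>t. mcoef (\<beta> t)) (\<lambda>t. mcoef (\<gamma> t)) t))"

theorem PK_normal_form:
  assumes \<beta>: "\<And>l j. (\<lambda>t x. \<beta> t x $ l $ j) \<in> Cb1_Cinf" and \<gamma>: "\<And>l j. (\<lambda>t x. \<gamma> t x $ l $ j) \<in> Cb1_Cinf"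
    and tr: "\<And>t. (LINT x|torus_measure. trace (\<beta> t x)) = 0" "\<And>t. (LINT x|torus_measure. trace (J_mat ** \<gamma> t x)) = 0"
  obtains S S' M lam where "normal_form_system (PK \<beta> \<gamma>) S S' M lam"
proof -
  obtain \<beta>' where b: "Cb_mat \<beta>" "Cb_mat \<beta>'" "\<And>l j. has_Cinf_time_derivative (\<lambda>t x. \<beta> t x $ l $ j) (\<lambda>t x. \<beta>' t x $ l $ j)"
    using Cb1_mat[OF \<beta>] by blast
  obtain \<gamma>' where c: "Cb_mat \<gamma>" "Cb_mat \<gamma>'" "\<And>l j. has_Cinf_time_derivative (\<lambda>t x. \<gamma> t x $ l $ j) (\<lambda>t x. \<gamma>' t x $ l $ j)"
    using Cb1_mat[OF \<gamma>] by blast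
  show ?thesis
    using pk_normal_form[OF rapid_Cb_mat[OF b(1)] rapid_Cb_mat[OF c(1)] rapid_Cb_mat[OF b(2)] rapid_Cb_mat[OF c(2)]
      mcoef_derivative[OF b] mcoef_derivative[OF c] mcoef_continuous[OF b(2)] mcoef_continuous[OF c(2)]
      mean_trace[OF Cb_mat_smoothm[OF b(1)] tr(1)] mean_trace_J[OF Cb_mat_smoothm[OF c(1)] tr(2)]] that
    unfolding PK_def by blast
qed

lemma smoothm_const: "smoothm (\<lambda>x. A)" by (simp add: smoothm_def Cinf_torus_const)

lemma rapid_smoothm: "smoothm B \<Longrightarrow> rapid (\<lambda>t::real. mcoef B)"
  using rapid_mcoef[of "\<lambda>t. B"] fr_seminorm_bound unfolding smoothm_def by meson

section \<open>Test functions and the weak formulation\<close>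

lemma smooth_tx_partial:
  assumes "smooth_tx f"
  shows "smooth_tx (partial_t f)" "smooth_tx (partial_x f)"
proof -
  have *: "(\<lambda>(t, x). fold (\<lambda>d. d) ds (d f) t x) differentiable_on UNIV"
    if "ds \<in> lists {partial_t, partial_x}" "d \<in> {partial_t, partial_x}" for d ds
  proof -
    have "d # ds \<in> lists {partial_t, partial_x}" using that by (simp only: Cons_in_lists_iff)
    from assms[unfolded smooth_tx_def, THEN bspec, OF this] show ?thesis by (simp only: fold_simps)
  qed
  show "smooth_tx (partial_t f)" unfolding smooth_tx_def
    by (rule ballI, rule *[where d = partial_t]) simp_all
  show "smooth_tx (partial_x f)" unfolding smooth_tx_def
    by (rule ballI, rule *[where d = partial_x]) simp_all
qed

lemma smooth_tx_differentiable:
  assumes "smooth_tx f"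
  shows "(\<lambda>(t, x). f t x) differentiable (at z)"
  using assms[unfolded smooth_tx_def, THEN bspec, of "[]"] unfolding fold_simps(1) differentiable_on_def by blast

lemma smooth_tx_continuous: "smooth_tx f \<Longrightarrow> continuous_on A (\<lambda>(t, x). f t x)"
  by (rule continuous_at_imp_continuous_on) (blast intro: differentiable_imp_continuous_within smooth_tx_differentiable)

lemma smooth_tx_section_t:
  assumes "smooth_tx f"
  shows "((\<lambda>s. f s x) has_real_derivative partial_t f t x) (at t)"
proof -
  have "(\<lambda>s. (case (s, x) of (t, x) \<Rightarrow> f t x)) differentiable (at t)"
    by (rule differentiable_compose[OF smooth_tx_differentiable[OF assms]]) simp
  then show ?thesis unfolding partial_t_def unfolding prod.case by (rule DERIV_deriv_iff_real_differentiable[THEN iffD2])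
qed

lemma smooth_tx_section_x:
  assumes "smooth_tx f"
  shows "f t differentiable (at x)"
proof -
  have "(\<lambda>y. (case (t, y) of (t, x) \<Rightarrow> f t x)) differentiable (at x)"
    by (rule differentiable_compose[OF smooth_tx_differentiable[OF assms]]) simp
  then show ?thesis by simp
qed

lemma smooth_tx_funpow: "smooth_tx f \<Longrightarrow> smooth_tx ((partial_x ^^ k) f)"
  by (induction k) (auto intro: smooth_tx_partial)

lemma smooth_tx_smooth1: "smooth_tx f \<Longrightarrow> smooth1 (f t)"
  using smooth_tx_section_x[OF smooth_tx_funpow] unfolding smooth1_def
  by (simp add: partial_x_funpow[abs_def])

text \<open>One scalar component of a test function. The support radius is explicit, so that all
  components and derivatives share it and pairings become integrals over one interval.\<close>

definition test1 :: "real \<Rightarrow> (real \<Rightarrow> real \<Rightarrow> real) \<Rightarrow> bool" where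
  "test1 R f \<longleftrightarrow> smooth_tx f \<and> (\<forall>t. torus_periodic (f t)) \<and> (\<forall>t x. R < \<bar>t\<bar> \<longrightarrow> f t x = 0)"

lemma test1D:
  assumes "test1 R f"
  shows "smooth_tx f" "f t \<in> Cinf_torus" "R < \<bar>t\<bar> \<Longrightarrow> f t x = 0" "f t (x + 2 * pi) = f t x"
  using assms smooth_tx_smooth1[of f t] by (auto simp: test1_def Cinf_torus_iff torus_periodic_def)

lemma test1_partial_t:
  assumes f: "test1 R f"
  shows "test1 R (partial_t f)"
  unfolding test1_def
proof (intro conjI allI impI)
  show "torus_periodic (partial_t f t)" for t
    unfolding torus_periodic_def partial_t_def test1D(4)[OF f] by simp
  fix t x assume R: "R < \<bar>t\<bar>"
  have "((\<lambda>s. f s x) has_real_derivative 0) (at t)"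
  proof (rule DERIV_cong_ev[THEN iffD2, OF refl _ refl DERIV_const[of 0]])
    have "open {s. R < \<bar>s\<bar>}" by (intro open_Collect_less continuous_intros)
    then have "\<forall>\<^sub>F s in nhds t. s \<in> {s. R < \<bar>s\<bar>}" using R by (intro eventually_nhds_in_open) auto
    then show "\<forall>\<^sub>F s in nhds t. f s x = 0" by eventually_elim (simp add: test1D(3)[OF f])
  qed
  then show "partial_t f t x = 0" unfolding partial_t_def by (rule DERIV_imp_deriv)
qed (rule smooth_tx_partial[OF test1D(1)[OF f]])

text \<open>A bound uniform in \<open>t\<close> and \<open>x\<close> requires joint continuity of
  the iterated derivatives. Compactness of a rectangle then does the rest, with periodicity in
  \<open>x\<close> and bounded support in \<open>t\<close>.\<close>

lemma test1_bounded:
  assumes f: "test1 R f"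
  shows "\<exists>B. \<forall>t x. \<bar>(deriv ^^ p) (f t) x\<bar> \<le> B"
proof -
  let ?g = "\<lambda>(t, x). (partial_x ^^ p) f t x"
  have "compact (?g ` ({-\<bar>R\<bar>..\<bar>R\<bar>} \<times> {0..2*pi}))"
    by (intro compact_continuous_image smooth_tx_continuous smooth_tx_funpow test1D(1)[OF f] compact_Times) simp_all
  then obtain B where B: "B > 0" "\<And>z. z \<in> {-\<bar>R\<bar>..\<bar>R\<bar>} \<times> {0..2*pi} \<Longrightarrow> norm (?g z) \<le> B"
    using compact_imp_bounded bounded_pos by (metis imageI)
  have "\<bar>(deriv ^^ p) (f t) x\<bar> \<le> B" for t x
  proof (cases "\<bar>t\<bar> \<le> \<bar>R\<bar>")
    case True
    have "torus_periodic ((deriv ^^ p) (f t))" using Cinf_torus_funpow[OF test1D(2)[OF f]] by (simp add: Cinf_torus_iff)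
    then obtain y where "y \<in> {0..2*pi}" "(deriv ^^ p) (f t) x = (deriv ^^ p) (f t) y"
      using torus_periodic_reduce by blast
    then show ?thesis using B(2)[of "(t, y)"] True by (auto simp: partial_x_funpow abs_le_iff)
  next
    case False
    then have "f t = (\<lambda>x. 0)" using test1D(3)[OF f] by auto
    moreover have "(deriv ^^ p) (\<lambda>x. 0) = (\<lambda>x. 0 :: real)" by (induction p) auto
    ultimately show ?thesis using B(1) by simp
  qed
  then show ?thesis by blast
qed

lemma fr_torus_integral:
  assumes "f \<in> Cinf_torus"
  shows "fr f n = integral {0..2*pi} (\<lambda>x. of_real (f x) * ew (- n) x) / (2 * pi)"
  unfolding fr_def fc_def
  by (subst integral_torus) (auto intro!: L2c_integrable_mult L2c_ew L2c_Cinf assms)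

lemma test1_fr_derivative:
  assumes f: "test1 R f"
  shows "((\<lambda>t. fr (f t) n) has_vector_derivative fr (partial_t f t) n) (at t)"
proof -
  note f' = test1_partial_t[OF f]
  have "((\<lambda>t. integral (cbox 0 (2*pi)) (\<lambda>x. of_real (f t x) * ew (- n) x)) has_vector_derivative
      integral (cbox 0 (2*pi)) (\<lambda>x. of_real (partial_t f t x) * ew (- n) x)) (at t within UNIV)"
  proof (rule leibniz_rule_vector_derivative)
    show "((\<lambda>t. of_real (f t x) * ew (- n) x) has_vector_derivative of_real (partial_t f t x) * ew (- n) x) (at t within UNIV)" for t x
      by (intro has_vector_derivative_mult_left has_vector_derivative_of_real smooth_tx_section_t test1D(1)[OF f])
    show "(\<lambda>x. of_real (f t x) * ew (- n) x) integrable_on cbox 0 (2*pi)" for t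
      by (intro integrable_continuous continuous_intros ew_continuous Cinf_torus_continuous test1D(2)[OF f])
    have "continuous_on (UNIV \<times> cbox 0 (2 * pi)) (\<lambda>z. of_real (case z of (t, x) \<Rightarrow> partial_t f t x) * ew (- n) (snd z))"
      by (intro continuous_intros smooth_tx_continuous test1D(1)[OF f'] continuous_on_compose2[OF ew_continuous[of UNIV]]) auto
    then show "continuous_on (UNIV \<times> cbox 0 (2 * pi)) (\<lambda>(t, x). of_real (partial_t f t x) * ew (- n) x)"
      by (simp add: case_prod_unfold)
  qed auto
  then show ?thesis
    unfolding fr_torus_integral[OF test1D(2)[OF f]] fr_torus_integral[OF test1D(2)[OF f']] box_real(2)
    by (rule has_vector_derivative_divide)
qed

definition test2 :: "real \<Rightarrow> (real \<Rightarrow> real \<Rightarrow> real^2) \<Rightarrow> bool" where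
  "test2 R \<phi> \<longleftrightarrow> (\<forall>j. test1 R (\<lambda>t x. \<phi> t x $ j))"

lemma test_functions_test2: "\<phi> \<in> test_functions \<longleftrightarrow> (\<exists>R. test2 R \<phi>)"
proof -
  have a: "(\<forall>t. torus_periodic (\<phi> t)) \<longleftrightarrow> (\<forall>j t. torus_periodic (\<lambda>x. \<phi> t x $ j))"
    unfolding torus_periodic_def vec_eq_iff by blast
  have b: "(\<forall>t x. R < \<bar>t\<bar> \<longrightarrow> \<phi> t x = 0) \<longleftrightarrow> (\<forall>j t x. R < \<bar>t\<bar> \<longrightarrow> \<phi> t x $ j = 0)" for R
    unfolding vec_eq_iff zero_index by blast
  show ?thesis unfolding test_functions_def test2_def test1_def mem_Collect_eq a b by blast
qed

lemma test2_mono: "test2 R \<phi> \<Longrightarrow> R \<le> R' \<Longrightarrow> test2 R' \<phi>"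
  by (auto simp: test2_def test1_def)

lemma test2D:
  assumes "test2 R \<phi>"
  shows "test1 R (\<lambda>t x. \<phi> t x $ j)" "smooth2 (\<phi> t)" "R < \<bar>t\<bar> \<Longrightarrow> \<phi> t x = 0"
  using assms test1D(2) test1D(3)[of R "\<lambda>t x. \<phi> t x $ _" t x] by (auto simp: test2_def smooth2_def vec_eq_iff)

lemma test2_Dt: "test2 R \<phi> \<Longrightarrow> test2 R (Dt \<phi>)"
  unfolding test2_def Dt_def by (simp add: test1_partial_t)

lemma test2_FT_derivative:
  assumes "test2 R \<phi>"
  shows "((\<lambda>t. FT (\<phi> t) i) has_vector_derivative FT (Dt \<phi> t) i) (at t)"
  unfolding FT_fr[OF test2D(2)[OF assms]] FT_fr[OF test2D(2)[OF test2_Dt[OF assms]]]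
  unfolding Dt_def vec_lambda_beta
  by (rule has_vector_derivative_add[OF test1_fr_derivative[OF test2D(1)[OF assms]]
      has_vector_derivative_mult_right[OF test1_fr_derivative[OF test2D(1)[OF assms]]]])

lemma test2_FT_continuous: "test2 R \<phi> \<Longrightarrow> continuous_on A (\<lambda>t. FT (\<phi> t) i)"
  by (rule continuous_at_imp_continuous_on) (use has_vector_derivative_continuous[OF test2_FT_derivative] in blast)

lemma test2_decay:
  assumes "test2 R \<phi>"
  shows "\<exists>D. \<forall>t. tempered (- int p) D (FT (\<phi> t))"
proof -
  obtain Bf where Bf: "\<And>q j t x. \<bar>(deriv ^^ q) (\<lambda>x. \<phi> t x $ j) x\<bar> \<le> Bf q j"
    using test1_bounded[OF test2D(1)[OF assms]] by metis
  define B where "B = Max {Bf 0 1, Bf 0 2, Bf p 1, Bf p 2}"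
  have Bf_le: "Bf q j \<le> B" if "q \<in> {0, p}" for q j
    using that exhaust_2[of j] by (auto simp: B_def)
  have "\<bar>(deriv ^^ q) (\<lambda>y. \<phi> t y $ j) x\<bar> \<le> B" if "q \<in> {0, p}" for q j t x
    by (rule order_trans[OF Bf Bf_le[OF that]])
  from this[of 0] this[of p] show ?thesis using FT_decay[OF test2D(2)[OF assms], of _ B p] by auto
qed

lemma integral_compact_support:
  assumes X: "locint (\<lambda>t. complex_of_real (X t))" and R: "\<And>t. R < \<bar>t\<bar> \<Longrightarrow> X t = 0"
  shows "integrable lebesgue X" "of_real (LINT t|lebesgue. X t) = integral {-R..R} (\<lambda>t. complex_of_real (X t))"
proof -
  have ai: "X absolutely_integrable_on {-R..R}"
    using locintD(1)[OF locint_bounded_linear[OF bounded_linear_Re X]] by simp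
  have e: "(\<lambda>t. indicat_real {-R..R} t *\<^sub>R X t) = X"
    using R by (force simp: indicator_def)
  show i: "integrable lebesgue X" using ai unfolding set_integrable_def e .
  have "(LINT t|lebesgue. X t) = integral {-R..R} X"
    using set_lebesgue_integral_eq_integral(2)[OF ai] unfolding set_lebesgue_integral_def e .
  then show "of_real (LINT t|lebesgue. X t) = integral {-R..R} (\<lambda>t. complex_of_real (X t))"
    using integral_linear[OF set_lebesgue_integral_eq_integral(1)[OF ai] bounded_linear_of_real[where 'a = complex]]
    by (simp add: o_def)
qed

text \<open>The common pattern of all terms of the weak formulation. The test coefficients
  \<open>q\<close> decay by two powers more than the kernel grows, so the series is dominated by
  \<open>H t\<close> over a squared bracket and can be integrated term by term. Local integrability
  of the spatial pairing \<open>X\<close> is a result of this, obtained from the identity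
  \<open>s\<close>.\<close>

lemma kernel_pairing:
  assumes T: "kord (int m) T" "\<And>i j. continuous_on UNIV (\<lambda>t. T t i j)"
    and v: "\<And>j. locint (\<lambda>t. v t j)" "\<And>t. tempered 0 (H t) (v t)" "locint H"
    and q: "\<And>i. continuous_on UNIV (\<lambda>t. q t i)" "\<And>t. tempered (- int (m + 2)) D (q t)"
    and s: "\<And>t. ((\<lambda>i. kapp (T t) (v t) i * cnj (q t i)) has_sum of_real (X t / pi)) UNIV"
    and R: "\<And>t. R < \<bar>t\<bar> \<Longrightarrow> X t = 0"
  shows "integrable lebesgue X"
    and "(\<lambda>N. \<Sum>i\<in>initial N. integral {-R..R} (\<lambda>t. kapp (T t) (v t) i * cnj (q t i)))
      \<longlonglongrightarrow> of_real ((LINT t|lebesgue. X t) / pi)"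
    and "locint (\<lambda>t. kapp (T t) (v t) i * cnj (q t i))"
proof -
  obtain C where C: "C \<ge> 0" "\<And>t x D. tempered 0 D x \<Longrightarrow> tempered (int m + 0) (C * D) (kapp (T t) x)"
    using kapp_tempered[OF T(1), of 0] by blast
  have D: "D \<ge> 0" by (rule tempered_nonneg[OF q(2)])
  have H: "H t \<ge> 0" for t by (rule tempered_nonneg[OF v(2)])
  show li: "locint (\<lambda>t. kapp (T t) (v t) i * cnj (q t i))" for i
    using locint_mult_continuous[OF continuous_on_cnj[OF q(1)] locint_kapp[OF T v]] by (simp add: mult.commute)
  have bd: "norm (kapp (T t) (v t) i * cnj (q t i)) \<le> (C * D) / (jb (fst i))\<^sup>2 * H t" for i t
  proof -
    have "norm (kapp (T t) (v t) i * cnj (q t i)) \<le> (C * H t * jb (fst i) powi (int m + 0)) * (D * jb (fst i) powi (- int (m + 2)))"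
      unfolding norm_mult complex_mod_cnj
      by (intro mult_mono C(2)[OF v(2), unfolded tempered_def, rule_format] q(2)[unfolded tempered_def, rule_format])
        (simp_all add: C(1) H)
    also have "jb (fst i) powi (- int (m + 2)) = inverse (jb (fst i) ^ m * (jb (fst i))\<^sup>2)"
      by (simp only: power_int_minus power_int_of_nat power_add)
    finally show ?thesis by (simp add: field_simps)
  qed
  have sum: "(\<lambda>i::idx. (C * D) / (jb (fst i))\<^sup>2) summable_on UNIV"
    using summable_on_cmult_right[OF jb_summable_idx, of "C * D"] by simp
  note I = infsum_integral[OF li v(3) sum bd, unfolded infsumI[OF s]]
  have "locint (\<lambda>t. of_real pi * (complex_of_real (X t / pi)))" by (rule locint_cmult[OF I(1)])
  then have X: "locint (\<lambda>t. complex_of_real (X t))" by simp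
  note X' = integral_compact_support[OF X R]
  show "integrable lebesgue X" by (rule X'(1))
  have "integral {-R..R} (\<lambda>t. complex_of_real (X t / pi)) = of_real ((LINT t|lebesgue. X t) / pi)"
    using X'(2) by simp
  then show "(\<lambda>N. \<Sum>i\<in>initial N. integral {-R..R} (\<lambda>t. kapp (T t) (v t) i * cnj (q t i)))
      \<longlonglongrightarrow> of_real ((LINT t|lebesgue. X t) / pi)"
    using I(2)[of "-R" R] by simp
qed

lemma kord_id: "kord 0 (\<lambda>t::real. kdiag (\<lambda>i. 1))"
  unfolding kord_def
proof (intro allI exI)
  fix p t and i j :: idx
  show "cmod (kdiag (\<lambda>i. 1) i j) \<le> 1 * jb (fst j) powi 0 / jb (fst i - fst j) ^ p"
    by (simp add: kdiag_def)
qed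

definition Fh :: "(real \<Rightarrow> real^2) \<Rightarrow> idx ell2" where "Fh f = Ell2 (FT f)"

lemma ell2_at_Fh: "f \<in> L2_torus \<Longrightarrow> ell2_at (Fh f) = FT f" by (simp add: Fh_def FT_ell2)

lemma norm_Fh: "f \<in> L2_torus \<Longrightarrow> norm (Fh f) = L2_norm f / sqrt pi" by (simp add: Fh_def FT_ell2)

lemma norm_Fh_diff:
  assumes "f \<in> L2_torus" "g \<in> L2_torus"
  shows "norm (Fh f - Fh g) = L2_norm (\<lambda>x. f x - g x) / sqrt pi"
  using norm_Fh[OF L2_torus_diff[OF assms]] by (simp add: Fh_def Ell2_FT_diff[OF assms])

lemma tempered_FT: "f \<in> L2_torus \<Longrightarrow> tempered 0 (norm (Fh f)) (FT f)"
  using tempered_ell2[of "Fh f"] by (simp add: ell2_at_Fh)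

lemma C_L2_iff:
  "w \<in> C_L2 \<longleftrightarrow> (\<forall>t. w t \<in> L2_torus) \<and> continuous_on UNIV (\<lambda>t. Fh (w t))"
proof (cases "\<forall>t. w t \<in> L2_torus")
  case True
  have "((\<lambda>s. L2_norm (\<lambda>x. w s x - w t x)) \<longlongrightarrow> 0) (at t) \<longleftrightarrow> ((\<lambda>s. Fh (w s)) \<longlongrightarrow> Fh (w t)) (at t)" for t
  proof -
    have e: "(\<lambda>s. norm (Fh (w s) - Fh (w t))) = (\<lambda>s. L2_norm (\<lambda>x. w s x - w t x) / sqrt pi)"
      using norm_Fh_diff True by blast
    have "((\<lambda>s. Fh (w s)) \<longlongrightarrow> Fh (w t)) (at t) \<longleftrightarrow> ((\<lambda>s. L2_norm (\<lambda>x. w s x - w t x) / sqrt pi) \<longlongrightarrow> 0) (at t)"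
      unfolding e[symmetric] tendsto_norm_zero_iff by (rule LIM_zero_iff[symmetric])
    also have "\<dots> \<longleftrightarrow> ((\<lambda>s. L2_norm (\<lambda>x. w s x - w t x)) \<longlongrightarrow> 0) (at t)"
    proof
      assume "((\<lambda>s. L2_norm (\<lambda>x. w s x - w t x) / sqrt pi) \<longlongrightarrow> 0) (at t)"
      from tendsto_mult_right[OF this, of "sqrt pi"] show "((\<lambda>s. L2_norm (\<lambda>x. w s x - w t x)) \<longlongrightarrow> 0) (at t)" by simp
    next
      assume "((\<lambda>s. L2_norm (\<lambda>x. w s x - w t x)) \<longlongrightarrow> 0) (at t)"
      from tendsto_divide[OF this tendsto_const[of "sqrt pi"]]
      show "((\<lambda>s. L2_norm (\<lambda>x. w s x - w t x) / sqrt pi) \<longlongrightarrow> 0) (at t)" by simp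
    qed
    finally show ?thesis by simp
  qed
  then show ?thesis using True by (simp add: C_L2_def continuous_on_def)
qed (auto simp: C_L2_def)

lemma cmod_FT_le: "f \<in> L2_torus \<Longrightarrow> cmod (FT f i) \<le> L2_norm f / sqrt pi"
  using cmod_ell2_at_le[of "Fh f" i] by (simp add: ell2_at_Fh norm_Fh)

text \<open>Taking one coefficient is continuous for the L^2 norm. The simple functions behind
  strong measurability thus give simple functions converging almost everywhere to the coefficient,
  which is therefore measurable and dominated by the integrable norm.\<close>

lemma L1loc_FT:
  assumes h: "h \<in> L1loc_L2"
  shows "locint (\<lambda>t. FT (h t) i)" "locint (\<lambda>t. norm (Fh (h t)))"
proof -
  have hL: "h t \<in> L2_torus" for t using h by (simp add: L1loc_L2_def)
  have ni: "set_integrable lebesgue {a..b} (\<lambda>t. L2_norm (h t))" for a b using h by (simp add: L1loc_L2_def)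
  show nF: "locint (\<lambda>t. norm (Fh (h t)))"
    unfolding locint_def norm_Fh[OF hL] using ni by (intro allI set_integrable_divide)
  obtain s where s: "\<And>n. simple_function lebesgue (s n)" "\<And>n t. s n t \<in> L2_torus"
    "AE t in lebesgue. (\<lambda>n. L2_norm (\<lambda>x. s n t x - h t x)) \<longlonglongrightarrow> 0"
    using h unfolding L1loc_L2_def strongly_measurable_L2_def by blast
  have sm: "(\<lambda>t. FT (s n t) i) \<in> borel_measurable lebesgue" for n
    using borel_measurable_simple_function[OF simple_function_compose1[OF s(1)[of n], of "\<lambda>f. FT f i"]] by (simp add: o_def)
  have ae: "AE t in lebesgue. lim (\<lambda>n. FT (s n t) i) = FT (h t) i"
    using s(3)
  proof eventually_elim
    case (elim t)
    have "(\<lambda>n. FT (s n t) i - FT (h t) i) \<longlonglongrightarrow> 0"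
    proof (rule Lim_null_comparison)
      show "(\<lambda>n. L2_norm (\<lambda>x. s n t x - h t x) / sqrt pi) \<longlonglongrightarrow> 0"
        using tendsto_divide[OF elim tendsto_const[of "sqrt pi"]] by simp
      show "\<forall>\<^sub>F n in sequentially. norm (FT (s n t) i - FT (h t) i) \<le> L2_norm (\<lambda>x. s n t x - h t x) / sqrt pi"
        using cmod_FT_le[OF L2_torus_diff[OF s(2) hL]] by (simp add: FT_diff[OF s(2) hL])
    qed
    then show ?case using LIM_zero_iff limI by blast
  qed
  have "(\<lambda>t. lim (\<lambda>n. FT (s n t) i)) \<in> borel_measurable lebesgue"
    by (rule borel_measurable_lim_metric[OF sm])
  from borel_measurable_AE[OF this ae] have m: "(\<lambda>t. FT (h t) i) \<in> borel_measurable lebesgue" .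
  show "locint (\<lambda>t. FT (h t) i)"
    unfolding locint_def
  proof (intro allI)
    fix a b
    have a: "set_integrable lebesgue {a..b} (\<lambda>t. norm (Fh (h t)))" using nF by (simp add: locint_def)
    have b: "set_borel_measurable lebesgue {a..b} (\<lambda>t. FT (h t) i)"
      unfolding set_borel_measurable_def by (intro borel_measurable_scaleR borel_measurable_indicator m) simp
    have c: "norm (FT (h t) i) \<le> norm (norm (Fh (h t)))" for t
      using cmod_FT_le[OF hL, of t i] by (simp add: norm_Fh[OF hL, symmetric])
    show "(\<lambda>t. FT (h t) i) absolutely_integrable_on {a..b}"
      by (rule set_integrable_bound[OF a b]) (rule AE_I2, rule impI, rule c)
  qed
qed

lemma Dxv_zero: "Dxv m (\<lambda>x. 0) = (\<lambda>x. 0)"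
proof -
  have "(deriv ^^ m) (\<lambda>x. 0 :: real) = (\<lambda>x. 0)" by (induction m) auto
  then show ?thesis by (auto simp: Dxv_def vec_eq_iff)
qed

lemma C_L2D:
  assumes "w \<in> C_L2"
  shows "w t \<in> L2_torus" "continuous_on UNIV (\<lambda>t. Fh (w t))"
    "locint (\<lambda>t. FT (w t) i)" "locint (\<lambda>t. norm (Fh (w t)))"
proof -
  show L: "w t \<in> L2_torus" for t using assms by (simp add: C_L2_iff)
  show c: "continuous_on UNIV (\<lambda>t. Fh (w t))" using assms by (simp add: C_L2_iff)
  show "locint (\<lambda>t. norm (Fh (w t)))" by (intro locint_continuous continuous_on_norm c)
  have "continuous_on UNIV (\<lambda>t. ell2_at (Fh (w t)) i)"
    by (rule bounded_linear.continuous_on[OF bounded_linear_ell2_at c])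
  then show "locint (\<lambda>t. FT (w t) i)" by (simp add: locint_continuous ell2_at_Fh[OF L])
qed

lemma inner_pairing_expansion:
  assumes v: "\<And>t. v t \<in> L2_torus" "\<And>j. locint (\<lambda>t. FT (v t) j)" "locint (\<lambda>t. norm (Fh (v t)))" and \<phi>: "test2 R \<phi>"
  shows "(\<lambda>N. \<Sum>i\<in>initial N. integral {-R..R} (\<lambda>t. FT (v t) i * cnj (FT (\<phi> t) i))) \<longlonglongrightarrow> of_real (pairing v \<phi> / pi)"
    and "locint (\<lambda>t. FT (v t) i * cnj (FT (\<phi> t) i))"
proof -
  obtain D where D: "\<And>t. tempered (- int (0 + 2)) D (FT (\<phi> t))" using test2_decay[OF \<phi>] by blast
  have kc: "continuous_on UNIV (\<lambda>t::real. kdiag (\<lambda>i. 1) i j)" for i j by simp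
  have P: "((\<lambda>i. kapp (kdiag (\<lambda>i. 1)) (FT (v t)) i * cnj (FT (\<phi> t) i)) has_sum
      of_real ((LINT x|torus_measure. v t x \<bullet> \<phi> t x) / pi)) UNIV" for t
    unfolding kapp_kdiag mult_1 by (rule FT_Parseval[OF v(1) smooth2_L2[OF test2D(2)[OF \<phi>]]])
  have Z: "(LINT x|torus_measure. v t x \<bullet> \<phi> t x) = 0" if "R < \<bar>t\<bar>" for t
    using test2D(3)[OF \<phi> that] by simp
  note K = kernel_pairing[of 0 "\<lambda>t. kdiag (\<lambda>i. 1)", OF _ kc v(2) tempered_FT[OF v(1)] v(3) test2_FT_continuous[OF \<phi>] D P Z]
  show "(\<lambda>N. \<Sum>i\<in>initial N. integral {-R..R} (\<lambda>t. FT (v t) i * cnj (FT (\<phi> t) i))) \<longlonglongrightarrow> of_real (pairing v \<phi> / pi)"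
    using K(2) kord_id unfolding pairing_def kapp_kdiag mult_1 by simp
  show "locint (\<lambda>t. FT (v t) i * cnj (FT (\<phi> t) i))"
    using K(3) kord_id unfolding kapp_kdiag mult_1 by simp
qed

lemma dist_mult_expansion:
  assumes B: "rapid (\<lambda>t. mcoef (B t))" "\<And>s s' n. continuous_on UNIV (\<lambda>t. mcoef (B t) s s' n)" "\<And>t. smoothm (B t)"
    and w: "w \<in> C_L2" and \<phi>: "test2 R \<phi>"
  shows "(\<lambda>N. \<Sum>i\<in>initial N. integral {-R..R} (\<lambda>t. kapp (ksym m (mcoef (B t))) (FT (w t)) i * cnj (FT (\<phi> t) i)))
      \<longlonglongrightarrow> of_real (dist_mult B (dist_Dx m w) \<phi> / pi)"
    and "locint (\<lambda>t. kapp (ksym m (mcoef (B t))) (FT (w t)) i * cnj (FT (\<phi> t) i))"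
proof -
  obtain D where D: "\<And>t. tempered (- int (m + 2)) D (FT (\<phi> t))" using test2_decay[OF \<phi>] by blast
  define X where "X t = (-1) ^ m * (LINT x|torus_measure. w t x \<bullet> Dxv m (\<lambda>x. transpose (B t x) *v \<phi> t x) x)" for t
  have kc: "continuous_on UNIV (\<lambda>t. ksym m (mcoef (B t)) i j)" for i j
    unfolding ksym_def by (intro continuous_intros B(2))
  have P: "((\<lambda>i. kapp (ksym m (mcoef (B t))) (FT (w t)) i * cnj (FT (\<phi> t) i)) has_sum of_real (X t / pi)) UNIV" for t
    using spatial_pairing[OF B(3) test2D(2)[OF \<phi>] C_L2D(1)[OF w]] by (simp add: X_def mult.commute)
  have Z: "X t = 0" if "R < \<bar>t\<bar>" for t
    unfolding X_def test2D(3)[OF \<phi> that] by (simp add: Dxv_zero)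
  note K = kernel_pairing[OF kord_ksym[OF B(1)] kc C_L2D(3)[OF w] tempered_FT[OF C_L2D(1)[OF w]] C_L2D(4)[OF w]
      test2_FT_continuous[OF \<phi>] D P Z]
  have "(LINT t|lebesgue. X t) = dist_mult B (dist_Dx m w) \<phi>"
    by (simp add: X_def dist_mult_def dist_Dx_def pairing_def Dx_eq_Dxv)
  then show "(\<lambda>N. \<Sum>i\<in>initial N. integral {-R..R} (\<lambda>t. kapp (ksym m (mcoef (B t))) (FT (w t)) i * cnj (FT (\<phi> t) i)))
      \<longlonglongrightarrow> of_real (dist_mult B (dist_Dx m w) \<phi> / pi)"
    using K(2) by simp
  show "locint (\<lambda>t. kapp (ksym m (mcoef (B t))) (FT (w t)) i * cnj (FT (\<phi> t) i))" by (rule K(3))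
qed

lemma kapp_PK:
  assumes \<beta>: "smoothm (\<beta> t)" and \<gamma>: "smoothm (\<gamma> t)" and x: "tempered 0 D x"
  shows "kapp (PK \<beta> \<gamma> t) x i = kapp (ksym 4 (mcoef (\<lambda>x. J_mat))) x i + kapp (ksym 2 (mcoef (\<beta> t))) x i
      + kapp (ksym 1 (mcoef (\<gamma> t))) x i"
proof -
  have s: "(\<lambda>j. ksym m (mcoef B) i j * x j) summable_on UNIV" if "smoothm B" for m i B
    using kapp_summable[OF kord_ksym[OF rapid_smoothm[OF that]] x] .
  show ?thesis
    unfolding PK_def kA_def kapp_def ksym_J[symmetric] pk_ksym
    by (simp add: distrib_right add.assoc infsum_add s[OF smoothm_const] s[OF \<beta>] s[OF \<gamma>] summable_on_add)
qed

text \<open>If coordinate \<open>i\<close> solves the system, this is minus the derivative of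
  \<open>cnj (q t) * FT (w t) i\<close>. It is formulated for a general scalar \<open>q\<close>, so
  that it covers coefficients of test functions and pure cutoffs in time alike.\<close>

definition weak_term :: "(real \<Rightarrow> real \<Rightarrow> real^2^2) \<Rightarrow> (real \<Rightarrow> real \<Rightarrow> real^2^2) \<Rightarrow> (real \<Rightarrow> real \<Rightarrow> real^2) \<Rightarrow>
    (real \<Rightarrow> real \<Rightarrow> real^2) \<Rightarrow> idx \<Rightarrow> (real \<Rightarrow> complex) \<Rightarrow> (real \<Rightarrow> complex) \<Rightarrow> real \<Rightarrow> complex" where
  "weak_term \<beta> \<gamma> h w i q q' t = (kapp (PK \<beta> \<gamma> t) (FT (w t)) i - FT (h t) i) * cnj (q t) - FT (w t) i * cnj (q' t)"

text \<open>All five terms of the weak formulation converge along the same exhaustion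
  \<open>initial N\<close>, so their limits can be added. Applied to single modes this isolates
  coordinates; applied to a solution of the system every summand vanishes.\<close>

theorem distribution_expansion:
  assumes \<beta>: "Cb_mat \<beta>" and \<gamma>: "Cb_mat \<gamma>" and w: "w \<in> C_L2" and h: "h \<in> L1loc_L2" and \<phi>: "test2 R \<phi>"
  shows "(\<lambda>N. \<Sum>i\<in>initial N. integral {-R..R} (weak_term \<beta> \<gamma> h w i (\<lambda>t. FT (\<phi> t) i) (\<lambda>t. FT (Dt \<phi> t) i)))
      \<longlonglongrightarrow> of_real ((dist_P \<beta> \<gamma> w \<phi> - pairing h \<phi>) / pi)"
proof -
  have hL: "h t \<in> L2_torus" for t using h by (simp add: L1loc_L2_def)
  note E1 = inner_pairing_expansion[OF C_L2D(1,3,4)[OF w] test2_Dt[OF \<phi>]]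
  note E2 = inner_pairing_expansion[OF hL L1loc_FT[OF h] \<phi>]
  have J: "rapid (\<lambda>t::real. mcoef (\<lambda>x. J_mat))" by (rule rapid_smoothm[OF smoothm_const])
  note E3 = dist_mult_expansion[where B = "\<lambda>t x. J_mat", OF J continuous_on_const smoothm_const w \<phi>, where m = 4]
  note E4 = dist_mult_expansion[OF rapid_Cb_mat[OF \<beta>] mcoef_continuous[OF \<beta>] Cb_mat_smoothm[OF \<beta>] w \<phi>, where m = 2]
  note E5 = dist_mult_expansion[OF rapid_Cb_mat[OF \<gamma>] mcoef_continuous[OF \<gamma>] Cb_mat_smoothm[OF \<gamma>] w \<phi>, where m = 1]
  note L = E1(2) E2(2) E3(2) E4(2) E5(2)
  have e: "integral {-R..R} (weak_term \<beta> \<gamma> h w i (\<lambda>t. FT (\<phi> t) i) (\<lambda>t. FT (Dt \<phi> t) i)) =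
      integral {-R..R} (\<lambda>t. kapp (ksym 4 (mcoef (\<lambda>x. J_mat))) (FT (w t)) i * cnj (FT (\<phi> t) i))
      + integral {-R..R} (\<lambda>t. kapp (ksym 2 (mcoef (\<beta> t))) (FT (w t)) i * cnj (FT (\<phi> t) i))
      + integral {-R..R} (\<lambda>t. kapp (ksym 1 (mcoef (\<gamma> t))) (FT (w t)) i * cnj (FT (\<phi> t) i))
      - integral {-R..R} (\<lambda>t. FT (h t) i * cnj (FT (\<phi> t) i))
      - integral {-R..R} (\<lambda>t. FT (w t) i * cnj (FT (Dt \<phi> t) i))" for i
  proof -
    note I = locintD(2)[OF L(1)[of i]] locintD(2)[OF L(2)[of i]] locintD(2)[OF L(3)[of i]] locintD(2)[OF L(4)[of i]] locintD(2)[OF L(5)[of i]]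
    have "weak_term \<beta> \<gamma> h w i (\<lambda>t. FT (\<phi> t) i) (\<lambda>t. FT (Dt \<phi> t) i) = (\<lambda>t.
      kapp (ksym 4 (mcoef (\<lambda>x. J_mat))) (FT (w t)) i * cnj (FT (\<phi> t) i)
      + kapp (ksym 2 (mcoef (\<beta> t))) (FT (w t)) i * cnj (FT (\<phi> t) i)
      + kapp (ksym 1 (mcoef (\<gamma> t))) (FT (w t)) i * cnj (FT (\<phi> t) i)
      - FT (h t) i * cnj (FT (\<phi> t) i)
      - FT (w t) i * cnj (FT (Dt \<phi> t) i))"
      by (auto simp: weak_term_def kapp_PK[OF Cb_mat_smoothm[OF \<beta>] Cb_mat_smoothm[OF \<gamma>] tempered_FT[OF C_L2D(1)[OF w]]] algebra_simps)
    then show ?thesis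
      by (simp only: Henstock_Kurzweil_Integration.integral_diff Henstock_Kurzweil_Integration.integral_add
          integrable_add integrable_diff I)
  qed
  show ?thesis
    unfolding e sum_subtractf sum.distrib
    using tendsto_diff[OF tendsto_diff[OF tendsto_add[OF tendsto_add[OF E3(1) E4(1)] E5(1)] E2(1)] E1(1)]
    by (simp add: dist_P_def dist_Dt_def add_divide_distrib diff_divide_distrib algebra_simps)
qed

lemma weak_term_primitive:
  assumes p: "primitive_of (\<lambda>t. FT (w t) i) (\<lambda>t. FT (h t) i - kapp (PK \<beta> \<gamma> t) (FT (w t)) i)"
    and q: "\<And>t. (q has_vector_derivative q' t) (at t)" "continuous_on UNIV q'"
    and z: "q a = 0" "q b = 0" "a \<le> b"
  shows "integral {a..b} (weak_term \<beta> \<gamma> h w i q q') = 0"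
proof -
  have "primitive_of (\<lambda>t. cnj (q t) * FT (w t) i)
      (\<lambda>t. cnj (q' t) * FT (w t) i + cnj (q t) * (FT (h t) i - kapp (PK \<beta> \<gamma> t) (FT (w t)) i))"
    by (rule primitive_of_mult[OF p has_vector_derivative_cnj[OF q(1)] continuous_on_cnj[OF q(2)]])
  from primitive_ofD(2)[OF primitive_of_uminus[OF this] z(3)] show ?thesis
    using z(1,2) by (simp add: weak_term_def[abs_def] algebra_simps)
qed

section \<open>Bump functions and the du Bois-Reymond lemma\<close>

text \<open>The division by powers makes the family closed under differentiation: the derivative is
  a combination of two later members. Smoothness at the origin then follows by induction from the
  single limit \<open>flat_tendsto\<close>.\<close>

definition flat :: "nat \<Rightarrow> real \<Rightarrow> real" where
  "flat n x = (if 0 < x then exp (- (1 / x)) / x ^ n else 0)"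

lemma flat_tendsto: "(flat n \<longlongrightarrow> 0) (at 0)"
proof -
  have "((\<lambda>x. inverse x ^ n / exp (inverse x)) \<longlongrightarrow> 0) (at_right (0::real))"
    by (rule filterlim_compose[OF tendsto_power_div_exp_0 filterlim_inverse_at_top_right])
  moreover have "\<forall>\<^sub>F x in at_right 0. inverse x ^ n / exp (inverse x) = flat n x"
    unfolding eventually_at_right_field
    by (intro exI[of _ 1]) (simp add: flat_def exp_minus field_simps power_inverse)
  ultimately have "(flat n \<longlongrightarrow> 0) (at_right 0)" by (rule Lim_transform_eventually)
  moreover have "(flat n \<longlongrightarrow> 0) (at_left 0)"
    by (rule Lim_transform_eventually[OF tendsto_const])
      (simp add: eventually_at_left_field flat_def, intro exI[of _ "-1"], simp)
  ultimately show ?thesis by (rule filterlim_split_at_real[rotated])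
qed

lemma flat_DERIV: "(flat n has_real_derivative (flat (n + 2) x - real n * flat (n + 1) x)) (at x)"
proof -
  consider "x > 0" | "x < 0" | "x = 0" by linarith
  then show ?thesis
  proof cases
    case 1
    have "((\<lambda>x. exp (- (1 / x)) / x ^ n) has_real_derivative (flat (n + 2) x - real n * flat (n + 1) x)) (at x)"
      using 1 by (cases n) (auto intro!: derivative_eq_intros simp: flat_def field_simps power2_eq_square, metis One_nat_def power_eq_if)
    then show ?thesis
      by (rule has_field_derivative_transform_within_open[of _ _ _ "{0<..}"]) (use 1 in \<open>auto simp: flat_def\<close>)
  next
    case 2
    have "((\<lambda>x. 0) has_real_derivative (flat (n + 2) x - real n * flat (n + 1) x)) (at x)"
      using 2 by (simp add: flat_def)
    then show ?thesis
      by (rule has_field_derivative_transform_within_open[of _ _ _ "{..<0}"]) (use 2 in \<open>auto simp: flat_def\<close>)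
  next
    case 3
    have "\<forall>\<^sub>F h in at 0. flat (Suc n) h = (flat n (0 + h) - flat n 0) / h"
      unfolding eventually_at by (intro exI[of _ 1]) (auto simp: flat_def)
    from Lim_transform_eventually[OF flat_tendsto this] show ?thesis
      unfolding DERIV_def 3 by (simp add: flat_def)
  qed
qed

lemma times_diff_const: "times_diff k (\<lambda>x. c)"
  using smooth1_const by (simp add: smooth1_iff_times_diff)

lemma times_diff_cmult: "times_diff k f \<Longrightarrow> times_diff k (\<lambda>x. c * f x)"
  by (rule times_diff_mult[OF times_diff_const])

lemma times_diffI:
  assumes "\<And>x. (f has_real_derivative f' x) (at x)"
  shows "times_diff 0 f" "times_diff k f' \<Longrightarrow> times_diff (Suc k) f"
  using assms deriv_eqI[OF assms] by (auto simp: real_differentiable_def)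

lemma smooth1_flat: "smooth1 (flat n)"
proof -
  have "times_diff k (flat n)" for k n
  proof (induction k arbitrary: n)
    case (Suc k)
    have "times_diff k (\<lambda>x. flat (n + 2) x + - real n * flat (n + 1) x)"
      by (intro times_diff_add times_diff_cmult Suc)
    then have "times_diff k (\<lambda>x. flat (n + 2) x - real n * flat (n + 1) x)" by simp
    then show ?case by (rule times_diffI(2)[OF flat_DERIV])
  qed (rule times_diffI(1)[OF flat_DERIV])
  then show ?thesis by (simp add: smooth1_iff_times_diff)
qed

lemma smooth1_primitive:
  assumes "\<And>x. (f has_real_derivative f' x) (at x)" "smooth1 f'"
  shows "smooth1 f"
  unfolding smooth1_iff_times_diff
proof
  fix k show "times_diff k f"
    using times_diffI[OF assms(1)] assms(2) by (cases k) (auto simp: smooth1_iff_times_diff)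
qed

lemma smooth1_affine:
  assumes "smooth1 f"
  shows "smooth1 (\<lambda>x. f (a * x + b))"
proof -
  have "times_diff k (\<lambda>x. f (a * x + b))" if "times_diff k f" for k f
    using that
  proof (induction k arbitrary: f)
    case 0
    have "(f has_real_derivative deriv f (a * x + b)) (at (a * x + b))" for x by (rule times_diff_DERIV[OF 0])
    then have "((\<lambda>x. f (a * x + b)) has_real_derivative deriv f (a * x + b) * a) (at x)" for x
      by (rule DERIV_chain2) (auto intro!: derivative_eq_intros)
    then show ?case by (rule times_diffI(1))
  next
    case (Suc k)
    have "(f has_real_derivative deriv f (a * x + b)) (at (a * x + b))" for x by (rule times_diff_DERIV[OF Suc.prems])
    then have d: "((\<lambda>x. f (a * x + b)) has_real_derivative deriv f (a * x + b) * a) (at x)" for x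
      by (rule DERIV_chain2) (auto intro!: derivative_eq_intros)
    have "((\<lambda>x. f (a * x + b)) has_real_derivative a * deriv f (a * x + b)) (at x)" for x
      by (rule DERIV_cong[OF d mult.commute])
    then show ?case by (rule times_diffI(2)) (use Suc in \<open>auto intro: times_diff_cmult\<close>)
  qed
  then show ?thesis using assms by (simp add: smooth1_iff_times_diff)
qed

lemma smooth1_sin_cos: "smooth1 sin" "smooth1 cos"
proof -
  have "times_diff k sin \<and> times_diff k cos" for k
  proof (induction k)
    case 0 then show ?case using times_diffI(1)[of sin cos] times_diffI(1)[of cos "\<lambda>x. - sin x"] by (auto intro: DERIV_sin DERIV_cos)
  next
    case (Suc k)
    then have "times_diff k (\<lambda>x. - 1 * sin x)" by (intro times_diff_cmult) simp
    then show ?case using Suc times_diffI(2)[of sin cos k] times_diffI(2)[of cos "\<lambda>x. - sin x" k] DERIV_sin DERIV_cos by auto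
  qed
  then show "smooth1 sin" "smooth1 cos" by (auto simp: smooth1_iff_times_diff)
qed

text \<open>The step is the primitive of a bump supported in the unit interval, the product of
  \<open>flat 0\<close> with its reflection. The total mass \<open>c\<close> is not normalized; its
  positivity is all that the comparison of averages uses.\<close>

lemma smooth_step_exists:
  obtains \<psi> \<rho> :: "real \<Rightarrow> real" and c where "smooth1 \<psi>" "\<And>t. (\<psi> has_real_derivative \<rho> t) (at t)" "continuous_on UNIV \<rho>"
    "\<And>t. t \<le> 0 \<Longrightarrow> \<psi> t = 0" "\<And>t. t \<ge> 1 \<Longrightarrow> \<psi> t = c" "\<And>t. \<rho> t \<ge> 0" "\<And>t. t \<notin> {0..1} \<Longrightarrow> \<rho> t = 0" "c > 0"
proof -
  define \<rho> where "\<rho> t = flat 0 t * flat 0 ((-1) * t + 1)" for t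
  have s: "smooth1 \<rho>" unfolding \<rho>_def by (intro smooth1_mult smooth1_affine smooth1_flat)
  have c: "continuous_on A \<rho>" for A by (rule smooth1_continuous[OF s])
  have r: "\<rho> t \<ge> 0" "t \<notin> {0<..<1} \<Longrightarrow> \<rho> t = 0" "t \<in> {0<..<1} \<Longrightarrow> \<rho> t > 0" for t by (auto simp: \<rho>_def flat_def)
  obtain \<psi> where p: "primitive_of \<psi> \<rho>" "\<psi> 0 = 0" using primitive_of_exists[OF locint_continuous[OF c]] by blast
  have d: "(\<psi> has_real_derivative \<rho> t) (at t)" for t
    using primitive_of_derivative[OF p(1) c] by (simp add: has_real_derivative_iff_has_vector_derivative)
  have a1: "\<psi> t = 0" if "t \<le> 0" for t
  proof -
    have "integral {t..0} \<rho> = integral {t..0} (\<lambda>_. 0)"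
      by (rule Henstock_Kurzweil_Integration.integral_cong) (use r(2) in auto)
    then show ?thesis using primitive_ofD(2)[OF p(1) that] p(2) by simp
  qed
  have a2: "\<psi> t = \<psi> 1" if "t \<ge> 1" for t
  proof -
    have "integral {1..t} \<rho> = integral {1..t} (\<lambda>_. 0)"
      by (rule Henstock_Kurzweil_Integration.integral_cong) (use r(2) in auto)
    then show ?thesis using primitive_ofD(2)[OF p(1) that] by simp
  qed
  have a3: "\<psi> 0 < \<psi> 1"
  proof (rule DERIV_pos_imp_increasing_open[where f = \<psi> and a = 0 and b = 1])
    show "continuous_on {0..1} \<psi>" by (rule DERIV_continuous_on) (rule has_field_derivative_at_within[OF d])
    show "\<exists>y. (\<psi> has_real_derivative y) (at x) \<and> 0 < y" if "0 < x" "x < 1" for x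
      using d r(3)[of x] that by auto
  qed simp
  have a4: "\<rho> t = 0" if "t \<notin> {0..1}" for t by (rule r(2)) (use that in auto)
  from a3 have a5: "\<psi> 1 > 0" by (simp add: p(2))
  show ?thesis
    by (rule that[OF smooth1_primitive[OF d s] d c a1 a2 r(1) a4 a5])
qed

text \<open>A test function that rises near \<open>a\<close> and falls near \<open>b\<close> has as
  derivative the difference of two narrow bumps of equal mass. Testing with it says that the
  averages of \<open>d\<close> near the two points agree.\<close>

lemma du_Bois_Reymond_constant:
  fixes d :: "real \<Rightarrow> complex"
  assumes d: "continuous_on UNIV d"
    and z: "\<And>R \<zeta>. smooth1 \<zeta> \<Longrightarrow> (\<And>t. R \<le> \<bar>t\<bar> \<Longrightarrow> \<zeta> t = 0) \<Longrightarrow> integral {-R..R} (\<lambda>t. deriv \<zeta> t *\<^sub>R d t) = 0"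
    and ab: "a < b"
  shows "d a = d b"
proof (rule ccontr)
  obtain \<psi> \<rho> c where \<psi>: "smooth1 \<psi>" "\<And>t. (\<psi> has_real_derivative \<rho> t) (at t)" "continuous_on UNIV \<rho>"
    "\<And>t. t \<le> 0 \<Longrightarrow> \<psi> t = 0" "\<And>t. t \<ge> 1 \<Longrightarrow> \<psi> t = c" "\<And>t. \<rho> t \<ge> 0" "\<And>t. t \<notin> {0..1} \<Longrightarrow> \<rho> t = 0" "c > 0"
    by (rule smooth_step_exists) (rule that)
  assume "d a \<noteq> d b"
  \<comment> \<open>A third of the distance: the two averaging errors together stay below the
    distance of the values, which is the contradiction.\<close>
  define \<eta> where "\<eta> = norm (d a - d b) / 3"
  have \<eta>: "\<eta> > 0" using \<open>d a \<noteq> d b\<close> by (simp add: \<eta>_def)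
  have near: "\<exists>e>0. \<forall>t. \<bar>t - x\<bar> \<le> e \<longrightarrow> norm (d t - d x) \<le> \<eta>" for x
  proof -
    have "isCont d x" using d by (simp add: continuous_on_eq_continuous_at)
    then obtain e where e: "e > 0" "\<And>t. dist t x < e \<Longrightarrow> dist (d t) (d x) < \<eta>"
      using \<eta> unfolding continuous_at_eps_delta by blast
    have "norm (d t - d x) \<le> \<eta>" if "\<bar>t - x\<bar> \<le> e / 2" for t
      using e(2)[of t] that e(1) by (simp add: dist_norm)
    then show ?thesis using e(1) by (intro exI[of _ "e / 2"]) auto
  qed
  obtain ea eb where ea: "ea > 0" "\<And>t. \<bar>t - a\<bar> \<le> ea \<Longrightarrow> norm (d t - d a) \<le> \<eta>"
    and eb: "eb > 0" "\<And>t. \<bar>t - b\<bar> \<le> eb \<Longrightarrow> norm (d t - d b) \<le> \<eta>" using near[of a] near[of b] by blast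
  define e where "e = min ea eb"
  have e: "e > 0" "e \<le> ea" "e \<le> eb" using ea eb by (auto simp: e_def)
  define R where "R = \<bar>a\<bar> + \<bar>b\<bar> + e"
  define st where "st x t = \<psi> (inverse e * t + - (x * inverse e))" for x t
  define rt where "rt x t = \<rho> (inverse e * t + - (x * inverse e)) * inverse e" for x t
  have arg: "inverse e * t + - (x * inverse e) = (t - x) / e" for t x by (simp add: divide_inverse algebra_simps)
  have st_s: "smooth1 (st x)" for x unfolding st_def by (rule smooth1_affine[OF \<psi>(1)])
  have st_d: "(st x has_real_derivative rt x t) (at t)" for x t
    unfolding st_def rt_def by (rule DERIV_chain2[OF \<psi>(2)]) (auto intro!: derivative_eq_intros)
  have st0: "st x t = 0" if "t \<le> x" for x t
    unfolding st_def arg using that e by (intro \<psi>(4)) (simp add: divide_le_0_iff)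
  have st1: "st x t = c" if "x + e \<le> t" for x t
    unfolding st_def arg using that e by (intro \<psi>(5)) simp
  have rt0: "rt x t = 0" if "t \<notin> {x..x+e}" for x t
  proof -
    have "(t - x) / e \<notin> {0..1}" using that e by (auto simp: field_simps)
    then show ?thesis unfolding rt_def arg by (simp add: \<psi>(7))
  qed
  have rt_c: "continuous_on A (rt x)" for A x
    unfolding rt_def by (intro continuous_intros continuous_on_compose2[OF \<psi>(3)]) auto
  have rt_pos: "rt x t \<ge> 0" for x t unfolding rt_def using \<psi>(6) e by simp
  have near_mean: "norm (integral {-R..R} (\<lambda>t. rt x t *\<^sub>R d t) - c *\<^sub>R d x) \<le> \<eta> * c"
    if x: "x \<in> {a, b}" and dx: "\<And>t. \<bar>t - x\<bar> \<le> e \<Longrightarrow> norm (d t - d x) \<le> \<eta>" for x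
  proof -
    have "((rt x) has_integral (st x R - st x (- R))) {-R..R}"
      by (rule fundamental_theorem_of_calculus)
        (use e in \<open>auto simp: R_def has_real_derivative_iff_has_vector_derivative[symmetric] intro: has_field_derivative_at_within st_d\<close>)
    moreover have "st x R = c" "st x (-R) = 0" using x e by (auto intro!: st0 st1 simp: R_def)
    ultimately have I: "(rt x has_integral c) {-R..R}" by simp
    have "((\<lambda>t. rt x t *\<^sub>R d x) has_integral c *\<^sub>R d x) {-R..R}" by (rule has_integral_scaleR_left[OF I])
    moreover have di: "(\<lambda>t. rt x t *\<^sub>R d t) integrable_on {-R..R}"
      by (intro integrable_continuous_interval continuous_intros rt_c continuous_on_subset[OF d]) auto
    ultimately have "((\<lambda>t. rt x t *\<^sub>R d t - rt x t *\<^sub>R d x) has_integral (integral {-R..R} (\<lambda>t. rt x t *\<^sub>R d t) - c *\<^sub>R d x)) {-R..R}"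
      by (intro has_integral_diff integrable_integral)
    then have D: "((\<lambda>t. rt x t *\<^sub>R (d t - d x)) has_integral (integral {-R..R} (\<lambda>t. rt x t *\<^sub>R d t) - c *\<^sub>R d x)) {-R..R}"
      by (simp add: scaleR_diff_right)
    have "norm (rt x t *\<^sub>R (d t - d x)) \<le> \<eta> * rt x t" for t
    proof (cases "t \<in> {x..x+e}")
      case True
      then have "norm (d t - d x) \<le> \<eta>" by (intro dx) auto
      from mult_left_mono[OF this rt_pos[of x t]] show ?thesis using rt_pos[of x t] by (simp add: mult.commute)
    qed (simp add: rt0)
    then have "norm (integral {-R..R} (\<lambda>t. rt x t *\<^sub>R (d t - d x))) \<le> integral {-R..R} (\<lambda>t. \<eta> * rt x t)"
      using D has_integral_mult_right[OF I, of \<eta>] by (intro integral_norm_bound_integral) (auto simp: has_integral_integrable)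
    then show ?thesis unfolding integral_unique[OF D] integral_unique[OF has_integral_mult_right[OF I, of \<eta>]] .
  qed
  \<comment> \<open>Both steps have the same height, so their difference vanishes for large positive
    times as well and has compact support.\<close>
  define \<zeta> where "\<zeta> t = st a t + (-1) * st b t" for t
  have \<zeta>s: "smooth1 \<zeta>" unfolding \<zeta>_def by (intro smooth1_add smooth1_mult smooth1_const st_s)
  have "(\<zeta> has_real_derivative (rt a t + (-1) * rt b t)) (at t)" for t
    unfolding \<zeta>_def by (intro DERIV_add DERIV_cmult st_d)
  then have \<zeta>d: "deriv \<zeta> = (\<lambda>t. rt a t + (-1) * rt b t)" by (rule deriv_eqI)
  have "\<zeta> t = 0" if "R \<le> \<bar>t\<bar>" for t
  proof (cases "t \<ge> 0")
    case True
    then have "st a t = c" "st b t = c" using that e ab by (auto intro!: st1 simp: R_def)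
    then show ?thesis by (simp add: \<zeta>_def)
  next
    case False
    then have "st a t = 0" "st b t = 0" using that e ab by (auto intro!: st0 simp: R_def)
    then show ?thesis by (simp add: \<zeta>_def)
  qed
  from z[where R = R and \<zeta> = \<zeta>, OF \<zeta>s this] have "integral {-R..R} (\<lambda>t. rt a t *\<^sub>R d t - rt b t *\<^sub>R d t) = 0"
    unfolding \<zeta>d by (simp add: scaleR_diff_left)
  then have eq: "integral {-R..R} (\<lambda>t. rt a t *\<^sub>R d t) = integral {-R..R} (\<lambda>t. rt b t *\<^sub>R d t)"
    by (subst (asm) Henstock_Kurzweil_Integration.integral_diff)
      (auto intro!: integrable_continuous_interval continuous_intros rt_c continuous_on_subset[OF d])
  have "norm (c *\<^sub>R d a - c *\<^sub>R d b) \<le> \<eta> * c + \<eta> * c"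
  proof -
    let ?I = "integral {-R..R} (\<lambda>t. rt b t *\<^sub>R d t)"
    have "norm (?I - c *\<^sub>R d a) \<le> \<eta> * c" using near_mean[of a] ea(2) e(2) unfolding eq by simp
    moreover have "norm (?I - c *\<^sub>R d b) \<le> \<eta> * c" using near_mean[of b] eb(2) e(3) by simp
    ultimately show ?thesis using norm_triangle_ineq4[of "?I - c *\<^sub>R d b" "?I - c *\<^sub>R d a"] by simp
  qed
  then show False
    using \<psi>(8) \<eta> by (simp add: scaleR_diff_right[symmetric] \<eta>_def mult.commute)
qed

text \<open>Subtracting a primitive \<open>G\<close> of \<open>r\<close> and integrating by parts
  turns the condition into one on \<open>g - G\<close> with no zeroth order term, so that function
  is constant.\<close>

lemma du_Bois_Reymond:
  fixes g r :: "real \<Rightarrow> complex"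
  assumes g: "continuous_on UNIV g" and r: "locint r"
    and z: "\<And>R \<zeta>. smooth1 \<zeta> \<Longrightarrow> (\<And>t. R \<le> \<bar>t\<bar> \<Longrightarrow> \<zeta> t = 0) \<Longrightarrow>
      integral {-R..R} (\<lambda>t. deriv \<zeta> t *\<^sub>R g t + \<zeta> t *\<^sub>R r t) = 0"
  shows "primitive_of g r"
proof -
  obtain G where G: "primitive_of G r" using primitive_of_exists[OF r] by blast
  have Gc: "continuous_on UNIV G" by (rule primitive_of_continuous[OF G])
  have "g a - G a = g b - G b" if "a < b" for a b
  proof (rule du_Bois_Reymond_constant[of "\<lambda>t. g t - G t"])
    show "continuous_on UNIV (\<lambda>t. g t - G t)" by (intro continuous_intros g Gc)
    fix R :: real and \<zeta> assume s: "smooth1 \<zeta>" and supp: "\<And>t. R \<le> \<bar>t\<bar> \<Longrightarrow> \<zeta> t = 0"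
    have \<zeta>d: "((\<lambda>t. complex_of_real (\<zeta> t)) has_vector_derivative of_real (deriv \<zeta> t)) (at t)" for t
      by (rule has_vector_derivative_of_real[OF smooth1_DERIV[OF s]])
    have c': "continuous_on UNIV (\<lambda>t. complex_of_real (deriv \<zeta> t))"
      by (intro continuous_intros smooth1_continuous smooth1_deriv s)
    note P = primitive_of_mult[OF G \<zeta>d c']
    have cA: "continuous_on A \<zeta>" "continuous_on A (deriv \<zeta>)" for A by (intro smooth1_continuous smooth1_deriv s)+
    have i1: "(\<lambda>t. deriv \<zeta> t *\<^sub>R g t) integrable_on {-R..R}" "(\<lambda>t. deriv \<zeta> t *\<^sub>R G t) integrable_on {-R..R}"
      by (intro integrable_continuous_interval continuous_intros cA continuous_on_subset[OF g] continuous_on_subset[OF Gc]; simp)+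
    have i2: "(\<lambda>t. \<zeta> t *\<^sub>R r t) integrable_on {-R..R}"
      using locintD(2)[OF locint_mult_continuous[of "\<lambda>t. complex_of_real (\<zeta> t)", OF _ r]] cA
      by (simp add: scaleR_conv_of_real continuous_on_of_real)
    have "integral {-R..R} (\<lambda>t. deriv \<zeta> t *\<^sub>R G t + \<zeta> t *\<^sub>R r t) = 0"
    proof (cases "0 \<le> R")
      case True
      then show ?thesis
        using primitive_ofD(2)[OF P, of "-R" R] supp[of R] supp[of "-R"] by (simp add: scaleR_conv_of_real)
    qed simp
    then have e1: "integral {-R..R} (\<lambda>t. deriv \<zeta> t *\<^sub>R G t) + integral {-R..R} (\<lambda>t. \<zeta> t *\<^sub>R r t) = 0"
      by (simp add: Henstock_Kurzweil_Integration.integral_add i1 i2)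
    have e2: "integral {-R..R} (\<lambda>t. deriv \<zeta> t *\<^sub>R g t) + integral {-R..R} (\<lambda>t. \<zeta> t *\<^sub>R r t) = 0"
      using z[where R = R and \<zeta> = \<zeta>, OF s supp] by (simp add: Henstock_Kurzweil_Integration.integral_add i1 i2)
    show "integral {-R..R} (\<lambda>t. deriv \<zeta> t *\<^sub>R (g t - G t)) = 0"
      using add_right_imp_eq[OF trans[OF e2 e1[symmetric]]]
      by (simp add: scaleR_diff_right Henstock_Kurzweil_Integration.integral_diff i1)
  qed (rule that)
  then have "g t - G t = g 0 - G 0" for t by (cases t "0::real" rule: linorder_cases) auto
  then have "g = (\<lambda>t. G t + (g 0 - G 0))" by (auto simp: fun_eq_iff algebra_simps)
  then show ?thesis using primitive_of_add[OF G primitive_of_const, of "g 0 - G 0"] by simp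
qed

section \<open>Well-posedness\<close>

lemma partial_product:
  assumes "smooth1 p" "smooth1 q"
  shows "partial_t (\<lambda>t x. p t * q x) = (\<lambda>t x. deriv p t * q x)" "partial_x (\<lambda>t x. p t * q x) = (\<lambda>t x. p t * deriv q x)"
  unfolding partial_t_def partial_x_def fun_eq_iff
  by (auto intro!: DERIV_imp_deriv DERIV_cmult DERIV_cmult_right smooth1_DERIV assms)

text \<open>Products of a function of time and a function of space are closed under both partial
  derivatives, so the induction over words of derivatives stays inside this class.\<close>

lemma smooth_tx_product:
  assumes "smooth1 p" "smooth1 q"
  shows "smooth_tx (\<lambda>t x. p t * q x)"
  unfolding smooth_tx_def
proof
  fix ds assume "ds \<in> lists {partial_t, partial_x}"
  then have "\<exists>p' q'. smooth1 p' \<and> smooth1 q' \<and> fold (\<lambda>d. d) ds (\<lambda>t x. p t * q x) = (\<lambda>t x. p' t * q' x)"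
    using assms
  proof (induction ds arbitrary: p q)
    case (Cons d ds)
    from Cons.hyps(1) consider "d = partial_t" | "d = partial_x" by blast
    then show ?case
    proof cases
      case 1
      show ?thesis unfolding 1 fold_simps partial_product[OF Cons.prems] by (intro Cons.IH smooth1_deriv Cons.prems)
    next
      case 2
      show ?thesis unfolding 2 fold_simps partial_product[OF Cons.prems] by (intro Cons.IH smooth1_deriv Cons.prems)
    qed
  qed auto
  then obtain p' q' where pq: "smooth1 p'" "smooth1 q'" "fold (\<lambda>d. d) ds (\<lambda>t x. p t * q x) = (\<lambda>t x. p' t * q' x)" by blast
  have d: "f differentiable (at x)" if "smooth1 f" for f x
    using smooth1_DERIV[OF that] by (auto simp: real_differentiable_def)
  have "(\<lambda>z. p' (fst z) * q' (snd z)) differentiable (at z)" for z :: "real \<times> real"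
    by (intro differentiable_mult differentiable_compose[OF d[OF pq(1)]] differentiable_compose[OF d[OF pq(2)]]
        bounded_linear_imp_differentiable bounded_linear_fst bounded_linear_snd)
  then have "(\<lambda>z. p' (fst z) * q' (snd z)) differentiable_on UNIV" by (simp add: differentiable_on_def)
  then show "(\<lambda>(t, x). fold (\<lambda>d. d) ds (\<lambda>t x. p t * q x) t x) differentiable_on UNIV"
    unfolding pq(3) by (simp add: case_prod_unfold)
qed

text \<open>The real field whose complex coordinate for the sign \<open>True\<close> is
  \<open>\<zeta> t\<close> times \<open>c * ew k x\<close>. Being real, it also excites the mirrored
  index \<open>(- k, False)\<close>, with the conjugate amplitude.\<close>

definition mode :: "complex \<Rightarrow> int \<Rightarrow> (real \<Rightarrow> real) \<Rightarrow> real \<Rightarrow> real \<Rightarrow> real^2" where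
  "mode c k \<zeta> t x = (\<chi> j. \<zeta> t * (if j = 1 then Re (c * ew k x) else Im (c * ew k x)))"

lemma ew_Re_Im: "Re (ew k x) = cos (of_int k * x)" "Im (ew k x) = sin (of_int k * x)"
  by (simp_all add: ew_def Re_exp Im_exp)

lemma smooth1_mode: "smooth1 (\<lambda>x. Re (c * ew k x))" "smooth1 (\<lambda>x. Im (c * ew k x))"
proof -
  have sc: "smooth1 (\<lambda>x. cos (of_int k * x))" "smooth1 (\<lambda>x. sin (of_int k * x))"
    using smooth1_affine[OF smooth1_sin_cos(2), of "of_int k" 0] smooth1_affine[OF smooth1_sin_cos(1), of "of_int k" 0] by simp_all
  have "smooth1 (\<lambda>x. Re c * cos (of_int k * x) + - Im c * sin (of_int k * x))"
    "smooth1 (\<lambda>x. Re c * sin (of_int k * x) + Im c * cos (of_int k * x))"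
    by (intro smooth1_add smooth1_mult smooth1_const sc)+
  then show "smooth1 (\<lambda>x. Re (c * ew k x))" "smooth1 (\<lambda>x. Im (c * ew k x))"
    by (simp_all add: ew_Re_Im)
qed

lemma mode_test2:
  assumes "smooth1 \<zeta>" "\<And>t. R \<le> \<bar>t\<bar> \<Longrightarrow> \<zeta> t = 0"
  shows "test2 R (mode c k \<zeta>)"
  unfolding test2_def test1_def
proof (intro allI conjI impI)
  fix j :: 2
  show "smooth_tx (\<lambda>t x. mode c k \<zeta> t x $ j)"
  proof (cases "j = 1")
    case True
    then show ?thesis using smooth_tx_product[OF assms(1) smooth1_mode(1)] by (simp add: mode_def)
  next
    case False
    then show ?thesis using smooth_tx_product[OF assms(1) smooth1_mode(2)] by (simp add: mode_def)
  qed
  show "torus_periodic (\<lambda>x. mode c k \<zeta> t x $ j)" for t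
    unfolding torus_periodic_def mode_def ew_periodic by simp
  show "mode c k \<zeta> t x $ j = 0" if "R < \<bar>t\<bar>" for t x using assms(2)[of t] that by (simp add: mode_def)
qed

lemma Dt_mode:
  assumes "smooth1 \<zeta>"
  shows "Dt (mode c k \<zeta>) = mode c k (deriv \<zeta>)"
proof (intro ext)
  fix t x
  have "partial_t (\<lambda>s y. mode c k \<zeta> s y $ j) t x = mode c k (deriv \<zeta>) t x $ j" for j
    using partial_product(1)[OF assms smooth1_mode(1)] partial_product(1)[OF assms smooth1_mode(2)]
    by (cases "j = 1") (simp_all add: mode_def)
  then show "Dt (mode c k \<zeta>) t x = mode c k (deriv \<zeta>) t x" by (simp add: Dt_def vec_eq_iff)
qed

lemma FT_mode:
  "FT (mode c k \<zeta> t) (n, s) = of_real (\<zeta> t) * (if n = (if s then k else - k) then (if s then c else cnj c) else 0)"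
proof -
  have "cp s (mode c k \<zeta> t) x = (of_real (\<zeta> t) * (if s then c else cnj c)) * ew (if s then k else - k) x" for x
  proof -
    let ?z = "c * ew k x"
    have "cp s (mode c k \<zeta> t) x = of_real (\<zeta> t) * (of_real (Re ?z) + (if s then \<i> else - \<i>) * of_real (Im ?z))"
      by (simp add: cp_def mode_def PJ_def algebra_simps del: complex_cnj_mult times_complex.sel)
    also have "of_real (Re ?z) + (if s then \<i> else - \<i>) * of_real (Im ?z) = (if s then ?z else cnj ?z)"
      by (auto simp: complex_eq_iff)
    finally show ?thesis by (simp add: ew_cnj)
  qed
  then have "cp s (mode c k \<zeta> t) = (\<lambda>x. (of_real (\<zeta> t) * (if s then c else cnj c)) * ew (if s then k else - k) x)" by blast
  then show ?thesis by (simp add: FT_def fc_cmult fc_ew)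
qed

lemma initial_sum_limit:
  fixes f :: "'i::countable \<Rightarrow> complex"
  assumes l: "(\<lambda>N. \<Sum>i\<in>initial N. f i) \<longlonglongrightarrow> L" and F: "finite F" "\<And>i. i \<notin> F \<Longrightarrow> f i = 0"
  shows "L = sum f F"
proof -
  have h: "(f has_sum sum f F) UNIV" using has_sum_finiteI[OF F(1) refl, of f] F(2)
    by (subst has_sum_cong_neutral[where T = F]) auto
  show ?thesis
    using LIMSEQ_unique[OF l infsum_initial_tendsto[OF has_sum_imp_summable[OF h]]] infsumI[OF h] by simp
qed

lemma kapp_FT_locint:
  assumes "kord 4 (PK \<beta> \<gamma>)" "\<And>i j. continuous_on UNIV (\<lambda>t. PK \<beta> \<gamma> t i j)" "w \<in> C_L2"
  shows "locint (\<lambda>t. kapp (PK \<beta> \<gamma> t) (FT (w t)) i)"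
  by (rule locint_kapp[OF assms(1,2) C_L2D(3)[OF assms(3)] tempered_FT[OF C_L2D(1)[OF assms(3)]] C_L2D(4)[OF assms(3)]])

theorem weak_imp_system:
  assumes \<beta>: "Cb_mat \<beta>" and \<gamma>: "Cb_mat \<gamma>" and K: "kord 4 (PK \<beta> \<gamma>)" "\<And>i j. continuous_on UNIV (\<lambda>t. PK \<beta> \<gamma> t i j)"
    and w: "w \<in> C_L2" and h: "h \<in> L1loc_L2" and eq: "\<And>\<phi>. \<phi> \<in> test_functions \<Longrightarrow> dist_P \<beta> \<gamma> w \<phi> = pairing h \<phi>"
  shows "solves_system (PK \<beta> \<gamma>) (\<lambda>t. Fh (h t)) (\<lambda>t. Fh (w t))"
proof -
  have hL: "h t \<in> L2_torus" for t using h by (simp add: L1loc_L2_def)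
  define W where "W \<zeta> R i = integral {-R..R} (weak_term \<beta> \<gamma> h w i (\<lambda>t. of_real (\<zeta> t)) (\<lambda>t. of_real (deriv \<zeta> t)))" for \<zeta> i R
  have W0: "W \<zeta> R i = 0" if s: "smooth1 \<zeta>" and supp: "\<And>t. R \<le> \<bar>t\<bar> \<Longrightarrow> \<zeta> t = 0" for \<zeta> R i
  proof -
    \<comment> \<open>Real test fields see the two mirrored coordinates only in this combination.
      One amplitude enters conjugated and the other does not, so the choices 1 and
      \<open>\<i>\<close> for \<open>c\<close> give the sum and the difference, and both coordinates
      vanish.\<close>
    have lin: "cnj c * W \<zeta> R (k, True) + c * W \<zeta> R (- k, False) = 0" for c k
    proof -
      let ?\<phi> = "mode c k \<zeta>"
      let ?e = "\<lambda>i. if fst i = (if snd i then k else - k) then (if snd i then c else cnj c) else 0"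
      have t: "test2 R ?\<phi>" by (rule mode_test2[OF s supp])
      then have "dist_P \<beta> \<gamma> w ?\<phi> = pairing h ?\<phi>" using eq test_functions_test2 by blast
      moreover have FTm: "FT (mode c k \<xi> t) i = of_real (\<xi> t) * ?e i" for \<xi> t i
        using FT_mode[of c k \<xi> t "fst i" "snd i"] by simp
      have "weak_term \<beta> \<gamma> h w i (\<lambda>t. FT (?\<phi> t) i) (\<lambda>t. FT (Dt ?\<phi> t) i) =
          (\<lambda>t. cnj (?e i) * weak_term \<beta> \<gamma> h w i (\<lambda>t. of_real (\<zeta> t)) (\<lambda>t. of_real (deriv \<zeta> t)) t)" for i
        unfolding weak_term_def[abs_def] Dt_mode[OF s] FTm complex_cnj_mult complex_cnj_complex_of_real
        by (simp only: algebra_simps)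
      then have "integral {-R..R} (weak_term \<beta> \<gamma> h w i (\<lambda>t. FT (?\<phi> t) i) (\<lambda>t. FT (Dt ?\<phi> t) i)) = cnj (?e i) * W \<zeta> R i" for i
        unfolding W_def by simp
      ultimately have lim: "(\<lambda>N. \<Sum>i\<in>initial N. cnj (?e i) * W \<zeta> R i) \<longlonglongrightarrow> 0"
        using distribution_expansion[OF \<beta> \<gamma> w h t] by simp
      have "0 = (\<Sum>i\<in>{(k, True), (- k, False)}. cnj (?e i) * W \<zeta> R i)"
        by (rule initial_sum_limit[OF lim]) (auto split: if_splits)
      then show ?thesis by simp
    qed
    have a: "W \<zeta> R (k, True) + W \<zeta> R (- k, False) = 0" for k using lin[of 1 k] by simp
    have b: "W \<zeta> R (- k, False) - W \<zeta> R (k, True) = 0" for k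
    proof -
      have "\<i> * (W \<zeta> R (- k, False) - W \<zeta> R (k, True)) = 0" using lin[of \<i> k] by (simp add: algebra_simps)
      then show ?thesis by simp
    qed
    have "W \<zeta> R (k, True) = 0 \<and> W \<zeta> R (- k, False) = 0" for k
    proof -
      have e: "W \<zeta> R (- k, False) = W \<zeta> R (k, True)" using b[of k] by simp
      then have "2 * W \<zeta> R (k, True) = 0" using a[of k] by simp
      then show ?thesis using e by simp
    qed
    from this[of "fst i"] this[of "- fst i"] show ?thesis by (cases i; cases "snd i") auto
  qed
  have "primitive_of (\<lambda>t. FT (w t) i) (\<lambda>t. FT (h t) i - kapp (PK \<beta> \<gamma> t) (FT (w t)) i)" for i
  proof (rule du_Bois_Reymond)
    show "continuous_on UNIV (\<lambda>t. FT (w t) i)"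
      using bounded_linear.continuous_on[OF bounded_linear_ell2_at C_L2D(2)[OF w], of i] by (simp add: ell2_at_Fh[OF C_L2D(1)[OF w]])
    show "locint (\<lambda>t. FT (h t) i - kapp (PK \<beta> \<gamma> t) (FT (w t)) i)"
      by (intro locint_diff L1loc_FT[OF h] kapp_FT_locint K w)
    fix R :: real and \<zeta> assume s: "smooth1 \<zeta>" and supp: "\<And>t. R \<le> \<bar>t\<bar> \<Longrightarrow> \<zeta> t = 0"
    have "(\<lambda>t. deriv \<zeta> t *\<^sub>R FT (w t) i + \<zeta> t *\<^sub>R (FT (h t) i - kapp (PK \<beta> \<gamma> t) (FT (w t)) i)) =
        (\<lambda>t. - weak_term \<beta> \<gamma> h w i (\<lambda>t. of_real (\<zeta> t)) (\<lambda>t. of_real (deriv \<zeta> t)) t)"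
      by (simp add: weak_term_def scaleR_conv_of_real algebra_simps)
    then show "integral {-R..R} (\<lambda>t. deriv \<zeta> t *\<^sub>R FT (w t) i + \<zeta> t *\<^sub>R (FT (h t) i - kapp (PK \<beta> \<gamma> t) (FT (w t)) i)) = 0"
      using W0[where \<zeta> = \<zeta> and R = R, OF s supp, of i] by (simp add: W_def)
  qed
  then show ?thesis
    unfolding solves_system_def by (simp add: C_L2D(2)[OF w] ell2_at_Fh[OF hL] ell2_at_Fh[OF C_L2D(1)[OF w]])
qed

theorem system_imp_weak:
  assumes \<beta>: "Cb_mat \<beta>" and \<gamma>: "Cb_mat \<gamma>" and w: "w \<in> C_L2" and h: "h \<in> L1loc_L2"
    and sol: "solves_system (PK \<beta> \<gamma>) (\<lambda>t. Fh (h t)) (\<lambda>t. Fh (w t))" and \<phi>: "\<phi> \<in> test_functions"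
  shows "dist_P \<beta> \<gamma> w \<phi> = pairing h \<phi>"
proof -
  have hL: "h t \<in> L2_torus" for t using h by (simp add: L1loc_L2_def)
  obtain R0 where R0: "test2 R0 \<phi>" using \<phi> test_functions_test2 by blast
  \<comment> \<open>The support condition says nothing at \<open>\<bar>t\<bar> = R0\<close> itself.
    With the radius enlarged, the test function vanishes at both end points, as the integration by
    parts requires.\<close>
  define R where "R = \<bar>R0\<bar> + 1"
  have R: "test2 R \<phi>" by (rule test2_mono[OF R0]) (simp add: R_def)
  have z: "FT (\<phi> t) i = 0" if "\<bar>t\<bar> = R" for t i
  proof -
    have "\<phi> t = (\<lambda>x. 0)" using test2D(3)[OF R0, of t] that by (auto simp: R_def)
    then show ?thesis using FT_fr[OF test2D(2)[OF R, of t], of i] by (simp add: fr_const)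
  qed
  have "integral {-R..R} (weak_term \<beta> \<gamma> h w i (\<lambda>t. FT (\<phi> t) i) (\<lambda>t. FT (Dt \<phi> t) i)) = 0" for i
  proof (rule weak_term_primitive)
    show "primitive_of (\<lambda>t. FT (w t) i) (\<lambda>t. FT (h t) i - kapp (PK \<beta> \<gamma> t) (FT (w t)) i)"
      using solves_systemD(2)[OF sol, of i] by (simp add: ell2_at_Fh[OF hL] ell2_at_Fh[OF C_L2D(1)[OF w]])
    show "FT (\<phi> (- R)) i = 0" "FT (\<phi> R) i = 0" by (rule z, simp add: R_def)+
  qed (simp_all add: test2_FT_derivative[OF R] test2_FT_continuous[OF test2_Dt[OF R]] R_def)
  with distribution_expansion[OF \<beta> \<gamma> w h R] have "(\<lambda>N::nat. 0) \<longlonglongrightarrow> complex_of_real ((dist_P \<beta> \<gamma> w \<phi> - pairing h \<phi>) / pi)" by simp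
  from LIMSEQ_unique[OF this tendsto_const] show ?thesis by simp
qed

section \<open>Reality of the solution\<close>

definition rfl :: "idx \<Rightarrow> idx" where "rfl i = (- fst i, \<not> snd i)"

lemma rfl_rfl: "rfl (rfl i) = i" by (simp add: rfl_def)

lemma bij_rfl: "bij_betw rfl UNIV UNIV" by (rule bij_betwI[of _ _ _ rfl]) (auto simp: rfl_rfl)

text \<open>Its fixed points are the coefficients of real vector fields.\<close>

definition conj_ell2 :: "idx ell2 \<Rightarrow> idx ell2" where "conj_ell2 x = Ell2 (\<lambda>i. cnj (ell2_at x (rfl i)))"

lemma conj_ell2: "ell2_at (conj_ell2 x) i = cnj (ell2_at x (rfl i))" "norm (conj_ell2 x) \<le> norm x"
proof -
  have "(\<Sum>i\<in>F. (cmod (cnj (ell2_at x (rfl i))))\<^sup>2) \<le> (norm x)\<^sup>2" if "finite F" for F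
  proof -
    have "(\<Sum>i\<in>F. (cmod (cnj (ell2_at x (rfl i))))\<^sup>2) = (\<Sum>i\<in>rfl ` F. (cmod (ell2_at x i))\<^sup>2)"
      by (subst sum.reindex) (auto intro: inj_on_subset[OF bij_betw_imp_inj_on[OF bij_rfl]])
    also have "\<dots> \<le> (norm x)\<^sup>2" by (rule sum_ell2_le_norm) (simp add: that)
    finally show ?thesis .
  qed
  note N = norm_Ell2_le[OF this norm_ge_zero]
  show "ell2_at (conj_ell2 x) i = cnj (ell2_at x (rfl i))" using N(1) by (simp add: conj_ell2_def)
  show "norm (conj_ell2 x) \<le> norm x" using N(2) by (simp add: conj_ell2_def)
qed

lemma continuous_on_conj_ell2:
  assumes "continuous_on A u"
  shows "continuous_on A (\<lambda>t. conj_ell2 (u t))"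
proof -
  have "bounded_linear conj_ell2"
    by (rule bounded_linear_intro[of _ 1]) (auto intro!: ell2_eqI simp: conj_ell2)
  then show ?thesis using assms by (rule bounded_linear.continuous_on)
qed

text \<open>The matrix entries are real, so conjugation reverses frequencies and exchanges the two
  signs. Thus the operator commutes with complex conjugation of the coordinates.\<close>

lemma ksym_refl: "cnj (ksym m (mcoef B) (rfl i) (rfl j)) = ksym m (mcoef B) i j"
proof -
  have P: "cnj (PJ (\<not> s) l) = PJ s l" for s l by (simp add: PJ_def)
  have "cnj (mcoef B (\<not> s) (\<not> s') (- n)) = mcoef B s s' n" for s s' n
    using P[of "\<not> s'"] by (simp add: mcoef_def P fr_cnj)
  from this[of _ _ "fst i - fst j"] show ?thesis by (simp add: ksym_def rfl_def)
qed

lemma kapp_refl: "kapp (PK \<beta> \<gamma> t) (\<lambda>j. cnj (x (rfl j))) i = cnj (kapp (PK \<beta> \<gamma> t) x (rfl i))"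
proof -
  have PK: "cnj (PK \<beta> \<gamma> t (rfl i) (rfl j)) = PK \<beta> \<gamma> t i j" for i j
    unfolding PK_def kA_def ksym_J[symmetric] pk_ksym by (simp add: ksym_refl)
  have "kapp (PK \<beta> \<gamma> t) (\<lambda>j. cnj (x (rfl j))) i = (\<Sum>\<^sub>\<infinity>j. cnj (PK \<beta> \<gamma> t (rfl i) (rfl j) * x (rfl j)))"
    by (simp add: kapp_def PK)
  also have "\<dots> = (\<Sum>\<^sub>\<infinity>j. cnj (PK \<beta> \<gamma> t (rfl i) j * x j))"
    by (rule infsum_reindex_bij_betw[OF bij_rfl])
  finally show ?thesis unfolding kapp_def infsum_cnj .
qed

lemma FT_refl: "cnj (FT f (rfl i)) = FT f i"
proof (cases "snd i")
  case True
  then show ?thesis using FT_symmetric[of f "- fst i"] by (cases i) (simp add: rfl_def)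
next
  case False
  then show ?thesis using FT_symmetric[of f "fst i"] by (cases i) (simp add: rfl_def)
qed

lemma solves_system_conj:
  assumes u: "solves_system (PK \<beta> \<gamma>) (\<lambda>t. Fh (h t)) u" and hL: "\<And>t. h t \<in> L2_torus"
  shows "solves_system (PK \<beta> \<gamma>) (\<lambda>t. Fh (h t)) (\<lambda>t. conj_ell2 (u t))"
proof -
  have "primitive_of (\<lambda>t. ell2_at (conj_ell2 (u t)) i)
      (\<lambda>t. ell2_at (Fh (h t)) i - kapp (PK \<beta> \<gamma> t) (ell2_at (conj_ell2 (u t))) i)" for i
  proof -
    have e: "ell2_at (conj_ell2 x) = (\<lambda>i. cnj (ell2_at x (rfl i)))" for x by (auto simp: conj_ell2)
    show ?thesis
      using primitive_of_bounded_linear[OF solves_systemD(2)[OF u, of "rfl i"] bounded_linear_cnj]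
      by (simp add: e kapp_refl ell2_at_Fh[OF hL] FT_refl)
  qed
  then show ?thesis
    unfolding solves_system_def using continuous_on_conj_ell2[OF solves_systemD(1)[OF u]] by blast
qed

theorem theorem5:
  fixes \<beta> \<gamma> :: "real \<Rightarrow> real \<Rightarrow> real^2^2"
  assumes "\<And>j k. (\<lambda>t x. \<beta> t x $ j $ k) \<in> Cb1_Cinf"
    and "\<And>j k. (\<lambda>t x. \<gamma> t x $ j $ k) \<in> Cb1_Cinf"
    and "\<And>t. (LINT x|torus_measure. trace (\<beta> t x)) = 0"
    and "\<And>t. (LINT x|torus_measure. trace (J_mat ** \<gamma> t x)) = 0"
  shows "L2_well_posed \<beta> \<gamma>"
  unfolding L2_well_posed_def
proof (intro ballI conjI allI impI)
  obtain S S' M lam where nf: "normal_form_system (PK \<beta> \<gamma>) S S' M lam"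
    using PK_normal_form[OF assms] by blast
  note K = normal_form_system.A[OF nf] normal_form_system.Ac[OF nf]
  have \<beta>: "Cb_mat \<beta>" and \<gamma>: "Cb_mat \<gamma>" using assms(1,2) by (auto simp: Cb_mat_def Cb1_Cinf_def)
  fix w\<^sub>0 h assume w0: "w\<^sub>0 \<in> L2_torus" and h: "h \<in> L1loc_L2"
  have hL: "h t \<in> L2_torus" for t using h by (simp add: L1loc_L2_def)
  show "\<exists>w. solves_ivp \<beta> \<gamma> h w\<^sub>0 w"
  proof -
    obtain u where u: "solves_system (PK \<beta> \<gamma>) (\<lambda>t. Fh (h t)) u" "u 0 = Fh w\<^sub>0"
      using normal_form_system.system_exists[OF nf, of "\<lambda>t. Fh (h t)" "\<lambda>t. norm (Fh (h t))" "Fh w\<^sub>0"]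
        L1loc_FT[OF h] by (auto simp: ell2_at_Fh[OF hL])
    have "conj_ell2 (u 0) = u 0"
      by (rule ell2_eqI) (simp add: conj_ell2 u(2) ell2_at_Fh[OF w0] FT_refl)
    \<comment> \<open>The contraction argument does not know about real fields. Reality follows from
      uniqueness: the conjugate of \<open>u\<close> solves the same system with the same initial
      value.\<close>
    then have sym: "conj_ell2 (u t) = u t" for t
      by (rule normal_form_system.system_unique[OF nf solves_system_conj[OF u(1) hL] u(1)])
    have "\<exists>f\<in>L2_torus. FT f = ell2_at (u t)" for t
    proof (rule FT_surject)
      fix k show "ell2_at (u t) (k, False) = cnj (ell2_at (u t) (- k, True))"
        using arg_cong[OF sym[of t], of "\<lambda>x. ell2_at x (k, False)"] by (simp add: conj_ell2 rfl_def)
    qed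
    then obtain w where w: "\<And>t. w t \<in> L2_torus" "\<And>t. FT (w t) = ell2_at (u t)" by metis
    have wu: "Fh (w t) = u t" for t by (rule ell2_eqI) (simp add: ell2_at_Fh w)
    have wC: "w \<in> C_L2" using w(1) solves_systemD(1)[OF u(1)] by (simp add: C_L2_iff wu)
    have "AE x in torus_measure. w 0 x = w\<^sub>0 x"
      by (rule FT_inject[OF w(1) w0]) (simp add: w(2) u(2) ell2_at_Fh[OF w0])
    then have "solves_ivp \<beta> \<gamma> h w\<^sub>0 w"
      unfolding solves_ivp_def using wC system_imp_weak[OF \<beta> \<gamma> wC h] u(1) by (simp add: wu)
    then show ?thesis by blast
  qed
  fix w v t assume w: "solves_ivp \<beta> \<gamma> h w\<^sub>0 w" and v: "solves_ivp \<beta> \<gamma> h w\<^sub>0 v"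
  have sys: "solves_system (PK \<beta> \<gamma>) (\<lambda>t. Fh (h t)) (\<lambda>t. Fh (w t))" if "solves_ivp \<beta> \<gamma> h w\<^sub>0 w" for w
    using that unfolding solves_ivp_def by (intro weak_imp_system \<beta> \<gamma> K h) auto
  have L: "w t \<in> L2_torus" if "solves_ivp \<beta> \<gamma> h w\<^sub>0 w" for w t
    using that C_L2D(1) unfolding solves_ivp_def by blast
  \<comment> \<open>The initial condition holds only almost everywhere, and Fourier coefficients do
    not see null sets; equality becomes exact in \<open>ell2\<close>.\<close>
  have "Fh (w 0) = Fh w\<^sub>0" if w: "solves_ivp \<beta> \<gamma> h w\<^sub>0 w" for w
  proof -
    have ae: "AE x in torus_measure. w 0 x = w\<^sub>0 x" using w by (simp add: solves_ivp_def)
    have [measurable]: "w 0 \<in> borel_measurable torus_measure" "w\<^sub>0 \<in> borel_measurable torus_measure"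
      by (rule L2_torusD(2)[OF L[OF w]], rule L2_torusD(2)[OF w0])
    have "L2_norm (\<lambda>x. w 0 x - w\<^sub>0 x) = 0"
    proof -
      have "(LINT x|torus_measure. (norm (w 0 x - w\<^sub>0 x))\<^sup>2) = (LINT x|torus_measure. 0)"
        by (rule integral_cong_AE) (use ae in auto)
      then show ?thesis by (simp add: L2_norm_def)
    qed
    then show ?thesis using norm_Fh_diff[OF L[OF w] w0, of 0] by simp
  qed
  then have "Fh (w 0) = Fh (v 0)" using w v by simp
  from normal_form_system.system_unique[OF nf sys[OF w] sys[OF v] this]
  have "Fh (w t) = Fh (v t)" .
  then have "FT (w t) i = FT (v t) i" for i using ell2_at_Fh[OF L[OF w]] ell2_at_Fh[OF L[OF v]] by metis
  then show "AE x in torus_measure. w t x = v t x" by (rule FT_inject[OF L[OF w] L[OF v]])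
qed

end
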